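(* Let $M$ be a complete connected Riemannian manifold without boundary, $p\in(1,+\infty)$, $p'=\frac{p}{p-1}$, $\lambda>0$, and let $Lu=\operatorname{div}A(x,u,\nabla u)$ be a weakly-$p$-coercive operator on $M$ with coercivity constant $k>0$. Let $u\in W^{1,p}_{\mathrm{loc}}(M)$ satisfy \[ Lu=\lambda|u|^{p-2}u\qquad\text{(weakly) on }M . \] If for some $x_0\in M$ and $q\in(p-1,+\infty)$ \[ \int_{B_R(x_0)}|u|^q\le e^{CR}\qquad\text{for all sufficiently large }R \] with a constant \[ C<\frac{p(q-p+1)^{1/p'}}{(p-1)^{1/p'}}\,\frac{\lambda^{1/p}}{k}, \] then $u\equiv0$ (a.e. on $M$).
   Context: All integrals over $M$ or its subsets are with respect to the Riemannian volume measure; $\langle\cdot,\cdot\rangle$ is the Riemannian metric, $m=\dim M$. $B_R(x_0)$ is the geodesic ball of radius $R$ centered at $x_0$. $W^{1,p}_{\mathrm{loc}}(M)$ is the space of functions whose restriction to every relatively compact set $\Omega\subseteq M$ belongs to $W^{1,p}(\Omega)$, and $W^{1,p}_c(M)$ is its subspace of compactly supported functions. Operators. $A:\mathbb{R}\times TM\to TM$ is a map with $A(x,s,\xi)\in T_xM$ for all $x\in M$, $s\in\mathbb{R}$, $\xi\in T_xM$, whose local representation $\tilde A:\psi(U)\times\mathbb{R}\times\mathbb{R}^m\to\mathbb{R}^m$ in any chart $\psi:U\to\mathbb{R}^m$ satisfies the Carathéodory conditions: $\tilde A(y,\cdot,\cdot)$ is continuous for a.e. $y$, and $\tilde A(\cdot,s,v)$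 is measurable for every $(s,v)$. The operator $Lu=\operatorname{div}A(x,u,\nabla u)$ is weakly-$p$-coercive with coercivity constant $k>0$ if for all $x\in M$, $s\in\mathbb{R}$, $\xi\in T_xM$ \[ \langle A(x,s,\xi),\xi\rangle\ge0,\qquad |A(x,s,\xi)|\le k\,\langle A(x,s,\xi),\xi\rangle^{\frac{p-1}{p}} . \] "$Lu=\lambda|u|^{p-2}u$ weakly on $M$" means $-\int_M\langle A(x,u,\nabla u),\nabla\varphi\rangle=\int_M\lambda|u|^{p-2}u\,\varphi$ for all $\varphi\in W^{1,p}_c(M)$. *)

theory Defs
  imports "HOL-Analysis.Analysis"
begin

section \<open>Smooth functions between Euclidean spaces\<close>

text \<open>On an open set \<open>S\<close> this is membership in \<open>C\<^sup>k\<close>: all iterated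
  directional derivatives up to order \<open>k\<close> exist and are continuous.\<close>

primrec Ck_on :: "nat \<Rightarrow> 'e::real_normed_vector set \<Rightarrow> ('e \<Rightarrow> 'f::real_normed_vector) \<Rightarrow> bool" where
  "Ck_on 0 S f \<longleftrightarrow> continuous_on S f"
| "Ck_on (Suc k) S f \<longleftrightarrow>
     (\<forall>x\<in>S. f differentiable (at x)) \<and> (\<forall>v. Ck_on k S (\<lambda>x. frechet_derivative f (at x) v))"

definition smooth_on :: "'e::real_normed_vector set \<Rightarrow> ('e \<Rightarrow> 'f::real_normed_vector) \<Rightarrow> bool" where
  "smooth_on S f \<longleftrightarrow> (\<forall>k. Ck_on k S f)"

definition test_function :: "'e::real_normed_vector set \<Rightarrow> ('e \<Rightarrow> real) \<Rightarrow> bool" where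
  "test_function V \<phi> \<longleftrightarrow> smooth_on UNIV \<phi> \<and> (\<exists>K. compact K \<and> K \<subseteq> V \<and> (\<forall>y. y \<notin> K \<longrightarrow> \<phi> y = 0))"


section \<open>Smooth manifolds\<close>

text \<open>The manifold is the whole type \<open>'a\<close> with its topology; the dimension is \<open>CARD('m)\<close>.
  A chart is a pair of a domain and a coordinate map; the values of the coordinate map
  off the domain are irrelevant.\<close>

type_synonym ('a, 'm) chart = "'a set \<times> ('a \<Rightarrow> real ^ 'm)"

definition is_chart :: "('a::topological_space, 'm::finite) chart \<Rightarrow> bool" where
  "is_chart c \<longleftrightarrow> open (fst c) \<and> open (snd c ` fst c) \<and>
     homeomorphism (fst c) (snd c ` fst c) (snd c) (inv_into (fst c) (snd c))"

definition chart_inv :: "('a, 'm::finite) chart \<Rightarrow> real ^ 'm \<Rightarrow> 'a" where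
  "chart_inv c = inv_into (fst c) (snd c)"

definition transition :: "('a, 'm::finite) chart \<Rightarrow> ('a, 'm) chart \<Rightarrow> real ^ 'm \<Rightarrow> real ^ 'm" where
  "transition c d = snd d \<circ> chart_inv c"

definition smooth_compatible :: "('a, 'm::finite) chart \<Rightarrow> ('a, 'm) chart \<Rightarrow> bool" where
  "smooth_compatible c d \<longleftrightarrow>
     smooth_on (snd c ` (fst c \<inter> fst d)) (transition c d) \<and>
     smooth_on (snd d ` (fst c \<inter> fst d)) (transition d c)"

text \<open>A smooth structure is a maximal smooth atlas, so membership in it means being an
  arbitrary smooth chart of the manifold.\<close>

definition smooth_structure :: "('a::topological_space, 'm::finite) chart set \<Rightarrow> bool" where
  "smooth_structure \<A> \<longleftrightarrow>
     (\<forall>c\<in>\<A>. is_chart c) \<and>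
     (\<Union>c\<in>\<A>. fst c) = UNIV \<and>
     (\<forall>c\<in>\<A>. \<forall>d\<in>\<A>. smooth_compatible c d) \<and>
     (\<forall>c. is_chart c \<and> (\<forall>d\<in>\<A>. smooth_compatible c d) \<longrightarrow> c \<in> \<A>)"


section \<open>Tangent vectors\<close>

text \<open>A tangent vector at \<open>x\<close> is the family of its coordinate vectors in all charts around \<open>x\<close>,
  related by the derivatives of the transition maps; it is \<open>0\<close> at all other indices,
  so that equality of tangent vectors is equality of functions.\<close>

type_synonym ('a, 'm) tvec = "('a, 'm) chart \<Rightarrow> real ^ 'm"

definition tangent_space :: "('a, 'm::finite) chart set \<Rightarrow> 'a \<Rightarrow> ('a, 'm) tvec set" where
  "tangent_space \<A> x = {\<xi>.
     (\<forall>c\<in>\<A>. \<forall>d\<in>\<A>. x \<in> fst c \<longrightarrow> x \<in> fst d \<longrightarrow>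
        \<xi> d = frechet_derivative (transition c d) (at (snd c x)) (\<xi> c)) \<and>
     (\<forall>c. \<not> (c \<in> \<A> \<and> x \<in> fst c) \<longrightarrow> \<xi> c = 0)}"

text \<open>The tangent vector at \<open>x\<close> whose coordinate vector in the chart \<open>c\<close> is \<open>v\<close>.\<close>

definition tvec_of :: "('a, 'm::finite) chart set \<Rightarrow> ('a, 'm) chart \<Rightarrow> 'a \<Rightarrow> real ^ 'm \<Rightarrow> ('a, 'm) tvec" where
  "tvec_of \<A> c x v = (\<lambda>d. if d \<in> \<A> \<and> x \<in> fst d
     then frechet_derivative (transition c d) (at (snd c x)) v else 0)"


section \<open>Riemannian metrics\<close>

type_synonym ('a, 'm) metric_tensor = "'a \<Rightarrow> ('a, 'm) tvec \<Rightarrow> ('a, 'm) tvec \<Rightarrow> real"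

definition local_metric ::
  "('a, 'm::finite) chart set \<Rightarrow> ('a, 'm) metric_tensor \<Rightarrow> ('a, 'm) chart \<Rightarrow>
   real ^ 'm \<Rightarrow> real ^ 'm \<Rightarrow> real ^ 'm \<Rightarrow> real" where
  "local_metric \<A> g c y v w =
     g (chart_inv c y) (tvec_of \<A> c (chart_inv c y) v) (tvec_of \<A> c (chart_inv c y) w)"

definition riemannian_metric ::
  "('a, 'm::finite) chart set \<Rightarrow> ('a, 'm) metric_tensor \<Rightarrow> bool" where
  "riemannian_metric \<A> g \<longleftrightarrow>
     (\<forall>x. \<forall>\<xi>\<in>tangent_space \<A> x. \<forall>\<eta>\<in>tangent_space \<A> x. \<forall>\<zeta>\<in>tangent_space \<A> x. \<forall>a b.
        g x (\<lambda>c. a *\<^sub>R \<xi> c + b *\<^sub>R \<eta> c) \<zeta> = a * g x \<xi> \<zeta> + b * g x \<eta> \<zeta>) \<and>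
     (\<forall>x. \<forall>\<xi>\<in>tangent_space \<A> x. \<forall>\<eta>\<in>tangent_space \<A> x. g x \<xi> \<eta> = g x \<eta> \<xi>) \<and>
     (\<forall>x. \<forall>\<xi>\<in>tangent_space \<A> x. \<xi> \<noteq> (\<lambda>_. 0) \<longrightarrow> g x \<xi> \<xi> > 0) \<and>
     (\<forall>c\<in>\<A>. \<forall>v w. smooth_on (snd c ` fst c) (\<lambda>y. local_metric \<A> g c y v w))"

definition riemannian_manifold ::
  "('a::{t2_space, second_countable_topology}, 'm::finite) chart set \<Rightarrow> ('a, 'm) metric_tensor \<Rightarrow> bool" where
  "riemannian_manifold \<A> g \<longleftrightarrow> smooth_structure \<A> \<and> riemannian_metric \<A> g"

definition tnorm :: "('a, 'm) metric_tensor \<Rightarrow> 'a \<Rightarrow> ('a, 'm) tvec \<Rightarrow> real" where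
  "tnorm g x \<xi> = sqrt (g x \<xi> \<xi>)"


section \<open>Riemannian distance\<close>

definition piecewise_C1_curve ::
  "('a::topological_space, 'm::finite) chart set \<Rightarrow> (real \<Rightarrow> 'a) \<Rightarrow> bool" where
  "piecewise_C1_curve \<A> \<gamma> \<longleftrightarrow> continuous_on {0..1} \<gamma> \<and>
     (\<forall>c\<in>\<A>. \<forall>a b. 0 \<le> a \<longrightarrow> a \<le> b \<longrightarrow> b \<le> 1 \<longrightarrow> \<gamma> ` {a..b} \<subseteq> fst c \<longrightarrow>
        (snd c \<circ> \<gamma>) piecewise_C1_differentiable_on {a..b})"

definition velocity ::
  "('a, 'm::finite) chart set \<Rightarrow> (real \<Rightarrow> 'a) \<Rightarrow> real \<Rightarrow> ('a, 'm) tvec" where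
  "velocity \<A> \<gamma> t = (\<lambda>c. if c \<in> \<A> \<and> \<gamma> t \<in> fst c
     then vector_derivative (snd c \<circ> \<gamma>) (at t) else 0)"

definition curve_length ::
  "('a, 'm::finite) chart set \<Rightarrow> ('a, 'm) metric_tensor \<Rightarrow> (real \<Rightarrow> 'a) \<Rightarrow> ennreal" where
  "curve_length \<A> g \<gamma> =
     (\<integral>\<^sup>+t\<in>{0..1}. ennreal (tnorm g (\<gamma> t) (velocity \<A> \<gamma> t)) \<partial>lborel)"

text \<open>The infimum below is finite if the manifold is connected; otherwise
  \<open>enn2real\<close> would send an infinite distance to \<open>0\<close>.\<close>

definition rdist ::
  "('a::topological_space, 'm::finite) chart set \<Rightarrow> ('a, 'm) metric_tensor \<Rightarrow> 'a \<Rightarrow> 'a \<Rightarrow> real" where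
  "rdist \<A> g x y =
     enn2real (Inf {curve_length \<A> g \<gamma> |\<gamma>. piecewise_C1_curve \<A> \<gamma> \<and> \<gamma> 0 = x \<and> \<gamma> 1 = y})"

definition complete_manifold ::
  "('a::topological_space, 'm::finite) chart set \<Rightarrow> ('a, 'm) metric_tensor \<Rightarrow> bool" where
  "complete_manifold \<A> g \<longleftrightarrow> Metric_space.mcomplete UNIV (rdist \<A> g)"

definition geodesic_ball ::
  "('a::topological_space, 'm::finite) chart set \<Rightarrow> ('a, 'm) metric_tensor \<Rightarrow> 'a \<Rightarrow> real \<Rightarrow> 'a set" where
  "geodesic_ball \<A> g x R = Metric_space.mball UNIV (rdist \<A> g) x R"


section \<open>Riemannian volume\<close>

definition gram_matrix ::
  "('a, 'm::finite) chart set \<Rightarrow> ('a, 'm) metric_tensor \<Rightarrow> ('a, 'm) chart \<Rightarrow> real ^ 'm \<Rightarrow> real ^ 'm ^ 'm" where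
  "gram_matrix \<A> g c y = (\<chi> i j. local_metric \<A> g c y (axis i 1) (axis j 1))"

definition is_borel_volume ::
  "('a::topological_space, 'm::finite) chart set \<Rightarrow> ('a, 'm) metric_tensor \<Rightarrow> 'a measure \<Rightarrow> bool" where
  "is_borel_volume \<A> g \<mu> \<longleftrightarrow> sets \<mu> = sets borel \<and>
     (\<forall>c\<in>\<A>. \<forall>B\<in>sets borel. B \<subseteq> fst c \<longrightarrow>
        emeasure \<mu> B = (\<integral>\<^sup>+y\<in>snd c ` B. ennreal (sqrt (det (gram_matrix \<A> g c y))) \<partial>lborel))"

text \<open>On a Riemannian manifold there is exactly one such Borel measure. It is completed, as
  \<^const>\<open>lebesgue\<close> is, since \<open>x \<mapsto> A(x, u(x), \<nabla>u(x))\<close> is only Lebesgue measurable in general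
  for a Caratheodory map \<open>A\<close>.\<close>

definition volume_measure ::
  "('a::topological_space, 'm::finite) chart set \<Rightarrow> ('a, 'm) metric_tensor \<Rightarrow> 'a measure" where
  "volume_measure \<A> g = completion (THE \<mu>. is_borel_volume \<A> g \<mu>)"


section \<open>Sobolev spaces\<close>

definition loc_integrable :: "'a::topological_space measure \<Rightarrow> 'a set \<Rightarrow> ('a \<Rightarrow> real) \<Rightarrow> bool" where
  "loc_integrable \<mu> \<Omega> f \<longleftrightarrow> (\<forall>K. compact K \<and> K \<subseteq> \<Omega> \<longrightarrow> set_integrable \<mu> K f)"

definition measurable_field ::
  "('a, 'm::finite) chart set \<Rightarrow> 'a set \<Rightarrow> ('a \<Rightarrow> ('a, 'm) tvec) \<Rightarrow> bool" where
  "measurable_field \<A> \<Omega> X \<longleftrightarrow>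
     (\<forall>x\<in>\<Omega>. X x \<in> tangent_space \<A> x) \<and>
     (\<forall>c\<in>\<A>. (\<lambda>y. X (chart_inv c y) c) \<in> borel_measurable (lebesgue_on (snd c ` (fst c \<inter> \<Omega>))))"

text \<open>In every chart the function \<open>\<langle>X, \<partial>\<^sub>v\<rangle>\<close> is the distributional derivative of \<open>u\<close> in the
  coordinate direction \<open>v\<close>, i.e. \<open>X\<close> is metrically dual to the distributional differential of \<open>u\<close>.\<close>

definition is_weak_gradient ::
  "('a::topological_space, 'm::finite) chart set \<Rightarrow> ('a, 'm) metric_tensor \<Rightarrow> 'a set \<Rightarrow>
   ('a \<Rightarrow> real) \<Rightarrow> ('a \<Rightarrow> ('a, 'm) tvec) \<Rightarrow> bool" where
  "is_weak_gradient \<A> g \<Omega> u X \<longleftrightarrow>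
     loc_integrable (volume_measure \<A> g) \<Omega> u \<and>
     measurable_field \<A> \<Omega> X \<and>
     loc_integrable (volume_measure \<A> g) \<Omega> (\<lambda>x. tnorm g x (X x)) \<and>
     (\<forall>c\<in>\<A>. \<forall>v \<phi>. test_function (snd c ` (fst c \<inter> \<Omega>)) \<phi> \<longrightarrow>
        (LINT y:snd c ` (fst c \<inter> \<Omega>)|lebesgue. u (chart_inv c y) * frechet_derivative \<phi> (at y) v) =
        - (LINT y:snd c ` (fst c \<inter> \<Omega>)|lebesgue.
             g (chart_inv c y) (X (chart_inv c y)) (tvec_of \<A> c (chart_inv c y) v) * \<phi> y))"

definition W1p ::
  "('a::topological_space, 'm::finite) chart set \<Rightarrow> ('a, 'm) metric_tensor \<Rightarrow> real \<Rightarrow> 'a set \<Rightarrow> ('a \<Rightarrow> real) set" where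
  "W1p \<A> g p \<Omega> = {u. \<exists>X. is_weak_gradient \<A> g \<Omega> u X \<and>
     set_integrable (volume_measure \<A> g) \<Omega> (\<lambda>x. \<bar>u x\<bar> powr p) \<and>
     set_integrable (volume_measure \<A> g) \<Omega> (\<lambda>x. tnorm g x (X x) powr p)}"

definition W1p_loc ::
  "('a::topological_space, 'm::finite) chart set \<Rightarrow> ('a, 'm) metric_tensor \<Rightarrow> real \<Rightarrow> ('a \<Rightarrow> real) set" where
  "W1p_loc \<A> g p = {u. \<forall>\<Omega>. open \<Omega> \<and> compact (closure \<Omega>) \<longrightarrow> u \<in> W1p \<A> g p \<Omega>}"

text \<open>Compact support is meant for almost-everywhere classes of functions.\<close>

definition W1p_c ::
  "('a::topological_space, 'm::finite) chart set \<Rightarrow> ('a, 'm) metric_tensor \<Rightarrow> real \<Rightarrow> ('a \<Rightarrow> real) set" where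
  "W1p_c \<A> g p = {\<phi> \<in> W1p_loc \<A> g p.
     \<exists>K. compact K \<and> (AE x in volume_measure \<A> g. x \<notin> K \<longrightarrow> \<phi> x = 0)}"

text \<open>Weak gradients are unique up to null sets, hence the choice of a representative does not
  affect integrals.\<close>

definition weak_gradient ::
  "('a::topological_space, 'm::finite) chart set \<Rightarrow> ('a, 'm) metric_tensor \<Rightarrow> ('a \<Rightarrow> real) \<Rightarrow> 'a \<Rightarrow> ('a, 'm) tvec" where
  "weak_gradient \<A> g u = (SOME X. is_weak_gradient \<A> g UNIV u X)"


section \<open>Quasilinear operators in divergence form\<close>

type_synonym ('a, 'm) bundle_map = "'a \<Rightarrow> real \<Rightarrow> ('a, 'm) tvec \<Rightarrow> ('a, 'm) tvec"

definition local_rep ::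
  "('a, 'm::finite) chart set \<Rightarrow> ('a, 'm) bundle_map \<Rightarrow> ('a, 'm) chart \<Rightarrow>
   real ^ 'm \<Rightarrow> real \<Rightarrow> real ^ 'm \<Rightarrow> real ^ 'm" where
  "local_rep \<A> A c y s v = A (chart_inv c y) s (tvec_of \<A> c (chart_inv c y) v) c"

definition caratheodory_map ::
  "('a, 'm::finite) chart set \<Rightarrow> ('a, 'm) bundle_map \<Rightarrow> bool" where
  "caratheodory_map \<A> A \<longleftrightarrow>
     (\<forall>x s. \<forall>\<xi>\<in>tangent_space \<A> x. A x s \<xi> \<in> tangent_space \<A> x) \<and>
     (\<forall>c\<in>\<A>.
        (AE y in lebesgue_on (snd c ` fst c). continuous_on UNIV (\<lambda>(s, v). local_rep \<A> A c y s v)) \<and>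
        (\<forall>s v. (\<lambda>y. local_rep \<A> A c y s v) \<in> borel_measurable (lebesgue_on (snd c ` fst c))))"

definition weakly_p_coercive ::
  "('a, 'm::finite) chart set \<Rightarrow> ('a, 'm) metric_tensor \<Rightarrow> real \<Rightarrow> real \<Rightarrow> ('a, 'm) bundle_map \<Rightarrow> bool" where
  "weakly_p_coercive \<A> g p k A \<longleftrightarrow> caratheodory_map \<A> A \<and>
     (\<forall>x s. \<forall>\<xi>\<in>tangent_space \<A> x.
        g x (A x s \<xi>) \<xi> \<ge> 0 \<and>
        tnorm g x (A x s \<xi>) \<le> k * g x (A x s \<xi>) \<xi> powr ((p - 1) / p))"

text \<open>\<open>div A(x, u, \<nabla>u) = f\<close> weakly, tested against \<open>W\<^sup>1\<^sup>,\<^sup>p\<close> functions with compact support.\<close>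

definition weakly_solves ::
  "('a::topological_space, 'm::finite) chart set \<Rightarrow> ('a, 'm) metric_tensor \<Rightarrow> real \<Rightarrow>
   ('a, 'm) bundle_map \<Rightarrow> ('a \<Rightarrow> real) \<Rightarrow> ('a \<Rightarrow> real) \<Rightarrow> bool" where
  "weakly_solves \<A> g p A u f \<longleftrightarrow>
     (\<forall>\<phi>\<in>W1p_c \<A> g p.
        - (LINT x|volume_measure \<A> g. g x (A x (u x) (weak_gradient \<A> g u x)) (weak_gradient \<A> g \<phi> x)) =
        (LINT x|volume_measure \<A> g. f x * \<phi> x))"

end

theory Submission
  imports Defs "HOL-Real_Asymp.Real_Asymp"
begin

text \<open>Let \<open>b = q - p + 1\<close>. The equation is tested with \<open>\<eta> F(u)\<close>, where \<open>F\<close> is a Lipschitz approximation of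
 \<open>s \<mapsto> s \<bar>s\<bar>\<^sup>b\<^sup>-\<^sup>1\<close> and \<open>\<eta>\<close> is the \<open>p\<close>-th power of the positive part of \<open>exp (-\<alpha>\<rho>/p) - exp (-\<alpha>R/p)\<close>, with \<open>\<rho>\<close> a
 \<open>C\<^sup>1\<close> approximation of the distance \<open>r\<close> from \<open>x\<^sub>0\<close> such that \<open>\<bar>\<nabla>\<rho>\<bar> \<le> 1 + \<delta>\<close>. By coercivity and Young's inequality the
 gradient of \<open>u\<close> is absorbed, and removing the approximations gives
 \<open>\<lambda> \<integral> \<bar>u\<bar>\<^sup>q exp (-\<alpha>r) \<le> (p-1)\<^sup>p\<^sup>-\<^sup>1 p\<^sup>-\<^sup>p (k\<alpha>)\<^sup>p b\<^sup>1\<^sup>-\<^sup>p \<integral> \<bar>u\<bar>\<^sup>q exp (-\<alpha>r)\<close>. The growth condition makes the integral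
 finite for \<open>\<alpha> > C\<close>, and the constant on the right is smaller than \<open>\<lambda>\<close> exactly when \<open>\<alpha>\<close> is below the threshold
 for \<open>C\<close>, so the integral vanishes.\<close>

text \<open>Weak coercivity controls the flux A only through the energy density a = <A, grad u>, so
  a is the quantity to absorb: the flux enters as k a^((p-1)/p), and Young's inequality turns it
  into exactly the multiple of a that the test function produces. This dictates the p-th power in
  the cutoff: for \<eta> = \<zeta>^p the gradient carries \<zeta>^(p-1), which pairs with
  a^((p-1)/p) to give (\<zeta>^p a)^((p-1)/p). Subtracting the constant exp(-\<alpha>R/p) makes the
  support compact without changing the gradient where \<zeta> is positive, so no boundary error
  survives as R grows and the sharp constant is kept. The distance is only Lipschitz; replacing it
  by \<rho> costs factors 1 + \<delta> and exp(2\<alpha>\<delta>), harmless because \<alpha> is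
  strictly below its threshold. Completeness enters through the compactness of closed balls, which
  makes the cutoff admissible.\<close>

lemmas integrable_add_B = Bochner_Integration.integrable_add
 and integrable_bound_B = Bochner_Integration.integrable_bound
 and integrable_cong_B = Bochner_Integration.integrable_cong
 and integrable_diff_B = Bochner_Integration.integrable_diff
 and integral_add_B = Bochner_Integration.integral_add
 and integral_cong_B = Bochner_Integration.integral_cong
 and integral_diff_B = Bochner_Integration.integral_diff
 and integral_mult_left_zero_B = Bochner_Integration.integral_mult_left_zero
 and integral_mult_right_zero_B = Bochner_Integration.integral_mult_right_zero
 and integral_nonneg_B = Bochner_Integration.integral_nonneg

abbreviation ddir where "ddir f x v \<equiv> frechet_derivative f (at x) v"

section \<open>Smooth test functions\<close>

lemma Ck_on_Suc_imp: "Ck_on (Suc k) S f ==> Ck_on k S f"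
proof (induction k arbitrary: f)
 case 0
 then show ?case
  by (auto intro!: continuous_at_imp_continuous_on differentiable_imp_continuous_within)
next
 case (Suc k)
 then show ?case by auto
qed

lemma frechet_derivative_cong_open:
 assumes "open S" "x \<in> S" "\<And>y. y \<in> S ==> f y = h y"
 shows "frechet_derivative f (at x) = frechet_derivative h (at x)"
  and "f differentiable (at x) \<longleftrightarrow> h differentiable (at x)"
proof -
 have "(f has_derivative D) (at x) \<longleftrightarrow> (h has_derivative D) (at x)" for D
  using has_derivative_transform_within_open[OF _ assms(1,2), of f D UNIV h]
   has_derivative_transform_within_open[OF _ assms(1,2), of h D UNIV f] assms(3) by auto
 then show "frechet_derivative f (at x) = frechet_derivative h (at x)"
  "f differentiable (at x) \<longleftrightarrow> h differentiable (at x)"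
  by (simp_all add: frechet_derivative_def differentiable_def)
qed

lemma Ck_on_cong:
 assumes "open S" "\<And>y. y \<in> S ==> f y = h y"
 shows "Ck_on k S f \<longleftrightarrow> Ck_on k S h"
 using assms(2)
proof (induction k arbitrary: f h)
 case 0
 then show ?case by (auto cong: continuous_on_cong)
next
 case (Suc k)
 have "Ck_on k S (\<lambda>x. ddir f x v) \<longleftrightarrow> Ck_on k S (\<lambda>x. ddir h x v)" for v
  by (rule Suc.IH) (simp add: frechet_derivative_cong_open(1)[OF assms(1) _ Suc.prems])
 then show ?case using frechet_derivative_cong_open(2)[OF assms(1) _ Suc.prems] by simp
qed

lemma frechet_derivativeI: "(f has_derivative D) (at x) ==> frechet_derivative f (at x) = D"
 by (rule frechet_derivative_at[symmetric])

lemma Ck_on_const: "Ck_on k S (\<lambda>x. c)"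
 by (induction k arbitrary: c) (auto simp: frechet_derivativeI[OF has_derivative_const])

lemma Ck_on_add:
 assumes "open S" "Ck_on k S f" "Ck_on k S h"
 shows "Ck_on k S (\<lambda>x. f x + h x)"
 using assms(2,3)
proof (induction k arbitrary: f h)
 case 0
 then show ?case by (auto intro!: continuous_intros)
next
 case (Suc k)
 have d: "((\<lambda>x. f x + h x) has_derivative
   (\<lambda>v. ddir f x v + ddir h x v)) (at x)" if "x \<in> S" for x
  using Suc.prems that by (auto intro!: has_derivative_add simp: frechet_derivative_works[symmetric])
 have "Ck_on k S (\<lambda>x. frechet_derivative (\<lambda>x. f x + h x) (at x) v) \<longleftrightarrow>
    Ck_on k S (\<lambda>x. ddir f x v + ddir h x v)" for v
  by (rule Ck_on_cong[OF assms(1)]) (simp add: frechet_derivativeI[OF d])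
 then show ?case using Suc differentiableI[OF d] by auto
qed

lemma Ck_on_mult:
 fixes f h :: "'e::real_normed_vector \<Rightarrow> real"
 assumes "open S" "Ck_on k S f" "Ck_on k S h"
 shows "Ck_on k S (\<lambda>x. f x * h x)"
 using assms(2,3)
proof (induction k arbitrary: f h)
 case 0
 then show ?case by (auto intro!: continuous_intros)
next
 case (Suc k)
 have d: "((\<lambda>x. f x * h x) has_derivative
   (\<lambda>v. f x * ddir h x v + ddir f x v * h x)) (at x)" if "x \<in> S" for x
  using Suc.prems that by (auto intro!: has_derivative_mult simp: frechet_derivative_works[symmetric])
 have "Ck_on k S (\<lambda>x. frechet_derivative (\<lambda>x. f x * h x) (at x) v) \<longleftrightarrow>
    Ck_on k S (\<lambda>x. f x * ddir h x v + ddir f x v * h x)" for v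
  by (rule Ck_on_cong[OF assms(1)]) (simp add: frechet_derivativeI[OF d])
 moreover have "Ck_on k S (\<lambda>x. f x * ddir h x v + ddir f x v * h x)" for v
  using Suc Ck_on_Suc_imp[of k S f] Ck_on_Suc_imp[of k S h] assms(1)
  by (intro Ck_on_add Suc.IH) auto
 ultimately show ?case using differentiableI[OF d] by auto
qed

lemma Ck_on_prod:
 fixes f :: "'i \<Rightarrow> 'e::real_normed_vector \<Rightarrow> real"
 assumes "open S" "\<And>i. i \<in> I ==> Ck_on k S (f i)"
 shows "Ck_on k S (\<lambda>x. \<Prod>i\<in>I. f i x)"
proof (cases "finite I")
 case True
 then show ?thesis using assms(2)
  by (induction I rule: finite_induct) (auto intro!: Ck_on_const Ck_on_mult[OF assms(1)])
qed (simp add: Ck_on_const)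

text \<open>The functions \<open>t\<^sup>-\<^sup>k exp (-c/t)\<close> are closed under differentiation up to linear combinations.\<close>

definition flat_exp :: "real \<Rightarrow> nat \<Rightarrow> real \<Rightarrow> real" where
 "flat_exp c k t = (if t > 0 then (1 / t) ^ k * exp (- c / t) else 0)"

text \<open>With z = 1/t the quotient becomes z^(k+1) exp(-c z), where exponential decay wins. The
  division by t makes this the difference quotient at 0.\<close>

lemma flat_exp_tendsto_0:
 assumes "c > 0"
 shows "((\<lambda>t. flat_exp c k t / t) \<longlongrightarrow> 0) (at 0)"
proof -
 have "((\<lambda>z::real. z ^ Suc k / exp z) \<longlongrightarrow> 0) at_top"
  by (rule tendsto_power_div_exp_0)
 moreover have "filterlim (\<lambda>z. c * z) at_top at_top"
  using assms by (intro filterlim_tendsto_pos_mult_at_top[OF tendsto_const _ filterlim_ident])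
 ultimately have "((\<lambda>z::real. (c * z) ^ Suc k / exp (c * z)) \<longlongrightarrow> 0) at_top"
  by (rule filterlim_compose)
 then have "((\<lambda>z::real. (1 / c ^ Suc k) * ((c * z) ^ Suc k / exp (c * z))) \<longlongrightarrow> (1 / c ^ Suc k) * 0) at_top"
  by (intro tendsto_mult tendsto_const)
 then have "((\<lambda>z::real. z ^ Suc k * exp (- c * z)) \<longlongrightarrow> 0) at_top"
  by (rule Lim_transform_eventually[THEN tendsto_eq_rhs])
   (use assms in \<open>auto simp: power_mult_distrib exp_minus field_simps\<close>)
 from filterlim_compose[OF this filterlim_inverse_at_top_right]
 have "((\<lambda>t. (inverse t) ^ Suc k * exp (- c * inverse t)) \<longlongrightarrow> 0) (at_right 0)" .
 then have r: "((\<lambda>t. flat_exp c k t / t) \<longlongrightarrow> 0) (at_right 0)"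
  by (rule Lim_transform_eventually)
   (auto simp: flat_exp_def eventually_at_filter field_simps)
 have l: "((\<lambda>t. flat_exp c k t / t) \<longlongrightarrow> 0) (at_left 0)"
  by (rule Lim_transform_eventually[OF tendsto_const])
   (auto simp: flat_exp_def eventually_at_filter)
 show ?thesis using l r by (simp add: filterlim_split_at_real filterlim_split_at)
qed

lemma has_real_derivative_flat_exp:
 assumes "c > 0"
 shows "(flat_exp c k has_real_derivative (c * flat_exp c (k + 2) t - real k * flat_exp c (k + 1) t)) (at t)"
proof -
 consider "t > 0" | "t < 0" | "t = 0" by linarith
 then show ?thesis
 proof cases
  case 1
  have a: "((\<lambda>t. 1 / t) has_real_derivative (- 1 / t\<^sup>2)) (at t)"
   using 1 by (auto intro!: derivative_eq_intros simp: power2_eq_square field_simps)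
  have b: "((\<lambda>t. exp (- c / t)) has_real_derivative (exp (- c / t) * (c / t\<^sup>2))) (at t)"
   using 1 by (auto intro!: derivative_eq_intros simp: power2_eq_square field_simps)
  have "((\<lambda>t. (1 / t) ^ k * exp (- c / t)) has_real_derivative
   (real k * (1 / t) ^ (k - 1) * (- 1 / t\<^sup>2) * exp (- c / t) + (1 / t) ^ k * (exp (- c / t) * (c / t\<^sup>2)))) (at t)"
   using DERIV_mult[OF DERIV_power[OF a, of k] b] by (simp add: mult_ac add.commute)
  moreover have "real k * (1 / t) ^ (k - 1) * (- 1 / t\<^sup>2) * exp (- c / t) + (1 / t) ^ k * (exp (- c / t) * (c / t\<^sup>2))
   = c * flat_exp c (k + 2) t - real k * flat_exp c (k + 1) t"
   using 1 by (cases k) (auto simp: flat_exp_def power2_eq_square field_simps power_add)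
  ultimately have "((\<lambda>t. (1 / t) ^ k * exp (- c / t)) has_real_derivative
    (c * flat_exp c (k + 2) t - real k * flat_exp c (k + 1) t)) (at t)" by simp
  then show ?thesis
   by (rule has_field_derivative_transform_within_open[where S="{0<..}"]) (use 1 in \<open>auto simp: flat_exp_def\<close>)
 next
  case 2
  have "((\<lambda>t. 0) has_real_derivative 0) (at t)" by simp
  then have "(flat_exp c k has_real_derivative 0) (at t)"
   by (rule has_field_derivative_transform_within_open[where S="{..<0}"]) (use 2 in \<open>auto simp: flat_exp_def\<close>)
  then show ?thesis using 2 by (simp add: flat_exp_def)
 next
  case 3
  then show ?thesis using flat_exp_tendsto_0[OF assms, of k]
   by (simp add: has_field_derivative_iff flat_exp_def)
 qed
qed

text \<open>Keeping the coefficient s and the exponent k arbitrary closes the induction: a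
  directional derivative is a combination of the functions with k + 1 and k + 2.\<close>

lemma Ck_on_flat_exp:
 fixes a :: "'e::real_inner"
 assumes "c > 0"
 shows "Ck_on n UNIV (\<lambda>x. s * flat_exp c k (a \<bullet> x + d))"
proof (induction n arbitrary: s k)
 case 0
 have "isCont (flat_exp c k) t" for t
  using has_real_derivative_flat_exp[OF assms] DERIV_isCont by blast
 then have "continuous_on UNIV (flat_exp c k)" by (simp add: continuous_at_imp_continuous_on)
 then have "continuous_on UNIV (\<lambda>x. flat_exp c k (a \<bullet> x + d))"
  by (rule continuous_on_compose2) (auto intro!: continuous_intros)
 then show ?case by (auto intro!: continuous_intros)
next
 case (Suc n)
 have "((\<lambda>x. flat_exp c k (a \<bullet> x + d)) has_derivative
  (\<lambda>v. (c * flat_exp c (k + 2) (a \<bullet> x + d) - real k * flat_exp c (k + 1) (a \<bullet> x + d)) * (a \<bullet> v))) (at x)" for x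
  by (rule has_derivative_compose[OF _ has_real_derivative_flat_exp[OF assms, unfolded has_field_derivative_def],
     where f="\<lambda>x. a \<bullet> x + d"]) (auto intro!: derivative_eq_intros)
 then have d: "((\<lambda>x. s * flat_exp c k (a \<bullet> x + d)) has_derivative
  (\<lambda>v. s * ((c * flat_exp c (k + 2) (a \<bullet> x + d) - real k * flat_exp c (k + 1) (a \<bullet> x + d)) * (a \<bullet> v)))) (at x)" for x
  by (rule has_derivative_mult_right)
 have "Ck_on n UNIV (\<lambda>x. (s * c * (a \<bullet> v)) * flat_exp c (k + 2) (a \<bullet> x + d)
  + (- s * real k * (a \<bullet> v)) * flat_exp c (k + 1) (a \<bullet> x + d))" for v
  by (intro Ck_on_add Suc.IH) auto
 moreover have "frechet_derivative (\<lambda>x. s * flat_exp c k (a \<bullet> x + d)) (at x) v =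
  (s * c * (a \<bullet> v)) * flat_exp c (k + 2) (a \<bullet> x + d) + (- s * real k * (a \<bullet> v)) * flat_exp c (k + 1) (a \<bullet> x + d)" for x v
  unfolding frechet_derivativeI[OF d] by (simp only: algebra_simps)
 ultimately show ?case using differentiableI[OF d] by simp
qed

text \<open>The parameter c controls the steepness: at a fixed point of the open box every factor
  exp(-c/t) tends to 1 as c tends to 0, so these bumps converge to the indicator of the box.\<close>

definition box_bump :: "real \<Rightarrow> 'e::euclidean_space \<Rightarrow> 'e \<Rightarrow> 'e \<Rightarrow> real" where
 "box_bump c a b x = (\<Prod>i\<in>Basis. flat_exp c 0 (i \<bullet> x + (- (a \<bullet> i))) * flat_exp c 0 ((- i) \<bullet> x + b \<bullet> i))"

lemma flat_exp_0_bounds: "c > 0 ==> 0 \<le> flat_exp c 0 t \<and> flat_exp c 0 t \<le> 1"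
 by (auto simp: flat_exp_def)

lemma box_bump_bounds:
 assumes "c > 0"
 shows "0 \<le> box_bump c a b x" "box_bump c a b x \<le> 1"
 unfolding box_bump_def using flat_exp_0_bounds[OF assms]
 by (auto intro!: prod_nonneg prod_le_1 mult_le_one)

lemma box_bump_outside: "x \<notin> box a b ==> box_bump c a b x = 0"
 by (auto simp: box_bump_def box_def flat_exp_def inner_commute)

lemma smooth_on_box_bump:
 assumes "c > 0"
 shows "smooth_on UNIV (box_bump c a b :: 'e::euclidean_space \<Rightarrow> real)"
proof -
 have "Ck_on k UNIV (\<lambda>x. flat_exp c 0 (e \<bullet> x + d))" for k d and e :: 'e
  using Ck_on_flat_exp[OF assms, of k 1] by simp
 then show ?thesis
  unfolding smooth_on_def box_bump_def by (intro allI Ck_on_prod Ck_on_mult open_UNIV)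
qed

lemma test_function_box_bump:
 assumes "c > 0" "cbox a b \<subseteq> V"
 shows "test_function V (box_bump c a b)"
 unfolding test_function_def
 using smooth_on_box_bump[OF assms(1)] assms(2) box_bump_outside box_subset_cbox
 by (intro conjI exI[of _ "cbox a b"]) (auto, blast)

lemma box_bump_tendsto:
 "(\<lambda>n. box_bump (1 / (real n + 1)) a b x) \<longlonglongrightarrow> indicator (box a b) x"
proof (cases "x \<in> box a b")
 case True
 have lim: "(\<lambda>n. flat_exp (1 / (real n + 1)) 0 t) \<longlonglongrightarrow> 1" if "t > 0" for t
 proof -
  have "(\<lambda>n. 1 / real (n + 1)) \<longlonglongrightarrow> 0" using LIMSEQ_Suc[OF lim_1_over_n] by simp
  then have "(\<lambda>n. 1 / (real n + 1)) \<longlonglongrightarrow> 0" by (simp add: add.commute)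
  then have "(\<lambda>n. exp (- (1 / (real n + 1)) / t)) \<longlonglongrightarrow> exp (- 0 / t)"
   using that by (intro tendsto_intros) auto
  then show ?thesis using that by (simp add: flat_exp_def)
 qed
 have "(\<lambda>n. box_bump (1 / (real n + 1)) a b x) \<longlonglongrightarrow> (\<Prod>i\<in>(Basis::'a set). 1 * 1)"
  unfolding box_bump_def using True
  by (intro tendsto_prod tendsto_mult lim) (auto simp: box_def inner_commute)
 then show ?thesis using True by simp
qed (simp add: box_bump_outside)

text \<open>Open boxes form an intersection-stable generator of the Borel sets. The sets over which
  h integrates to 0 are closed under complements because the total integral is 0 too, by exhaustion
  with growing boxes; so all Borel sets qualify and the density h vanishes almost
  everywhere.\<close>

lemma integral_zero_cbox_imp_AE_zero:
 fixes h :: "'e::euclidean_space \<Rightarrow> real"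
 assumes h: "integrable lborel h" and z: "\<And>c d. (LINT x:box c d|lborel. h x) = 0"
 shows "AE x in lborel. h x = 0"
proof -
 have hA: "set_integrable lborel A h" if "A \<in> sets borel" for A
  using integrable_mult_indicator[OF _ h, of A] that by (simp add: set_integrable_def)
 have tot: "integral\<^sup>L lborel h = 0"
 proof -
  have "(\<lambda>n. LBINT x. indicator (box (- real n *\<^sub>R One) (real n *\<^sub>R One)) x *\<^sub>R h x) \<longlonglongrightarrow> (LBINT x. h x)"
  proof (rule integral_dominated_convergence[where w="\<lambda>x. \<bar>h x\<bar>"])
   show "AE x in lborel. (\<lambda>i. indicator (box (- real i *\<^sub>R One) (real i *\<^sub>R One)) x *\<^sub>R h x) \<longlonglongrightarrow> h x"
   proof (intro AE_I2)
    fix x :: 'e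
    obtain N where N: "x \<in> box (- real N *\<^sub>R One) (real N *\<^sub>R One)"
     using UN_box_eq_UNIV[where 'a='e] by (auto)
    have "eventually (\<lambda>i. indicator (box (- real i *\<^sub>R One) (real i *\<^sub>R One)) x *\<^sub>R h x = h x) sequentially"
     unfolding eventually_sequentially
    proof (intro exI allI impI)
     fix n assume "N \<le> n"
     then have "x \<in> box (- real n *\<^sub>R One) (real n *\<^sub>R One)" using N
      by (force simp: box_def)
     then show "indicator (box (- real n *\<^sub>R One) (real n *\<^sub>R One)) x *\<^sub>R h x = h x" by simp
    qed
    then show "(\<lambda>i. indicator (box (- real i *\<^sub>R One) (real i *\<^sub>R One)) x *\<^sub>R h x) \<longlonglongrightarrow> h x"
     by (rule tendsto_eventually)
   qed
  qed (use h in \<open>auto simp: indicator_def\<close>)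
  then show ?thesis using z by (simp add: set_lebesgue_integral_def LIMSEQ_const_iff)
 qed
 have "(LINT x:A|lborel. h x) = 0" if "A \<in> sets borel" for A
 proof -
  have "Int_stable (range (\<lambda>(a, b). box a b :: 'e set))"
  proof (rule Int_stableI)
   fix A B :: "'e set" assume "A \<in> range (\<lambda>(a, b). box a b)" "B \<in> range (\<lambda>(a, b). box a b)"
   then obtain a b c d where "A = box a b" "B = box c d" by auto
   then show "A \<inter> B \<in> range (\<lambda>(a, b). box a b)"
    unfolding \<open>A = _\<close> \<open>B = _\<close> box_Int_box by (intro range_eqI[where x="(_, _)"]) simp
  qed
  moreover have "range (\<lambda>(a, b). box a b :: 'e set) \<subseteq> Pow UNIV" by simp
  moreover have "A \<in> sigma_sets UNIV (range (\<lambda>(a, b). box a b))"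
   using that by (simp add: borel_eq_box)
  ultimately show ?thesis
  proof (induction rule: sigma_sets_induct_disjoint)
   case (basic A)
   then show ?case using z by auto
  next
   case empty
   then show ?case by (simp add: set_lebesgue_integral_def)
  next
   case (compl A)
   then have A: "A \<in> sets borel" by (simp add: borel_eq_box)
   have "(LINT x:UNIV - A|lborel. h x) = (LBINT x. h x - indicator A x *\<^sub>R h x)"
    unfolding set_lebesgue_integral_def
    by (rule integral_cong_B) (auto simp: indicator_def)
   also have "\<dots> = (LBINT x. h x) - (LINT x:A|lborel. h x)"
    unfolding set_lebesgue_integral_def
    by (rule integral_diff_B[OF h hA[OF A, unfolded set_integrable_def]])
   finally have "(LINT x:UNIV - A|lborel. h x) = (LBINT x. h x) - (LINT x:A|lborel. h x)" .
   then show ?case using compl tot by simp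
  next
   case (union A)
   then have A: "A i \<in> sets borel" for i by (auto simp: borel_eq_box)
   have "(LINT x:(\<Union>(range A))|lborel. h x) = (\<Sum>i. (LINT x:A i|lborel. h x))"
    using union(1) A by (intro lebesgue_integral_countable_add hA) (auto simp: disjoint_family_on_def)
   then show ?case using union by simp
  qed
 qed
 then show ?thesis
  by (intro density_unique_real[where f'="\<lambda>x. 0"] h) (auto simp: set_lebesgue_integral_def)
qed

text \<open>Bumps with c tending to 0 turn vanishing against test functions into vanishing of the
  integrals over open boxes whose closed hull lies in V. This forces w = 0 on each closed box inside
  V, and countably many of these cover V.\<close>

theorem fundamental_lemma:
 fixes w :: "'e::euclidean_space \<Rightarrow> real"
 assumes V: "open V" and w: "\<And>K. compact K ==> K \<subseteq> V ==> set_integrable lebesgue K w"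
  and z: "\<And>\<phi>. test_function V \<phi> ==> (LINT y:V|lebesgue. w y * \<phi> y) = 0"
 shows "AE y in lebesgue. y \<in> V \<longrightarrow> w y = 0"
proof -
 have box0: "(LINT y:box c d|lebesgue. w y) = 0" if "cbox c d \<subseteq> V" for c d
 proof -
  have wi: "integrable lebesgue (\<lambda>y. indicator (cbox c d) y *\<^sub>R w y)"
   using w[OF compact_cbox that] by (simp add: set_integrable_def)
  have meas: "(\<lambda>y. indicator (box c d) y * w y * box_bump (1 / (real n + 1)) c d y) \<in> borel_measurable lebesgue" for n
  proof -
   have "(\<lambda>y. indicator (cbox c d) y *\<^sub>R w y) \<in> borel_measurable lebesgue" using wi by blast
   moreover have "box_bump (1 / (real n + 1)) c d \<in> borel_measurable borel"
    using smooth_on_box_bump[of "1 / (real n + 1)" c d] unfolding smooth_on_def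
    by (auto dest!: spec[of _ 0] intro: borel_measurable_continuous_onI)
   ultimately have "(\<lambda>y. indicator (box c d) y * ((indicator (cbox c d) y *\<^sub>R w y) * box_bump (1 / (real n + 1)) c d y)) \<in> borel_measurable lebesgue"
    by (intro borel_measurable_times) (auto intro: measurable_completion)
   then show ?thesis
    by (rule subst[where P="\<lambda>f. f \<in> borel_measurable lebesgue", rotated])
     (use box_subset_cbox[of c d] in \<open>auto simp: fun_eq_iff indicator_def\<close>)
  qed
  have "(\<lambda>n. LINT y|lebesgue. indicator (box c d) y * w y * box_bump (1 / (real n + 1)) c d y)
    \<longlonglongrightarrow> (LINT y|lebesgue. indicator (box c d) y * w y)"
  proof (rule integral_dominated_convergence[where w="\<lambda>y. \<bar>indicator (cbox c d) y *\<^sub>R w y\<bar>"])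
   show "AE x in lebesgue. (\<lambda>i. indicator (box c d) x * w x * box_bump (1 / (real i + 1)) c d x)
     \<longlonglongrightarrow> indicator (box c d) x * w x"
   proof (intro AE_I2)
    fix x
    have "(\<lambda>i. indicator (box c d) x * w x * box_bump (1 / (real i + 1)) c d x)
     \<longlonglongrightarrow> indicator (box c d) x * w x * indicator (box c d) x"
     by (intro tendsto_intros box_bump_tendsto)
    then show "(\<lambda>i. indicator (box c d) x * w x * box_bump (1 / (real i + 1)) c d x)
     \<longlonglongrightarrow> indicator (box c d) x * w x" by (cases "x \<in> box c d") simp_all
   qed
   show "AE x in lebesgue. norm (indicator (box c d) x * w x * box_bump (1 / (real i + 1)) c d x) \<le> \<bar>indicator (cbox c d) x *\<^sub>R w x\<bar>" for i
    using box_bump_bounds[of "1 / (real i + 1)" c d] box_subset_cbox[of c d]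
    by (intro AE_I2) (auto simp: indicator_def abs_mult intro!: mult_left_le)
   show "(\<lambda>y. indicator (box c d) y * w y) \<in> borel_measurable lebesgue"
   proof -
    have "(\<lambda>y. indicator (box c d) y * (indicator (cbox c d) y *\<^sub>R w y)) \<in> borel_measurable lebesgue"
     using wi by (intro borel_measurable_times) (auto intro: measurable_completion)
    then show ?thesis
     by (rule subst[where P="\<lambda>f. f \<in> borel_measurable lebesgue", rotated])
      (use box_subset_cbox[of c d] in \<open>auto simp: fun_eq_iff indicator_def\<close>)
   qed
  qed (use wi meas in auto)
  moreover have "(LINT y|lebesgue. indicator (box c d) y * w y * box_bump (1 / (real n + 1)) c d y) = 0" for n
  proof -
   have "(LINT y|lebesgue. indicator (box c d) y * w y * box_bump (1 / (real n + 1)) c d y)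
    = (LINT y:V|lebesgue. w y * box_bump (1 / (real n + 1)) c d y)"
    unfolding set_lebesgue_integral_def using that box_subset_cbox[of c d]
    by (intro integral_cong_B)
     (auto simp: indicator_def box_bump_outside)
   also have "\<dots> = 0" by (rule z) (use that in \<open>auto intro!: test_function_box_bump\<close>)
   finally show ?thesis .
  qed
  ultimately show ?thesis by (simp add: LIMSEQ_const_iff set_lebesgue_integral_def)
 qed
 have AEbox: "AE y in lebesgue. y \<in> cbox a b \<longrightarrow> w y = 0" if ab: "cbox a b \<subseteq> V" for a b
 proof -
  have wi: "integrable lebesgue (\<lambda>y. indicator (cbox a b) y *\<^sub>R w y)"
   using w[OF compact_cbox ab] by (simp add: set_integrable_def)
  then obtain h where h: "h \<in> borel_measurable lborel" "AE x in lborel. indicator (cbox a b) x *\<^sub>R w x = h x"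
   using completion_ex_borel_measurable_real[of "\<lambda>y. indicator (cbox a b) y *\<^sub>R w y" lborel] by blast
  have h2: "AE x in lebesgue. indicator (cbox a b) x *\<^sub>R w x = h x"
   using h(2) by (rule AE_completion)
  have hi: "integrable lebesgue h"
   using wi by (rule integrable_cong_AE_imp) (use h h2 in \<open>auto simp: eq_commute intro: measurable_completion\<close>)
  have "AE x in lborel. h x = 0"
  proof (rule integral_zero_cbox_imp_AE_zero)
   show "integrable lborel h" using hi h(1) by (simp add: integrable_completion)
   fix c d :: 'e
   have "(LINT x:box c d|lborel. h x) = (LINT x:box c d|lebesgue. h x)"
    unfolding set_lebesgue_integral_def using h(1) by (intro integral_completion[symmetric]) simp
   also have "\<dots> = (LINT x|lebesgue. indicator (box c d) x * (indicator (cbox a b) x * w x))"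
    unfolding set_lebesgue_integral_def
   proof (rule integral_cong_AE)
    show "(\<lambda>x. indicator (box c d) x *\<^sub>R h x) \<in> borel_measurable lebesgue"
     using h(1) by (intro measurable_completion) simp
    show "(\<lambda>x. indicator (box c d) x * (indicator (cbox a b) x * w x)) \<in> borel_measurable lebesgue"
     using wi by (intro borel_measurable_times[of _ _ "\<lambda>x. indicator (cbox a b) x * w x"]) (auto intro: measurable_completion)
    show "AE x in lebesgue. indicator (box c d) x *\<^sub>R h x = indicator (box c d) x * (indicator (cbox a b) x * w x)"
     using h2 by eventually_elim simp
   qed
   \<comment> \<open>The boundary of the closed box is a null set, so the open box may replace it;
     an intersection of open boxes is again an open box.\<close>
   also have "\<dots> = (LINT x|lebesgue. indicator (box c d \<inter> box a b) x * w x)"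
   proof (rule integral_cong_AE)
    have "AE x in lebesgue. x \<notin> cbox a b - box a b"
     using AE_completion[OF AE_not_in[OF null_sets_cbox_Diff_box]] by auto
    then show "AE x in lebesgue. indicator (box c d) x * (indicator (cbox a b) x * w x) = indicator (box c d \<inter> box a b) x * w x"
     by eventually_elim (use box_subset_cbox[of a b] in \<open>auto simp: indicator_def\<close>)
    show m: "(\<lambda>x. indicator (box c d) x * (indicator (cbox a b) x * w x)) \<in> borel_measurable lebesgue"
     using wi by (intro borel_measurable_times[of _ _ "\<lambda>x. indicator (cbox a b) x * w x"]) (auto intro: measurable_completion)
    have "(\<lambda>x. indicator (box a b) x * (indicator (box c d) x * (indicator (cbox a b) x * w x))) \<in> borel_measurable lebesgue"
     by (intro borel_measurable_times[OF _ m]) (auto intro: measurable_completion)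
    then show "(\<lambda>x. indicator (box c d \<inter> box a b) x * w x) \<in> borel_measurable lebesgue"
     by (rule subst[where P="\<lambda>f. f \<in> borel_measurable lebesgue", rotated])
      (use box_subset_cbox[of a b] in \<open>auto simp: fun_eq_iff indicator_def\<close>)
   qed
   also have "\<dots> = 0"
   proof -
    obtain e f where ef: "box c d \<inter> box a b = box e f" unfolding box_Int_box by blast
    show ?thesis
    \<comment> \<open>Only for a nonempty box is \<open>cbox e f\<close> the closure of
      \<open>box e f\<close>, and hence known to lie in V.\<close>
    proof (cases "box e f = {}")
     case False
     then have "cbox e f = closure (box e f)" by simp
     also have "\<dots> \<subseteq> cbox a b" using ef box_subset_cbox[of a b] by (intro closure_minimal) auto
     finally show ?thesis using box0[of e f] ab ef by (simp add: set_lebesgue_integral_def)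
    qed (simp add: ef)
   qed
   finally show "(LINT x:box c d|lborel. h x) = 0" .
  qed
  then have "AE x in lebesgue. h x = 0" by (rule AE_completion)
  then show ?thesis using h2 by eventually_elim (auto simp: indicator_def)
 qed
 obtain \<D> where D: "countable \<D>" "\<D> \<subseteq> Pow V" "\<And>X. X \<in> \<D> ==> \<exists>a b. X = cbox a b" "\<Union>\<D> = V"
  using open_countable_Union_open_cbox[OF V] by metis
 have "AE y in lebesgue. \<forall>X\<in>\<D>. y \<in> X \<longrightarrow> w y = 0"
 proof (subst AE_ball_countable[OF D(1)], rule ballI)
  fix X assume X: "X \<in> \<D>"
  then obtain a b where "X = cbox a b" using D(3) by blast
  then show "AE y in lebesgue. y \<in> X \<longrightarrow> w y = 0" using AEbox[of a b] D(2) X by auto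
 qed
 then show ?thesis by eventually_elim (use D in auto)
qed

section \<open>Chain and product rule for weak derivatives\<close>

lemma lborel_translate:
 fixes f :: "'e::euclidean_space \<Rightarrow> real"
 shows "integrable lborel (\<lambda>x. f (x + s)) \<longleftrightarrow> integrable lborel f"
  and "(LBINT x. f (x + s)) = (LBINT x. f x)"
proof -
 have m: "(+) s \<in> borel_measurable lborel" by simp
 have *: "integrable lborel (\<lambda>x. h (x + s))" if "integrable lborel h" for s and h :: "'e \<Rightarrow> real"
  using that integrable_distr[of "(+) s" lborel borel h] by (simp add: lborel_distr_plus add.commute)
 show i: "integrable lborel (\<lambda>x. f (x + s)) \<longleftrightarrow> integrable lborel f"
  using *[of f s] *[of "\<lambda>x. f (x + s)" "- s"] by auto
 show "(LBINT x. f (x + s)) = (LBINT x. f x)"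
 proof (cases "integrable lborel f")
  case True
  then show ?thesis
   using integral_distr[of "(+) s" lborel borel f] by (simp add: lborel_distr_plus add.commute borel_measurable_integrable)
 qed (simp add: i not_integrable_integral_eq)
qed

text \<open>A is squeezed between a compact K and an open U of nearly the same measure. A small
  shift keeps K inside U, so the two indicators differ only on \<open>U - K\<close> and on its
  translate.\<close>

lemma L1_translation_indicator:
 fixes A :: "'e::euclidean_space set" and e :: real
 assumes A: "A \<in> sets borel" "emeasure lborel A < \<infinity>" and e: "e > 0"
 shows "\<exists>d>0. \<forall>s. norm s < d \<longrightarrow> (LBINT x. \<bar>indicator A (x + s) - indicator A x\<bar>) < e"
proof -
 \<comment> \<open>Lebesgue measure restricted to A is finite, so inner regularity applies to
   it.\<close>
 let ?M = "density lborel (indicator A) :: 'e measure"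
 have emM: "emeasure ?M B = emeasure lborel (A \<inter> B)" if "B \<in> sets borel" for B
 proof -
  have "emeasure ?M B = (\<integral>\<^sup>+x. indicator A x * indicator B x \<partial>lborel)"
   using A that by (intro emeasure_density) auto
  also have "\<dots> = (\<integral>\<^sup>+x. indicator (A \<inter> B) x \<partial>lborel)"
   by (intro nn_integral_cong) (auto simp: indicator_def)
  finally show ?thesis using A that by simp
 qed
 have "emeasure ?M A = (SUP K\<in>{K. K \<subseteq> A \<and> compact K}. emeasure ?M K)"
  using A by (intro inner_regular) (auto simp: emM)
 also have "emeasure ?M A = emeasure lborel A" using A by (simp add: emM)
 finally have sup: "emeasure lborel A = (SUP K\<in>{K. K \<subseteq> A \<and> compact K}. emeasure ?M K)" .
 \<comment> \<open>With slack e/5 on each side \<open>U - K\<close> has measure at most 2e/5; it is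
   counted twice below, once translated, which stays under e.\<close>
 obtain K where K: "K \<subseteq> A" "compact K" "emeasure lborel A < emeasure ?M K + ennreal (e / 5)"
 proof -
  have "{K. K \<subseteq> A \<and> compact K} \<noteq> {}" by (auto intro: exI[of _ "{}"])
  from SUP_approx_ennreal[OF _ this sup, of "e/5"] show ?thesis using that A e by (auto simp: less_top[symmetric])
 qed
 have Kb: "K \<in> sets borel" using K by (simp add: compact_imp_closed borel_closed)
 have eK: "emeasure ?M K = emeasure lborel K" using emM[OF Kb] K by (simp add: Int_absorb1)
 obtain U where U: "open U" "A \<subseteq> U" "emeasure lborel (U - A) < ennreal (e / 5)"
  using outer_regular_lborel[OF A(1), of "e / 5"] e by auto
 have Kfin: "emeasure lborel K < \<infinity>" using A K emeasure_mono[OF K(1), of lborel] by (auto intro: le_less_trans)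
 have "emeasure lborel (A - K) = emeasure lborel A - emeasure lborel K"
  using A K Kb Kfin by (intro emeasure_Diff) auto
 also have "\<dots> \<le> ennreal (e / 5)"
  using K(3) A(2) unfolding eK by (auto simp: ennreal_minus_le_iff less_imp_le add.commute)
 finally have AK: "emeasure lborel (A - K) \<le> ennreal (e / 5)" .
 have "emeasure lborel (U - K) \<le> emeasure lborel ((U - A) \<union> (A - K))"
  using A Kb U by (intro emeasure_mono) auto
 also have "\<dots> \<le> emeasure lborel (U - A) + emeasure lborel (A - K)"
  using A Kb U by (intro emeasure_subadditive) auto
 also have "\<dots> \<le> ennreal (e / 5) + ennreal (e / 5)"
  using U(3) AK by (intro add_mono) auto
 also have "\<dots> = ennreal (2 * e / 5)" using e by (simp add: ennreal_plus[symmetric] del: ennreal_plus)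
 finally have UK: "emeasure lborel (U - K) \<le> ennreal (2 * e / 5)" .
 have UKs: "U - K \<in> sets borel" using U Kb by auto
 have UKi: "integrable lborel (indicator (U - K) :: 'e \<Rightarrow> real)"
  using UK UKs by (auto intro!: integrable_real_indicator simp: le_less_trans[OF UK])
 have UKint: "(LBINT x. indicator (U - K) x :: real) \<le> 2 * e / 5"
 proof -
  have "measure lborel (U - K) \<le> 2 * e / 5" unfolding measure_def using UK e by (intro enn2real_leI) auto
  then show ?thesis using UKs by simp
 qed
 obtain d where d: "d > 0" "(\<Union>x\<in>K. ball x d) \<subseteq> U"
  using compact_subset_open_imp_ball_epsilon_subset[OF K(2) U(1)] K(1) U(2) by auto
 show ?thesis
 proof (intro exI conjI allI impI)
  fix s :: 'e assume s: "norm s < d"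
  have shift: "x + s \<in> U" "x - s \<in> U" if "x \<in> K" for x
   using that d(2) s by (auto simp: subset_eq dist_norm intro!: d(2)[THEN subsetD, OF UN_I[OF that]])
  have "(LBINT x. \<bar>indicator A (x + s) - indicator A x\<bar>)
   \<le> (LBINT x. (indicator (U - K) (x + s) + indicator (U - K) x :: real))"
  proof (rule integral_mono')
   show "integrable lborel (\<lambda>x. indicator (U - K) (x + s) + indicator (U - K) x :: real)"
    using UKi by (intro integrable_add_B) (auto simp: lborel_translate(1)[of "indicator (U - K)"])
   show "\<bar>indicator A (x + s) - indicator A x\<bar> \<le> (indicator (U - K) (x + s) + indicator (U - K) x :: real)" for x
    using shift(1)[of x] shift(2)[of "x + s"] K(1) U(2) by (auto simp: indicator_def)
  qed auto
  also have "\<dots> = (LBINT x. indicator (U - K) (x + s)) + (LBINT x. indicator (U - K) x :: real)"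
   using UKi by (intro integral_add_B) (auto simp: lborel_translate(1)[of "indicator (U - K)"])
  also have "\<dots> = 2 * (LBINT x. indicator (U - K) x :: real)"
   by (simp add: lborel_translate(2)[of "indicator (U - K)"])
  also have "\<dots> < e" using UKint e by linarith
  finally show "(LBINT x. \<bar>indicator A (x + s) - indicator A x\<bar>) < e" .
 qed (use d in simp)
qed

text \<open>Approximation by simple functions; the three-term split in the limit case works because
  translation preserves the L1 distance.\<close>

theorem L1_translation_continuous:
 fixes f :: "'e::euclidean_space \<Rightarrow> real"
 assumes "integrable lborel f" "e > 0"
 shows "\<exists>d>0. \<forall>s. norm s < d \<longrightarrow> (LBINT x. \<bar>f (x + s) - f x\<bar>) < e"
 using assms
proof (induction f arbitrary: e rule: integrable_induct)
 case (base A c)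
 obtain d where d: "d > 0" "\<And>s. norm s < d ==> (LBINT x. \<bar>indicator A (x + s) - indicator A x\<bar>) < e / (\<bar>c\<bar> + 1)"
  using L1_translation_indicator[of A "e / (\<bar>c\<bar> + 1)"] base by auto
 show ?case
 proof (intro exI conjI allI impI)
  fix s :: 'e assume "norm s < d"
  note d' = d(2)[OF this]
  have "(LBINT x. \<bar>indicator A (x + s) *\<^sub>R c - indicator A x *\<^sub>R c\<bar>) = (LBINT x. \<bar>c\<bar> * \<bar>indicator A (x + s) - indicator A x\<bar>)"
   by (rule integral_cong_B) (auto simp: abs_mult[symmetric] algebra_simps)
  also have "\<dots> = \<bar>c\<bar> * (LBINT x. \<bar>indicator A (x + s) - indicator A x\<bar>)" by simp
  also have "\<dots> \<le> \<bar>c\<bar> * (e / (\<bar>c\<bar> + 1))" using d' by (intro mult_left_mono) auto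
  also have "\<dots> < e" using base(3) by (simp add: field_simps)
  finally show "(LBINT x. \<bar>indicator A (x + s) *\<^sub>R c - indicator A x *\<^sub>R c\<bar>) < e" .
 qed (use d in simp)
next
 case (add f h)
 obtain d1 where d1: "d1 > 0" "\<And>s. norm s < d1 ==> (LBINT x. \<bar>f (x + s) - f x\<bar>) < e / 2"
  using add.IH(1)[of "e/2"] add.prems by auto
 obtain d2 where d2: "d2 > 0" "\<And>s. norm s < d2 ==> (LBINT x. \<bar>h (x + s) - h x\<bar>) < e / 2"
  using add.IH(2)[of "e/2"] add.prems by auto
 show ?case
 proof (intro exI conjI allI impI)
  show "min d1 d2 > 0" using d1 d2 by simp
  fix s :: 'e assume s: "norm s < min d1 d2"
  have i: "integrable lborel (\<lambda>x. \<bar>f (x + s) - f x\<bar>)" "integrable lborel (\<lambda>x. \<bar>h (x + s) - h x\<bar>)"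
   using add.hyps by (auto simp: lborel_translate(1) intro!: integrable_abs integrable_diff_B)
  have "(LBINT x. \<bar>f (x + s) + h (x + s) - (f x + h x)\<bar>) \<le> (LBINT x. \<bar>f (x + s) - f x\<bar> + \<bar>h (x + s) - h x\<bar>)"
   using i by (intro integral_mono' integrable_add_B) auto
  also have "\<dots> = (LBINT x. \<bar>f (x + s) - f x\<bar>) + (LBINT x. \<bar>h (x + s) - h x\<bar>)"
   using i by (rule integral_add_B)
  also have "\<dots> < e" using d1(2)[of s] d2(2)[of s] s by simp
  finally show "(LBINT x. \<bar>f (x + s) + h (x + s) - (f x + h x)\<bar>) < e" .
 qed
next
 case (lim f F)
 have bd: "\<bar>F i x\<bar> \<le> 2 * \<bar>f x\<bar>" for i x using lim.hyps by simp
 have "(\<lambda>i. LBINT x. norm (F i x - f x)) \<longlonglongrightarrow> (LINT x|(lborel :: 'e measure). (0::real))"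
 proof (rule integral_dominated_convergence[where w="\<lambda>x. 3 * \<bar>f x\<bar>"])
  show "AE x in lborel. norm (norm (F i x - f x)) \<le> 3 * \<bar>f x\<bar>" for i
  proof (intro AE_I2)
   fix x show "norm (norm (F i x - f x)) \<le> 3 * \<bar>f x\<bar>"
    using bd[of i x] abs_triangle_ineq4[of "F i x" "f x"] by simp
  qed
  show "AE x in lborel. (\<lambda>i. norm (F i x - f x)) \<longlonglongrightarrow> 0"
   using lim.hyps by (intro AE_I2 tendsto_norm_zero LIM_zero) auto
 qed (use lim in auto)
 then have "(\<lambda>i. LBINT x. \<bar>F i x - f x\<bar>) \<longlonglongrightarrow> 0" by simp
 from order_tendstoD(2)[OF this, of "e/3"] obtain i where i: "(LBINT x. \<bar>F i x - f x\<bar>) < e / 3"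
  using lim.prems by (auto simp: eventually_sequentially)
 obtain d where d: "d > 0" "\<And>s. norm s < d ==> (LBINT x. \<bar>F i (x + s) - F i x\<bar>) < e / 3"
  using lim.IH[of "e/3" i] lim.prems by auto
 show ?case
 proof (intro exI conjI allI impI)
  fix s :: 'e assume s: "norm s < d"
  have a: "integrable lborel (\<lambda>x. \<bar>F i x - f x\<bar>)" using lim by auto
  have b: "integrable lborel (\<lambda>x. \<bar>F i (x + s) - f (x + s)\<bar>)"
   using a by (subst lborel_translate(1)[of "\<lambda>x. \<bar>F i x - f x\<bar>"])
  have c: "integrable lborel (\<lambda>x. \<bar>F i (x + s) - F i x\<bar>)"
   using lim by (auto simp: lborel_translate(1) intro!: integrable_abs integrable_diff_B)
  have "(LBINT x. \<bar>f (x + s) - f x\<bar>) \<le> (LBINT x. \<bar>F i (x + s) - f (x + s)\<bar> + \<bar>F i (x + s) - F i x\<bar> + \<bar>F i x - f x\<bar>)"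
   using a b c by (intro integral_mono' integrable_add_B) auto
  also have "\<dots> = (LBINT x. \<bar>F i (x + s) - f (x + s)\<bar>) + (LBINT x. \<bar>F i (x + s) - F i x\<bar>) + (LBINT x. \<bar>F i x - f x\<bar>)"
   using a b c by simp
  also have "(LBINT x. \<bar>F i (x + s) - f (x + s)\<bar>) = (LBINT x. \<bar>F i x - f x\<bar>)"
   by (rule lborel_translate(2)[of "\<lambda>x. \<bar>F i x - f x\<bar>"])
  also have "(LBINT x. \<bar>F i x - f x\<bar>) + (LBINT x. \<bar>F i (x + s) - F i x\<bar>) + (LBINT x. \<bar>F i x - f x\<bar>) < e"
   using i d(2)[OF s] by linarith
  finally show "(LBINT x. \<bar>f (x + s) - f x\<bar>) < e" .
 qed (use d in simp)
qed

section \<open>Difference quotients of weakly differentiable functions\<close>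

lemma test_functionE:
 fixes \<phi> :: "'e::euclidean_space \<Rightarrow> real"
 assumes "test_function V \<phi>"
 obtains K B where "compact K" "K \<subseteq> V" "\<And>y. y \<notin> K ==> \<phi> y = 0" "continuous_on UNIV \<phi>"
  "\<And>y. \<phi> differentiable (at y)" "continuous_on UNIV (\<lambda>y. ddir \<phi> y v)"
  "\<And>y. y \<notin> K ==> ddir \<phi> y v = 0" "B > 0" "\<And>y. \<bar>\<phi> y\<bar> \<le> B"
  "\<And>y. \<bar>ddir \<phi> y v\<bar> \<le> B"
proof -
 from assms obtain K where K: "compact K" "K \<subseteq> V" "\<And>y. y \<notin> K ==> \<phi> y = 0"
  and s: "smooth_on UNIV \<phi>" unfolding test_function_def by auto
 have c: "continuous_on UNIV \<phi>" using s unfolding smooth_on_def by (auto dest: spec[of _ 0])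
 have d: "\<phi> differentiable (at y)" "continuous_on UNIV (\<lambda>y. ddir \<phi> y v)" for y
  using s unfolding smooth_on_def by (auto dest!: spec[of _ "Suc 0"])
 have z: "ddir \<phi> y v = 0" if "y \<notin> K" for y
 proof -
  have "frechet_derivative \<phi> (at y) = frechet_derivative (\<lambda>y. 0) (at y)"
   using K that by (intro frechet_derivative_cong_open(1)[of "- K"]) (auto simp: compact_imp_closed open_Compl)
  then show ?thesis by simp
 qed
 have "bounded (\<phi> ` K)" "bounded ((\<lambda>y. ddir \<phi> y v) ` K)"
  using K(1) c d(2) by (auto intro!: compact_imp_bounded compact_continuous_image intro: continuous_on_subset)
 then obtain B1 B2 where B: "B1 > 0" "\<And>y. y \<in> K ==> \<bar>\<phi> y\<bar> \<le> B1" "B2 > 0" "\<And>y. y \<in> K ==> \<bar>ddir \<phi> y v\<bar> \<le> B2"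
  unfolding bounded_pos by auto
 show thesis
 proof (rule that[of K "max B1 B2"])
  show "\<bar>\<phi> y\<bar> \<le> max B1 B2" "\<bar>ddir \<phi> y v\<bar> \<le> max B1 B2" for y
   using B K(3)[of y] z[of y] by (cases "y \<in> K"; fastforce)+
 qed (use K c d z B in auto)
qed

lemma frechet_derivative_translate:
 assumes "f differentiable (at (x - a))"
 shows "((\<lambda>x. f (x - a)) has_derivative frechet_derivative f (at (x - a))) (at x)"
proof -
 have "((\<lambda>x. x - a) has_derivative (\<lambda>h. h)) (at x)" by (auto intro!: derivative_eq_intros)
 from has_derivative_compose[OF this] assms show ?thesis
  by (auto simp: frechet_derivative_works)
qed

lemma Ck_on_translate: "Ck_on k UNIV f ==> Ck_on k UNIV (\<lambda>x. f (x - a))"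
proof (induction k arbitrary: f)
 case 0
 then show ?case by (auto intro!: continuous_intros intro: continuous_on_compose2)
next
 case (Suc k)
 have d: "((\<lambda>x. f (x - a)) has_derivative frechet_derivative f (at (x - a))) (at x)" for x
  using Suc.prems by (intro frechet_derivative_translate) auto
 have "Ck_on k UNIV (\<lambda>x. frechet_derivative f (at (x - a)) v)" for v
  using Suc.IH[of "\<lambda>x. ddir f x v"] Suc.prems by simp
 then show ?case using differentiableI[OF d] by (simp add: frechet_derivativeI[OF d])
qed

lemma test_function_translate:
 fixes \<phi> :: "'e::euclidean_space \<Rightarrow> real"
 assumes "test_function O1 \<phi>" "\<And>x. x \<in> O1 ==> x + a \<in> V"
 shows "test_function V (\<lambda>x. \<phi> (x - a))"
proof -
 from assms(1) obtain K where K: "compact K" "K \<subseteq> O1" "\<And>y. y \<notin> K ==> \<phi> y = 0"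
  and s: "smooth_on UNIV \<phi>" unfolding test_function_def by auto
 have "compact ((\<lambda>x. a + x) ` K)" using K(1) by (rule compact_translation)
 moreover have "(\<lambda>x. a + x) ` K \<subseteq> V" using K(2) assms(2) by (auto simp: add.commute)
 moreover have "\<phi> (y - a) = 0" if "y \<notin> (\<lambda>x. a + x) ` K" for y
  using that by (intro K(3)) (metis add_diff_cancel_left' diff_add_cancel image_eqI add.commute)
 ultimately show ?thesis unfolding test_function_def
  using s Ck_on_translate unfolding smooth_on_def by blast
qed

text \<open>Licenses the exchanges of the x- and t-integrals below. The two speeds s and r let the
  shift fall on the integrable or on the bounded factor.\<close>

lemma integrable_pair_shift:
 fixes w \<psi> :: "'e::euclidean_space \<Rightarrow> real"
 assumes w: "integrable lborel w" and \<psi>: "\<psi> \<in> borel_measurable borel" "\<And>x. \<bar>\<psi> x\<bar> \<le> B"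
 shows "integrable (lborel \<Otimes>\<^sub>M lborel) (\<lambda>(x, t). indicator {0..h} t * (w (x + (s * t) *\<^sub>R v) * \<psi> (x + (r * t) *\<^sub>R v)))"
proof -
 have [measurable]: "w \<in> borel_measurable borel" using w by auto
 note [measurable] = \<psi>(1)
 have i: "integrable lborel (\<lambda>x. w (x + (s * t) *\<^sub>R v) * \<psi> (x + (r * t) *\<^sub>R v))" for t
 proof (rule integrable_bound_B[where f="\<lambda>x. B * w (x + (s * t) *\<^sub>R v)"])
  show "integrable lborel (\<lambda>x. B * w (x + (s * t) *\<^sub>R v))"
   using w by (simp add: lborel_translate(1))
  show "AE x in lborel. norm (w (x + (s * t) *\<^sub>R v) * \<psi> (x + (r * t) *\<^sub>R v)) \<le> norm (B * w (x + (s * t) *\<^sub>R v))"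
  proof (intro AE_I2)
   fix x show "norm (w (x + (s * t) *\<^sub>R v) * \<psi> (x + (r * t) *\<^sub>R v)) \<le> norm (B * w (x + (s * t) *\<^sub>R v))"
    using order_trans[OF \<psi>(2)[of "x + (r * t) *\<^sub>R v"] abs_ge_self]
    by (simp add: abs_mult mult.commute mult_right_mono)
  qed
 qed measurable
 have nb: "(LBINT x. norm (w (x + (s * t) *\<^sub>R v) * \<psi> (x + (r * t) *\<^sub>R v))) \<le> B * (LBINT x. norm (w x))" for t
 proof -
  have "(LBINT x. norm (w (x + (s * t) *\<^sub>R v) * \<psi> (x + (r * t) *\<^sub>R v))) \<le> (LBINT x. B * norm (w (x + (s * t) *\<^sub>R v)))"
  proof (rule integral_mono)
   show "integrable lborel (\<lambda>x. B * norm (w (x + (s * t) *\<^sub>R v)))"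
    using w by (auto simp: lborel_translate(1) intro!: integrable_norm)
   fix x
   show "norm (w (x + (s * t) *\<^sub>R v) * \<psi> (x + (r * t) *\<^sub>R v)) \<le> B * norm (w (x + (s * t) *\<^sub>R v))"
    using \<psi>(2)[of "x + (r * t) *\<^sub>R v"] by (simp add: abs_mult mult.commute mult_right_mono)
  qed (use i in auto)
  then show ?thesis by (simp add: lborel_translate(2)[of "\<lambda>x. \<bar>w x\<bar>"])
 qed
 have "integrable (lborel \<Otimes>\<^sub>M lborel) (\<lambda>(t, x). indicator {0..h} t * (w (x + (s * t) *\<^sub>R v) * \<psi> (x + (r * t) *\<^sub>R v)))"
 proof (rule lborel_pair.Fubini_integrable)
  show "AE t in lborel. integrable lborel (\<lambda>x. case (t, x) of (t, x) \<Rightarrow> indicator {0..h} t * (w (x + (s * t) *\<^sub>R v) * \<psi> (x + (r * t) *\<^sub>R v)))"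
   using i by auto
  show "integrable lborel (\<lambda>t. LBINT x. norm (case (t, x) of (t, x) \<Rightarrow> indicator {0..h} t * (w (x + (s * t) *\<^sub>R v) * \<psi> (x + (r * t) *\<^sub>R v))))"
  proof (rule integrable_bound_B[where f="\<lambda>t. indicator {0..h} t * (B * (LBINT x. norm (w x)))"])
   show "AE t in lborel. norm (LBINT x. norm (case (t, x) of (t, x) \<Rightarrow> indicator {0..h} t * (w (x + (s * t) *\<^sub>R v) * \<psi> (x + (r * t) *\<^sub>R v))))
     \<le> norm (indicator {0..h} t * (B * (LBINT x. norm (w x))))"
    using order_trans[OF nb abs_ge_self] by (intro AE_I2) (auto simp: indicator_def abs_mult)
   have "integrable lborel (indicator {0..h} :: real \<Rightarrow> real)" by (cases "0 \<le> h"; rule integrable_real_indicator) auto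
   then show "integrable lborel (\<lambda>t. indicator {0..h} t * (B * (LBINT x. norm (w x))))" by simp
  qed auto
 qed measurable
 then have "integrable (lborel \<Otimes>\<^sub>M lborel) (\<lambda>(x, y). (\<lambda>(t, x). indicator {0..h} t * (w (x + (s * t) *\<^sub>R v) * \<psi> (x + (r * t) *\<^sub>R v))) (y, x))"
  by (rule lborel_pair.integrable_product_swap)
 then show ?thesis by simp
qed

text \<open>Shift and difference are moved onto the test function, where the classical fundamental
  theorem of calculus applies; the fundamental lemma then removes the test function. The condition
  on \<open>O1\<close> guarantees that the translates by t v with t in [0, h] are still test
  functions on V.\<close>

lemma weak_derivative_increment:
 fixes u w :: "'e::euclidean_space \<Rightarrow> real"
 assumes u: "integrable lborel u" and w: "integrable lborel w"
  and weak: "\<And>\<phi>. test_function V \<phi> ==>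
   (LBINT y. u y * ddir \<phi> y v) = - (LBINT y. w y * \<phi> y)"
  and O1: "open O1" "\<And>x t. x \<in> O1 ==> 0 \<le> t ==> t \<le> h ==> x + t *\<^sub>R v \<in> V" and h: "h > 0"
 shows "AE x in lborel. x \<in> O1 \<longrightarrow> u (x + h *\<^sub>R v) - u x = (LBINT t. indicator {0..h} t * w (x + t *\<^sub>R v))"
proof -
 define W where "W x = (LBINT t. indicator {0..h} t * w (x + t *\<^sub>R v))" for x
 have mu [measurable]: "u \<in> borel_measurable borel" "w \<in> borel_measurable borel" using u w by auto
 have "integrable (lborel \<Otimes>\<^sub>M lborel) (\<lambda>(x, t). indicator {0..h} t * (w (x + (1 * t) *\<^sub>R v) * 1))"
  by (rule integrable_pair_shift[OF w, of "\<lambda>x. 1"]) auto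
 from lborel_pair.integrable_fst'[OF this] have W: "integrable lborel W"
  by (simp add: W_def[abs_def])
 have uh: "integrable lborel (\<lambda>x. u (x + h *\<^sub>R v))" using u by (simp add: lborel_translate(1))
 define k where "k x = u (x + h *\<^sub>R v) - u x - W x" for x
 have k: "integrable lborel k" unfolding k_def using u uh W by auto
 then have k': "integrable lebesgue k" by (simp add: integrable_completion borel_measurable_integrable)
 have "AE x in lebesgue. x \<in> O1 \<longrightarrow> k x = 0"
 proof (rule fundamental_lemma[OF O1(1)])
  fix K :: "'e set" assume "compact K"
  then show "set_integrable lebesgue K k" unfolding set_integrable_def
   using k' by (intro integrable_mult_indicator) (auto simp: compact_imp_closed)
 next
  fix \<phi> assume \<phi>: "test_function O1 \<phi>"
  then obtain K B where K: "compact K" "K \<subseteq> O1" "\<And>y. y \<notin> K ==> \<phi> y = 0" "continuous_on UNIV \<phi>"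
   "\<And>y. \<phi> differentiable (at y)" "continuous_on UNIV (\<lambda>y. ddir \<phi> y v)"
   "\<And>y. y \<notin> K ==> ddir \<phi> y v = 0" "B > 0" "\<And>y. \<bar>\<phi> y\<bar> \<le> B"
   "\<And>y. \<bar>ddir \<phi> y v\<bar> \<le> B" by (rule test_functionE[where v=v]) metis
  define D where "D y = ddir \<phi> y v" for y
  have m\<phi> [measurable]: "\<phi> \<in> borel_measurable borel" "D \<in> borel_measurable borel"
   unfolding D_def using K by (auto intro: borel_measurable_continuous_onI)
  have bnd: "integrable lborel (\<lambda>x. f x * \<phi> (x + a))" if "integrable lborel f" for f a
  proof (rule integrable_bound_B[where f="\<lambda>x. B * f x"])
   show "AE x in lborel. norm (f x * \<phi> (x + a)) \<le> norm (B * f x)"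
    using mult_right_mono[OF K(9) abs_ge_zero] K(8) by (intro AE_I2) (auto simp: abs_mult mult.commute)
  qed (use that in auto)
  have ftc: "(LBINT t. indicator {0..h} t * D (x + (- t) *\<^sub>R v)) = \<phi> x - \<phi> (x - h *\<^sub>R v)" for x
  proof -
   have der: "((\<lambda>t. \<phi> (x - t *\<^sub>R v)) has_real_derivative - D (x - t *\<^sub>R v)) (at t)" for t
   proof -
    have "((\<lambda>t. x - t *\<^sub>R v) has_derivative (\<lambda>s. - (s *\<^sub>R v))) (at t)" by (auto intro!: derivative_eq_intros)
    from has_derivative_compose[OF this] K(5) have "((\<lambda>t. \<phi> (x - t *\<^sub>R v)) has_derivative (\<lambda>s. frechet_derivative \<phi> (at (x - t *\<^sub>R v)) (- (s *\<^sub>R v)))) (at t)"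
     by (auto simp: frechet_derivative_works)
    moreover have "frechet_derivative \<phi> (at (x - t *\<^sub>R v)) (- (s *\<^sub>R v)) = - D (x - t *\<^sub>R v) * s" for s
     using linear_frechet_derivative[OF K(5), of "x - t *\<^sub>R v"]
     by (simp add: D_def linear_neg linear_cmul)
    ultimately show ?thesis unfolding has_field_derivative_def
     by (elim has_derivative_eq_rhs) (simp add: fun_eq_iff)
   qed
   have "(LBINT t. (- D (x - t *\<^sub>R v)) * indicator {0..h} t) = \<phi> (x - h *\<^sub>R v) - \<phi> (x - 0 *\<^sub>R v)"
   proof (rule integral_FTC_Icc_real)
    show "isCont (\<lambda>t. - D (x - t *\<^sub>R v)) t" for t
    proof -
     have "continuous_on UNIV (\<lambda>t. D (x - t *\<^sub>R v))"
      using K(6) unfolding D_def[symmetric] by (rule continuous_on_compose2) (auto intro!: continuous_intros)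
     then show ?thesis by (auto simp: continuous_on_eq_continuous_at)
    qed
   qed (use h der in auto)
   then show ?thesis by (simp add: mult.commute)
  qed
  have pu: "integrable (lborel \<Otimes>\<^sub>M lborel) (\<lambda>(x, t). indicator {0..h} t * (u (x + (0 * t) *\<^sub>R v) * D (x + ((-1) * t) *\<^sub>R v)))"
   by (rule integrable_pair_shift[OF u]) (use K in \<open>auto simp: D_def[symmetric]\<close>)
  have pw: "integrable (lborel \<Otimes>\<^sub>M lborel) (\<lambda>(x, t). indicator {0..h} t * (w (x + (1 * t) *\<^sub>R v) * \<phi> (x + (0 * t) *\<^sub>R v)))"
   by (rule integrable_pair_shift[OF w]) (use K in auto)
  have "(LBINT x. (u (x + h *\<^sub>R v) - u x) * \<phi> x) = (LBINT x. u (x + h *\<^sub>R v) * \<phi> x) - (LBINT x. u x * \<phi> x)"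
   using bnd[OF u, of 0] bnd[OF uh, of 0] by (simp add: left_diff_distrib)
  also have "(LBINT x. u (x + h *\<^sub>R v) * \<phi> x) = (LBINT x. u x * \<phi> (x - h *\<^sub>R v))"
   using lborel_translate(2)[of "\<lambda>x. u x * \<phi> (x - h *\<^sub>R v)" "h *\<^sub>R v"] by simp
  also have "(LBINT x. u x * \<phi> (x - h *\<^sub>R v)) - (LBINT x. u x * \<phi> x) = - (LBINT x. u x * (\<phi> x - \<phi> (x - h *\<^sub>R v)))"
   using bnd[OF u, of 0] bnd[OF u, of "- (h *\<^sub>R v)"] by (simp add: right_diff_distrib)
  also have "(LBINT x. u x * (\<phi> x - \<phi> (x - h *\<^sub>R v))) = (LBINT x. (LBINT t. indicator {0..h} t * (u x * D (x + (- t) *\<^sub>R v))))"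
   unfolding ftc[symmetric] integral_mult_right_zero_B[symmetric] by (simp add: ac_simps)
  also have "\<dots> = (LBINT t. (LBINT x. indicator {0..h} t * (u x * D (x + (- t) *\<^sub>R v))))"
   using lborel_pair.Fubini_integral[OF pu] by simp
  also have "\<dots> = (LBINT t. - (LBINT x. indicator {0..h} t * (w (x + t *\<^sub>R v) * \<phi> x)))"
  proof (rule integral_cong_B[OF refl])
   fix t :: real
   show "(LBINT x. indicator {0..h} t * (u x * D (x + (- t) *\<^sub>R v))) = - (LBINT x. indicator {0..h} t * (w (x + t *\<^sub>R v) * \<phi> x))"
   proof (cases "t \<in> {0..h}")
    case True
    have tf: "test_function V (\<lambda>x. \<phi> (x - t *\<^sub>R v))"
     using True O1(2) by (intro test_function_translate[OF \<phi>]) auto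
    have "frechet_derivative (\<lambda>x. \<phi> (x - t *\<^sub>R v)) (at x) v = D (x - t *\<^sub>R v)" for x
     unfolding D_def by (subst frechet_derivativeI[OF frechet_derivative_translate[OF K(5)]]) simp
    then have "(LBINT x. u x * D (x - t *\<^sub>R v)) = - (LBINT x. w x * \<phi> (x - t *\<^sub>R v))"
     using weak[OF tf] by simp
    also have "(LBINT x. w x * \<phi> (x - t *\<^sub>R v)) = (LBINT x. w (x + t *\<^sub>R v) * \<phi> x)"
     using lborel_translate(2)[of "\<lambda>x. w x * \<phi> (x - t *\<^sub>R v)" "t *\<^sub>R v"] by simp
    finally show ?thesis using True by simp
   qed simp
  qed
  also have "\<dots> = - (LBINT x. (LBINT t. indicator {0..h} t * (w (x + t *\<^sub>R v) * \<phi> x)))"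
   using lborel_pair.Fubini_integral[OF pw] by simp
  also have "(LBINT x. (LBINT t. indicator {0..h} t * (w (x + t *\<^sub>R v) * \<phi> x))) = (LBINT x. W x * \<phi> x)"
   unfolding W_def integral_mult_left_zero_B[symmetric] by (simp add: ac_simps)
  finally have eq: "(LBINT x. (u (x + h *\<^sub>R v) - u x) * \<phi> x) = (LBINT x. W x * \<phi> x)" by simp
  have "(LINT y:O1|lebesgue. k y * \<phi> y) = (LINT y|lebesgue. k y * \<phi> y)"
   unfolding set_lebesgue_integral_def using K(2,3)
   by (intro integral_cong_B) (auto simp: indicator_def)
  also have "\<dots> = (LBINT y. k y * \<phi> y)"
   using k by (intro integral_completion) (auto simp: borel_measurable_integrable)
  also have "\<dots> = (LBINT x. (u (x + h *\<^sub>R v) - u x) * \<phi> x) - (LBINT x. W x * \<phi> x)"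
   unfolding k_def left_diff_distrib[of _ "W _"]
   using bnd[OF integrable_diff_B[OF uh u], of 0] bnd[OF W, of 0] by simp
  finally show "(LINT y:O1|lebesgue. k y * \<phi> y) = 0" using eq by simp
 qed
 then have "AE x in lborel. x \<in> O1 \<longrightarrow> k x = 0" by (simp add: AE_completion_iff)
 then show ?thesis by eventually_elim (auto simp: k_def W_def)
qed

text \<open>A weak derivative is the \<open>L\<^sup>1\<close> limit of difference quotients, which turns the chain and
 product rules into statements about ordinary difference quotients.\<close>

lemma difference_quotient_L1:
 fixes u w :: "'e::euclidean_space \<Rightarrow> real"
 assumes u: "integrable lborel u" and w: "integrable lborel w"
  and weak: "\<And>\<phi>. test_function V \<phi> ==>
   (LBINT y. u y * ddir \<phi> y v) = - (LBINT y. w y * \<phi> y)"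
  and O1: "open O1" "\<And>x t. x \<in> O1 ==> 0 \<le> t ==> t \<le> h0 ==> x + t *\<^sub>R v \<in> V"
  and e: "e > 0" and h0: "h0 > 0"
 shows "\<exists>d>0. \<forall>h. 0 < h \<longrightarrow> h < d \<longrightarrow>
   (LBINT x. indicator O1 x * \<bar>(u (x + h *\<^sub>R v) - u x) / h - w x\<bar>) \<le> e"
proof -
 have mw [measurable]: "u \<in> borel_measurable borel" "w \<in> borel_measurable borel" using u w by auto
 have mO [measurable]: "O1 \<in> sets borel" using O1 by simp
 obtain d1 where d1: "d1 > 0" "\<And>s. norm s < d1 ==> (LBINT x. \<bar>w (x + s) - w x\<bar>) < e"
  using L1_translation_continuous[OF w e] by auto
 \<comment> \<open>Every shift t v with t \<le> h < d is then shorter than \<open>d1\<close>; the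
   summand 1 covers v = 0.\<close>
 define d where "d = min h0 (d1 / (norm v + 1))"
 show ?thesis
 proof (intro exI conjI allI impI)
  show "d > 0" using d1 h0 by (auto simp: d_def intro!: divide_pos_pos add_nonneg_pos)
  fix h assume h: "0 < h" "h < d"
  have hv: "norm (t *\<^sub>R v) < d1" if "t \<in> {0..h}" for t
  proof -
   have "norm (t *\<^sub>R v) \<le> h * (norm v + 1)" using that by (auto intro!: mult_mono)
   also have "\<dots> < d1" using h pos_less_divide_eq[of "norm v + 1" h d1] by (simp add: d_def add_nonneg_pos)
   finally show ?thesis .
  qed
  have ae: "AE x in lborel. x \<in> O1 \<longrightarrow> u (x + h *\<^sub>R v) - u x = (LBINT t. indicator {0..h} t * w (x + t *\<^sub>R v))"
   by (rule weak_derivative_increment[OF u w weak O1(1)]) (use O1(2) h in \<open>auto simp: d_def\<close>)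
  have p1: "integrable (lborel \<Otimes>\<^sub>M lborel) (\<lambda>(x, t). indicator {0..h} t * (w (x + (1 * t) *\<^sub>R v) * 1))"
   by (rule integrable_pair_shift[OF w, of "\<lambda>x. 1"]) auto
  have p0: "integrable (lborel \<Otimes>\<^sub>M lborel) (\<lambda>(x, t). indicator {0..h} t * (w (x + (0 * t) *\<^sub>R v) * 1))"
   by (rule integrable_pair_shift[OF w, of "\<lambda>x. 1"]) auto
  have p: "integrable (lborel \<Otimes>\<^sub>M lborel) (\<lambda>(x, t). \<bar>indicator {0..h} t * (w (x + t *\<^sub>R v) - w x)\<bar>)"
   using integrable_abs[OF integrable_diff_B[OF p1 p0]] by (simp add: split_beta' right_diff_distrib)
  \<comment> \<open>The difference quotient minus w is the mean over [0, h] of the translation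
    differences of w. g integrates their absolute values, and continuity of translation bounds its
    integral by h e.\<close>
  define g where "g x = (LBINT t. \<bar>indicator {0..h} t * (w (x + t *\<^sub>R v) - w x)\<bar>)" for x
  have gi: "integrable lborel g" using lborel_pair.integrable_fst'[OF p] by (simp add: g_def[abs_def])
  have ig: "(LBINT x. g x) \<le> h * e"
  proof -
   have "(LBINT x. g x) = (LBINT t. (LBINT x. \<bar>indicator {0..h} t * (w (x + t *\<^sub>R v) - w x)\<bar>))"
    unfolding g_def using lborel_pair.Fubini_integral[OF p] by simp
   also have "\<dots> = (LBINT t. indicator {0..h} t * (LBINT x. \<bar>w (x + t *\<^sub>R v) - w x\<bar>))"
    by (intro integral_cong_B) (auto simp: abs_mult)
   also have "\<dots> \<le> (LBINT t. indicator {0..h} t * e)"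
   proof (rule integral_mono')
    have "integrable lborel (indicator {0..h} :: real \<Rightarrow> real)" by (rule integrable_real_indicator) (use h in auto)
    then show "integrable lborel (\<lambda>t. indicator {0..h} t * e)" by simp
    show "indicator {0..h} t * (LBINT x. \<bar>w (x + t *\<^sub>R v) - w x\<bar>) \<le> indicator {0..h} t * e" for t
     using d1(2)[OF hv[of t]] by (auto simp: indicator_def)
    show "0 \<le> indicator {0..h} t * e" for t using e by simp
   qed
   also have "\<dots> = h * e" using h by simp
   finally show ?thesis .
  qed
  have "(LBINT x. indicator O1 x * \<bar>(u (x + h *\<^sub>R v) - u x) / h - w x\<bar>) \<le> (LBINT x. g x / h)"
  proof (rule integral_mono_AE')
   show "integrable lborel (\<lambda>x. g x / h)" using gi by simp
   show "AE x in lborel. 0 \<le> g x / h" unfolding g_def using h by (intro AE_I2 divide_nonneg_pos integral_nonneg_B) auto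
   have ai: "AE x in lborel. integrable lborel (\<lambda>t. indicator {0..h} t * w (x + t *\<^sub>R v))"
    using lborel_pair.AE_integrable_fst'[OF p1] by simp
   show "AE x in lborel. indicator O1 x * \<bar>(u (x + h *\<^sub>R v) - u x) / h - w x\<bar> \<le> g x / h"
    using ae ai
   proof eventually_elim
    case (elim x)
    have gx: "g x / h \<ge> 0" unfolding g_def using h by (intro divide_nonneg_pos integral_nonneg_B) auto
    have ih: "integrable lborel (\<lambda>t. indicator {0..h} t * w x)"
     by (intro integrable_mult_left integrable_real_indicator) (use h in auto)
    have "(LBINT t. indicator {0..h} t * w (x + t *\<^sub>R v)) - h * w x
      = (LBINT t. indicator {0..h} t * w (x + t *\<^sub>R v)) - (LBINT t. indicator {0..h} t * w x)"
     using h by simp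
    also have "\<dots> = (LBINT t. indicator {0..h} t * (w (x + t *\<^sub>R v) - w x))"
     unfolding right_diff_distrib by (rule integral_diff_B[symmetric, OF elim(2) ih])
    finally have "\<bar>(LBINT t. indicator {0..h} t * w (x + t *\<^sub>R v)) - h * w x\<bar> \<le> g x"
     unfolding g_def by (simp add: integral_abs_bound)
    then show ?case using elim(1) gx h
     by (cases "x \<in> O1") (auto simp: field_simps abs_le_iff)
   qed
  qed
  also have "\<dots> \<le> e" using ig h by (simp add: field_simps)
  finally show "(LBINT x. indicator O1 x * \<bar>(u (x + h *\<^sub>R v) - u x) / h - w x\<bar>) \<le> e" .
 qed
qed

lemma directional_increment_bound:
 fixes f :: "'e::real_normed_vector \<Rightarrow> real"
 assumes "\<And>t. 0 \<le> t ==> t \<le> h ==> f differentiable (at (x + t *\<^sub>R v))"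
  and "\<And>t. 0 \<le> t ==> t \<le> h ==> \<bar>frechet_derivative f (at (x + t *\<^sub>R v)) v\<bar> \<le> B" and h: "h > 0"
 shows "\<bar>f (x + h *\<^sub>R v) - f x\<bar> \<le> B * h"
proof -
 have der: "((\<lambda>t. f (x + t *\<^sub>R v)) has_real_derivative frechet_derivative f (at (x + t *\<^sub>R v)) v) (at t)"
  if "0 \<le> t" "t \<le> h" for t
 proof -
  have "((\<lambda>t. x + t *\<^sub>R v) has_derivative (\<lambda>s. s *\<^sub>R v)) (at t)" by (auto intro!: derivative_eq_intros)
  from has_derivative_compose[OF this] assms(1)[OF that]
  have "((\<lambda>t. f (x + t *\<^sub>R v)) has_derivative (\<lambda>s. frechet_derivative f (at (x + t *\<^sub>R v)) (s *\<^sub>R v))) (at t)"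
   by (auto simp: frechet_derivative_works)
  then show ?thesis unfolding has_field_derivative_def
   by (rule has_derivative_eq_rhs)
    (use linear_frechet_derivative[OF assms(1)[OF that]] in \<open>auto simp: linear_cmul fun_eq_iff\<close>)
 qed
 obtain z where z: "0 < z" "z < h" "f (x + h *\<^sub>R v) - f (x + 0 *\<^sub>R v) = (h - 0) * frechet_derivative f (at (x + z *\<^sub>R v)) v"
  using MVT2[OF h, of "\<lambda>t. f (x + t *\<^sub>R v)" "\<lambda>t. frechet_derivative f (at (x + t *\<^sub>R v)) v"] der by auto
 then show ?thesis using assms(2)[of z] h by (simp add: abs_mult mult.commute)
qed

lemma directional_quotient_tendsto:
 fixes f :: "'e::real_normed_vector \<Rightarrow> real"
 assumes "f differentiable (at x)" and h: "h \<longlonglongrightarrow> 0" "\<And>n. h n \<noteq> 0"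
 shows "(\<lambda>n. (f (x + h n *\<^sub>R v) - f x) / h n) \<longlonglongrightarrow> ddir f x v"
proof -
 have "((\<lambda>t. x + t *\<^sub>R v) has_derivative (\<lambda>s. s *\<^sub>R v)) (at (0::real))" by (auto intro!: derivative_eq_intros)
 from has_derivative_compose[OF this, of f] assms(1)
 have "((\<lambda>t. f (x + t *\<^sub>R v)) has_derivative (\<lambda>s. frechet_derivative f (at x) (s *\<^sub>R v))) (at (0::real))"
  by (auto simp: frechet_derivative_works)
 then have "((\<lambda>t. f (x + t *\<^sub>R v)) has_real_derivative ddir f x v) (at 0)"
  unfolding has_field_derivative_def
  by (rule has_derivative_eq_rhs) (use linear_frechet_derivative[OF assms(1)] in \<open>auto simp: linear_cmul fun_eq_iff\<close>)
 then have "((\<lambda>t. (f (x + t *\<^sub>R v) - f x) / t) \<longlongrightarrow> ddir f x v) (at 0)"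
  by (simp add: has_field_derivative_iff)
 moreover have "filterlim h (at 0) sequentially" using h by (simp add: filterlim_at)
 ultimately show ?thesis by (rule filterlim_compose)
qed

text \<open>A discrete product rule comes first: the difference quotient of \<eta> F(u) is the
  shifted \<eta> times the secant slope of F times the quotient of u, plus F(u) times the quotient
  of \<eta>. The quotient of u converges in L1, the secant slope boundedly and almost everywhere, so
  every piece passes to the limit without smoothing u.\<close>

theorem weak_derivative_product_chain:
 fixes u w \<eta> :: "'e::euclidean_space \<Rightarrow> real" and F F' :: "real \<Rightarrow> real"
 assumes V: "open V"
  and u: "\<And>K. compact K ==> K \<subseteq> V ==> set_integrable lebesgue K u"
  and w: "\<And>K. compact K ==> K \<subseteq> V ==> set_integrable lebesgue K w"
  and weak: "\<And>\<phi>. test_function V \<phi> ==>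
   (LINT y:V|lebesgue. u y * ddir \<phi> y v) = - (LINT y:V|lebesgue. w y * \<phi> y)"
  and F: "\<And>s. (F has_real_derivative F' s) (at s)" "continuous_on UNIV F'" "\<And>s. \<bar>F' s\<bar> \<le> L"
  and \<eta>: "\<And>y. y \<in> V ==> \<eta> differentiable (at y)" "continuous_on V (\<lambda>y. ddir \<eta> y v)"
  and \<phi>: "test_function V \<phi>"
 shows "(LINT y:V|lebesgue. (\<eta> y * F (u y)) * ddir \<phi> y v) =
  - (LINT y:V|lebesgue. (\<eta> y * F' (u y) * w y + F (u y) * ddir \<eta> y v) * \<phi> y)"
proof -
 obtain K B where K: "compact K" "K \<subseteq> V" "\<And>y. y \<notin> K ==> \<phi> y = 0" "continuous_on UNIV \<phi>"
  "\<And>y. \<phi> differentiable (at y)" "continuous_on UNIV (\<lambda>y. ddir \<phi> y v)"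
  "\<And>y. y \<notin> K ==> ddir \<phi> y v = 0" "B > 0" "\<And>y. \<bar>\<phi> y\<bar> \<le> B"
  "\<And>y. \<bar>ddir \<phi> y v\<bar> \<le> B" using \<phi> by (rule test_functionE[where v=v]) metis
 define D where "D y = ddir \<phi> y v" for y
 obtain e where e: "e > 0" "(\<Union>x\<in>K. ball x e) \<subseteq> V"
  using compact_subset_open_imp_ball_epsilon_subset[OF K(1) V K(2)] by auto
 define r where "r = e / 2"
 have r: "r > 0" using e by (simp add: r_def)
 \<comment> \<open>Nested neighbourhoods of the support K: \<open>O1\<close> inside
   \<open>V2\<close> inside the compact \<open>K2\<close> inside V. Shifts t v with t at most h0
   lead from \<open>O1\<close> into \<open>V2\<close> and from K into \<open>K2\<close>.\<close>
 define K2 where "K2 = (\<Union>x\<in>K. \<Union>y\<in>cball 0 r. {x + y})"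
 have K2: "compact K2" unfolding K2_def using K(1) by (intro compact_sums') auto
 have K2I: "x + y \<in> K2" if "x \<in> K" "norm y \<le> r" for x y
  unfolding K2_def using that by (intro UN_I[OF that(1)] UN_I[of y]) auto
 have K2V: "K2 \<subseteq> V"
 proof
  fix z assume "z \<in> K2"
  then obtain x y where "x \<in> K" "norm y \<le> r" "z = x + y" by (auto simp: K2_def)
  then have "z \<in> ball x e" using e by (auto simp: r_def dist_norm)
  then show "z \<in> V" using e(2) \<open>x \<in> K\<close> by blast
 qed
 have KK2: "K \<subseteq> K2" using K2I[of _ 0] r by auto
 define V2 where "V2 = (\<Union>x\<in>K. ball x r)"
 have V2: "open V2" "V2 \<subseteq> K2" "K \<subseteq> V2"
 proof -
  show "V2 \<subseteq> K2"
  proof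
   fix z assume "z \<in> V2"
   then obtain x where "x \<in> K" "dist x z < r" by (auto simp: V2_def)
   then show "z \<in> K2" using K2I[of x "z - x"] by (simp add: dist_norm norm_minus_commute)
  qed
  show "K \<subseteq> V2" using r by (auto simp: V2_def)
 qed (auto simp: V2_def)
 define O1 where "O1 = (\<Union>x\<in>K. ball x (r / 2))"
 have O1: "open O1" "K \<subseteq> O1" using r by (auto simp: O1_def)
 define h0 where "h0 = r / (2 * (norm v + 1))"
 have h0: "h0 > 0" using r by (auto simp: h0_def intro!: divide_pos_pos mult_pos_pos add_nonneg_pos)
 have tv: "norm (t *\<^sub>R v) < r / 2" if "\<bar>t\<bar> \<le> h0" for t
 proof -
  have "norm (t *\<^sub>R v) \<le> h0 * norm v" using that by (auto intro!: mult_right_mono)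
  also have "\<dots> < h0 * (norm v + 1)" using h0 by (intro mult_strict_left_mono) auto
  also have "\<dots> = r / 2" using norm_ge_zero[of v] by (simp add: h0_def field_simps add_nonneg_eq_0_iff)
  finally show ?thesis .
 qed
 have O1V2: "x + t *\<^sub>R v \<in> V2" if xt: "x \<in> O1" "0 \<le> t" "t \<le> h0" for x t
 proof -
  obtain z where "z \<in> K" "x \<in> ball z (r / 2)" using xt(1) unfolding O1_def by blast
  then have z: "z \<in> K" "dist z x < r / 2" by simp_all
  have "dist z (x + t *\<^sub>R v) \<le> dist z x + dist x (x + t *\<^sub>R v)" by (rule dist_triangle)
  also have "\<dots> < r / 2 + r / 2" using z tv[of t] xt by (intro add_strict_mono) (auto simp: dist_norm)
  finally show ?thesis using z by (auto simp: V2_def)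
 qed
 have Kt: "x + t *\<^sub>R v \<in> K2" if "x \<in> K" "\<bar>t\<bar> \<le> h0" for x t
  using K2I[OF that(1), of "t *\<^sub>R v"] tv[OF that(2)] r by simp
 \<comment> \<open>Integrable Borel representatives vanishing off \<open>K2\<close>: translations
   and Fubini then apply on the whole space.\<close>
 have rep: "\<exists>f0. integrable lborel f0 \<and> (\<forall>x. x \<notin> K2 \<longrightarrow> f0 x = 0) \<and> (AE x in lebesgue. x \<in> K2 \<longrightarrow> f0 x = f x)"
  if f: "set_integrable lebesgue K2 f" for f :: "'e \<Rightarrow> real"
 proof -
  obtain h where h: "h \<in> borel_measurable lborel" "AE x in lborel. indicator K2 x *\<^sub>R f x = h x"
   using completion_ex_borel_measurable_real[of "\<lambda>y. indicator K2 y *\<^sub>R f y" lborel] f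
   unfolding set_integrable_def by blast
  have h2: "AE x in lebesgue. indicator K2 x *\<^sub>R f x = h x" using h(2) by (rule AE_completion)
  have "integrable lebesgue h"
   using f unfolding set_integrable_def
   by (rule integrable_cong_AE_imp) (use h h2 in \<open>auto simp: eq_commute intro: measurable_completion\<close>)
  then have "integrable lborel h" using h(1) by (simp add: integrable_completion)
  then have "integrable lborel (\<lambda>x. indicator K2 x *\<^sub>R h x)"
   using K2 by (intro integrable_mult_indicator) (auto simp: compact_imp_closed)
  moreover have "AE x in lebesgue. x \<in> K2 \<longrightarrow> indicator K2 x *\<^sub>R h x = f x"
   using h2 by eventually_elim auto
  ultimately show ?thesis by (intro exI[of _ "\<lambda>x. indicator K2 x *\<^sub>R h x"]) auto
 qed
 obtain u0 where u0: "integrable lborel u0" "\<And>x. x \<notin> K2 ==> u0 x = 0" "AE x in lebesgue. x \<in> K2 \<longrightarrow> u0 x = u x"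
  using rep[OF u[OF K2 K2V]] by auto
 obtain w0 where w0: "integrable lborel w0" "\<And>x. x \<notin> K2 ==> w0 x = 0" "AE x in lebesgue. x \<in> K2 \<longrightarrow> w0 x = w x"
  using rep[OF w[OF K2 K2V]] by auto
 have [measurable]: "u0 \<in> borel_measurable borel" "w0 \<in> borel_measurable borel" using u0 w0 by auto
 have contF: "continuous_on UNIV F" using F(1) by (meson DERIV_isCont continuous_at_imp_continuous_on)
 have [measurable]: "F \<in> borel_measurable borel" "F' \<in> borel_measurable borel"
  using contF F(2) by (auto intro: borel_measurable_continuous_onI)
 have [measurable]: "\<phi> \<in> borel_measurable borel" "D \<in> borel_measurable borel"
  unfolding D_def using K by (auto intro: borel_measurable_continuous_onI)
 have [measurable]: "K2 \<in> sets borel" "K \<in> sets borel" "O1 \<in> sets borel"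
  using K2 K(1) O1 by (auto simp: compact_imp_closed)
 have transfer: "(LINT y:V|lebesgue. a y * b y) = (LBINT y. a0 y * b y)"
  if b: "\<And>y. y \<notin> K2 ==> b y = 0" and a: "AE y in lebesgue. y \<in> K2 \<longrightarrow> a0 y = a y"
   and m: "(\<lambda>y. a0 y * b y) \<in> borel_measurable borel" for a b a0 :: "'e \<Rightarrow> real"
 proof -
  have AEe: "AE y in lebesgue. indicator V y *\<^sub>R (a y * b y) = a0 y * b y"
   using a
  proof eventually_elim
   case (elim y)
   show ?case
   proof (cases "y \<in> K2")
    case True
    then have "y \<in> V" "a0 y = a y" using elim K2V by auto
    then show ?thesis by simp
   next
    case False
    then have "b y = 0" by (rule b)
    then show ?thesis by simp
   qed
  qed
  have m': "(\<lambda>y. a0 y * b y) \<in> borel_measurable lebesgue" using m by (intro measurable_completion) (simp only: measurable_lborel1 measurable_lborel2)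
  have m2: "(\<lambda>y. indicator V y *\<^sub>R (a y * b y)) \<in> borel_measurable lebesgue"
  proof (rule borel_measurable_AE[OF m'])
   show "AE y in lebesgue. a0 y * b y = indicator V y *\<^sub>R (a y * b y)"
    using AEe by eventually_elim (rule sym)
  qed
  have "(LINT y:V|lebesgue. a y * b y) = (LINT y|lebesgue. a0 y * b y)"
   unfolding set_lebesgue_integral_def by (rule integral_cong_AE[OF m2 m' AEe])
  also have "\<dots> = (LBINT y. a0 y * b y)" using m by (intro integral_completion) (simp only: measurable_lborel1 measurable_lborel2)
  finally show ?thesis .
 qed
 \<comment> \<open>After truncation to \<open>K2\<close> the weak identity remains available for
   test functions supported in \<open>V2\<close>, where nothing was cut off.\<close>
 have weak0: "(LBINT y. u0 y * ddir \<psi> y v) = - (LBINT y. w0 y * \<psi> y)"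
  if \<psi>: "test_function V2 \<psi>" for \<psi>
 proof -
  obtain K' B' where K': "compact K'" "K' \<subseteq> V2" "\<And>y. y \<notin> K' ==> \<psi> y = 0" "continuous_on UNIV \<psi>"
   "\<And>y. \<psi> differentiable (at y)" "continuous_on UNIV (\<lambda>y. ddir \<psi> y v)"
   "\<And>y. y \<notin> K' ==> ddir \<psi> y v = 0" "B' > 0" "\<And>y. \<bar>\<psi> y\<bar> \<le> B'"
   "\<And>y. \<bar>ddir \<psi> y v\<bar> \<le> B'" using \<psi> by (rule test_functionE[where v=v]) metis
  have [measurable]: "\<psi> \<in> borel_measurable borel" "(\<lambda>y. ddir \<psi> y v) \<in> borel_measurable borel"
   using K' by (auto intro: borel_measurable_continuous_onI)
  have "test_function V \<psi>" using \<psi> V2(2) K2V unfolding test_function_def by blast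
  note wk = weak[OF this]
  have z: "ddir \<psi> y v = 0" "\<psi> y = 0" if "y \<notin> K2" for y
   using K'(2,3,7) V2(2) that by blast+
  have "(LINT y:V|lebesgue. u y * ddir \<psi> y v) = (LBINT y. u0 y * ddir \<psi> y v)"
   by (rule transfer[OF _ u0(3)]) (use z in auto)
  moreover have "(LINT y:V|lebesgue. w y * \<psi> y) = (LBINT y. w0 y * \<psi> y)"
   by (rule transfer[OF _ w0(3)]) (use z in auto)
  ultimately show ?thesis using wk by simp
 qed
 \<comment> \<open>\<eta> is controlled only inside V, so it is cut to \<open>K2\<close>, where
   compactness bounds it together with its derivative.\<close>
 define \<eta>K where "\<eta>K x = indicator K2 x *\<^sub>R \<eta> x" for x
 define D\<eta> where "D\<eta> x = indicator K2 x *\<^sub>R ddir \<eta> x v" for x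
 have "continuous_on K2 \<eta>"
  using \<eta>(1) K2V by (auto intro!: continuous_at_imp_continuous_on differentiable_imp_continuous_within)
 moreover have "continuous_on K2 (\<lambda>x. ddir \<eta> x v)"
  using \<eta>(2) K2V by (rule continuous_on_subset)
 ultimately have c\<eta>: "continuous_on K2 \<eta>" "continuous_on K2 (\<lambda>x. ddir \<eta> x v)" .
 have [measurable]: "\<eta>K \<in> borel_measurable borel" "D\<eta> \<in> borel_measurable borel"
  unfolding \<eta>K_def D\<eta>_def using c\<eta> K2 by (auto simp del: real_scaleR_def simp: compact_imp_closed intro!: borel_measurable_continuous_on_indicator)
 have "bounded (\<eta> ` K2)" "bounded ((\<lambda>y. ddir \<eta> y v) ` K2)"
  using K2 c\<eta> by (auto intro!: compact_imp_bounded compact_continuous_image)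
 then obtain B1 B2 where B12: "B1 > 0" "\<And>y. y \<in> K2 ==> \<bar>\<eta> y\<bar> \<le> B1" "B2 > 0" "\<And>y. y \<in> K2 ==> \<bar>ddir \<eta> y v\<bar> \<le> B2"
  unfolding bounded_pos by auto
 have B1: "\<bar>\<eta>K y\<bar> \<le> B1" for y using B12 by (auto simp: \<eta>K_def indicator_def)
 have B2: "\<bar>D\<eta> y\<bar> \<le> B2" for y using B12 by (auto simp: D\<eta>_def indicator_def)
 have L0: "L \<ge> 0" using F(3)[of 0] by linarith
 have lipF: "\<bar>F s - F t\<bar> \<le> L * \<bar>s - t\<bar>" for s t
  using field_differentiable_bound[of UNIV F F' L s t] F by auto
 have Fu: "integrable lborel (\<lambda>x. indicator K2 x * F (u0 x))"
 proof (rule integrable_bound_B[where f="\<lambda>x. \<bar>F 0\<bar> * indicator K2 x + L * \<bar>u0 x\<bar>"])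
  have "integrable lborel (indicator K2 :: 'e \<Rightarrow> real)"
   using K2 emeasure_compact_finite[OF K2] by (intro integrable_real_indicator) (auto simp: compact_imp_closed)
  then show "integrable lborel (\<lambda>x. \<bar>F 0\<bar> * indicator K2 x + L * \<bar>u0 x\<bar>)"
   using u0(1) by (intro integrable_add_B integrable_mult_right integrable_abs)
  show "AE x in lborel. norm (indicator K2 x * F (u0 x)) \<le> norm (\<bar>F 0\<bar> * indicator K2 x + L * \<bar>u0 x\<bar>)"
  proof (intro AE_I2)
   fix x
   have "\<bar>F (u0 x)\<bar> \<le> \<bar>F 0\<bar> + L * \<bar>u0 x\<bar>" using lipF[of "u0 x" 0] by auto
   then show "norm (indicator K2 x * F (u0 x)) \<le> norm (\<bar>F 0\<bar> * indicator K2 x + L * \<bar>u0 x\<bar>)"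
    using L0 by (auto simp: indicator_def)
  qed
 qed measurable
 define G where "G x = \<eta>K x * F (u0 x)" for x
 have [measurable]: "G \<in> borel_measurable borel" unfolding G_def by measurable
 have bndint: "integrable lborel (\<lambda>x. a x * b x)" if "integrable lborel a" "b \<in> borel_measurable borel" "\<And>x. \<bar>b x\<bar> \<le> c" for a b :: "'e \<Rightarrow> real" and c
 proof (rule integrable_bound_B[where f="\<lambda>x. c * a x"])
  show "AE x in lborel. norm (a x * b x) \<le> norm (c * a x)"
  proof (intro AE_I2)
   fix x show "norm (a x * b x) \<le> norm (c * a x)"
    using mult_right_mono[OF order_trans[OF that(3)[of x] abs_ge_self[of c]] abs_ge_zero[of "a x"]] by (simp add: abs_mult mult.commute)
  qed
 qed (use that in auto)
 have Gi: "integrable lborel G"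
 proof -
  have "integrable lborel (\<lambda>x. indicator K2 x * F (u0 x) * \<eta>K x)" by (rule bndint[OF Fu]) (use B1 in auto)
  moreover have "indicator K2 x * F (u0 x) * \<eta>K x = G x" for x by (simp add: G_def \<eta>K_def indicator_def)
  ultimately show ?thesis by simp
 qed
 define h where "h n = h0 / (real n + 1)" for n
 have h: "0 < h n" "h n \<le> h0" for n using h0 by (auto simp: h_def field_simps)
 have "(\<lambda>n. h0 * (1 / (real n + 1))) \<longlonglongrightarrow> h0 * 0"
  using LIMSEQ_Suc[OF lim_1_over_n[where 'a=real]] by (intro tendsto_intros) (simp add: add.commute)
 then have hlim: "h \<longlonglongrightarrow> 0" by (simp add: h_def[abs_def])
 have "(\<lambda>n. LBINT x. norm (u0 (x + h n *\<^sub>R v) - u0 x)) \<longlonglongrightarrow> 0"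
 proof (rule LIMSEQ_I)
  fix \<epsilon> :: real assume "\<epsilon> > 0"
  from L1_translation_continuous[OF u0(1) this] obtain d where d: "d > 0" "\<And>s. norm s < d ==> (LBINT x. \<bar>u0 (x + s) - u0 x\<bar>) < \<epsilon>" by auto
  have "(\<lambda>n. norm (h n *\<^sub>R v)) \<longlonglongrightarrow> norm (0 *\<^sub>R v)" by (intro tendsto_intros hlim)
  then have "eventually (\<lambda>n. norm (h n *\<^sub>R v) < d) sequentially" using d(1) order_tendstoD(2) by fastforce
  then obtain N where "\<And>n. n \<ge> N ==> norm (h n *\<^sub>R v) < d" by (auto simp: eventually_sequentially)
  then show "\<exists>no. \<forall>n\<ge>no. norm ((LBINT x. norm (u0 (x + h n *\<^sub>R v) - u0 x)) - 0) < \<epsilon>"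
   using d(2) by (intro exI[of _ N]) (auto simp: abs_of_nonneg)
 qed
 \<comment> \<open>L1 convergence of the translates gives pointwise convergence only along a
   subsequence; all later limits run along this one.\<close>
 from tendsto_L1_AE_subseq[OF _ this] obtain \<rho> :: "nat \<Rightarrow> nat"
  where \<rho>: "strict_mono \<rho>" "AE x in lborel. (\<lambda>n. u0 (x + h (\<rho> n) *\<^sub>R v) - u0 x) \<longlonglongrightarrow> 0"
  using u0(1) by (auto simp: lborel_translate(1) intro!: integrable_diff_B)
 define k where "k n = h (\<rho> n)" for n
 have k: "0 < k n" "k n \<le> h0" for n using h by (auto simp: k_def)
 have kz: "k n \<noteq> 0" for n using k(1)[of n] by simp
 have klim: "k \<longlonglongrightarrow> 0" using LIMSEQ_subseq_LIMSEQ[OF hlim \<rho>(1)] by (simp add: k_def[abs_def] o_def)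
 let ?p = "\<lambda>n x. (\<phi> x - \<phi> (x - k n *\<^sub>R v)) / k n" and ?s = "\<lambda>n x. x + k n *\<^sub>R v" and ?f = "\<lambda>x. indicator K2 x * F (u0 x)"
 let ?d = "\<lambda>n x. (\<eta>K (?s n x) - \<eta>K x) / k n" and ?e = "\<lambda>n x. \<phi> x * \<eta>K (?s n x)"
 define Dq where "Dq n x = (u0 (?s n x) - u0 x) / k n" for n x
 have DqL1: "(\<lambda>n. LBINT x. indicator O1 x * \<bar>Dq n x - w0 x\<bar>) \<longlonglongrightarrow> 0"
 proof (rule LIMSEQ_I)
  fix \<epsilon> :: real assume \<epsilon>: "\<epsilon> > 0"
  obtain d where d: "d > 0" "\<And>h. 0 < h ==> h < d ==>
   (LBINT x. indicator O1 x * \<bar>(u0 (x + h *\<^sub>R v) - u0 x) / h - w0 x\<bar>) \<le> \<epsilon> / 2"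
   using difference_quotient_L1[OF u0(1) w0(1) weak0 O1(1) O1V2, of h0 "\<epsilon> / 2"] \<epsilon> h0 by auto
  obtain N where N: "\<And>n. n \<ge> N ==> k n < d" using order_tendstoD(2)[OF klim d(1)] by (auto simp: eventually_sequentially)
  have "0 \<le> (LBINT x. indicator O1 x * \<bar>Dq n x - w0 x\<bar>)" for n
   by (rule integral_nonneg_B) auto
  moreover have "(LBINT x. indicator O1 x * \<bar>Dq n x - w0 x\<bar>) < \<epsilon>" if "n \<ge> N" for n
   using d(2)[OF k(1) N[OF that]] \<epsilon> by (simp add: Dq_def)
  ultimately show "\<exists>no. \<forall>n\<ge>no. norm ((LBINT x. indicator O1 x * \<bar>Dq n x - w0 x\<bar>) - 0) < \<epsilon>"
   by (intro exI[of _ N]) simp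
 qed
 have \<phi>inc: "\<bar>\<phi> x - \<phi> (x - k n *\<^sub>R v)\<bar> \<le> B * k n" for x n
  using directional_increment_bound[of "k n" \<phi> "x - k n *\<^sub>R v" v B] K(5,10) k by simp
 have lim1: "(\<lambda>n. LBINT x. G x * ?p n x) \<longlonglongrightarrow> (LBINT x. G x * D x)"
 proof (rule integral_dominated_convergence[where w="\<lambda>x. \<bar>G x\<bar> * B"])
  show "AE x in lborel. (\<lambda>n. G x * ?p n x) \<longlonglongrightarrow> G x * D x"
  proof (intro AE_I2 tendsto_mult tendsto_const)
   fix x
   have "(\<lambda>n. (\<phi> (x + (- k n) *\<^sub>R v) - \<phi> x) / (- k n)) \<longlonglongrightarrow> ddir \<phi> x v"
    by (intro directional_quotient_tendsto K(5)) (use kz tendsto_minus[OF klim] in auto)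
   moreover have "(\<phi> (x + (- k n) *\<^sub>R v) - \<phi> x) / (- k n) = ?p n x" for n
    using kz[of n] by (simp add: field_simps)
   ultimately show "(\<lambda>n. ?p n x) \<longlonglongrightarrow> D x"
    by (simp add: D_def)
  qed
  show "AE x in lborel. norm (G x * ?p n x) \<le> \<bar>G x\<bar> * B" for n
  proof (intro AE_I2)
   fix x
   have "\<bar>?p n x\<bar> \<le> B"
    using \<phi>inc[of x n] k(1)[of n] by (simp add: divide_le_eq)
   then show "norm (G x * ?p n x) \<le> \<bar>G x\<bar> * B"
    unfolding real_norm_def abs_mult by (intro mult_left_mono) auto
  qed
 qed (use Gi in auto)
 \<comment> \<open>Secant slope of F between u and its translate, continued by the derivative where
   both values agree. Thus \<open>FQ\<close> holds without exception and the Lipschitz constant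
   bounds Q everywhere.\<close>
 define Q where "Q n x = (if u0 (?s n x) = u0 x then F' (u0 x)
  else (F (u0 (?s n x)) - F (u0 x)) / (u0 (?s n x) - u0 x))" for n x
 let ?m = "\<lambda>n x. ?e n x * Q n x" and ?q = "\<lambda>n x. Dq n x - w0 x" and ?j = "\<lambda>x. \<phi> x * \<eta>K x * F' (u0 x) * w0 x"
 let ?A = "\<lambda>n. LBINT x. ?m n x * ?q n x" and ?B = "\<lambda>n. LBINT x. ?m n x * w0 x"
  and ?C = "\<lambda>n. LBINT x. ?f x * (\<phi> x * ?d n x)" and ?E = "\<lambda>n. LBINT x. indicator O1 x * \<bar>?q n x\<bar>"
 have [measurable]: "Q n \<in> borel_measurable borel" "Dq n \<in> borel_measurable borel" for n
  unfolding Q_def Dq_def by measurable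
 have Qb: "\<bar>Q n x\<bar> \<le> L" for n x
  using lipF[of "u0 (?s n x)" "u0 x"] F(3) by (auto simp: Q_def divide_le_eq)
 have FQ: "(F (u0 (?s n x)) - F (u0 x)) / k n = Q n x * Dq n x" for n x
  by (simp add: Q_def Dq_def)
 have Qlim: "AE x in lborel. (\<lambda>n. Q n x) \<longlonglongrightarrow> F' (u0 x)"
  using \<rho>(2)
 proof eventually_elim
  case (elim x)
  define q where "q t = (if t = u0 x then F' (u0 x) else (F t - F (u0 x)) / (t - u0 x))" for t
  have "isCont q (u0 x)"
  proof -
   have "((\<lambda>t. (F t - F (u0 x)) / (t - u0 x)) \<longlongrightarrow> F' (u0 x)) (at (u0 x))"
    using F(1)[of "u0 x"] by (simp add: has_field_derivative_iff)
   then have "(q \<longlongrightarrow> F' (u0 x)) (at (u0 x))"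
    by (rule Lim_transform_eventually) (auto simp: q_def eventually_at_filter)
   then show ?thesis by (simp add: isCont_def q_def)
  qed
  moreover have "(\<lambda>n. u0 (?s n x)) \<longlonglongrightarrow> u0 x" using elim by (simp add: k_def LIM_zero_iff)
  ultimately have "(\<lambda>n. q (u0 (?s n x))) \<longlonglongrightarrow> q (u0 x)" by (rule isCont_tendsto_compose)
  then show ?case by (simp add: q_def Q_def)
 qed
 have KtK2: "?s n x \<in> K2" if "x \<in> K" for x n
  using Kt[OF that, of "k n"] k[of n] by simp
 have \<eta>lim: "(\<lambda>n. ?e n x) \<longlonglongrightarrow> \<phi> x * \<eta>K x" for x
 proof (cases "x \<in> K")
  case True
  have "isCont \<eta> x" using \<eta>(1) True K(2) differentiable_imp_continuous_within by blast
  moreover have "(\<lambda>n. ?s n x) \<longlonglongrightarrow> x + 0 *\<^sub>R v" by (intro tendsto_intros klim)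
  ultimately have "(\<lambda>n. \<eta> (?s n x)) \<longlonglongrightarrow> \<eta> x" by (intro isCont_tendsto_compose[of x \<eta>]) simp_all
  from tendsto_mult[OF tendsto_const[of "\<phi> x"] this] show ?thesis
   using subsetD[OF KK2 True] KtK2[OF True] by (simp add: \<eta>K_def)
 qed (simp add: K(3))
 have mb: "\<bar>?m n x\<bar> \<le> B * B1 * L" for x n
  unfolding abs_mult using K(8) B12(1) by (intro mult_mono K(9) B1 Qb) auto
 have S1: "(\<lambda>n. ?A n) \<longlonglongrightarrow> 0"
 proof (rule Lim_null_comparison)
  show "(\<lambda>n. (B * B1 * L) * ?E n) \<longlonglongrightarrow> 0"
   using tendsto_mult_right_zero[OF DqL1] .
  show "eventually (\<lambda>n. norm (?A n)
    \<le> (B * B1 * L) * ?E n) sequentially"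
  proof (intro always_eventually allI)
   fix n
   have i: "integrable lborel (\<lambda>x. ?q n x)"
    unfolding Dq_def using u0(1) w0(1)
    by (intro integrable_diff_B integrable_divide) (auto simp: lborel_translate(1))
   have "norm (?A n)
    \<le> (LBINT x. (B * B1 * L) * (indicator O1 x * \<bar>?q n x\<bar>))"
   proof (rule order_trans[OF integral_norm_bound integral_mono'])
    have "integrable lborel (\<lambda>x. \<bar>?q n x\<bar> * indicator O1 x)"
     by (rule bndint[OF integrable_abs[OF i], of "indicator O1" 1]) (auto simp: indicator_def)
    then show "integrable lborel (\<lambda>x. (B * B1 * L) * (indicator O1 x * \<bar>?q n x\<bar>))"
     by (simp add: mult.commute)
    fix x
    show "norm (?m n x * ?q n x) \<le> (B * B1 * L) * (indicator O1 x * \<bar>?q n x\<bar>)"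
    proof (cases "x \<in> K")
     case True
     then have "x \<in> O1" using O1 by auto
     then show ?thesis
      using mult_right_mono[OF mb[of x n], of "\<bar>?q n x\<bar>"] by (simp add: abs_mult)
    next
     case False
     then show ?thesis using K(3,8) B12(1) L0 by simp
    qed
   qed (use K(8) B12(1) L0 in simp)
   then show "norm (?A n)
    \<le> (B * B1 * L) * ?E n" by simp
  qed
 qed
 have S2: "(\<lambda>n. ?B n) \<longlonglongrightarrow> (LBINT x. ?j x)"
 proof (rule integral_dominated_convergence[where w="\<lambda>x. B * B1 * L * \<bar>w0 x\<bar>"])
  show "AE x in lborel. (\<lambda>n. ?m n x * w0 x) \<longlonglongrightarrow> ?j x"
   using Qlim by eventually_elim (intro tendsto_mult \<eta>lim tendsto_const)
  show "AE x in lborel. norm (?m n x * w0 x) \<le> B * B1 * L * \<bar>w0 x\<bar>" for n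
   unfolding real_norm_def abs_mult[of _ "w0 _"] by (intro AE_I2 mult_right_mono mb) auto
 qed (use w0(1) in auto)
 have S3: "(\<lambda>n. ?C n)
   \<longlonglongrightarrow> (LBINT x. ?f x * (\<phi> x * D\<eta> x))"
 proof (rule integral_dominated_convergence[where w="\<lambda>x. \<bar>?f x\<bar> * (B * B2)"])
  show "AE x in lborel. (\<lambda>n. ?f x * (\<phi> x * ?d n x))
   \<longlonglongrightarrow> ?f x * (\<phi> x * D\<eta> x)"
  proof (rule AE_I2, rule tendsto_mult[OF tendsto_const])
   fix x
   show "(\<lambda>n. \<phi> x * ?d n x) \<longlonglongrightarrow> \<phi> x * D\<eta> x"
   proof (cases "x \<in> K")
    case True
    have "(\<lambda>n. (\<eta> (?s n x) - \<eta> x) / k n) \<longlonglongrightarrow> ddir \<eta> x v"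
     using True K(2) by (intro directional_quotient_tendsto \<eta>(1) klim kz) auto
    from tendsto_mult[OF tendsto_const[of "\<phi> x"] this] show ?thesis
     using subsetD[OF KK2 True] KtK2[OF True] by (simp add: \<eta>K_def D\<eta>_def)
   qed (simp add: K(3))
  qed
  show "AE x in lborel. norm (?f x * (\<phi> x * ?d n x)) \<le> \<bar>?f x\<bar> * (B * B2)" for n
  proof (intro AE_I2)
   fix x
   have "\<bar>\<phi> x * ?d n x\<bar> \<le> B * B2"
   proof (cases "x \<in> K")
    case True
    have "\<bar>\<eta> (?s n x) - \<eta> x\<bar> \<le> B2 * k n"
    proof (rule directional_increment_bound)
     fix t assume "0 \<le> t" "t \<le> k n"
     then have "x + t *\<^sub>R v \<in> K2" using Kt[OF True, of t] k[of n] by auto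
     then show "\<eta> differentiable (at (x + t *\<^sub>R v))" "\<bar>frechet_derivative \<eta> (at (x + t *\<^sub>R v)) v\<bar> \<le> B2"
      using \<eta>(1) K2V B12(4) by auto
    qed (use k in auto)
    then have "\<bar>\<phi> x\<bar> * (\<bar>\<eta>K (?s n x) - \<eta>K x\<bar> / k n) \<le> B * B2"
     using True KK2 KtK2[OF True, of n] k[of n] K(8,9) B12(3)
     by (intro mult_mono) (auto simp: \<eta>K_def divide_le_eq)
    then show ?thesis using k(1)[of n] by (simp add: abs_mult)
   qed (use K(3,8) B12(3) in simp)
   then show "norm (?f x * (\<phi> x * ?d n x)) \<le> \<bar>?f x\<bar> * (B * B2)"
    unfolding real_norm_def abs_mult[of "?f x"] by (intro mult_left_mono) auto
  qed
 qed (use Fu in auto)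
 \<comment> \<open>Discrete integration by parts, then the discrete product rule. Writing
   \<open>Dq\<close> as (\<open>Dq\<close> - w0) + w0 separates a part that vanishes in L1 from a
   part with a pointwise limit.\<close>
 have eqn: "(LBINT x. G x * ?p n x) =
   - (?A n
   + ?B n
   + ?C n)" for n
 proof -
  have b1: "integrable lborel (\<lambda>x. G x * \<phi> (x - k n *\<^sub>R v))" "integrable lborel (\<lambda>x. G x * \<phi> x)"
   using K(9) by (auto intro!: bndint[OF Gi])
  have b2: "integrable lborel (\<lambda>x. G (?s n x) * \<phi> x)"
   using Gi K(9) by (auto intro!: bndint simp: lborel_translate(1))
  have i: "integrable lborel (\<lambda>x. ?q n x)"
   unfolding Dq_def using u0(1) w0(1)
   by (intro integrable_diff_B integrable_divide) (auto simp: lborel_translate(1))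
  have i1: "integrable lborel (\<lambda>x. ?m n x * ?q n x)"
   using bndint[OF i _ mb] by (simp add: mult.commute)
  have i2: "integrable lborel (\<lambda>x. ?m n x * w0 x)"
   using bndint[OF w0(1) _ mb] by (simp add: mult.commute)
  have i3: "integrable lborel (\<lambda>x. ?f x * (\<phi> x * ?d n x))"
  proof (rule bndint[where c="B * ((B1 + B1) / k n)", OF Fu])
   fix x
   have "\<bar>\<phi> x\<bar> * (\<bar>\<eta>K (?s n x) - \<eta>K x\<bar> / k n) \<le> B * ((B1 + B1) / k n)"
    using K(8,9) B12(1) k(1)[of n] B1[of "?s n x"] B1[of x] abs_triangle_ineq4[of "\<eta>K (?s n x)" "\<eta>K x"]
    by (intro mult_mono divide_right_mono) auto
   then show "\<bar>\<phi> x * ?d n x\<bar> \<le> B * ((B1 + B1) / k n)"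
    using k(1)[of n] by (simp add: abs_mult)
  qed measurable
  have "(LBINT x. G x * ?p n x) = ((LBINT x. G x * \<phi> x) - (LBINT x. G x * \<phi> (x - k n *\<^sub>R v))) / k n"
   using b1 by (simp add: right_diff_distrib diff_divide_distrib)
  also have "(LBINT x. G x * \<phi> (x - k n *\<^sub>R v)) = (LBINT x. G (?s n x) * \<phi> x)"
   using lborel_translate(2)[of "\<lambda>x. G x * \<phi> (x - k n *\<^sub>R v)" "k n *\<^sub>R v"] by simp
  also have "((LBINT x. G x * \<phi> x) - (LBINT x. G (?s n x) * \<phi> x)) / k n
   = - (LBINT x. (G (?s n x) * \<phi> x - G x * \<phi> x) / k n)"
   using b1 b2 by (simp add: diff_divide_distrib)
  also have "(LBINT x. (G (?s n x) * \<phi> x - G x * \<phi> x) / k n)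
   = (LBINT x. ?m n x * ?q n x
     + ?m n x * w0 x
     + ?f x * (\<phi> x * ?d n x))"
  proof (rule integral_cong_B[OF refl])
   fix x
   have ind: "indicator K2 x * \<phi> x = \<phi> x" using K(3) KK2 by (auto simp: indicator_def)
   have "?m n x * ?q n x + ?m n x * w0 x
     + ?f x * (\<phi> x * ?d n x)
    = ?e n x * (Q n x * Dq n x)
     + (indicator K2 x * \<phi> x) * F (u0 x) * ?d n x"
    by (simp add: algebra_simps)
   also have "\<dots> = (G (?s n x) * \<phi> x - G x * \<phi> x) / k n"
    unfolding ind FQ[symmetric] G_def using kz[of n] by (simp add: divide_simps) (simp add: algebra_simps)
   finally show "(G (?s n x) * \<phi> x - G x * \<phi> x) / k n = ?m n x * ?q n x + ?m n x * w0 x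
     + ?f x * (\<phi> x * ?d n x)" by simp
  qed
  finally show ?thesis using i1 i2 i3 by simp
 qed
 have "(\<lambda>n. LBINT x. G x * ?p n x) \<longlonglongrightarrow>
  - (0 + (LBINT x. ?j x) + (LBINT x. ?f x * (\<phi> x * D\<eta> x)))"
  unfolding eqn by (intro tendsto_minus tendsto_add S1 S2 S3)
 from LIMSEQ_unique[OF lim1 this]
 have main: "(LBINT x. G x * D x) = - ((LBINT x. ?j x)
   + (LBINT x. ?f x * (\<phi> x * D\<eta> x)))" by simp
 have j1: "integrable lborel (\<lambda>x. ?j x)"
 proof -
  have "\<bar>\<phi> x * \<eta>K x * F' (u0 x)\<bar> \<le> B * B1 * L" for x
   unfolding abs_mult using K(8) B12(1) by (intro mult_mono K(9) B1 F(3)) auto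
  from bndint[OF w0(1) _ this] show ?thesis by (simp add: mult.commute)
 qed
 have j2: "integrable lborel (\<lambda>x. ?f x * (\<phi> x * D\<eta> x))"
 proof (rule bndint[where c="B * B2", OF Fu])
  show "\<bar>\<phi> x * D\<eta> x\<bar> \<le> B * B2" for x
   unfolding abs_mult using K(8) by (intro mult_mono K(9) B2) auto
 qed measurable
 have l: "(LINT y:V|lebesgue. (\<eta> y * F (u y)) * ddir \<phi> y v) = (LBINT x. G x * D x)"
  unfolding D_def[symmetric]
 proof (rule transfer)
  show "AE y in lebesgue. y \<in> K2 \<longrightarrow> G y = \<eta> y * F (u y)"
   using u0(3) by eventually_elim (auto simp: G_def \<eta>K_def)
 qed (use K(7) KK2 in \<open>auto simp: D_def[symmetric]\<close>)
 have "(LINT y:V|lebesgue. (\<eta> y * F' (u y) * w y + F (u y) * ddir \<eta> y v) * \<phi> y)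
  = (LBINT x. (\<eta>K x * F' (u0 x) * w0 x + F (u0 x) * D\<eta> x) * \<phi> x)"
 proof (rule transfer)
  show "AE y in lebesgue. y \<in> K2 \<longrightarrow> \<eta>K y * F' (u0 y) * w0 y + F (u0 y) * D\<eta> y = \<eta> y * F' (u y) * w y + F (u y) * ddir \<eta> y v"
   using u0(3) w0(3) by eventually_elim (auto simp: D\<eta>_def \<eta>K_def)
 qed (use K(3) KK2 in auto)
 also have "\<dots> = (LBINT x. ?j x + ?f x * (\<phi> x * D\<eta> x))"
  using K(3) KK2 by (intro integral_cong_B refl) (auto simp: indicator_def algebra_simps)
 also have "\<dots> = (LBINT x. ?j x) + (LBINT x. ?f x * (\<phi> x * D\<eta> x))"
  by (rule integral_add_B[OF j1 j2])
 finally show ?thesis using l main by simp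
qed

section \<open>Mollification of Lipschitz functions\<close>

text \<open>Only a C1 approximation of the distance is wanted, so a squared positive part serves as
  kernel. Its explicit derivative later also gives the gradient bound for the partition
  functions.\<close>

definition quartic_bump :: "real \<Rightarrow> 'e::real_inner \<Rightarrow> real" where
 "quartic_bump r z = (max 0 (r\<^sup>2 - z \<bullet> z))\<^sup>2"

lemma has_real_derivative_max_square:
 "((\<lambda>t::real. (max 0 t)\<^sup>2) has_real_derivative 2 * max 0 t) (at t)"
proof -
 consider "t > 0" | "t < 0" | "t = 0" by linarith
 then show ?thesis
 proof cases
  case 1
  have "((\<lambda>t. t\<^sup>2) has_real_derivative 2 * t) (at t)" by (auto intro!: derivative_eq_intros)
  then have "((\<lambda>t. (max 0 t)\<^sup>2) has_real_derivative 2 * t) (at t)"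
   by (rule has_field_derivative_transform_within_open[where S="{0<..}"]) (use 1 in auto)
  then show ?thesis using 1 by simp
 next
  case 2
  have "((\<lambda>t. 0) has_real_derivative 0) (at t)" by simp
  then have "((\<lambda>t. (max 0 t)\<^sup>2) has_real_derivative 0) (at t)"
   by (rule has_field_derivative_transform_within_open[where S="{..<0}"]) (use 2 in auto)
  then show ?thesis using 2 by simp
 next
  case 3
  have "((\<lambda>h::real. (max 0 h)\<^sup>2 / h) \<longlongrightarrow> 0) (at 0)"
  proof (rule Lim_null_comparison)
   show "eventually (\<lambda>h::real. norm ((max 0 h)\<^sup>2 / h) \<le> \<bar>h\<bar>) (at 0)"
    by (rule always_eventually) (auto simp: max_def power2_eq_square)
   show "((\<lambda>h::real. \<bar>h\<bar>) \<longlongrightarrow> 0) (at 0)" by (auto intro!: tendsto_eq_intros)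
  qed
  then show ?thesis using 3 by (simp add: has_field_derivative_iff)
 qed
qed

lemma has_derivative_quartic_bump:
 "((\<lambda>y. quartic_bump r (z - y)) has_derivative
  (\<lambda>v. 4 * max 0 (r\<^sup>2 - (z - y) \<bullet> (z - y)) * ((z - y) \<bullet> v))) (at y)"
proof -
 have "((\<lambda>y. r\<^sup>2 - (z - y) \<bullet> (z - y)) has_derivative (\<lambda>v. 2 * ((z - y) \<bullet> v))) (at y)"
  by (auto intro!: derivative_eq_intros simp: inner_commute)
 from has_derivative_compose[OF this has_real_derivative_max_square[unfolded has_field_derivative_def]]
 show ?thesis unfolding quartic_bump_def by (rule has_derivative_eq_rhs) (auto simp: fun_eq_iff)
qed

lemma quartic_bump_nonneg: "quartic_bump r z \<ge> 0"
 by (simp add: quartic_bump_def)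

lemma quartic_bump_zero: "r \<ge> 0 ==> norm z \<ge> r ==> quartic_bump r z = 0"
 using power_mono[of r "norm z" 2] by (simp add: quartic_bump_def power2_norm_eq_inner)

lemma quartic_bump_pos: "norm z < r ==> quartic_bump r z > 0"
 using power_strict_mono[of "norm z" r 2] by (simp add: quartic_bump_def power2_norm_eq_inner)

lemma continuous_quartic_bump [continuous_intros]:
 "continuous_on S f ==> continuous_on S (\<lambda>x. quartic_bump r (f x))"
 unfolding quartic_bump_def by (auto intro!: continuous_intros)

lemma integral_quartic_bump_pos:
 assumes "r > 0"
 shows "(LINT z|(lborel :: 'e::euclidean_space measure). quartic_bump r z) > 0"
  and "integrable (lborel :: 'e::euclidean_space measure) (quartic_bump r)"
proof -
 have "integrable (lborel :: 'e measure) (\<lambda>z. indicator (cball 0 r) z *\<^sub>R quartic_bump r z)"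
  by (rule borel_integrable_compact) (auto intro!: continuous_intros)
 moreover have "(\<lambda>z :: 'e. indicator (cball 0 r) z *\<^sub>R quartic_bump r z) = quartic_bump r"
 proof (rule ext)
  fix z :: 'e
  show "indicator (cball 0 r) z *\<^sub>R quartic_bump r z = quartic_bump r z"
   using quartic_bump_zero[of r z] assms by (cases "norm z \<le> r") auto
 qed
 ultimately show i: "integrable (lborel :: 'e measure) (quartic_bump r)" by (simp only:)
 show "(LINT z|(lborel :: 'e measure). quartic_bump r z) > 0"
 proof (rule ccontr)
  assume "\<not> ?thesis"
  moreover have "(LINT z|(lborel :: 'e measure). quartic_bump r z) \<ge> 0"
   by (rule integral_nonneg_B) (simp add: quartic_bump_nonneg)
  ultimately have "(LINT z|(lborel :: 'e measure). quartic_bump r z) = 0" by simp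
  then have "AE z in lborel. quartic_bump r (z :: 'e) = 0"
   using integral_nonneg_eq_0_iff_AE[OF i] by (simp add: quartic_bump_nonneg)
  then have "AE z in lborel. (z :: 'e) \<notin> ball 0 r"
   by eventually_elim (use quartic_bump_pos[of _ r] in force)
  then have "emeasure lborel (ball (0 :: 'e) r) = 0"
  proof -
   have "{x \<in> space lborel. \<not> x \<notin> ball (0::'e) r} = ball 0 r" by auto
   then show ?thesis using \<open>AE z in lborel. z \<notin> ball 0 r\<close>
    by (subst (asm) AE_iff_measurable[of "ball 0 r"]) auto
  qed
  then have "ball (0::'e) r \<in> null_sets lborel" by auto
  then have "negligible (ball (0::'e) r)" using null_sets_completionI[of "ball (0::'e) r" lborel] by (simp add: negligible_iff_null_sets)
  then show False using open_not_negligible[of "ball (0::'e) r"] assms by simp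
 qed
qed

text \<open>The mollification is an average of translates of f, so it inherits the bound by N
  direction by direction with no loss of constant; N stands for a norm adapted to the metric. A
  kernel radius of at most s keeps averages at points of the 2s-ball inside the 3s-ball.\<close>

lemma mollify_Lipschitz:
 fixes f N :: "'e::euclidean_space \<Rightarrow> real"
 assumes s: "s > 0" and e: "e > 0" and c: "c \<ge> 0"
  and lip: "\<And>y y'. y \<in> cball y0 (3 * s) ==> y' \<in> cball y0 (3 * s) ==> \<bar>f y' - f y\<bar> \<le> N (y' - y)"
  and N: "\<And>t v. N (t *\<^sub>R v) = \<bar>t\<bar> * N v" "\<And>v. N v \<le> c * norm v"
 shows "\<exists>h. (\<forall>y\<in>ball y0 (2 * s). h differentiable (at y) \<and> \<bar>h y - f y\<bar> \<le> e \<and>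
   (\<forall>v. \<bar>ddir h y v\<bar> \<le> N v)) \<and>
  (\<forall>v. continuous_on (ball y0 (2 * s)) (\<lambda>y. ddir h y v))"
proof -
 define B where "B = cball y0 (3 * s)"
 have B: "convex B" "closed B" "B \<noteq> {}" "compact B" using s by (auto simp: B_def)
 \<comment> \<open>Averaging over radius r moves values by at most c r, which has to stay below e;
   the summand 1 covers c = 0.\<close>
 define r where "r = min s (e / (c + 1))"
 have r: "r > 0" "r \<le> s" "c * r \<le> e"
 proof -
  show "c * r \<le> e"
  proof -
   have "c * r \<le> c * (e / (c + 1))" using c by (intro mult_left_mono) (auto simp: r_def)
   also have "\<dots> \<le> e" using c e by (simp add: field_simps)
   finally show ?thesis .
  qed
 qed (use s e c in \<open>auto simp: r_def\<close>)
 \<comment> \<open>Extension by nearest-point projection makes the integrand continuous everywhere,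
   so one can differentiate under an integral over a fixed box. At points of the 2s-ball only
   original values of f enter.\<close>
 define F where "F z = f (closest_point B z)" for z
 have FB: "F z = f z" if "z \<in> B" for z using that by (simp add: F_def closest_point_self)
 have Nn: "\<bar>f y' - f y\<bar> \<le> c * norm (y' - y)" if "y \<in> B" "y' \<in> B" for y y'
  using order_trans[OF lip N(2)] that by (auto simp: B_def)
 have contf: "continuous_on B f"
 proof -
  have "c-lipschitz_on B f" using Nn c by (intro lipschitz_onI) (auto simp: dist_norm)
  then show ?thesis by (rule lipschitz_on_continuous_on)
 qed
 have contF: "continuous_on S F" for S
  unfolding F_def using closest_point_in_set[OF B(2,3)]
  by (intro continuous_on_compose2[OF contf continuous_on_closest_point[OF B(1-3)]]) auto
 obtain a b where ab: "B \<subseteq> cbox a b" using bounded_subset_cbox_symmetric[of B] B(4) compact_imp_bounded by metis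
 define I0 where "I0 = (LINT z|(lborel :: 'e measure). quartic_bump r z)"
 have I0: "I0 > 0" unfolding I0_def by (rule integral_quartic_bump_pos[OF r(1)])
 define g where "g y z = F z * quartic_bump r (z - y)" for y z
 define Dg where "Dg y z = (F z * (4 * max 0 (r\<^sup>2 - (z - y) \<bullet> (z - y)))) *\<^sub>R blinfun_inner_right (z - y)" for y z
 define h where "h y = (1 / I0) * integral (cbox a b) (g y)" for y
 have cDg: "continuous_on (UNIV \<times> cbox a b) (\<lambda>(y, z). Dg y z)"
  unfolding Dg_def split_beta
  by (intro continuous_intros continuous_on_compose2[OF contF[of UNIV]] bounded_linear.continuous_on[OF bounded_linear_blinfun_inner_right]) auto
 have "((\<lambda>y. integral (cbox a b) (g y)) has_derivative blinfun_apply (integral (cbox a b) (Dg y))) (at y within UNIV)" for y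
 proof (rule leibniz_rule[OF _ _ cDg])
  fix y z
  have "((\<lambda>y. F z * quartic_bump r (z - y)) has_derivative (\<lambda>v. F z * (4 * max 0 (r\<^sup>2 - (z - y) \<bullet> (z - y)) * ((z - y) \<bullet> v)))) (at y)"
   by (intro has_derivative_mult_right has_derivative_quartic_bump)
  then show "((\<lambda>y. g y z) has_derivative blinfun_apply (Dg y z)) (at y within UNIV)"
   unfolding g_def by (rule has_derivative_eq_rhs) (auto simp: Dg_def fun_eq_iff scaleR_blinfun.rep_eq)
  show "g y integrable_on cbox a b" unfolding g_def
   by (intro integrable_continuous continuous_intros contF)
 qed auto
 then have dh: "(h has_derivative (\<lambda>v. (1 / I0) * blinfun_apply (integral (cbox a b) (Dg y)) v)) (at y)" for y
  unfolding h_def by (intro has_derivative_mult_right) simp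
 have ch: "continuous_on S (\<lambda>y. ddir h y v)" for S v
 proof -
  have "continuous_on UNIV (\<lambda>y. integral (cbox a b) (Dg y))" by (rule integral_continuous_on_param[OF cDg])
  then have "continuous_on UNIV (\<lambda>y. (1 / I0) * blinfun_apply (integral (cbox a b) (Dg y)) v)"
   by (intro continuous_intros)
  then show ?thesis by (subst frechet_derivativeI[OF dh]) (auto intro: continuous_on_subset)
 qed
 have gi: "integrable lborel (\<lambda>z. F (y + z) * quartic_bump r z)" for y
 proof -
  have "integrable lborel (\<lambda>z. indicator (cball 0 r) z *\<^sub>R (F (y + z) * quartic_bump r z))"
   by (rule borel_integrable_compact)
    (auto intro!: continuous_intros continuous_on_compose2[OF contF[of UNIV]])
  moreover have "(\<lambda>z. indicator (cball 0 r) z *\<^sub>R (F (y + z) * quartic_bump r z)) = (\<lambda>z. F (y + z) * quartic_bump r z)"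
  proof (rule ext)
   fix z
   show "indicator (cball 0 r) z *\<^sub>R (F (y + z) * quartic_bump r z) = F (y + z) * quartic_bump r z"
    using quartic_bump_zero[of r z] r(1) by (cases "norm z \<le> r") auto
  qed
  ultimately show ?thesis by (simp only:)
 qed
 have hy: "h y = (1 / I0) * (LBINT z. F (y + z) * quartic_bump r z)" if y: "y \<in> ball y0 (2 * s)" for y
 proof -
  have zin: "z \<in> cbox a b" if "norm (z - y) < r" for z
  proof -
   have "dist y0 z \<le> dist y0 y + dist y z" by (rule dist_triangle)
   also have "\<dots> \<le> 3 * s" using y that r by (simp add: dist_norm norm_minus_commute)
   finally show ?thesis using ab by (auto simp: B_def)
  qed
  have gz: "g y z = 0" if "z \<notin> cbox a b" for z
   using zin[of z] that quartic_bump_zero[of r "z - y"] r(1) by (force simp: g_def)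
  have gint: "integrable lborel (g y)"
   using gi[of y] lborel_translate(1)[of "\<lambda>z. F (y + z) * quartic_bump r z" "- y"] by (simp add: g_def[abs_def])
  have "integral (cbox a b) (g y) = integral UNIV (g y)"
  proof -
   have "(\<lambda>z. if z \<in> cbox a b then g y z else 0) = g y" using gz by (auto simp: fun_eq_iff)
   then show ?thesis using integral_restrict_UNIV[of "cbox a b" "g y"] by simp
  qed
  also have "\<dots> = (LBINT z. g y z)" using gint by (rule integral_lborel)
  also have "\<dots> = (LBINT z. F (y + z) * quartic_bump r z)"
   using lborel_translate(2)[of "\<lambda>z. F (y + z) * quartic_bump r z" "- y"] by (simp add: g_def[abs_def])
  finally show ?thesis by (simp add: h_def)
 qed
 have key: "\<bar>(LBINT z. k z * quartic_bump r z)\<bar> \<le> C * I0"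
  if "integrable lborel (\<lambda>z. k z * quartic_bump r z)" "\<And>z. norm z \<le> r ==> \<bar>k z\<bar> \<le> C" for k :: "'e \<Rightarrow> real" and C
 proof -
  have C: "C \<ge> 0" using that(2)[of 0] r(1) by auto
  have "\<bar>(LBINT z. k z * quartic_bump r z)\<bar> \<le> (LBINT z. C * quartic_bump r (z::'e))"
  proof (rule order_trans[OF integral_abs_bound integral_mono'])
   show "integrable lborel (\<lambda>z::'e. C * quartic_bump r z)" using integral_quartic_bump_pos(2)[OF r(1), where 'e='e] by simp
   show "\<bar>k z * quartic_bump r z\<bar> \<le> C * quartic_bump r z" for z
    using that(2)[of z] quartic_bump_zero[of r z] quartic_bump_nonneg[of r z] r(1)
    by (cases "norm z \<le> r") (auto simp: abs_mult intro!: mult_right_mono)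
   show "0 \<le> C * quartic_bump r z" for z :: 'e using C quartic_bump_nonneg[of r z] by auto
  qed
  then show ?thesis by (simp add: I0_def)
 qed
 have inB: "y + z \<in> B" if "y \<in> ball y0 (2 * s)" "norm z \<le> r" for y z
 proof -
  have "dist y0 (y + z) \<le> dist y0 y + dist y (y + z)" by (rule dist_triangle)
  also have "\<dots> \<le> 3 * s" using that r by (simp add: dist_norm)
  finally show ?thesis by (simp add: B_def)
 qed
 have close: "\<bar>h y - f y\<bar> \<le> e" if y: "y \<in> ball y0 (2 * s)" for y
 proof -
  have i2: "integrable lborel (\<lambda>z::'e. f y * quartic_bump r z)" using integral_quartic_bump_pos(2)[OF r(1), where 'e='e] by simp
  have "(LBINT z. F (y + z) * quartic_bump r z) - f y * I0 = (LBINT z. (F (y + z) - f y) * quartic_bump r z)"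
   using gi[of y] i2 unfolding I0_def left_diff_distrib by (subst integral_diff_B) auto
  moreover have "\<bar>(LBINT z. (F (y + z) - f y) * quartic_bump r z)\<bar> \<le> e * I0"
  proof (rule key)
   show "integrable lborel (\<lambda>z. (F (y + z) - f y) * quartic_bump r z)"
    unfolding left_diff_distrib using gi[of y] i2 by (rule integrable_diff_B)
   fix z :: 'e assume z: "norm z \<le> r"
   have "\<bar>F (y + z) - f y\<bar> \<le> c * norm z"
    using Nn[of y "y + z"] inB[OF y z] inB[OF y, of 0] r(1) by (simp add: FB)
   also have "\<dots> \<le> c * r" using z c by (intro mult_left_mono)
   finally show "\<bar>F (y + z) - f y\<bar> \<le> e" using r(3) by linarith
  qed
  ultimately have "\<bar>h y * I0 - f y * I0\<bar> \<le> e * I0" using I0 hy[OF y] by simp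
  then have "\<bar>h y - f y\<bar> * I0 \<le> e * I0" using I0 by (simp add: abs_mult left_diff_distrib[symmetric])
  then show ?thesis using I0 by simp
 qed
 have inc: "\<bar>h (y + t *\<^sub>R v) - h y\<bar> \<le> \<bar>t\<bar> * N v" if y: "y \<in> ball y0 (2 * s)" "y + t *\<^sub>R v \<in> ball y0 (2 * s)" for y t v
 proof -
  have "(LBINT z. F (y + t *\<^sub>R v + z) * quartic_bump r z) - (LBINT z. F (y + z) * quartic_bump r z)
   = (LBINT z. (F (y + t *\<^sub>R v + z) - F (y + z)) * quartic_bump r z)"
   using gi[of y] gi[of "y + t *\<^sub>R v"] unfolding left_diff_distrib by (subst integral_diff_B) auto
  moreover have "\<bar>(LBINT z. (F (y + t *\<^sub>R v + z) - F (y + z)) * quartic_bump r z)\<bar> \<le> (\<bar>t\<bar> * N v) * I0"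
  proof (rule key)
   show "integrable lborel (\<lambda>z. (F (y + t *\<^sub>R v + z) - F (y + z)) * quartic_bump r z)"
    unfolding left_diff_distrib using gi[of "y + t *\<^sub>R v"] gi[of y] by (rule integrable_diff_B)
   fix z :: 'e assume z: "norm z \<le> r"
   have "\<bar>f (y + t *\<^sub>R v + z) - f (y + z)\<bar> \<le> N ((y + t *\<^sub>R v + z) - (y + z))"
    using inB[OF y(1) z] inB[OF y(2) z] unfolding B_def by (rule lip)
   also have "\<dots> = \<bar>t\<bar> * N v" using N(1) by simp
   finally show "\<bar>F (y + t *\<^sub>R v + z) - F (y + z)\<bar> \<le> \<bar>t\<bar> * N v"
    using inB[OF y(1) z] inB[OF y(2) z] by (simp add: FB)
  qed
  ultimately have "\<bar>h (y + t *\<^sub>R v) * I0 - h y * I0\<bar> \<le> (\<bar>t\<bar> * N v) * I0" using I0 hy y by simp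
  then have "\<bar>h (y + t *\<^sub>R v) - h y\<bar> * I0 \<le> (\<bar>t\<bar> * N v) * I0" using I0 by (simp add: abs_mult left_diff_distrib[symmetric])
  then show ?thesis using I0 by simp
 qed
 have bound: "\<bar>ddir h y v\<bar> \<le> N v" if y: "y \<in> ball y0 (2 * s)" for y v
 proof -
  define t where "t n = 1 / (real n + 1)" for n
  have t: "t n > 0" "t n \<noteq> 0" for n by (auto simp: t_def add_nonneg_pos)
  have tl: "t \<longlonglongrightarrow> 0" using LIMSEQ_Suc[OF lim_1_over_n[where 'a=real]] by (simp add: t_def[abs_def] add.commute)
  have "(\<lambda>n. \<bar>(h (y + t n *\<^sub>R v) - h y) / t n\<bar>) \<longlonglongrightarrow> \<bar>ddir h y v\<bar>"
   using differentiableI[OF dh] by (intro tendsto_rabs directional_quotient_tendsto tl t)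
  moreover have "eventually (\<lambda>n. y + t n *\<^sub>R v \<in> ball y0 (2 * s)) sequentially"
  proof -
   have "(\<lambda>n. y + t n *\<^sub>R v) \<longlonglongrightarrow> y + 0 *\<^sub>R v" by (intro tendsto_intros tl)
   then show ?thesis using y by (intro topological_tendstoD[of _ "y + 0 *\<^sub>R v"]) auto
  qed
  then have "eventually (\<lambda>n. \<bar>(h (y + t n *\<^sub>R v) - h y) / t n\<bar> \<le> N v) sequentially"
  proof eventually_elim
   case (elim n)
   then show ?case using inc[OF y elim] t(1)[of n] by (simp add: divide_le_eq mult.commute)
  qed
  ultimately show ?thesis by (rule tendsto_upperbound) simp
 qed
 show ?thesis
  using differentiableI[OF dh] close bound ch by (intro exI[of _ h]) blast
qed

section \<open>Tangent vectors and local metrics\<close>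

locale rmfd =
 fixes \<A> :: "('a::{t2_space, second_countable_topology}, 'm::finite) chart set"
  and g :: "('a, 'm) metric_tensor"
 assumes rm: "riemannian_manifold \<A> g"
begin

abbreviation img where "img c \<equiv> snd c ` fst c"
abbreviation TM where "TM \<equiv> tangent_space \<A>"
abbreviation tv where "tv \<equiv> tvec_of \<A>"
abbreviation imgs where "imgs c W \<equiv> snd c ` (fst c \<inter> W)"
abbreviation pairing where "pairing X c v y \<equiv> g (chart_inv c y) (X (chart_inv c y)) (tv c (chart_inv c y) v)"
abbreviation mfield where "mfield \<equiv> measurable_field \<A>"
abbreviation wgrad where "wgrad \<equiv> is_weak_gradient \<A> g"
abbreviation nabla where "nabla \<equiv> weak_gradient \<A> g"
abbreviation Wloc where "Wloc \<equiv> W1p_loc \<A> g"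

lemma chart: 
 assumes "c \<in> \<A>"
 shows open_dom: "open (fst c)" and open_img: "open (img c)"
  and inj_chart: "inj_on (snd c) (fst c)"
  and cont_chart: "continuous_on (fst c) (snd c)"
  and cont_chart_inv: "continuous_on (img c) (chart_inv c)"
proof -
 have "is_chart c" using rm assms by (auto simp: riemannian_manifold_def smooth_structure_def)
 then have o: "open (fst c)" "open (img c)" and h: "homeomorphism (fst c) (img c) (snd c) (inv_into (fst c) (snd c))"
  by (auto simp: is_chart_def)
 show "open (fst c)" "open (img c)" by (fact o)+
 show "inj_on (snd c) (fst c)" using h by (metis homeomorphism_def inj_on_inverseI)
 show "continuous_on (fst c) (snd c)" "continuous_on (img c) (chart_inv c)"
  using h by (auto simp: homeomorphism_def chart_inv_def)
qed

lemma chart_inv_chart [simp]: "c \<in> \<A> ==> x \<in> fst c ==> chart_inv c (snd c x) = x"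
 unfolding chart_inv_def by (rule inv_into_f_f[OF inj_chart])

lemma chart_chart_inv [simp]: "y \<in> img c ==> snd c (chart_inv c y) = y"
 unfolding chart_inv_def by (rule f_inv_into_f)

lemma chart_inv_in [simp]: "y \<in> img c ==> chart_inv c y \<in> fst c"
 unfolding chart_inv_def by (rule inv_into_into)

lemma chart_cover: obtains c where "c \<in> \<A>" "x \<in> fst c"
 using rm unfolding riemannian_manifold_def smooth_structure_def by blast

lemma open_image_chart: "c \<in> \<A> ==> open S ==> S \<subseteq> fst c ==> open (snd c ` S)"
proof -
 assume c: "c \<in> \<A>" and S: "open S" "S \<subseteq> fst c"
 have "snd c ` S = img c \<inter> chart_inv c -` S"
  using S c by (auto intro!: image_eqI[of _ "snd c"])
 then show ?thesis using continuous_open_preimage[OF cont_chart_inv[OF c] open_img[OF c] S(1)] by simp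
qed

lemma open_chart_inv_image: "c \<in> \<A> ==> open S ==> S \<subseteq> img c ==> open (chart_inv c ` S)"
proof -
 assume c: "c \<in> \<A>" and S: "open S" "S \<subseteq> img c"
 have "chart_inv c ` S = fst c \<inter> snd c -` S"
  using S c by (auto 4 3 intro!: image_eqI[of _ "chart_inv c"] dest: subsetD)
 then show ?thesis using continuous_open_preimage[OF cont_chart[OF c] open_dom[OF c] S(1)] by simp
qed

lemma compact_chart_inv_image: "c \<in> \<A> ==> compact K ==> K \<subseteq> img c ==> compact (chart_inv c ` K)"
 using compact_continuous_image[OF continuous_on_subset[OF cont_chart_inv]] by blast

lemma compact_chart_image: "c \<in> \<A> ==> compact K ==> K \<subseteq> fst c ==> compact (snd c ` K)"
 using compact_continuous_image[OF continuous_on_subset[OF cont_chart]] by blast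

lemma transition_Ck:
 assumes "c \<in> \<A>" "d \<in> \<A>"
 shows "Ck_on k (snd c ` (fst c \<inter> fst d)) (transition c d)"
 using rm assms unfolding riemannian_manifold_def smooth_structure_def smooth_compatible_def smooth_on_def by blast

lemma open_overlap: "c \<in> \<A> ==> d \<in> \<A> ==> open (snd c ` (fst c \<inter> fst d))"
 by (intro open_image_chart) (auto intro: open_dom)

lemma transition_chart [simp]: "c \<in> \<A> ==> x \<in> fst c ==> transition c d (snd c x) = snd d x"
 by (simp add: transition_def)

definition dtrans :: "('a, 'm) chart \<Rightarrow> ('a, 'm) chart \<Rightarrow> 'a \<Rightarrow> real ^ 'm \<Rightarrow> real ^ 'm" where
 "dtrans c d x = frechet_derivative (transition c d) (at (snd c x))"

lemma transition_has_derivative: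
 assumes "c \<in> \<A>" "d \<in> \<A>" "x \<in> fst c" "x \<in> fst d"
 shows "(transition c d has_derivative dtrans c d x) (at (snd c x))"
 using transition_Ck[OF assms(1,2), of "Suc 0"] assms(3,4)
 unfolding dtrans_def by (auto simp: frechet_derivative_works)

lemma linear_dtrans:
 assumes "c \<in> \<A>" "d \<in> \<A>" "x \<in> fst c" "x \<in> fst d"
 shows "linear (dtrans c d x)"
 using has_derivative_linear[OF transition_has_derivative[OF assms]] .

lemma dtrans_self:
 assumes "c \<in> \<A>" "x \<in> fst c"
 shows "dtrans c c x = id"
proof -
 have "(id has_derivative id) (at (snd c x))" by (rule has_derivative_id)
 then have "(transition c c has_derivative id) (at (snd c x))"
  by (rule has_derivative_transform_within_open[OF _ open_img[OF assms(1)]]) (use assms in \<open>auto simp: transition_def\<close>)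
 then show ?thesis unfolding dtrans_def by (rule frechet_derivativeI)
qed

lemma dtrans_comp:
 assumes "c \<in> \<A>" "d \<in> \<A>" "e \<in> \<A>" "x \<in> fst c" "x \<in> fst d" "x \<in> fst e"
 shows "dtrans d e x (dtrans c d x v) = dtrans c e x v"
proof -
 have "(transition d e has_derivative dtrans d e x) (at (transition c d (snd c x)))"
  using transition_has_derivative[of d e x] assms by simp
 from has_derivative_compose[OF transition_has_derivative[of c d x] this] assms
 have "((\<lambda>y. transition d e (transition c d y)) has_derivative (\<lambda>v. dtrans d e x (dtrans c d x v))) (at (snd c x))"
  by simp
 then have "(transition c e has_derivative (\<lambda>v. dtrans d e x (dtrans c d x v))) (at (snd c x))"
  by (rule has_derivative_transform_within_open[OF _ open_overlap[of c d]])
   (use assms in \<open>auto simp: transition_def\<close>)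
 then show ?thesis unfolding dtrans_def[of c e] by (simp add: frechet_derivativeI)
qed

lemma tvec_of_eq: "tv c x v = (\<lambda>d. if d \<in> \<A> \<and> x \<in> fst d then dtrans c d x v else 0)"
 unfolding tvec_of_def dtrans_def ..

lemma tvec_of_in [intro, simp]:
 assumes "c \<in> \<A>" "x \<in> fst c"
 shows "tv c x v \<in> TM x"
 unfolding tangent_space_def mem_Collect_eq
proof (intro conjI ballI impI allI)
 fix d e assume "d \<in> \<A>" "e \<in> \<A>" "x \<in> fst d" "x \<in> fst e"
 then show "tv c x v e = frechet_derivative (transition d e) (at (snd d x)) (tv c x v d)"
  unfolding dtrans_def[symmetric] using assms by (simp add: tvec_of_eq dtrans_comp)
qed (auto simp: tvec_of_eq)

lemma tvec_of_self [simp]: "c \<in> \<A> ==> x \<in> fst c ==> tv c x v c = v"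
 by (simp add: tvec_of_eq dtrans_self)

lemma tangent_eq_tvec_of:
 assumes "\<xi> \<in> TM x" "c \<in> \<A>" "x \<in> fst c"
 shows "\<xi> = tv c x (\<xi> c)"
proof (rule ext)
 fix d
 show "\<xi> d = tv c x (\<xi> c) d"
 proof (cases "d \<in> \<A> \<and> x \<in> fst d")
  case True
  then have "\<xi> d = frechet_derivative (transition c d) (at (snd c x)) (\<xi> c)"
   using assms unfolding tangent_space_def by blast
  then show ?thesis unfolding tvec_of_def if_P[OF True] .
 next
  case False
  then have "\<xi> d = 0" using assms(1) unfolding tangent_space_def by blast
  then show ?thesis unfolding tvec_of_def if_not_P[OF False] .
 qed
qed

lemma tvec_of_linear:
 assumes "c \<in> \<A>" "x \<in> fst c"
 shows "tv c x (a *\<^sub>R v + b *\<^sub>R w) = (\<lambda>d. a *\<^sub>R tv c x v d + b *\<^sub>R tv c x w d)"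
 using linear_dtrans[OF assms(1) _ assms(2)]
 by (auto simp: tvec_of_eq fun_eq_iff linear_add linear_cmul)

lemma tangent_comb [intro]:
 assumes "\<xi> \<in> TM x" "\<eta> \<in> TM x"
 shows "(\<lambda>c. a *\<^sub>R \<xi> c + b *\<^sub>R \<eta> c) \<in> TM x"
proof -
 obtain c where c: "c \<in> \<A>" "x \<in> fst c" by (rule chart_cover)
 have "tv c x (a *\<^sub>R \<xi> c + b *\<^sub>R \<eta> c) = (\<lambda>d. a *\<^sub>R \<xi> d + b *\<^sub>R \<eta> d)"
  unfolding tvec_of_linear[OF c] tangent_eq_tvec_of[OF assms(1) c, symmetric] tangent_eq_tvec_of[OF assms(2) c, symmetric] ..
 then show ?thesis using tvec_of_in[OF c, of "a *\<^sub>R \<xi> c + b *\<^sub>R \<eta> c"] by simp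
qed

lemma tangent_zero [simp]: "(\<lambda>_. 0) \<in> TM x"
proof -
 obtain c where c: "c \<in> \<A>" "x \<in> fst c" by (rule chart_cover)
 have "tv c x 0 = (\<lambda>_. 0)" using tvec_of_linear[OF c, of 0 0 0 0] by simp
 then show ?thesis using tvec_of_in[OF c, of 0] by simp
qed

lemma g_left:
 assumes "\<xi> \<in> TM x" "\<eta> \<in> TM x" "\<zeta> \<in> TM x"
 shows "g x (\<lambda>c. a *\<^sub>R \<xi> c + b *\<^sub>R \<eta> c) \<zeta> = a * g x \<xi> \<zeta> + b * g x \<eta> \<zeta>"
 using rm assms unfolding riemannian_manifold_def riemannian_metric_def by blast

lemma g_sym:
 assumes "\<xi> \<in> TM x" "\<eta> \<in> TM x"
 shows "g x \<xi> \<eta> = g x \<eta> \<xi>"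
 using rm assms unfolding riemannian_manifold_def riemannian_metric_def by blast

lemma g_pos:
 assumes "\<xi> \<in> TM x" "\<xi> \<noteq> (\<lambda>_. 0)"
 shows "g x \<xi> \<xi> > 0"
 using rm assms unfolding riemannian_manifold_def riemannian_metric_def by blast

lemma g_right:
 assumes "\<xi> \<in> TM x" "\<eta> \<in> TM x" "\<zeta> \<in> TM x"
 shows "g x \<zeta> (\<lambda>c. a *\<^sub>R \<xi> c + b *\<^sub>R \<eta> c) = a * g x \<zeta> \<xi> + b * g x \<zeta> \<eta>"
 unfolding g_sym[OF assms(3) tangent_comb[OF assms(1,2)]] g_left[OF assms]
  g_sym[OF assms(3) assms(1)] g_sym[OF assms(3) assms(2)] ..

lemma g_zero [simp]: "\<zeta> \<in> TM x ==> g x (\<lambda>_. 0) \<zeta> = 0"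
 using g_left[of "\<lambda>_. 0" x "\<lambda>_. 0" \<zeta> 0 0] by simp

lemma g_nonneg: "\<xi> \<in> TM x ==> g x \<xi> \<xi> \<ge> 0"
 using g_pos[of \<xi> x] g_zero[of "\<lambda>_. 0" x] by (cases "\<xi> = (\<lambda>_. 0)") auto

lemma tnorm_nonneg: "\<xi> \<in> TM x ==> tnorm g x \<xi> \<ge> 0"
 by (simp add: tnorm_def g_nonneg)

lemma tnorm_zero [simp]: "tnorm g x (\<lambda>_. 0) = 0"
 by (simp add: tnorm_def)

lemma tnorm_sq: "\<xi> \<in> TM x ==> (tnorm g x \<xi>)\<^sup>2 = g x \<xi> \<xi>"
 by (simp add: tnorm_def g_nonneg)

lemma g_Cauchy_Schwarz:
 assumes x: "\<xi> \<in> TM x" and y: "\<eta> \<in> TM x"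
 shows "\<bar>g x \<xi> \<eta>\<bar> \<le> tnorm g x \<xi> * tnorm g x \<eta>"
proof -
 have q: "g x \<xi> \<xi> * t\<^sup>2 + 2 * g x \<xi> \<eta> * t + g x \<eta> \<eta> \<ge> 0" for t
 proof -
  have "g x (\<lambda>c. t *\<^sub>R \<xi> c + 1 *\<^sub>R \<eta> c) (\<lambda>c. t *\<^sub>R \<xi> c + 1 *\<^sub>R \<eta> c) \<ge> 0"
   by (rule g_nonneg[OF tangent_comb[OF x y]])
  then show ?thesis
   unfolding g_left[OF x y tangent_comb[OF x y]] g_right[OF x y x] g_right[OF x y y] g_sym[OF y x]
   by (simp add: algebra_simps power2_eq_square)
 qed
 have "(g x \<xi> \<eta>)\<^sup>2 \<le> g x \<xi> \<xi> * g x \<eta> \<eta>"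
 proof (cases "g x \<xi> \<xi> = 0")
  case True
  then have "\<xi> = (\<lambda>_. 0)" using g_pos[OF x] by force
  then show ?thesis using y by simp
 next
  case False
  then have p: "g x \<xi> \<xi> > 0" using g_nonneg[OF x] by simp
  from q[of "- g x \<xi> \<eta> / g x \<xi> \<xi>"] p show ?thesis
   by (simp add: power2_eq_square field_simps)
 qed
 then have "sqrt ((g x \<xi> \<eta>)\<^sup>2) \<le> sqrt (g x \<xi> \<xi> * g x \<eta> \<eta>)" by (rule real_sqrt_le_mono)
 then show ?thesis by (simp add: tnorm_def real_sqrt_mult)
qed

lemma tnorm_triangle:
 assumes x: "\<xi> \<in> TM x" and y: "\<eta> \<in> TM x"
 shows "tnorm g x (\<lambda>c. a *\<^sub>R \<xi> c + b *\<^sub>R \<eta> c) \<le> \<bar>a\<bar> * tnorm g x \<xi> + \<bar>b\<bar> * tnorm g x \<eta>"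
proof -
 have "g x (\<lambda>c. a *\<^sub>R \<xi> c + b *\<^sub>R \<eta> c) (\<lambda>c. a *\<^sub>R \<xi> c + b *\<^sub>R \<eta> c)
  = a\<^sup>2 * g x \<xi> \<xi> + 2 * (a * b * g x \<xi> \<eta>) + b\<^sup>2 * g x \<eta> \<eta>"
  unfolding g_left[OF x y tangent_comb[OF x y]] g_right[OF x y x] g_right[OF x y y] g_sym[OF y x]
  by (simp add: algebra_simps power2_eq_square)
 also have "\<dots> \<le> a\<^sup>2 * g x \<xi> \<xi> + 2 * (\<bar>a\<bar> * \<bar>b\<bar> * (tnorm g x \<xi> * tnorm g x \<eta>)) + b\<^sup>2 * g x \<eta> \<eta>"
 proof -
  have "a * b * g x \<xi> \<eta> \<le> \<bar>a\<bar> * \<bar>b\<bar> * \<bar>g x \<xi> \<eta>\<bar>" by (simp flip: abs_mult)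
  also have "\<dots> \<le> \<bar>a\<bar> * \<bar>b\<bar> * (tnorm g x \<xi> * tnorm g x \<eta>)"
   using g_Cauchy_Schwarz[OF x y] by (intro mult_left_mono) auto
  finally show ?thesis by simp
 qed
 also have "\<dots> = (\<bar>a\<bar> * tnorm g x \<xi> + \<bar>b\<bar> * tnorm g x \<eta>)\<^sup>2"
  unfolding tnorm_sq[OF x, symmetric] tnorm_sq[OF y, symmetric] by (simp add: power2_eq_square algebra_simps)
 finally have "sqrt (g x (\<lambda>c. a *\<^sub>R \<xi> c + b *\<^sub>R \<eta> c) (\<lambda>c. a *\<^sub>R \<xi> c + b *\<^sub>R \<eta> c)) \<le> sqrt ((\<bar>a\<bar> * tnorm g x \<xi> + \<bar>b\<bar> * tnorm g x \<eta>)\<^sup>2)"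
  by (rule real_sqrt_le_mono)
 then show ?thesis using tnorm_nonneg[OF x] tnorm_nonneg[OF y] by (simp add: tnorm_def)
qed

section \<open>The metric in local coordinates\<close>

abbreviation lm :: "('a, 'm) chart \<Rightarrow> real ^ 'm \<Rightarrow> real ^ 'm \<Rightarrow> real ^ 'm \<Rightarrow> real" where
 "lm \<equiv> local_metric \<A> g"

lemma g_eq_lm:
 assumes "c \<in> \<A>" "x \<in> fst c" "\<xi> \<in> TM x" "\<eta> \<in> TM x"
 shows "g x \<xi> \<eta> = lm c (snd c x) (\<xi> c) (\<eta> c)"
 using assms by (simp add: local_metric_def tangent_eq_tvec_of[symmetric])

lemma tnorm_eq_lm:
 assumes "c \<in> \<A>" "x \<in> fst c" "\<xi> \<in> TM x"
 shows "tnorm g x \<xi> = sqrt (lm c (snd c x) (\<xi> c) (\<xi> c))"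
 unfolding tnorm_def g_eq_lm[OF assms assms(3)] ..

lemma lm_bilinear:
 assumes "c \<in> \<A>" "y \<in> img c"
 shows "lm c y (a *\<^sub>R v + b *\<^sub>R w) z = a * lm c y v z + b * lm c y w z"
  and "lm c y z (a *\<^sub>R v + b *\<^sub>R w) = a * lm c y z v + b * lm c y z w"
  and "lm c y v w = lm c y w v"
proof -
 have c: "c \<in> \<A>" "chart_inv c y \<in> fst c" using assms by auto
 show "lm c y (a *\<^sub>R v + b *\<^sub>R w) z = a * lm c y v z + b * lm c y w z"
  unfolding local_metric_def tvec_of_linear[OF c] by (rule g_left) (use c in auto)
 show "lm c y z (a *\<^sub>R v + b *\<^sub>R w) = a * lm c y z v + b * lm c y z w"
  unfolding local_metric_def tvec_of_linear[OF c] by (rule g_right) (use c in auto)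
 show "lm c y v w = lm c y w v"
  unfolding local_metric_def by (rule g_sym) (use c in auto)
qed

lemma linear_lm:
 assumes "c \<in> \<A>" "y \<in> img c"
 shows "linear (\<lambda>v. lm c y v z)" "linear (\<lambda>v. lm c y z v)"
 using lm_bilinear(1)[OF assms, of 1 _ 1] lm_bilinear(1)[OF assms, of _ _ 0]
  lm_bilinear(2)[OF assms, of _ 1 _ 1] lm_bilinear(2)[OF assms, of _ _ _ 0]
 by (auto intro!: linearI)

lemma lm_pos:
 assumes "c \<in> \<A>" "y \<in> img c" "v \<noteq> 0"
 shows "lm c y v v > 0"
proof -
 have c: "c \<in> \<A>" "chart_inv c y \<in> fst c" using assms by auto
 have "tv c (chart_inv c y) v \<noteq> (\<lambda>_. 0)" using tvec_of_self[OF c, of v] assms(3) by metis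
 then show ?thesis unfolding local_metric_def by (intro g_pos tvec_of_in c)
qed

lemma lm_nonneg: "c \<in> \<A> ==> y \<in> img c ==> lm c y v v \<ge> 0"
 using lm_pos[of c y v] lm_bilinear(1)[of c y 0 0 0 0 0] by (cases "v = 0") auto

lemma Ck_lm:
 assumes "c \<in> \<A>"
 shows "Ck_on k (img c) (\<lambda>y. lm c y v w)"
 using rm assms unfolding riemannian_manifold_def riemannian_metric_def smooth_on_def by blast

lemma continuous_lm_fixed:
 assumes "c \<in> \<A>"
 shows "continuous_on (img c) (\<lambda>y. lm c y v w)"
 using Ck_lm[OF assms, of 0] by simp

text \<open>Reduces joint continuity and measurability in the point and both vectors to the entries
  of the Gram matrix.\<close>

lemma lm_expand:
 assumes "c \<in> \<A>" "y \<in> img c"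
 shows "lm c y v w = (\<Sum>i\<in>UNIV. \<Sum>j\<in>UNIV. v $ i * w $ j * lm c y (axis i 1) (axis j 1))"
proof -
 have ax: "v = (\<Sum>i\<in>UNIV. v $ i *\<^sub>R axis i 1)" for v :: "real ^ 'm"
  by (simp add: basis_expansion scalar_mult_eq_scaleR[symmetric])
 have "lm c y v w = lm c y (\<Sum>i\<in>UNIV. v $ i *\<^sub>R axis i 1) (\<Sum>j\<in>UNIV. w $ j *\<^sub>R axis j 1)"
  using ax[of v] ax[of w] by simp
 also have "\<dots> = (\<Sum>i\<in>UNIV. v $ i * lm c y (axis i 1) (\<Sum>j\<in>UNIV. w $ j *\<^sub>R axis j 1))"
  by (simp only: linear_sum[OF linear_lm(1)[OF assms]] linear_cmul[OF linear_lm(1)[OF assms]] real_scaleR_def)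
 also have "\<dots> = (\<Sum>i\<in>UNIV. v $ i * (\<Sum>j\<in>UNIV. w $ j * lm c y (axis i 1) (axis j 1)))"
  by (simp only: linear_sum[OF linear_lm(2)[OF assms]] linear_cmul[OF linear_lm(2)[OF assms]] real_scaleR_def)
 finally show ?thesis by (simp add: sum_distrib_left mult.assoc)
qed

lemma continuous_lm:
 assumes "c \<in> \<A>" "continuous_on S f" "continuous_on S v" "continuous_on S w" "\<And>x. x \<in> S ==> f x \<in> img c"
 shows "continuous_on S (\<lambda>x. lm c (f x) (v x) (w x))"
proof -
 have "continuous_on S (\<lambda>x. \<Sum>i\<in>UNIV. \<Sum>j\<in>UNIV. v x $ i * w x $ j * lm c (f x) (axis i 1) (axis j 1))"
  using assms by (intro continuous_intros continuous_on_compose2[OF continuous_lm_fixed[OF assms(1)]]) auto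
 then show ?thesis by (rule continuous_on_eq) (simp add: lm_expand[OF assms(1)] assms(5))
qed

definition lnorm :: "('a, 'm) chart \<Rightarrow> real ^ 'm \<Rightarrow> real ^ 'm \<Rightarrow> real" where
 "lnorm c y v = sqrt (lm c y v v)"

lemma lnorm_eq_tnorm:
 assumes "c \<in> \<A>" "x \<in> fst c"
 shows "lnorm c (snd c x) v = tnorm g x (tv c x v)"
 using tnorm_eq_lm[OF assms tvec_of_in[OF assms]] assms by (simp add: lnorm_def)

lemma lnorm_scale:
 assumes "c \<in> \<A>" "y \<in> img c"
 shows "lnorm c y (a *\<^sub>R v) = \<bar>a\<bar> * lnorm c y v"
 using lm_bilinear(1)[OF assms, of a v 0 0 "a *\<^sub>R v"] lm_bilinear(2)[OF assms, of v a v 0 0]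
 by (simp add: lnorm_def real_sqrt_mult mult.assoc[symmetric])

lemma continuous_lnorm:
 assumes "c \<in> \<A>" "continuous_on S f" "continuous_on S v" "\<And>x. x \<in> S ==> f x \<in> img c"
 shows "continuous_on S (\<lambda>x. lnorm c (f x) (v x))"
 unfolding lnorm_def using assms by (intro continuous_intros continuous_lm)

text \<open>Extremal values on the compact product of K with the Euclidean unit sphere, extended to
  all vectors by homogeneity.\<close>

lemma lnorm_bounds:
 assumes c: "c \<in> \<A>" and K: "compact K" "K \<subseteq> img c"
 obtains b B where "b > 0" "B > 0" "\<And>y v. y \<in> K ==> b * norm v \<le> lnorm c y v"
  "\<And>y v. y \<in> K ==> lnorm c y v \<le> B * norm v"
proof (cases "K = {}")
 case True
 then show ?thesis using that[of 1 1] by auto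
next
 case False
 define S where "S = K \<times> sphere (0::real^'m) 1"
 have S: "compact S" "S \<noteq> {}" using K False by (auto simp: S_def intro!: compact_Times)
 have cont: "continuous_on S (\<lambda>z. lnorm c (fst z) (snd z))"
  using K by (intro continuous_lnorm[OF c] continuous_intros) (auto simp: S_def)
 obtain z1 where z1: "z1 \<in> S" "\<And>z. z \<in> S ==> lnorm c (fst z1) (snd z1) \<le> lnorm c (fst z) (snd z)"
  using continuous_attains_inf[OF S cont] by auto
 obtain z2 where z2: "z2 \<in> S" "\<And>z. z \<in> S ==> lnorm c (fst z) (snd z) \<le> lnorm c (fst z2) (snd z2)"
  using continuous_attains_sup[OF S cont] by auto
 have p: "lnorm c (fst z) (snd z) > 0" if "z \<in> S" for z
 proof -
  have "snd z \<noteq> 0" "fst z \<in> img c" using that K by (auto simp: S_def)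
  then show ?thesis unfolding lnorm_def using lm_pos[OF c] by simp
 qed
 have sc: "lnorm c y v = norm v * lnorm c y (v /\<^sub>R norm v)" "(y, v /\<^sub>R norm v) \<in> S" if "y \<in> K" "v \<noteq> 0" for y v
  using lnorm_scale[OF c, of y "norm v" "v /\<^sub>R norm v"] that K by (auto simp: S_def)
 have z: "lnorm c y 0 = 0" if "y \<in> K" for y
  using lnorm_scale[OF c, of y 0 0] that K by auto
 show ?thesis
 proof (rule that[OF p[OF z1(1)] p[OF z2(1)]])
  fix y v assume y: "y \<in> K"
  show "lnorm c (fst z1) (snd z1) * norm v \<le> lnorm c y v"
   using z1(2)[of "(y, v /\<^sub>R norm v)"] sc[OF y, of v] z[OF y]
   by (cases "v = 0") (auto simp: mult.commute intro: mult_right_mono)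
  show "lnorm c y v \<le> lnorm c (fst z2) (snd z2) * norm v"
   using z2(2)[of "(y, v /\<^sub>R norm v)"] sc[OF y, of v] z[OF y]
   by (cases "v = 0") (auto simp: mult.commute intro: mult_right_mono)
 qed
qed

text \<open>Uniform continuity on unit vectors bounds the difference of the two norms by e b. Since
  b bounds the norm itself from below, the additive error becomes a relative one.\<close>

lemma lnorm_near:
 assumes c: "c \<in> \<A>" and y0: "y0 \<in> img c" and e: "e > 0"
 obtains s where "s > 0" "cball y0 s \<subseteq> img c"
  "\<And>y y' v. y \<in> cball y0 s ==> y' \<in> cball y0 s ==> lnorm c y v \<le> (1 + e) * lnorm c y' v"
proof -
 obtain s0 where s0: "s0 > 0" "cball y0 s0 \<subseteq> img c"
  using open_img[OF c] y0 by (meson open_contains_cball)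
 obtain b B where b: "b > 0" "B > 0" "\<And>y v. y \<in> cball y0 s0 ==> b * norm v \<le> lnorm c y v"
  "\<And>y v. y \<in> cball y0 s0 ==> lnorm c y v \<le> B * norm v"
  by (rule lnorm_bounds[OF c compact_cball s0(2)]) (rule that)
 define S where "S = cball y0 s0 \<times> sphere (0::real^'m) 1"
 have S: "compact S" by (auto simp: S_def intro!: compact_Times)
 have cont: "continuous_on S (\<lambda>z. lnorm c (fst z) (snd z))"
  using s0 by (intro continuous_lnorm[OF c] continuous_intros) (auto simp: S_def)
 from compact_uniformly_continuous[OF cont S] b(1) e
 obtain d where d: "d > 0" "\<And>z z'. z \<in> S ==> z' \<in> S ==> dist z' z < d ==> dist (lnorm c (fst z') (snd z')) (lnorm c (fst z) (snd z)) < e * b"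
  unfolding uniformly_continuous_on_def by (metis mult_pos_pos)
 define s where "s = min s0 (d / 3)"
 have s: "s > 0" "s \<le> s0" "s \<le> d / 3" using s0 d by (auto simp: s_def)
 show ?thesis
 proof (rule that[of s])
  show "cball y0 s \<subseteq> img c" using s s0 by auto
  fix y y' v assume y: "y \<in> cball y0 s" "y' \<in> cball y0 s"
  then have yc: "y \<in> img c" "y' \<in> img c" "y' \<in> cball y0 s0" using s s0 by auto
  show "lnorm c y v \<le> (1 + e) * lnorm c y' v"
  proof (cases "v = 0")
   case True
   then show ?thesis using lnorm_scale[OF c yc(1), of 0 0] lnorm_scale[OF c yc(2), of 0 0] by simp
  next
   case False
   let ?w = "v /\<^sub>R norm v"
   have "dist y y' \<le> dist y y0 + dist y0 y'" by (rule dist_triangle)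
   also have "\<dots> < d" using y s d(1) by (simp add: dist_commute)
   finally have "dist (y, ?w) (y', ?w) < d" by (simp add: dist_Pair_Pair)
   then have "dist (lnorm c y ?w) (lnorm c y' ?w) < e * b"
    using d(2)[of "(y', ?w)" "(y, ?w)"] y s False by (auto simp: S_def)
   moreover have "e * b \<le> e * lnorm c y' ?w" using b(3)[of y' ?w] yc False e by simp
   ultimately have "lnorm c y ?w \<le> lnorm c y' ?w + e * lnorm c y' ?w"
    unfolding dist_real_def by linarith
   then have "norm v * lnorm c y ?w \<le> norm v * ((1 + e) * lnorm c y' ?w)"
    by (intro mult_left_mono) (auto simp: algebra_simps)
   then show ?thesis
    using lnorm_scale[OF c yc(1), of "norm v" ?w] lnorm_scale[OF c yc(2), of "norm v" ?w] False by (simp add: mult.left_commute)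
  qed
 qed (use s in auto)
qed

end

section \<open>Length of curves\<close>

text \<open>Piecewise C1 in this sense lets the derivative blow up at the finitely many exceptional
  points, so the length may be infinite; the extended integral makes that case trivial.\<close>

lemma norm_increment_le_nn_integral_derivative:
 fixes f :: "real \<Rightarrow> 'e::euclidean_space"
 assumes f: "f piecewise_C1_differentiable_on {a..b}" and ab: "a \<le> b"
 shows "ennreal (norm (f b - f a)) \<le> (\<integral>\<^sup>+t\<in>{a..b}. ennreal (norm (vector_derivative f (at t))) \<partial>lborel)"
  (is "_ \<le> ?I")
proof -
 obtain S where S: "finite S" "continuous_on {a..b} f" "f C1_differentiable_on ({a..b} - S)"
  using f by (auto simp: piecewise_C1_differentiable_on_def)
 define D where "D t = vector_derivative f (at t)" for t
 have d: "(f has_vector_derivative D t) (at t)" if "t \<in> {a..b} - S" for t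
  using S(3) that unfolding C1_differentiable_on_eq D_def by (auto simp: vector_derivative_works)
 have c: "continuous_on ({a..b} - S) D" using S(3) unfolding C1_differentiable_on_eq D_def by auto
 define h where "h t = indicator ({a..b} - S) t *\<^sub>R D t" for t
 have hm [measurable]: "h \<in> borel_measurable borel"
  unfolding h_def using S(1) c by (intro borel_measurable_continuous_on_indicator sets.Diff) (auto simp: finite_imp_closed borel_closed)
 have hle: "(\<integral>\<^sup>+t. ennreal (norm (h t)) \<partial>lborel) \<le> ?I"
  by (intro nn_integral_mono) (auto simp: h_def D_def indicator_def)
 show ?thesis
 proof (cases "?I = \<infinity>")
  case False
  then have fin: "(\<integral>\<^sup>+t. ennreal (norm (h t)) \<partial>lborel) < \<infinity>" using hle by (auto simp: top.not_eq_extremum intro: le_less_trans)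
  then have hi: "integrable lborel h" by (simp add: integrable_iff_bounded)
  have "(D has_integral (f b - f a)) {a..b}"
   using S(1,2) ab d by (intro fundamental_theorem_of_calculus_interior_strong[of S]) auto
  then have "(h has_integral (f b - f a)) {a..b}"
   by (rule has_integral_spike_finite[OF S(1), rotated]) (auto simp: h_def)
  then have "((\<lambda>x. if x \<in> {a..b} then h x else 0) has_integral (f b - f a)) UNIV" by (simp only: has_integral_restrict_UNIV)
  moreover have "(\<lambda>x. if x \<in> {a..b} then h x else 0) = h" by (auto simp: h_def fun_eq_iff)
  ultimately have "(h has_integral (f b - f a)) UNIV" by simp
  with has_integral_integral_lborel[OF hi] have "f b - f a = (LBINT t. h t)" by (metis has_integral_unique)
  then have "norm (f b - f a) \<le> (LBINT t. norm (h t))" by simp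
  then have "ennreal (norm (f b - f a)) \<le> ennreal (LBINT t. norm (h t))" by (rule ennreal_leI)
  also have "\<dots> = (\<integral>\<^sup>+t. ennreal (norm (h t)) \<partial>lborel)"
   by (rule nn_integral_eq_integral[symmetric]) (use hi in auto)
  finally show ?thesis using hle by simp
 qed simp
qed

context rmfd
begin

abbreviation curve where "curve \<equiv> piecewise_C1_curve \<A>"
abbreviation len where "len \<equiv> curve_length \<A> g"

definition speed :: "(real \<Rightarrow> 'a) \<Rightarrow> real \<Rightarrow> real" where
 "speed C t = tnorm g (C t) (velocity \<A> C t)"

abbreviation arc where "arc C a b \<equiv> (\<integral>\<^sup>+t\<in>{a..b}. ennreal (speed C t) \<partial>lborel)"

lemma len_speed: "len C = arc C 0 1"
 by (simp add: curve_length_def speed_def)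

lemma velocity_eq:
 assumes C: "continuous_on W C" "open W" "t \<in> W" and c: "c \<in> \<A>" "C t \<in> fst c"
  and d: "((snd c \<circ> C) has_vector_derivative w) (at t)"
 shows "velocity \<A> C t = tv c (C t) w"
  and "d' \<in> \<A> ==> C t \<in> fst d' ==> ((snd d' \<circ> C) has_vector_derivative dtrans c d' (C t) w) (at t)"
proof -
 have *: "((snd d' \<circ> C) has_vector_derivative dtrans c d' (C t) w) (at t)" if d': "d' \<in> \<A>" "C t \<in> fst d'" for d'
 proof -
  have "(transition c d' has_derivative dtrans c d' (C t)) (at ((snd c \<circ> C) t))"
   using transition_has_derivative[OF c(1) d'(1) c(2) d'(2)] by simp
  from has_derivative_compose[OF d[unfolded has_vector_derivative_def] this]
  have "((\<lambda>t. transition c d' ((snd c \<circ> C) t)) has_derivative (\<lambda>s. dtrans c d' (C t) (s *\<^sub>R w))) (at t)" .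
  then have "((snd d' \<circ> C) has_derivative (\<lambda>s. dtrans c d' (C t) (s *\<^sub>R w))) (at t)"
  proof (rule has_derivative_transform_within_open)
   show "open (W \<inter> C -` (fst c \<inter> fst d'))"
    using C open_dom[OF c(1)] open_dom[OF d'(1)] by (intro continuous_open_preimage) auto
  qed (use C c d' in auto)
  then show ?thesis unfolding has_vector_derivative_def
   by (rule has_derivative_eq_rhs) (use linear_dtrans[OF c(1) d'(1) c(2) d'(2)] in \<open>auto simp: linear_cmul\<close>)
 qed
 show "d' \<in> \<A> ==> C t \<in> fst d' ==> ((snd d' \<circ> C) has_vector_derivative dtrans c d' (C t) w) (at t)" by (rule *)
 show "velocity \<A> C t = tv c (C t) w"
  unfolding velocity_def tvec_of_eq using vector_derivative_at[OF *] by (auto simp: fun_eq_iff)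
qed

lemma speed_eq:
 assumes "continuous_on W C" "open W" "t \<in> W" "c \<in> \<A>" "C t \<in> fst c"
  "(snd c \<circ> C) differentiable (at t)"
 shows "speed C t = lnorm c (snd c (C t)) (vector_derivative (snd c \<circ> C) (at t))"
 using velocity_eq(1)[OF assms(1-5) iffD1[OF vector_derivative_works assms(6)]] lnorm_eq_tnorm[OF assms(4,5)]
 by (simp add: speed_def)

text \<open>\<open>piecewise_C1_curve\<close> speaks only about parameter intervals mapped into one
  chart. By compactness finitely many of them cover [0, 1], so a single finite exceptional set
  serves the whole curve.\<close>

lemma curve_regular:
 assumes C: "curve C"
 obtains S where "finite S" "\<And>t. t \<in> {0<..<1} - S ==> \<exists>c\<in>\<A>. \<exists>W. open W \<and> t \<in> W \<and> W \<subseteq> {0<..<1} - S \<and> C ` W \<subseteq> fst c \<and>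
  (snd c \<circ> C) C1_differentiable_on W"
proof -
 have cont: "continuous_on {0..1} C" using C by (simp add: piecewise_C1_curve_def)
 have "\<exists>c e. c \<in> \<A> \<and> e > 0 \<and> C ` ({0..1} \<inter> ball t e) \<subseteq> fst c" if t: "t \<in> {0..1}" for t
 proof -
  obtain c where c: "c \<in> \<A>" "C t \<in> fst c" by (rule chart_cover)
  have "openin (top_of_set {0..1}) ({0..1} \<inter> C -` fst c)"
   using continuous_openin_preimage_gen[OF cont open_dom[OF c(1)]] .
  then obtain e where "e > 0" "ball t e \<inter> {0..1} \<subseteq> {0..1} \<inter> C -` fst c"
   using t c unfolding openin_contains_ball by blast
  then show ?thesis using c by (intro exI[of _ c] exI[of _ e]) auto
 qed
 then obtain ch e where ce: "\<And>t. t \<in> {0..1} ==> ch t \<in> \<A>" "\<And>t. t \<in> {0..1} ==> e t > 0"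
  "\<And>t. t \<in> {0..1} ==> C ` ({0..1} \<inter> ball t (e t)) \<subseteq> fst (ch t)" by metis
 have "\<exists>S. finite S \<and> (snd (ch t) \<circ> C) C1_differentiable_on (({0..1} \<inter> cball t (e t / 2)) - S)" if t: "t \<in> {0..1}" for t
 proof -
  \<comment> \<open>The radius is halved because the curve condition is about closed intervals,
    while the image is known to lie in the chart only over the open ball of full radius.\<close>
  have eq: "{0..1} \<inter> cball t (e t / 2) = {max 0 (t - e t / 2)..min 1 (t + e t / 2)}"
   by (auto simp: cball_eq_atLeastAtMost)
  have "{0..1} \<inter> cball t (e t / 2) \<subseteq> {0..1} \<inter> ball t (e t)" using ce(2)[OF t] by auto
  then have "C ` {max 0 (t - e t / 2)..min 1 (t + e t / 2)} \<subseteq> fst (ch t)" using ce(3)[OF t] eq by blast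
  then have "(snd (ch t) \<circ> C) piecewise_C1_differentiable_on {max 0 (t - e t / 2)..min 1 (t + e t / 2)}"
   using C ce(1)[OF t] ce(2)[OF t] t unfolding piecewise_C1_curve_def by (auto simp: max_def min_def)
  then show ?thesis unfolding eq piecewise_C1_differentiable_on_def by auto
 qed
 then obtain Sf where Sf: "\<And>t. t \<in> {0..1} ==> finite (Sf t)"
  "\<And>t. t \<in> {0..1} ==> (snd (ch t) \<circ> C) C1_differentiable_on (({0..1} \<inter> cball t (e t / 2)) - Sf t)" by metis
 obtain T where T: "T \<subseteq> {0..1}" "finite T" "{0..1} \<subseteq> (\<Union>t\<in>T. ball t (e t / 2))"
 proof (rule compactE_image[of "{0..1::real}" "{0..1}" "\<lambda>t. ball t (e t / 2)"])
  show "{0..1} \<subseteq> (\<Union>t\<in>{0..1}. ball t (e t / 2))" using ce(2) by force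
 qed auto
 define S where "S = (\<Union>t\<in>T. Sf t)"
 show ?thesis
 proof (rule that[of S])
  show fS: "finite S" unfolding S_def using T Sf by auto
  fix t assume t: "t \<in> {0<..<1} - S"
  then have "t \<in> {0..1}" by auto
  then obtain t' where t': "t' \<in> T" "t \<in> ball t' (e t' / 2)" using T(3) by blast
  then have t'1: "t' \<in> {0..1}" using T by auto
  define W where "W = {0<..<1} \<inter> ball t' (e t' / 2) - S"
  have "open W" unfolding W_def using fS by (intro open_Diff finite_imp_closed) auto
  moreover have "t \<in> W" using t t' by (auto simp: W_def)
  moreover have "C ` W \<subseteq> fst (ch t')"
  proof -
   have "W \<subseteq> {0..1} \<inter> ball t' (e t')" using ce(2)[OF t'1] by (auto simp: W_def)
   then show ?thesis using ce(3)[OF t'1] by blast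
  qed
  moreover have "(snd (ch t') \<circ> C) C1_differentiable_on W"
   by (rule C1_differentiable_on_subset[OF Sf(2)[OF t'1]]) (use t' in \<open>auto simp: W_def S_def\<close>)
  ultimately show "\<exists>c\<in>\<A>. \<exists>W. open W \<and> t \<in> W \<and> W \<subseteq> {0<..<1} - S \<and> C ` W \<subseteq> fst c \<and> (snd c \<circ> C) C1_differentiable_on W"
   using ce(1)[OF t'1] by (intro bexI[of _ "ch t'"] exI[of _ W]) (auto simp: W_def)
 qed
qed

lemma curve_speed:
 assumes C: "curve C"
 obtains S where "finite S" "continuous_on ({0<..<1} - S) (speed C)"
  "\<And>t c. t \<in> {0<..<1} - S ==> c \<in> \<A> ==> C t \<in> fst c ==> (snd c \<circ> C) differentiable (at t)"
proof -
 have cont: "continuous_on {0..1} C" using C by (simp add: piecewise_C1_curve_def)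
 then have cont': "continuous_on W C" if "W \<subseteq> {0<..<1}" for W
  by (rule continuous_on_subset) (use that in fastforce)
 obtain S where S: "finite S" "\<And>t. t \<in> {0<..<1} - S ==> \<exists>c\<in>\<A>. \<exists>W. open W \<and> t \<in> W \<and> W \<subseteq> {0<..<1} - S \<and> C ` W \<subseteq> fst c \<and>
  (snd c \<circ> C) C1_differentiable_on W" by (rule curve_regular[OF C]) (rule that)
 show ?thesis
 proof (rule that[OF S(1)])
  have "isCont (speed C) t" if t: "t \<in> {0<..<1} - S" for t
  proof -
   obtain c W where W: "c \<in> \<A>" "open W" "t \<in> W" "W \<subseteq> {0<..<1} - S" "C ` W \<subseteq> fst c" "(snd c \<circ> C) C1_differentiable_on W"
    using S(2)[OF t] by blast
   have cW: "continuous_on W C" using W by (intro cont') auto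
   have "continuous_on W (\<lambda>t. lnorm c (snd c (C t)) (vector_derivative (snd c \<circ> C) (at t)))"
    using W cW unfolding C1_differentiable_on_eq
    by (intro continuous_lnorm continuous_on_compose2[OF cont_chart cW]) auto
   moreover have "speed C t = lnorm c (snd c (C t)) (vector_derivative (snd c \<circ> C) (at t))" if "t \<in> W" for t
    using W that unfolding C1_differentiable_on_eq by (intro speed_eq[OF cW]) auto
   ultimately have "continuous_on W (speed C)" by (simp cong: continuous_on_cong)
   then show ?thesis using W by (simp add: continuous_on_eq_continuous_at)
  qed
  then show "continuous_on ({0<..<1} - S) (speed C)" by (intro continuous_at_imp_continuous_on) auto
  fix t c assume t: "t \<in> {0<..<1} - S" and c: "c \<in> \<A>" "C t \<in> fst c"
  obtain c' W where W: "c' \<in> \<A>" "open W" "t \<in> W" "W \<subseteq> {0<..<1} - S" "C ` W \<subseteq> fst c'" "(snd c' \<circ> C) C1_differentiable_on W"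
   using S(2)[OF t] by blast
  have cW: "continuous_on W C" using W by (intro cont') auto
  have "((snd c' \<circ> C) has_vector_derivative vector_derivative (snd c' \<circ> C) (at t)) (at t)"
   using W unfolding C1_differentiable_on_eq by (simp add: vector_derivative_works[symmetric])
  from velocity_eq(2)[OF cW W(2,3,1) _ this c] W(3,5) show "(snd c \<circ> C) differentiable (at t)"
   by (auto intro: differentiableI_vector)
 qed
qed

lemma AE_not_finite: "finite S ==> AE t in lborel. t \<notin> (S :: real set)"
 by (intro AE_not_in) (simp add: finite_imp_null_set_lborel)

text \<open>p < q restricts to a subarc and p > q also reverses it, so both the symmetry of the
  distance and the cutting of curves come from this one formula.\<close>

lemma curve_affine:
 assumes C: "curve C" and p: "0 \<le> p" "p \<le> 1" and q: "0 \<le> q" "q \<le> 1" "p \<noteq> q"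
 shows "curve (\<lambda>t. C (p + (q - p) * t))"
  and "len (\<lambda>t. C (p + (q - p) * t)) = arc C (min p q) (max p q)"
proof -
 define A where "A t = p + (q - p) * t" for t
 have A01: "A t \<in> {0..1}" if "t \<in> {0..1}" for t
 proof -
  have "A t = (1 - t) *\<^sub>R p + t *\<^sub>R q" by (simp add: A_def algebra_simps)
  then show ?thesis using that p q convexD[of "{0..1::real}" p q "1 - t" t] by auto
 qed
 have Aoo: "A t \<in> {0<..<1}" if "t \<in> {0<..<1}" for t
 proof (cases "p < q")
  case True
  have "(q - p) * t < (q - p) * 1" "0 < (q - p) * t" using that True by (auto intro: mult_strict_left_mono)
  then show ?thesis using p q by (simp add: A_def)
 next
  case False
  have "(p - q) * t < (p - q) * 1" "0 < (p - q) * t" using that False q by (auto intro: mult_strict_left_mono)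
  then show ?thesis using p q by (simp add: A_def algebra_simps)
 qed
 have cont: "continuous_on {0..1} C" using C by (simp add: piecewise_C1_curve_def)
 have cA: "continuous_on S A" for S unfolding A_def by (intro continuous_intros)
 have img: "A ` {a..b} = {min (A a) (A b)..max (A a) (A b)}" if "a \<le> b" for a b
 proof -
  have "A ` {a..b} = (\<lambda>x. (q - p) * x + p) ` {a..b}" by (simp add: A_def add.commute)
  also have "\<dots> = {min (A a) (A b)..max (A a) (A b)}"
   using that q(3) mult_left_mono[OF that, of "q - p"] mult_left_mono_neg[OF that, of "q - p"]
   unfolding image_affinity_atLeastAtMost by (cases "p < q") (auto simp: A_def max_def min_def)
  finally show ?thesis .
 qed
 show "curve (\<lambda>t. C (p + (q - p) * t))"
  unfolding piecewise_C1_curve_def A_def[symmetric]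
 proof (intro conjI ballI allI impI)
  show "continuous_on {0..1} (\<lambda>t. C (A t))"
   by (rule continuous_on_compose2[OF cont cA]) (use A01 in auto)
  fix c a b assume c: "c \<in> \<A>" and ab: "(0::real) \<le> a" "a \<le> b" "b \<le> 1" "(\<lambda>t. C (A t)) ` {a..b} \<subseteq> fst c"
  have "C ` {min (A a) (A b)..max (A a) (A b)} \<subseteq> fst c"
   using ab(4) unfolding img[OF ab(2), symmetric] by auto
  then have "(snd c \<circ> C) piecewise_C1_differentiable_on {min (A a) (A b)..max (A a) (A b)}"
   using C c A01[of a] A01[of b] ab unfolding piecewise_C1_curve_def by (auto simp: max_def min_def)
  then have "(snd c \<circ> C) piecewise_C1_differentiable_on ((\<lambda>x. (q - p) * x + p) ` {a..b})"
   unfolding img[OF ab(2), symmetric] by (simp add: A_def add.commute)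
  from piecewise_C1_differentiable_affine[OF this]
  show "(snd c \<circ> (\<lambda>t. C (A t))) piecewise_C1_differentiable_on {a..b}"
   by (simp add: o_def A_def add.commute)
 qed
 obtain S where S: "finite S" "continuous_on ({0<..<1} - S) (speed C)"
  "\<And>t c. t \<in> {0<..<1} - S ==> c \<in> \<A> ==> C t \<in> fst c ==> (snd c \<circ> C) differentiable (at t)"
  by (rule curve_speed[OF C]) (rule that)
 have sp: "speed (\<lambda>t. C (A t)) t = \<bar>q - p\<bar> * speed C (A t)" if t: "t \<in> {0<..<1}" "A t \<notin> S" for t
 proof -
  obtain c where c: "c \<in> \<A>" "C (A t) \<in> fst c" by (rule chart_cover)
  have d: "(snd c \<circ> C) differentiable (at (A t))" using S(3)[OF _ c] Aoo[OF t(1)] t(2) by auto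
  have d1: "(A has_vector_derivative (q - p)) (at t)" unfolding A_def by (auto intro!: derivative_eq_intros)
  have "((snd c \<circ> C) \<circ> A has_vector_derivative (q - p) *\<^sub>R vector_derivative (snd c \<circ> C) (at (A t))) (at t)"
   by (rule vector_diff_chain_at[OF d1 iffD1[OF vector_derivative_works d]])
  then have vd: "((snd c \<circ> (\<lambda>t. C (A t))) has_vector_derivative (q - p) *\<^sub>R vector_derivative (snd c \<circ> C) (at (A t))) (at t)"
   by (simp add: o_def)
  have "continuous_on {0<..<1} C" by (rule continuous_on_subset[OF cont]) auto
  moreover have c2: "continuous_on {0<..<1} (\<lambda>t. C (A t))"
   by (rule continuous_on_compose2[OF calculation cA]) (use Aoo in auto)
  ultimately show ?thesis
   using speed_eq[of "{0<..<1}" C "A t" c] speed_eq[OF c2 _ t(1) c differentiableI_vector[OF vd]]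
    Aoo[OF t(1)] c d vector_derivative_at[OF vd] lnorm_scale[OF c(1)] by simp
 qed
 \<comment> \<open>The speed is known to be continuous only off a finite set; this restriction of it
   is Borel and changes no integral.\<close>
 define f where "f t = indicator ({min p q..max p q} \<inter> ({0<..<1} - S)) t * speed C t" for t
 have fm [measurable]: "f \<in> borel_measurable borel"
 proof -
  have "open ({0<..<1} - S)" using S(1) by (intro open_Diff finite_imp_closed) auto
  then have "{min p q..max p q} \<inter> ({0<..<1} - S) \<in> sets borel" by auto
  moreover have "continuous_on ({min p q..max p q} \<inter> ({0<..<1} - S)) (speed C)"
   using S(2) by (rule continuous_on_subset) auto
  ultimately have "(\<lambda>t. indicator ({min p q..max p q} \<inter> ({0<..<1} - S)) t *\<^sub>R speed C t) \<in> borel_measurable borel"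
   by (rule borel_measurable_continuous_on_indicator)
  then show ?thesis by (simp add: f_def[abs_def])
 qed
 have ae: "AE t in lborel. (t::real) \<notin> S \<union> {0, 1}" using S(1) by (intro AE_not_finite) auto
 have "inj A" using q by (auto simp: inj_on_def A_def)
 then have fin: "finite (A -` S \<union> {0, 1})" using S(1) by (auto intro: finite_vimageI)
 have ae2: "AE t in lborel. (t::real) \<notin> A -` S \<union> {0, 1}" using fin by (rule AE_not_finite)
 have "len (\<lambda>t. C (A t)) = (\<integral>\<^sup>+t\<in>{0..1}. ennreal (\<bar>q - p\<bar> * speed C (A t)) \<partial>lborel)"
  unfolding len_speed
  by (rule nn_integral_cong_AE, use ae2 in eventually_elim) (auto simp: indicator_def sp)
 also have "\<dots> = (\<integral>\<^sup>+t. ennreal \<bar>q - p\<bar> * ennreal (f (p + (q - p) * t)) \<partial>lborel)"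
 proof (rule nn_integral_cong_AE, use ae2 in eventually_elim)
  case (elim t)
  have mem: "A t \<in> {min p q..max p q} \<longleftrightarrow> t \<in> {0..1}"
   using img[of 0 1] \<open>inj A\<close> inj_image_mem_iff[of A t "{0..1}"] by (simp add: A_def)
  show ?case
  proof (cases "t \<in> {0..1}")
   case True
   then have "t \<in> {0<..<1}" using elim by auto
   then have "f (A t) = speed C (A t)" using elim Aoo[of t] mem True by (auto simp: f_def)
   then show ?thesis using True by (simp add: ennreal_mult' A_def)
  next
   case False
   then have "f (A t) = 0" using mem by (auto simp: f_def)
   then show ?thesis using False by (simp add: A_def)
  qed
 qed
 also have "\<dots> = (\<integral>\<^sup>+t. ennreal (f t) \<partial>lborel)"
  using nn_integral_real_affine[of "\<lambda>t. ennreal (f t)" "q - p" p] q(3) by (simp add: nn_integral_cmult)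
 also have "\<dots> = arc C (min p q) (max p q)"
  by (rule nn_integral_cong_AE, use ae in eventually_elim) (use p q in \<open>auto simp: f_def indicator_def\<close>)
 finally show "len (\<lambda>t. C (p + (q - p) * t)) = arc C (min p q) (max p q)"
  by (simp add: A_def)
qed

lemma nn_integral_speed_split:
 assumes C: "curve C" and s: "0 \<le> s" "s \<le> 1"
 shows "arc C 0 1
  = arc C 0 s + arc C s 1"
proof -
 obtain S where S: "finite S" "continuous_on ({0<..<1} - S) (speed C)"
  by (rule curve_speed[OF C]) (rule that)
 define f where "f t = indicator ({0<..<1} - S) t * speed C t" for t
 have "open ({0<..<1} - S)" using S(1) by (intro open_Diff finite_imp_closed) auto
 then have "(\<lambda>t. indicator ({0<..<1} - S) t *\<^sub>R speed C t) \<in> borel_measurable borel"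
  using S(2) by (intro borel_measurable_continuous_on_indicator) auto
 then have fm [measurable]: "f \<in> borel_measurable borel" by (simp add: f_def[abs_def])
 have ae: "AE t in lborel. (t::real) \<notin> S \<union> {0, 1, s}" using S(1) by (intro AE_not_finite) auto
 have eq: "arc C a b = (\<integral>\<^sup>+t. ennreal (f t) * indicator ({a..b} - {s}) t \<partial>lborel)"
  if "0 \<le> a" "b \<le> 1" for a b
  by (rule nn_integral_cong_AE, use ae in eventually_elim) (use that in \<open>auto simp: f_def indicator_def\<close>)
 have "(\<integral>\<^sup>+t. ennreal (f t) * indicator ({0..1} - {s}) t \<partial>lborel)
  = (\<integral>\<^sup>+t. ennreal (f t) * indicator ({0..s} - {s}) t + ennreal (f t) * indicator ({s..1} - {s}) t \<partial>lborel)"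
  by (rule nn_integral_cong) (use s in \<open>auto simp: indicator_def\<close>)
 also have "\<dots> = (\<integral>\<^sup>+t. ennreal (f t) * indicator ({0..s} - {s}) t \<partial>lborel) + (\<integral>\<^sup>+t. ennreal (f t) * indicator ({s..1} - {s}) t \<partial>lborel)"
  by (rule nn_integral_add) auto
 finally show ?thesis using s by (simp add: eq)
qed

section \<open>Constant and concatenated curves\<close>

lemma curve_const: "curve (\<lambda>_. x)" "len (\<lambda>_. x) = 0"
proof -
 show "curve (\<lambda>_. x)" unfolding piecewise_C1_curve_def
  by (auto simp: o_def intro!: C1_differentiable_imp_piecewise)
 have "velocity \<A> (\<lambda>_. x) t = (\<lambda>_. 0)" for t by (auto simp: velocity_def o_def)
 then have "speed (\<lambda>_. x) t = 0" for t by (simp add: speed_def)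
 then show "len (\<lambda>_. x) = 0" by (simp add: len_speed)
qed

text \<open>\<open>C1_differentiable_on\<close> uses two-sided derivatives, and h may differ from f
  outside the interval; therefore the endpoints join the exceptional set.\<close>

lemma piecewise_C1_cong:
 fixes f h :: "real \<Rightarrow> 'e::real_normed_vector"
 assumes f: "f piecewise_C1_differentiable_on {a..b}" and eq: "\<And>t. t \<in> {a..b} ==> h t = f t"
 shows "h piecewise_C1_differentiable_on {a..b}"
proof -
 obtain S where S: "continuous_on {a..b} f" "finite S" "f C1_differentiable_on ({a..b} - S)"
  using f by (auto simp: piecewise_C1_differentiable_on_def)
 obtain D where D: "\<And>x. x \<in> {a..b} - S ==> (f has_vector_derivative D x) (at x)" "continuous_on ({a..b} - S) D"
  using S(3) unfolding C1_differentiable_on_def by blast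
 show ?thesis unfolding piecewise_C1_differentiable_on_def C1_differentiable_on_def
 proof (intro conjI exI[of _ "S \<union> {a, b}"] exI[of _ D] ballI)
  show "continuous_on {a..b} h" using S(1) by (rule continuous_on_eq) (use eq in auto)
  show "continuous_on ({a..b} - (S \<union> {a, b})) D" using D(2) by (rule continuous_on_subset) auto
  fix x assume x: "x \<in> {a..b} - (S \<union> {a, b})"
  show "(h has_vector_derivative D x) (at x)"
   by (rule has_vector_derivative_transform_within_open[OF D(1), of x "{a<..<b}"]) (use x eq in auto)
 qed (use S in auto)
qed

lemma len_cong:
 assumes "\<And>t. t \<in> {0<..<1} ==> C t = C' t"
 shows "len C = len C'"
proof -
 have vd: "((snd c \<circ> C') has_vector_derivative w) (at t)"
  if "((snd c \<circ> C) has_vector_derivative w) (at t)" "t \<in> {0<..<1}" "\<And>t. t \<in> {0<..<1} ==> C t = C' t"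
  for c :: "('a, 'm) chart" and w t C C'
  by (rule has_vector_derivative_transform_within_open[OF that(1), of "{0<..<1}"]) (use that in auto)
 have "speed C t = speed C' t" if t: "t \<in> {0<..<1}" for t
 proof -
  have "vector_derivative (snd c \<circ> C) (at t) = vector_derivative (snd c \<circ> C') (at t)" for c :: "('a, 'm) chart"
   unfolding vector_derivative_def by (rule arg_cong[where f = Eps], rule ext, rule iffI) (auto intro: vd[OF _ t] simp: assms)
  then show ?thesis using assms[OF t] by (simp add: speed_def velocity_def cong: if_cong)
 qed
 note sp = this
 have ae: "AE t in lborel. (t::real) \<notin> {0, 1}" by (rule AE_not_finite) simp
 show ?thesis unfolding len_speed
 proof (rule nn_integral_cong_AE, use ae in eventually_elim)
  case (elim t)
  then show ?case using sp[of t] by (cases "t \<in> {0..1}") auto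
 qed
qed

text \<open>Each half is an affine subarc of the joined curve, so the lengths follow from
  \<open>curve_affine\<close> and additivity of the arclength integral.\<close>

lemma curve_join:
 assumes C1: "curve C1" and C2: "curve C2" and j: "C1 1 = C2 0"
 defines "C \<equiv> \<lambda>t. if t \<le> 1 / 2 then C1 (2 * t) else C2 (2 * t - 1)"
 shows "curve C" "len C = len C1 + len C2"
proof -
 have c1: "continuous_on {0..1} C1" and c2: "continuous_on {0..1} C2"
  using C1 C2 by (auto simp: piecewise_C1_curve_def)
 show C: "curve C"
  unfolding piecewise_C1_curve_def
 proof (intro conjI ballI allI impI)
  have "continuous_on ({0..1/2} \<union> {1/2..1}) C"
   unfolding C_def
  proof (rule continuous_on_cases_le)
   show "continuous_on {t \<in> {0..1/2} \<union> {1/2..1}. t \<le> 1/2} (\<lambda>t. C1 (2 * t))"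
    by (rule continuous_on_compose2[OF c1]) (auto intro!: continuous_intros)
   show "continuous_on {t \<in> {0..1/2} \<union> {1/2..1}. 1/2 \<le> t} (\<lambda>t. C2 (2 * t - 1))"
    by (rule continuous_on_compose2[OF c2]) (auto intro!: continuous_intros)
   show "C1 (2 * t) = C2 (2 * t - 1)" if "t \<in> {0..1/2} \<union> {1/2..1}" "t = 1/2" for t
    unfolding that(2) using j by simp
  qed (auto intro!: continuous_intros)
  moreover have "{0..1/2} \<union> {1/2..1} = {0..1::real}" by auto
  ultimately show "continuous_on {0..1} C" by simp
  fix c a b assume c: "c \<in> \<A>" and ab: "(0::real) \<le> a" "a \<le> b" "b \<le> 1" "C ` {a..b} \<subseteq> fst c"
  have P1: "(snd c \<circ> (\<lambda>t. C1 (2 * t))) piecewise_C1_differentiable_on {a'..b'}"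
   if "0 \<le> a'" "a' \<le> b'" "b' \<le> 1 / 2" "{a'..b'} \<subseteq> {a..b}" for a' b'
  proof -
   have im: "(\<lambda>x. 2 * x + 0) ` {a'..b'} = {2 * a'..2 * b'}" using that by (subst image_affinity_atLeastAtMost) auto
   have "C1 ` {2 * a'..2 * b'} \<subseteq> fst c"
   proof
    fix z assume "z \<in> C1 ` {2 * a'..2 * b'}"
    then obtain s where s: "s \<in> {2 * a'..2 * b'}" "z = C1 s" by auto
    then have h: "s / 2 \<in> {a..b}" "s / 2 \<le> 1 / 2" using that by auto
    have "C (s / 2) \<in> fst c" using ab(4) h(1) by blast
    moreover have "C (s / 2) = C1 s" using h(2) by (simp add: C_def)
    ultimately show "z \<in> fst c" using s by simp
   qed
   then have "(snd c \<circ> C1) piecewise_C1_differentiable_on {2 * a'..2 * b'}"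
    using C1 c that unfolding piecewise_C1_curve_def by auto
   then show ?thesis using piecewise_C1_differentiable_affine[of "snd c \<circ> C1" 2 0 "{a'..b'}"] im by (simp add: o_def)
  qed
  have P2: "(snd c \<circ> (\<lambda>t. C2 (2 * t - 1))) piecewise_C1_differentiable_on {a'..b'}"
   if "1 / 2 \<le> a'" "a' \<le> b'" "b' \<le> 1" "{a'..b'} \<subseteq> {a..b}" for a' b'
  proof -
   have im: "(\<lambda>x. 2 * x + - 1) ` {a'..b'} = {2 * a' - 1..2 * b' - 1}" using that by (subst image_affinity_atLeastAtMost) auto
   have "C2 ` {2 * a' - 1..2 * b' - 1} \<subseteq> fst c"
   proof
    fix z assume "z \<in> C2 ` {2 * a' - 1..2 * b' - 1}"
    then obtain s where s: "s \<in> {2 * a' - 1..2 * b' - 1}" "z = C2 s" by auto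
    then have "(s + 1) / 2 \<in> {a..b}" "(s + 1) / 2 \<ge> 1 / 2" using that by auto
    moreover have "C ((s + 1) / 2) = C2 s"
    proof (cases "s = 0")
     case True
     then show ?thesis using j by (simp add: C_def)
    next
     case False
     then have "\<not> (s + 1) / 2 \<le> 1 / 2" using s(1) that by auto
     moreover have "2 * ((s + 1) / 2) - 1 = s" by (simp add: field_simps)
     ultimately show ?thesis by (simp only: C_def if_False)
    qed
    ultimately show "z \<in> fst c" using s ab(4) by (metis image_subset_iff)
   qed
   then have "(snd c \<circ> C2) piecewise_C1_differentiable_on {2 * a' - 1..2 * b' - 1}"
    using C2 c that unfolding piecewise_C1_curve_def by auto
   then show ?thesis using piecewise_C1_differentiable_affine[of "snd c \<circ> C2" 2 "-1" "{a'..b'}"] im by (simp add: o_def)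
  qed
  have eq: "snd c \<circ> C = (\<lambda>t. if t \<le> 1/2 then (snd c \<circ> (\<lambda>t. C1 (2 * t))) t else (snd c \<circ> (\<lambda>t. C2 (2 * t - 1))) t)"
   by (auto simp: C_def fun_eq_iff)
  consider "b \<le> 1/2" | "a > 1/2" | "a \<le> 1/2" "1/2 \<le> b" by linarith
  then show "(snd c \<circ> C) piecewise_C1_differentiable_on {a..b}"
  proof cases
   case 3
   show ?thesis unfolding eq
   proof (rule piecewise_C1_differentiable_cases)
    show "(snd c \<circ> (\<lambda>t. C1 (2 * t))) piecewise_C1_differentiable_on {a..1/2}" by (rule P1) (use 3 ab in auto)
    show "(snd c \<circ> (\<lambda>t. C2 (2 * t - 1))) piecewise_C1_differentiable_on {1/2..b}" by (rule P2) (use 3 ab in auto)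
   qed (use 3 j in auto)
  next
   case 1
   show ?thesis unfolding eq by (rule piecewise_C1_cong[OF P1]) (use 1 ab in auto)
  next
   case 2
   show ?thesis unfolding eq by (rule piecewise_C1_cong[OF P2]) (use 2 ab in auto)
  qed
 qed
 have "len C1 = len (\<lambda>t. C (0 + (1/2 - 0) * t))" by (rule len_cong) (simp add: C_def)
 also have "\<dots> = arc C 0 (1/2)"
  using curve_affine(2)[OF C, of 0 "1/2"] by simp
 finally have l1: "len C1 = arc C 0 (1/2)" .
 have "len C2 = len (\<lambda>t. C (1/2 + (1 - 1/2) * t))" by (rule len_cong) (simp add: C_def)
 also have "\<dots> = arc C (1/2) 1"
  using curve_affine(2)[OF C, of "1/2" 1] by simp
 finally have l2: "len C2 = arc C (1/2) 1" .
 show "len C = len C1 + len C2"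
  using nn_integral_speed_split[OF C, of "1/2"] l1 l2 len_speed[of C] by simp
qed

end

section \<open>The Riemannian distance\<close>

text \<open>Hopf--Rinow for length spaces: no geodesics are needed, only almost-midpoints.\<close>

lemma (in Metric_space) compactin_mcball_of_intermediate:
 assumes lc: "\<And>x. x \<in> M ==> \<exists>r>0. compactin mtopology (mcball x r)"
  and im: "\<And>x y a b. x \<in> M ==> y \<in> M ==> 0 \<le> a ==> 0 < b ==> d x y < a + b ==> \<exists>z\<in>M. d x z \<le> a \<and> d z y < b"
  and mc: "mcomplete" and x0: "x0 \<in> M"
 shows "compactin mtopology (mcball x0 R)"
proof (rule ccontr)
 assume R: "\<not> compactin mtopology (mcball x0 R)"
 define P where "P = {r. r \<ge> 0 \<and> compactin mtopology (mcball x0 r)}"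
 have down: "compactin mtopology (mcball x0 r)" if "compactin mtopology (mcball x0 r')" "r \<le> r'" for r r'
  using that mcball_subset_concentric[of r r' x0] by (auto intro: closed_compactin)
 obtain r0 where r0: "r0 > 0" "compactin mtopology (mcball x0 r0)" using lc[OF x0] by auto
 have bdd: "r < R" if "r \<in> P" for r using that down[of r R] R by (force simp: P_def)
 then have bP: "bdd_above P" by (meson bdd_above.I less_imp_le)
 have r0P: "r0 \<in> P" using r0 by (simp add: P_def)
 define \<rho> where "\<rho> = Sup P"
 have \<rho>0: "\<rho> > 0" using r0(1) cSup_upper[OF r0P bP] by (simp add: \<rho>_def)
 have less: "compactin mtopology (mcball x0 r)" if rr: "r < \<rho>" for r
 proof -
  obtain r' where "r' \<in> P" "r < r'" using rr less_cSup_iff[OF _ bP, of r] r0P unfolding \<rho>_def by blast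
  then show ?thesis using down[of r' r] by (simp add: P_def)
 qed
 have "mtotally_bounded (mcball x0 \<rho>)"
  unfolding mtotally_bounded_def
 proof (intro allI impI)
  fix e :: real assume e: "e > 0"
  \<comment> \<open>A radius below \<rho>, so that its ball is compact, but within e/2 of \<rho>, so
    that points of the larger ball have an intermediate point in the smaller one.\<close>
  define a where "a = max 0 (\<rho> - e / 4)"
  have a: "0 \<le> a" "a < \<rho>" "\<rho> < a + e / 2" using e \<rho>0 by (auto simp: a_def)
  have "mtotally_bounded (mcball x0 a)" using less[OF a(2)] by (rule compactin_imp_mtotally_bounded)
  then obtain K where K: "finite K" "K \<subseteq> mcball x0 a" "mcball x0 a \<subseteq> (\<Union>x\<in>K. mball x (e / 2))"
   using e unfolding mtotally_bounded_def by (meson half_gt_zero)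
  have "mcball x0 \<rho> \<subseteq> (\<Union>x\<in>K. mball x e)"
  proof
   fix y assume y: "y \<in> mcball x0 \<rho>"
   then obtain z where z: "z \<in> M" "d x0 z \<le> a" "d z y < e / 2"
    using im[OF x0, of y a "e / 2"] a e by auto
   then have "z \<in> mcball x0 a" using x0 by simp
   then obtain k where k: "k \<in> K" "k \<in> M" "d k z < e / 2" using K(3) by auto
   have "d k y \<le> d k z + d z y" using k z y by (intro triangle) auto
   then show "y \<in> (\<Union>x\<in>K. mball x e)" using k z y by (intro UN_I[of k]) auto
  qed
  then show "\<exists>K. finite K \<and> K \<subseteq> mcball x0 \<rho> \<and> mcball x0 \<rho> \<subseteq> (\<Union>x\<in>K. mball x e)"
   using K mcball_subset_concentric[of a \<rho> x0] a by (intro exI[of _ K]) auto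
 qed
 then have "compactin mtopology (mtopology closure_of (mcball x0 \<rho>))"
  using mtotally_bounded_eq_compact_closure_of[OF mc] by simp
 then have comp: "compactin mtopology (mcball x0 \<rho>)" by (simp add: closure_of_closedin)
 obtain r where r: "\<And>x. x \<in> M ==> r x > 0" "\<And>x. x \<in> M ==> compactin mtopology (mcball x (r x))"
  using lc by metis
 have "\<exists>\<F>. finite \<F> \<and> \<F> \<subseteq> (\<lambda>x. mball x (r x / 2)) ` mcball x0 \<rho> \<and> mcball x0 \<rho> \<subseteq> \<Union>\<F>"
 proof (rule compactinD[OF comp])
  show "mcball x0 \<rho> \<subseteq> \<Union> ((\<lambda>x. mball x (r x / 2)) ` mcball x0 \<rho>)"
  proof
   fix z assume z: "z \<in> mcball x0 \<rho>"
   then have "z \<in> mball z (r z / 2)" using r(1)[of z] by simp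
   then show "z \<in> \<Union> ((\<lambda>x. mball x (r x / 2)) ` mcball x0 \<rho>)" using z by blast
  qed
 qed auto
 then obtain \<F> where F: "finite \<F>" "\<F> \<subseteq> (\<lambda>x. mball x (r x / 2)) ` mcball x0 \<rho>" "mcball x0 \<rho> \<subseteq> \<Union>\<F>" by blast
 obtain X where "X \<subseteq> mcball x0 \<rho>" "finite X" "\<F> = (\<lambda>x. mball x (r x / 2)) ` X"
  using finite_subset_image[OF F(1,2)] by blast
 with F have X: "finite X" "X \<subseteq> mcball x0 \<rho>" "mcball x0 \<rho> \<subseteq> (\<Union>x\<in>X. mball x (r x / 2))" by auto
 have XM: "X \<subseteq> M" using X by auto
 have "x0 \<in> mcball x0 \<rho>" using x0 \<rho>0 by simp
 then have Xne: "X \<noteq> {}" using X(3) by blast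
 \<comment> \<open>Slack from the half-radius cover: a point closer than \<delta> to the ball of
   radius \<rho> stays in the compact union of the full balls, which pushes the compact radius past
   the supremum.\<close>
 define \<delta> where "\<delta> = Min ((\<lambda>x. r x / 2) ` X)"
 have "\<delta> > 0" using X(1) Xne XM r(1) by (auto simp: \<delta>_def)
 moreover have "\<delta> \<le> r x / 2" if "x \<in> X" for x unfolding \<delta>_def using X(1) that by (intro Min_le) auto
 ultimately have \<delta>: "\<delta> > 0" "\<And>x. x \<in> X ==> \<delta> \<le> r x / 2" by blast+
 have "compactin mtopology (\<Union>x\<in>X. mcball x (r x))"
  using X(1) XM r(2) by (intro compactin_Union) auto
 moreover have "mcball x0 (\<rho> + \<delta> / 2) \<subseteq> (\<Union>x\<in>X. mcball x (r x))"
 proof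
  fix y assume y: "y \<in> mcball x0 (\<rho> + \<delta> / 2)"
  then obtain z where z: "z \<in> M" "d x0 z \<le> \<rho>" "d z y < \<delta>"
   using im[OF x0, of y \<rho> \<delta>] \<delta> \<rho>0 by auto
  then have "z \<in> mcball x0 \<rho>" using x0 by simp
  then obtain k where k: "k \<in> X" "k \<in> M" "d k z < r k / 2" using X(3) by auto
  have "d k y \<le> d k z + d z y" using k z y by (intro triangle) auto
  then show "y \<in> (\<Union>x\<in>X. mcball x (r x))" using k z y \<delta>(2)[OF k(1)] by (intro UN_I[of k]) auto
 qed
 ultimately have "compactin mtopology (mcball x0 (\<rho> + \<delta> / 2))" by (auto intro: closed_compactin)
 then have "\<rho> + \<delta> / 2 \<in> P" using \<rho>0 \<delta> by (simp add: P_def)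
 then show False using cSup_upper[OF _ bP] \<delta> by (force simp: \<rho>_def)
qed

context rmfd
begin

text \<open>Extended-valued form of the distance. \<open>rdist\<close> sends infinity to 0, so the
  triangle inequality is proved here and transferred once connectedness gives finiteness.\<close>

definition ed :: "'a \<Rightarrow> 'a \<Rightarrow> ennreal" where
 "ed x y = Inf {len C |C. curve C \<and> C 0 = x \<and> C 1 = y}"

lemma rdist_ed: "rdist \<A> g x y = enn2real (ed x y)"
 by (simp add: rdist_def ed_def)

lemma ed_le: "curve C ==> C 0 = x ==> C 1 = y ==> ed x y \<le> len C"
 unfolding ed_def by (rule Inf_lower) auto

lemma ed_lessE:
 assumes "ed x y < r"
 obtains C where "curve C" "C 0 = x" "C 1 = y" "len C < r"
 using assms unfolding ed_def Inf_less_iff by auto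

lemma ed_refl [simp]: "ed x x = 0"
 using ed_le[OF curve_const(1), of x x x] curve_const(2) by simp

lemma ed_sym: "ed x y = ed y x"
proof -
 have "ed x y \<le> ed y x" for x y
  unfolding ed_def[of y]
 proof (rule Inf_greatest)
  fix l assume "l \<in> {len C |C. curve C \<and> C 0 = y \<and> C 1 = x}"
  then obtain C where C: "curve C" "C 0 = y" "C 1 = x" "l = len C" by auto
  have "ed x y \<le> len (\<lambda>t. C (1 + (0 - 1) * t))"
   using C by (intro ed_le curve_affine(1)) auto
  also have "\<dots> = len C" using curve_affine(2)[OF C(1), of 1 0] by (simp add: len_speed)
  finally show "ed x y \<le> l" using C by simp
 qed
 then show ?thesis by (simp add: antisym)
qed

lemma ed_triangle: "ed x z \<le> ed x y + ed y z"
proof (rule ennreal_le_epsilon)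
 fix e :: real assume fin: "ed x y + ed y z < top" and e: "e > 0"
 have "ed x y < ed x y + ennreal (e / 2)" "ed y z < ed y z + ennreal (e / 2)"
  using fin e by (cases "ed x y"; cases "ed y z"; simp flip: ennreal_plus add: ennreal_less_iff)+
 then obtain C1 C2 where g: "curve C1" "C1 0 = x" "C1 1 = y" "len C1 < ed x y + ennreal (e / 2)"
  "curve C2" "C2 0 = y" "C2 1 = z" "len C2 < ed y z + ennreal (e / 2)"
  by (metis ed_lessE)
 have "ed x z \<le> len (\<lambda>t. if t \<le> 1 / 2 then C1 (2 * t) else C2 (2 * t - 1))"
  using g curve_join(1)[OF g(1,5)] by (intro ed_le) auto
 also have "\<dots> = len C1 + len C2" using curve_join(2)[OF g(1,5)] g by simp
 also have "\<dots> \<le> (ed x y + ennreal (e / 2)) + (ed y z + ennreal (e / 2))" using g by (intro add_mono) auto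
 also have "\<dots> = ed x y + ed y z + (ennreal (e / 2) + ennreal (e / 2))" by (simp add: ac_simps)
 also have "ennreal (e / 2) + ennreal (e / 2) = ennreal e" using e by (simp flip: ennreal_plus)
 finally show "ed x z \<le> ed x y + ed y z + ennreal e" .
qed

text \<open>A nearly minimal curve is cut where its arclength reaches a; arclength depends
  continuously on the parameter, so the intermediate value theorem finds the point. If the whole
  curve is no longer than a, then y itself serves.\<close>

lemma ed_intermediate:
 assumes xy: "ed x y < ennreal (a + b)" and a: "0 \<le> a" and b: "0 < b"
 shows "\<exists>z. ed x z \<le> ennreal a \<and> ed z y < ennreal b"
proof -
 obtain C where C: "curve C" "C 0 = x" "C 1 = y" "len C < ennreal (a + b)" using xy by (rule ed_lessE)
 obtain S where S: "finite S" "continuous_on ({0<..<1} - S) (speed C)"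
  by (rule curve_speed[OF C(1)])
 \<comment> \<open>\<open>sqrt\<close> is negative on negative numbers and \<open>speed\<close> is
   not known to be nonnegative at exceptional points; the positive part changes nothing under
   \<open>ennreal\<close>.\<close>
 define f where "f t = indicator ({0<..<1} - S) t * max 0 (speed C t)" for t
 have "open ({0<..<1} - S)" using S(1) by (intro open_Diff finite_imp_closed) auto
 then have "(\<lambda>t. indicator ({0<..<1} - S) t *\<^sub>R max 0 (speed C t)) \<in> borel_measurable borel"
  using S(2) by (intro borel_measurable_continuous_on_indicator continuous_intros) auto
 then have fm [measurable]: "f \<in> borel_measurable borel" by (simp add: f_def[abs_def])
 have f0: "f t \<ge> 0" for t by (simp add: f_def)
 have ae: "AE t in lborel. (t::real) \<notin> S \<union> {0, 1}" using S(1) by (intro AE_not_finite) auto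
 have eq: "arc C 0 s = (\<integral>\<^sup>+t. ennreal (indicator {0..s} t * f t) \<partial>lborel)"
  if "0 \<le> s" "s \<le> 1" for s
  by (rule nn_integral_cong_AE, use ae in eventually_elim) (use that in \<open>auto simp: f_def indicator_def max_def ennreal_neg\<close>)
 have "(\<integral>\<^sup>+t. ennreal (indicator {0..1} t * f t) \<partial>lborel) < \<infinity>"
  using C(4) eq[of 1] by (auto simp: len_speed intro: less_trans)
 then have "integrable lborel (\<lambda>t. indicator {0..1} t * f t)"
  using f0 by (intro integrableI_nonneg) auto
 then have i1: "set_integrable lborel {0..1} f" by (simp add: set_integrable_def)
 have ise: "set_integrable lborel {0..s} f" if "s \<le> 1" for s
  using i1 by (rule set_integrable_subset) (use that in auto)
 define H where "H s = integral {0..s} f" for s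
 have Heq: "arc C 0 s = ennreal (H s)" if "0 \<le> s" "s \<le> 1" for s
 proof -
  have "(\<integral>\<^sup>+t. ennreal (indicator {0..s} t * f t) \<partial>lborel) = ennreal (LBINT t. indicator {0..s} t * f t)"
   using ise[OF that(2)] f0 by (intro nn_integral_eq_integral) (auto simp: set_integrable_def)
  also have "(LBINT t. indicator {0..s} t * f t) = H s"
   using set_borel_integral_eq_integral(2)[OF ise[OF that(2)]] by (simp add: H_def set_lebesgue_integral_def)
  finally show ?thesis using eq[OF that] by simp
 qed
 have Hc: "continuous_on {0..1} H"
  unfolding H_def using set_borel_integral_eq_integral(1)[OF i1] by (rule indefinite_integral_continuous_1)
 have H0: "H 0 = 0" by (simp add: H_def)
 have lenH: "len C = ennreal (H 1)" using Heq[of 1] by (simp add: len_speed)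
 show ?thesis
 proof (cases "H 1 \<le> a")
  case True
  then have "ed x y \<le> ennreal a" using ed_le[OF C(1-3)] lenH by (auto intro: order_trans ennreal_leI)
  then show ?thesis using b by (intro exI[of _ y]) auto
 next
  case False
  then obtain s where s: "0 \<le> s" "s \<le> 1" "H s = a" using IVT'[of H 0 a 1] Hc H0 a by auto
  have e1: "ed x (C s) \<le> ennreal a"
  proof (cases "s = 0")
   case False
   have "ed x (C s) \<le> len (\<lambda>t. C (0 + (s - 0) * t))"
    using C s False by (intro ed_le curve_affine(1)) auto
   also have "\<dots> = ennreal a" using curve_affine(2)[OF C(1), of 0 s] s False Heq[OF s(1,2)] by simp
   finally show ?thesis .
  qed (use C in simp)
  have s1: "s < 1" using s False by (cases "s = 1") auto
  have "ed (C s) y \<le> len (\<lambda>t. C (s + (1 - s) * t))"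
   using C s s1 by (intro ed_le curve_affine(1)) auto
  also have "\<dots> = arc C s 1" (is "_ = ?r")
   using curve_affine(2)[OF C(1), of s 1] s s1 by simp
  also have "ennreal a + ?r < ennreal a + ennreal b"
   using nn_integral_speed_split[OF C(1) s(1,2)] Heq[OF s(1,2)] s(3) C(4) a b by (simp add: len_speed)
  then have "?r < ennreal b" by (simp add: ennreal_add_left_cancel_less)
  finally show ?thesis using e1 by blast
 qed
qed

text \<open>Up to the first exit from the coordinate ball the metric speed is at least b times the
  coordinate speed, and at that time the coordinate displacement is at least s. Whatever the curve
  does afterwards only adds length.\<close>

lemma escape_length:
 assumes c: "c \<in> \<A>" and s: "s > 0" "cball y0 s \<subseteq> img c"
  and b: "b > 0" "\<And>y v. y \<in> cball y0 s ==> b * norm v \<le> lnorm c y v"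
  and C: "curve C" "C 0 = chart_inv c y0" "C 1 \<notin> chart_inv c ` ball y0 s"
 shows "ennreal (b * s) \<le> len C"
proof -
 have cont: "continuous_on {0..1} C" using C by (simp add: piecewise_C1_curve_def)
 define B where "B = chart_inv c ` ball y0 s"
 have oB: "open B" unfolding B_def using s by (intro open_chart_inv_image[OF c]) (auto intro: order_trans[OF ball_subset_cball])
 have cB: "closed (chart_inv c ` cball y0 s)"
  using compact_chart_inv_image[OF c compact_cball s(2)] by (rule compact_imp_closed)
 \<comment> \<open>The closed set of parameters outside the open coordinate ball; its least element
   is the exit time.\<close>
 define T where "T = {0..1} \<inter> C -` (- B)"
 have "closed T" unfolding T_def using cont oB by (intro continuous_closed_preimage) auto
 moreover have "bounded T" by (rule bounded_subset[of "{0..1}"]) (auto simp: T_def)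
 ultimately have cT: "compact T" by (simp add: compact_eq_bounded_closed)
 have "1 \<in> T" using C(3) by (simp add: T_def B_def)
 then obtain \<tau> where \<tau>: "\<tau> \<in> T" "\<And>t. t \<in> T ==> \<tau> \<le> t" using cT compact_attains_inf[of T] by auto
 have "y0 \<in> ball y0 s" using s by simp
 then have "C 0 \<in> B" using C(2) by (auto simp: B_def)
 then have \<tau>0: "0 < \<tau>" "\<tau> \<le> 1" using \<tau>(1) by (auto simp: T_def le_less)
 have before: "C t \<in> B" if "0 \<le> t" "t < \<tau>" for t using \<tau>(2)[of t] \<tau>0 that by (auto simp: T_def)
 have "C ` {0..\<tau>} \<subseteq> chart_inv c ` cball y0 s"
 proof -
  have "C ` closure {0..<\<tau>} \<subseteq> chart_inv c ` cball y0 s"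
  proof (rule image_closure_subset[OF _ cB])
   show "continuous_on (closure {0..<\<tau>}) C" using \<tau>0 by (auto intro: continuous_on_subset[OF cont])
   show "C ` {0..<\<tau>} \<subseteq> chart_inv c ` cball y0 s" using before ball_subset_cball by (force simp: B_def)
  qed
  moreover have "{0..\<tau>} = closure {0..<\<tau>}" using \<tau>0 by simp
  ultimately show ?thesis by simp
 qed
 then have inc: "C t \<in> fst c" "snd c (C t) \<in> cball y0 s" if "t \<in> {0..\<tau>}" for t
 proof -
  have "C t \<in> chart_inv c ` cball y0 s" using \<open>C ` {0..\<tau>} \<subseteq> _\<close> that by blast
  then obtain y where "y \<in> cball y0 s" "C t = chart_inv c y" by auto
  then show "C t \<in> fst c" "snd c (C t) \<in> cball y0 s" using s(2) by auto
 qed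
 define f where "f = snd c \<circ> C"
 have f: "f piecewise_C1_differentiable_on {0..\<tau>}"
  using C(1) c \<tau>0 inc(1) unfolding f_def piecewise_C1_curve_def by (auto simp: image_subset_iff)
 have "norm (f \<tau> - f 0) \<ge> s"
 proof -
  have "f \<tau> \<notin> ball y0 s"
  proof
   assume "f \<tau> \<in> ball y0 s"
   moreover have "C \<tau> = chart_inv c (f \<tau>)" using inc(1)[of \<tau>] c \<tau>0 by (simp add: f_def)
   ultimately have "C \<tau> \<in> B" by (auto simp: B_def)
   then show False using \<tau>(1) by (simp add: T_def)
  qed
  moreover have "y0 \<in> img c" using s by auto
  then have "f 0 = y0" using C(2) by (simp add: f_def)
  ultimately show ?thesis by (simp add: dist_norm norm_minus_commute)
 qed
 then have "ennreal (b * s) \<le> ennreal b * ennreal (norm (f \<tau> - f 0))"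
  using b s by (simp add: ennreal_mult'[symmetric] ennreal_leI)
 also have "\<dots> \<le> ennreal b * (\<integral>\<^sup>+t\<in>{0..\<tau>}. ennreal (norm (vector_derivative f (at t))) \<partial>lborel)"
  using norm_increment_le_nn_integral_derivative[OF f] \<tau>0 by (intro mult_left_mono) auto
 also have "\<dots> \<le> arc C 0 1"
 proof -
  obtain S where S: "finite S" "continuous_on ({0<..<1} - S) (speed C)"
   "\<And>t c. t \<in> {0<..<1} - S ==> c \<in> \<A> ==> C t \<in> fst c ==> (snd c \<circ> C) differentiable (at t)"
   by (rule curve_speed[OF C(1)]) (rule that)
  have ae: "AE t in lborel. (t::real) \<notin> S \<union> {0, 1}" using S(1) by (intro AE_not_finite) auto
  have "b * norm (vector_derivative f (at t)) \<le> speed C t" if "t \<in> {0..\<tau>}" "t \<notin> S \<union> {0, 1}" for t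
  proof -
   have "continuous_on {0<..<1} C" by (rule continuous_on_subset[OF cont]) auto
   then have "speed C t = lnorm c (f t) (vector_derivative f (at t))"
    using speed_eq[of "{0<..<1}" C t c] S(3)[of t c] inc(1)[OF that(1)] c that \<tau>0 by (auto simp: f_def)
   then show ?thesis using b(2)[of "f t"] inc(2)[OF that(1)] by (simp add: f_def)
  qed note sp = this
  obtain S' where S': "finite S'" "f C1_differentiable_on ({0..\<tau>} - S')"
   using f by (auto simp: piecewise_C1_differentiable_on_def)
  have m: "(\<lambda>t. indicator ({0..\<tau>} - S') t *\<^sub>R norm (vector_derivative f (at t))) \<in> borel_measurable borel"
   using S' unfolding C1_differentiable_on_eq
   by (intro borel_measurable_continuous_on_indicator sets.Diff continuous_on_norm) (auto simp: finite_imp_closed borel_closed)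
  have ae': "AE t in lborel. (t::real) \<notin> S' \<union> (S \<union> {0, 1})" using S(1) S'(1) by (intro AE_not_finite) auto
  have "ennreal b * (\<integral>\<^sup>+t\<in>{0..\<tau>}. ennreal (norm (vector_derivative f (at t))) \<partial>lborel)
   = ennreal b * (\<integral>\<^sup>+t. ennreal (indicator ({0..\<tau>} - S') t *\<^sub>R norm (vector_derivative f (at t))) \<partial>lborel)"
   by (intro arg_cong2[where f="(*)"] refl nn_integral_cong_AE, use ae' in eventually_elim) (auto simp: indicator_def)
  also have "\<dots> = (\<integral>\<^sup>+t. ennreal b * ennreal (indicator ({0..\<tau>} - S') t *\<^sub>R norm (vector_derivative f (at t))) \<partial>lborel)"
   using m by (intro nn_integral_cmult[symmetric]) simp
  also have "\<dots> \<le> arc C 0 1"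
  proof (rule nn_integral_mono_AE, use ae' in eventually_elim)
   case (elim t)
   then show ?case using sp[of t] \<tau>0 b(1)
    by (cases "t \<in> {0..\<tau>}") (auto simp: ennreal_mult'[symmetric] intro!: ennreal_leI)
  qed
  finally show ?thesis .
 qed
 finally show ?thesis by (simp add: len_speed)
qed

text \<open>The coordinate segment competes in the infimum. The bound is kept in the metric norm of
  the displacement, because a Lipschitz constant close to 1 is wanted later and a Euclidean bound
  would lose it.\<close>

lemma segment_length:
 assumes c: "c \<in> \<A>" and B: "convex B" "B \<subseteq> img c" and y: "y \<in> B" "y' \<in> B"
  and M: "\<And>z. z \<in> B ==> lnorm c z (y' - y) \<le> M"
 shows "ed (chart_inv c y) (chart_inv c y') \<le> ennreal M"
proof -
 define l where "l t = y + t *\<^sub>R (y' - y)" for t :: real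
 have lB: "l t \<in> B" if "t \<in> {0..1}" for t
 proof -
  have "l t = (1 - t) *\<^sub>R y + t *\<^sub>R y'" by (simp add: l_def algebra_simps)
  then show ?thesis using convexD[OF B(1) y, of "1 - t" t] that by simp
 qed
 have ld: "(l has_vector_derivative (y' - y)) (at t)" for t
  unfolding l_def by (auto intro!: derivative_eq_intros)
 define W where "W = l -` (img c)"
 have lc: "continuous_on UNIV l" unfolding l_def by (intro continuous_intros)
 have "open W" unfolding W_def by (rule open_vimage[OF open_img[OF c] lc])
 moreover have "{0..1} \<subseteq> W" unfolding W_def using lB B(2) by blast
 ultimately have W: "open W" "{0..1} \<subseteq> W" .
 define C where "C t = chart_inv c (l t)" for t
 have CW: "continuous_on W C" unfolding C_def
  by (rule continuous_on_compose2[OF cont_chart_inv[OF c] continuous_on_subset[OF lc]]) (auto simp: W_def)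
 have cg: "(snd c \<circ> C) t = l t" "C t \<in> fst c" if "t \<in> W" for t using that by (auto simp: C_def W_def)
 have vd: "((snd c \<circ> C) has_vector_derivative (y' - y)) (at t)" if "t \<in> W" for t
  by (rule has_vector_derivative_transform_within_open[OF ld W(1) that]) (use cg in auto)
 have Cc: "curve C" unfolding piecewise_C1_curve_def
 proof (intro conjI ballI allI impI)
  show "continuous_on {0..1} C" using CW W(2) by (rule continuous_on_subset)
  fix d a b assume d: "d \<in> \<A>" and ab: "(0::real) \<le> a" "a \<le> b" "b \<le> 1" "C ` {a..b} \<subseteq> fst d"
  have inW: "t \<in> W" "C t \<in> fst d" if "t \<in> {a..b}" for t using that ab W by (auto simp: image_subset_iff)
  show "(snd d \<circ> C) piecewise_C1_differentiable_on {a..b}"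
  proof (rule C1_differentiable_imp_piecewise, unfold C1_differentiable_on_def, intro exI conjI ballI)
   fix t assume t: "t \<in> {a..b}"
   show "((snd d \<circ> C) has_vector_derivative frechet_derivative (transition c d) (at (l t)) (y' - y)) (at t)"
    using velocity_eq(2)[OF CW W(1) inW(1)[OF t] c cg(2)[OF inW(1)[OF t]] vd[OF inW(1)[OF t]] d inW(2)[OF t]]
     cg(1)[OF inW(1)[OF t]] by (simp add: dtrans_def)
  next
   have "Ck_on (Suc 0) (snd c ` (fst c \<inter> fst d)) (transition c d)" by (rule transition_Ck[OF c d])
   then have "continuous_on (snd c ` (fst c \<inter> fst d)) (\<lambda>z. frechet_derivative (transition c d) (at z) (y' - y))" by simp
   then show "continuous_on {a..b} (\<lambda>t. frechet_derivative (transition c d) (at (l t)) (y' - y))"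
   proof (rule continuous_on_compose2[OF _ continuous_on_subset[OF lc]])
    show "l ` {a..b} \<subseteq> snd c ` (fst c \<inter> fst d)"
    proof
     fix z assume "z \<in> l ` {a..b}"
     then obtain t where t: "t \<in> {a..b}" "z = l t" by auto
     then show "z \<in> snd c ` (fst c \<inter> fst d)" using cg[OF inW(1)[OF t(1)]] inW(2)[OF t(1)] by (intro image_eqI[of _ _ "C t"]) auto
    qed
   qed auto
  qed
 qed
 have "ed (chart_inv c y) (chart_inv c y') \<le> len C" using Cc by (rule ed_le) (auto simp: C_def l_def)
 also have "len C \<le> (\<integral>\<^sup>+t\<in>{0..1::real}. ennreal M \<partial>lborel)"
  unfolding len_speed
 proof (intro nn_integral_mono)
  fix t :: real
  have "speed C t \<le> M" if t: "t \<in> {0..1}"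
  proof -
   have tW: "t \<in> W" using t W by auto
   have "speed C t = lnorm c (l t) (y' - y)"
    using speed_eq[OF CW W(1) tW c cg(2)[OF tW] differentiableI_vector[OF vd[OF tW]]] cg(1)[OF tW] vector_derivative_at[OF vd[OF tW]] by simp
   then show ?thesis using M[OF lB[OF t]] by simp
  qed
  then show "ennreal (speed C t) * indicator {0..1} t \<le> ennreal M * indicator {0..1} t"
   by (auto simp: indicator_def intro: ennreal_leI)
 qed
 also have "\<dots> = ennreal M" by (simp add: nn_integral_cmult)
 finally show ?thesis .
qed

lemma chart_ball:
 obtains c s b B where "c \<in> \<A>" "x \<in> fst c" "s > 0" "cball (snd c x) s \<subseteq> img c" "b > 0" "B > 0"
  "\<And>y v. y \<in> cball (snd c x) s ==> b * norm v \<le> lnorm c y v"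
  "\<And>y v. y \<in> cball (snd c x) s ==> lnorm c y v \<le> B * norm v"
proof -
 obtain c where c: "c \<in> \<A>" "x \<in> fst c" by (rule chart_cover)
 obtain s where s: "s > 0" "cball (snd c x) s \<subseteq> img c"
  using open_img[OF c(1)] c(2) by (meson open_contains_cball imageI)
 show ?thesis by (rule lnorm_bounds[OF c(1) compact_cball s(2)]) (rule that[OF c s])
qed

lemma ed_chart_le:
 assumes "c \<in> \<A>" "cball y0 s \<subseteq> img c" "\<And>y v. y \<in> cball y0 s ==> lnorm c y v \<le> B * norm v"
  "y \<in> cball y0 s" "s > 0"
 shows "ed (chart_inv c y0) (chart_inv c y) \<le> ennreal (B * norm (y - y0))"
 by (rule segment_length[OF assms(1) convex_cball assms(2)]) (use assms in auto)

end

locale rmfd_conn = rmfd \<A> g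
 for \<A> :: "('a::{t2_space, second_countable_topology}, 'm::finite) chart set" and g :: "('a, 'm) metric_tensor" +
 assumes conn: "connected (UNIV :: 'a set)"
begin

text \<open>Nearby points are joined by coordinate segments, so lying at finite distance from x is
  an open condition with open complement.\<close>

lemma ed_finite: "ed x y < top"
proof -
 define S where "S = {y. ed x y < top}"
 have nb: "\<exists>N. open N \<and> y \<in> N \<and> (\<forall>z\<in>N. ed y z < top)" for y
 proof -
  obtain c s b B where c: "c \<in> \<A>" "y \<in> fst c" "s > 0" "cball (snd c y) s \<subseteq> img c" "b > 0" "B > 0"
   "\<And>z v. z \<in> cball (snd c y) s ==> b * norm v \<le> lnorm c z v"
   "\<And>z v. z \<in> cball (snd c y) s ==> lnorm c z v \<le> B * norm v" by (rule chart_ball[of y]) (rule that)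
  have "open (chart_inv c ` ball (snd c y) s)"
   using c(4) ball_subset_cball by (intro open_chart_inv_image[OF c(1)]) blast+
  moreover have "y \<in> chart_inv c ` ball (snd c y) s" using c by (intro image_eqI[of _ _ "snd c y"]) auto
  moreover have "ed y z < top" if "z \<in> chart_inv c ` ball (snd c y) s" for z
  proof -
   obtain w where w: "w \<in> ball (snd c y) s" "z = chart_inv c w" using \<open>z \<in> _\<close> by auto
   then have "ed y z \<le> ennreal (B * norm (w - snd c y))"
    using ed_chart_le[OF c(1,4,8), of w] c by auto
   then show ?thesis by (rule le_less_trans) simp
  qed
  ultimately show ?thesis by blast
 qed
 have "open S"
 proof (subst open_subopen, intro ballI)
  fix y assume y: "y \<in> S"
  obtain N where N: "open N" "y \<in> N" "\<forall>z\<in>N. ed y z < top" using nb by blast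
  have "N \<subseteq> S"
  proof
   fix z assume z: "z \<in> N"
   have "ed x z \<le> ed x y + ed y z" by (rule ed_triangle)
   also have "\<dots> < top" using y N(3) z by (auto simp: S_def)
   finally show "z \<in> S" by (simp add: S_def)
  qed
  then show "\<exists>T. open T \<and> y \<in> T \<and> T \<subseteq> S" using N by blast
 qed
 moreover have "open (- S)"
 proof (subst open_subopen, intro ballI)
  fix y assume y: "y \<in> - S"
  obtain N where N: "open N" "y \<in> N" "\<forall>z\<in>N. ed y z < top" using nb by blast
  have "N \<subseteq> - S"
  proof
   fix z assume z: "z \<in> N"
   have "ed x y \<le> ed x z + ed z y" by (rule ed_triangle)
   then show "z \<in> - S" using y N(3) z ed_sym[of z y] by (auto simp: S_def less_top[symmetric] top_unique)
  qed
  then show "\<exists>T. open T \<and> y \<in> T \<and> T \<subseteq> - S" using N by blast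
 qed
 moreover have "x \<in> S" by (simp add: S_def)
 ultimately have "S = UNIV" using connectedD[OF conn, of S "- S"] by auto
 then show ?thesis by (auto simp: S_def)
qed

section \<open>The distance as a metric inducing the manifold topology\<close>

abbreviation "dist_g \<equiv> rdist \<A> g"

lemma ed_eq: "ed x y = ennreal (dist_g x y)"
 using ed_finite[of x y] by (simp add: rdist_ed)

lemma dist_g_nonneg: "dist_g x y \<ge> 0"
 by (simp add: rdist_ed)

lemma dist_g_le_iff: "r \<ge> 0 ==> dist_g x y \<le> r \<longleftrightarrow> ed x y \<le> ennreal r"
 by (simp add: ed_eq)

lemma dist_g_less_iff: "dist_g x y < r \<longleftrightarrow> ed x y < ennreal r"
 using dist_g_nonneg[of x y] by (cases "r > 0") (auto simp: ed_eq ennreal_less_iff ennreal_neg)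

lemma chart_ball_dist:
 assumes "c \<in> \<A>" "x \<in> fst c" "s > 0" "cball (snd c x) s \<subseteq> img c" "b > 0"
  "\<And>y v. y \<in> cball (snd c x) s ==> b * norm v \<le> lnorm c y v" "z \<notin> chart_inv c ` ball (snd c x) s"
 shows "b * s \<le> dist_g x z"
proof (rule ccontr)
 assume "\<not> ?thesis"
 then have "ed x z < ennreal (b * s)" by (simp add: dist_g_less_iff[symmetric])
 then obtain C where "curve C" "C 0 = x" "C 1 = z" "len C < ennreal (b * s)" by (rule ed_lessE)
 then show False using escape_length[OF assms(1,3,4,5,6), of C] assms by (simp add: not_less[symmetric])
qed

sublocale M: Metric_space UNIV dist_g
proof
 fix x y z :: 'a
 show "0 \<le> dist_g x y" by (rule dist_g_nonneg)
 show "dist_g x y = dist_g y x" by (simp add: rdist_ed ed_sym)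
 show "dist_g x z \<le> dist_g x y + dist_g y z"
  using ed_triangle[of x z y] dist_g_nonneg by (simp add: dist_g_le_iff ed_eq)
 show "dist_g x y = 0 \<longleftrightarrow> x = y"
 proof
  assume d: "dist_g x y = 0"
  show "x = y"
  proof (rule ccontr)
   assume ne: "x \<noteq> y"
   obtain c s b B where c: "c \<in> \<A>" "x \<in> fst c" "s > 0" "cball (snd c x) s \<subseteq> img c" "b > 0" "B > 0"
    "\<And>z v. z \<in> cball (snd c x) s ==> b * norm v \<le> lnorm c z v"
    "\<And>z v. z \<in> cball (snd c x) s ==> lnorm c z v \<le> B * norm v" by (rule chart_ball[of x]) (rule that)
   \<comment> \<open>A radius small enough to exclude y, whether or not y lies in the chart around
     x.\<close>
   define s' where "s' = (if y \<in> fst c then min s (dist (snd c x) (snd c y)) else s)"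
   have "snd c x \<noteq> snd c y" if "y \<in> fst c" using ne c(2) that inj_onD[OF inj_chart[OF c(1)]] by metis
   then have s': "s' > 0" "s' \<le> s" using c(3) by (auto simp: s'_def)
   have "y \<notin> chart_inv c ` ball (snd c x) s'"
   proof
    assume "y \<in> chart_inv c ` ball (snd c x) s'"
    then obtain w where w: "w \<in> ball (snd c x) s'" "y = chart_inv c w" by auto
    then have "w \<in> img c" using c(4) s' by auto
    then have "snd c y = w" "y \<in> fst c" using w by auto
    then show False using w by (auto simp: s'_def)
   qed
   then have "b * s' \<le> dist_g x y"
    using c s' by (intro chart_ball_dist[of c]) auto
   then show False using d c(5) s' by (simp add: mult_le_0_iff)
  qed
 qed (simp add: rdist_ed)
qed

text \<open>\<open>chart_ball_dist\<close> puts metric balls inside coordinate balls, and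
  \<open>ed_chart_le\<close> puts coordinate balls inside metric balls.\<close>

lemma mtopology_eq: "openin M.mtopology U \<longleftrightarrow> open U"
proof
 assume U: "open U"
 show "openin M.mtopology U" unfolding M.openin_mtopology
 proof (intro conjI allI impI)
  fix x assume x: "x \<in> U"
  obtain c where c: "c \<in> \<A>" "x \<in> fst c" by (rule chart_cover)
  have "open (imgs c U)" using U open_dom[OF c(1)] by (intro open_image_chart[OF c(1)]) auto
  moreover have "snd c x \<in> imgs c U" using c x by auto
  ultimately obtain s where s: "s > 0" "cball (snd c x) s \<subseteq> imgs c U" using open_contains_cball by blast
  then have s2: "cball (snd c x) s \<subseteq> img c" by blast
  obtain b B where b: "b > 0" "B > 0" "\<And>y v. y \<in> cball (snd c x) s ==> b * norm v \<le> lnorm c y v"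
   "\<And>y v. y \<in> cball (snd c x) s ==> lnorm c y v \<le> B * norm v"
   by (rule lnorm_bounds[OF c(1) compact_cball s2]) (rule that)
  have "z \<in> U" if "dist_g x z < b * s" for z
  proof (rule ccontr)
   assume zU: "z \<notin> U"
   have "z \<notin> chart_inv c ` ball (snd c x) s"
   proof
    assume "z \<in> chart_inv c ` ball (snd c x) s"
    then obtain w where w: "w \<in> ball (snd c x) s" "z = chart_inv c w" by auto
    then have "w \<in> imgs c U" using s by auto
    then show False using w zU c(1) by auto
   qed
   then have "b * s \<le> dist_g x z" using b(3) by (intro chart_ball_dist[OF c s(1) s2 b(1)]) auto
   then show False using that by simp
  qed
  then show "\<exists>r>0. M.mball x r \<subseteq> U" using b s by (intro exI[of _ "b * s"]) auto
 qed simp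
next
 assume U: "openin M.mtopology U"
 show "open U"
 proof (subst open_subopen, intro ballI)
  fix x assume "x \<in> U"
  then obtain r where r: "r > 0" "M.mball x r \<subseteq> U" using U unfolding M.openin_mtopology by blast
  obtain c s b B where c: "c \<in> \<A>" "x \<in> fst c" "s > 0" "cball (snd c x) s \<subseteq> img c" "b > 0" "B > 0"
   "\<And>z v. z \<in> cball (snd c x) s ==> b * norm v \<le> lnorm c z v"
   "\<And>z v. z \<in> cball (snd c x) s ==> lnorm c z v \<le> B * norm v" by (rule chart_ball[of x]) (rule that)
  define s' where "s' = min s (r / B)"
  have s': "s' > 0" "s' \<le> s" using c r by (auto simp: s'_def)
  have "open (chart_inv c ` ball (snd c x) s')"
   using c(4) s' by (intro open_chart_inv_image[OF c(1)]) auto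
  moreover have "x \<in> chart_inv c ` ball (snd c x) s'" using c s' by (intro image_eqI[of _ _ "snd c x"]) auto
  moreover have "chart_inv c ` ball (snd c x) s' \<subseteq> U"
  proof
   fix z assume "z \<in> chart_inv c ` ball (snd c x) s'"
   then obtain w where w: "w \<in> ball (snd c x) s'" "z = chart_inv c w" by auto
   have "ed x z \<le> ennreal (B * norm (w - snd c x))"
    using ed_chart_le[OF c(1,4,8), of w] c w s' by auto
   then have "dist_g x z \<le> B * norm (w - snd c x)" using c by (subst dist_g_le_iff) auto
   also have "\<dots> < B * (r / B)" using w c by (intro mult_strict_left_mono) (auto simp: s'_def dist_norm norm_minus_commute)
   finally show "z \<in> U" using r c by auto
  qed
  ultimately show "\<exists>T. open T \<and> x \<in> T \<and> T \<subseteq> U" by blast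
 qed
qed

lemma mtopology_euclidean: "M.mtopology = euclidean"
 by (simp add: topology_eq mtopology_eq open_openin[symmetric])

lemma compactin_iff: "compactin M.mtopology K \<longleftrightarrow> compact K"
 by (simp add: mtopology_euclidean)

lemma open_mball: "open (M.mball x r)"
 using M.openin_mball[of x r] by (simp add: mtopology_eq)

lemma continuous_dist_g: "continuous_on S (dist_g x)"
proof -
 have "\<exists>T. open T \<and> z \<in> T \<and> (\<forall>w\<in>T. \<bar>dist_g x w - dist_g x z\<bar> < e)" if "e > 0" for z and e :: real
 proof (intro exI conjI ballI)
  show "open (M.mball z e)" by (rule open_mball)
  show "z \<in> M.mball z e" using that by simp
  fix w assume "w \<in> M.mball z e"
  then show "\<bar>dist_g x w - dist_g x z\<bar> < e"
   using M.triangle[of x z w] M.triangle[of x w z] M.commute[of w z] by auto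
 qed
 then have "continuous (at z) (dist_g x)" for z
  unfolding continuous_at tendsto_iff eventually_at_topological dist_real_def by meson
 then show ?thesis by (simp add: continuous_at_imp_continuous_on)
qed

end

section \<open>Compactness of closed balls in the complete case\<close>

locale rmfd_complete = rmfd_conn \<A> g
 for \<A> :: "('a::{t2_space, second_countable_topology}, 'm::finite) chart set" and g :: "('a, 'm) metric_tensor" +
 assumes complete: "complete_manifold \<A> g"
begin

text \<open>Small closed balls are compact as closed subsets of coordinate balls, and cutting nearly
  minimal curves gives the intermediate points that the abstract criterion asks for.\<close>

theorem compact_mcball: "compact (M.mcball x0 R)"
proof -
 have "compactin M.mtopology (M.mcball x0 R)"
 proof (rule M.compactin_mcball_of_intermediate)
  show "M.mcomplete" using complete by (simp add: complete_manifold_def)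
  fix x :: 'a
  obtain c s b B where c: "c \<in> \<A>" "x \<in> fst c" "s > 0" "cball (snd c x) s \<subseteq> img c" "b > 0" "B > 0"
   "\<And>z v. z \<in> cball (snd c x) s ==> b * norm v \<le> lnorm c z v"
   "\<And>z v. z \<in> cball (snd c x) s ==> lnorm c z v \<le> B * norm v" by (rule chart_ball[of x]) (rule that)
  have "compact (chart_inv c ` cball (snd c x) s)" by (rule compact_chart_inv_image[OF c(1) compact_cball c(4)])
  moreover have "M.mcball x (b * s / 2) \<subseteq> chart_inv c ` cball (snd c x) s"
  proof
   fix z assume "z \<in> M.mcball x (b * s / 2)"
   then have "dist_g x z < b * s" using mult_pos_pos[OF c(5) c(3)] by simp
   then have "z \<in> chart_inv c ` ball (snd c x) s" using chart_ball_dist[OF c(1-5,7), of z] by force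
   then show "z \<in> chart_inv c ` cball (snd c x) s" by auto
  qed
  ultimately have "compactin M.mtopology (M.mcball x (b * s / 2))"
   using M.closedin_mcball by (metis closed_compactin compactin_iff)
  then show "\<exists>r>0. compactin M.mtopology (M.mcball x r)" using c by (intro exI[of _ "b * s / 2"]) auto
 next
  fix x y :: 'a and a b :: real assume "0 \<le> a" "0 < b" "dist_g x y < a + b"
  then show "\<exists>z\<in>UNIV. dist_g x z \<le> a \<and> dist_g z y < b"
   using ed_intermediate[of x y a b] by (simp add: dist_g_le_iff dist_g_less_iff)
 qed simp
 then show ?thesis by (simp add: compactin_iff)
qed

lemma compact_subset_mball:
 assumes "compact K"
 obtains R where "K \<subseteq> M.mball x0 R" "R > 0"
proof -
 have "compact (dist_g x0 ` K)" using assms by (intro compact_continuous_image continuous_dist_g)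
 then obtain B where "\<And>z. z \<in> K ==> \<bar>dist_g x0 z\<bar> \<le> B" using compact_imp_bounded[of "dist_g x0 ` K"] by (auto simp: bounded_iff)
 then show ?thesis using that[of "\<bar>B\<bar> + 1"] by force
qed

lemma mball_relatively_compact: "open (M.mball x0 R)" "compact (closure (M.mball x0 R))"
proof -
 have "closure (M.mball x0 R) \<subseteq> M.mcball x0 R"
  using compact_mcball M.mball_subset_mcball by (intro closure_minimal compact_imp_closed)
 then show "compact (closure (M.mball x0 R))"
  using compact_mcball by (metis compact_Int_closed closed_closure inf.absorb2)
qed (rule open_mball)

end

section \<open>Change of variables\<close>

text \<open>The change-of-variables theorem of the library needs a well-ordered index type, so it is
 transported along a bijection from a copy of \<open>{..<CARD('a)}\<close>.\<close>

typedef 'a wo_index = "{..<CARD('a::finite)}"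
 by (auto intro: exI[of _ 0])

instance wo_index :: (finite) finite
proof
 show "finite (UNIV :: 'a wo_index set)"
  unfolding type_definition.univ[OF type_definition_wo_index] by simp
qed

instantiation wo_index :: (finite) wellorder
begin

definition "i \<le> j \<longleftrightarrow> Rep_wo_index i \<le> Rep_wo_index j"
definition "i < j \<longleftrightarrow> Rep_wo_index i < Rep_wo_index j"

instance
proof
 fix x y z :: "'a wo_index" and P
 show "(x < y) = (x \<le> y \<and> \<not> y \<le> x)" "x \<le> x" "x \<le> y ==> y \<le> z ==> x \<le> z" "x \<le> y \<or> y \<le> x"
  by (auto simp: less_eq_wo_index_def less_wo_index_def)
 show "x \<le> y ==> y \<le> x ==> x = y"
  by (simp add: less_eq_wo_index_def Rep_wo_index_inject[symmetric])
 assume H: "\<And>x :: 'a wo_index. (\<And>y. y < x ==> P y) ==> P x"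
 show "P x"
 proof (induction x rule: measure_induct_rule[of Rep_wo_index])
  case (less x)
  show ?case by (rule H) (rule less, simp add: less_wo_index_def)
 qed
qed

end

lemma wo_index_bij: obtains h :: "'a::finite wo_index \<Rightarrow> 'a" where "bij h"
proof -
 have "card (UNIV :: 'a wo_index set) = CARD('a)"
  using type_definition.card[OF type_definition_wo_index[where 'a='a]] by simp
 then show ?thesis using finite_same_card_bij[of "UNIV :: 'a wo_index set" "UNIV :: 'a set"] that by auto
qed

text \<open>Conjugation sends transpositions to transpositions, so the sign survives the induction.
  Being a permutation is carried along because \<open>sign_compose\<close> asks for it.\<close>

lemma sign_conjugate:
 fixes h :: "'a::finite \<Rightarrow> 'b::finite"
 assumes h: "bij h" and p: "p permutes (UNIV :: 'b set)"
 shows "sign (inv h \<circ> p \<circ> h) = sign p \<and> permutation (inv h \<circ> p \<circ> h)"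
 using p finite[of "UNIV :: 'b set"]
proof (induction p rule: permutes_induct)
 case id
 have "inv h \<circ> id \<circ> h = id" using h by (simp add: bij_is_inj)
 then show ?case by simp
next
 case (swap a b p)
 have e: "inv h \<circ> (Transposition.transpose a b \<circ> p) \<circ> h = Transposition.transpose (inv h a) (inv h b) \<circ> (inv h \<circ> p \<circ> h)"
 proof
  fix x
  have i: "inv h y = inv h z \<longleftrightarrow> y = z" for y z using h by (metis bij_inv_eq_iff)
  show "(inv h \<circ> (Transposition.transpose a b \<circ> p) \<circ> h) x = (Transposition.transpose (inv h a) (inv h b) \<circ> (inv h \<circ> p \<circ> h)) x"
   by (auto simp: Transposition.transpose_def i)
 qed
 have ne: "inv h a = inv h b \<longleftrightarrow> a = b" using h by (metis bij_inv_eq_iff)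
 have pp: "permutation p" using swap finite[of "UNIV :: 'b set"] unfolding permutation_permutes by blast
 have ih: "sign (inv h \<circ> p \<circ> h) = sign p" "permutation (inv h \<circ> p \<circ> h)" using swap.IH by blast+
 show ?case
  unfolding e sign_compose[OF permutation_swap_id ih(2)] sign_compose[OF permutation_swap_id pp] ih(1) sign_swap_id ne
  by (intro conjI refl permutation_compose permutation_swap_id ih(2))
qed

lemma det_reindex:
 fixes M :: "real ^ 'm::finite ^ 'm" and h :: "'n::finite \<Rightarrow> 'm"
 assumes h: "bij h"
 shows "det (\<chi> i j. M $ h i $ h j) = det M"
proof -
 have "det M = (\<Sum>p | p permutes (UNIV::'m set). of_int (sign p) * (\<Prod>i\<in>UNIV. M $ i $ p i))"
  by (simp add: det_def)
 also have "\<dots> = (\<Sum>p | p permutes (UNIV::'n set). of_int (sign p) * (\<Prod>i\<in>UNIV. M $ h i $ h (p i)))"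
 proof (rule sum.reindex_bij_witness[where i="\<lambda>p. h \<circ> p \<circ> inv h" and j="\<lambda>p. inv h \<circ> p \<circ> h"])
  fix p assume "p \<in> {p. p permutes (UNIV::'m set)}"
  then have p: "p permutes UNIV" by simp
  have bp: "bij p" using p by (simp add: permutes_bij)
  show "h \<circ> (inv h \<circ> p \<circ> h) \<circ> inv h = p" using h by (auto simp: fun_eq_iff bij_is_surj surj_f_inv_f)
  show "inv h \<circ> p \<circ> h \<in> {p. p permutes UNIV}"
   using h bp bij_imp_bij_inv[OF h] by (auto intro!: bij_imp_permutes bij_comp)
  have "(\<Prod>i\<in>UNIV. M $ h i $ h ((inv h \<circ> p \<circ> h) i)) = (\<Prod>i\<in>UNIV. M $ h i $ p (h i))"
   using h by (simp add: bij_is_surj surj_f_inv_f)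
  also have "\<dots> = (\<Prod>i\<in>UNIV. M $ i $ p i)"
   by (rule prod.reindex_bij_betw[OF h])
  finally show "of_int (sign (inv h \<circ> p \<circ> h)) * (\<Prod>i\<in>UNIV. M $ h i $ h ((inv h \<circ> p \<circ> h) i)) = of_int (sign p) * (\<Prod>i\<in>UNIV. M $ i $ p i)"
   using sign_conjugate[OF h p] by simp
 next
  fix p assume "p \<in> {p. p permutes (UNIV::'n set)}"
  then have bp: "bij p" by (simp add: permutes_bij)
  show "inv h \<circ> (h \<circ> p \<circ> inv h) \<circ> h = p" using h by (auto simp: fun_eq_iff bij_is_inj)
  show "h \<circ> p \<circ> inv h \<in> {p. p permutes UNIV}"
   using h bp bij_imp_bij_inv[OF h] by (auto intro!: bij_imp_permutes bij_comp)
 qed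
 also have "\<dots> = det (\<chi> i j. M $ h i $ h j)" by (simp add: det_def)
 finally show ?thesis by simp
qed

text \<open>Stated for a prescribed finite value b: two extended integrals coincide once they attain
  the same finite values, which is how a theorem about absolute integrability yields an identity of
  extended integrals.\<close>

lemma nn_integral_eq_abs_integral:
 fixes F :: "'e::euclidean_space \<Rightarrow> real"
 assumes m: "(\<lambda>x. indicator S x * F x) \<in> borel_measurable borel" and F: "\<And>x. x \<in> S ==> F x \<ge> 0" and b: "b \<ge> 0"
 shows "(\<integral>\<^sup>+x\<in>S. ennreal (F x) \<partial>lborel) = ennreal b \<longleftrightarrow> F absolutely_integrable_on S \<and> integral S F = b"
proof -
 have "(\<integral>\<^sup>+x\<in>S. ennreal (F x) \<partial>lborel) = (\<integral>\<^sup>+x. ennreal (indicator S x * F x) \<partial>lborel)"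
  by (rule nn_integral_cong) (auto simp: indicator_def)
 also have "\<dots> = ennreal b \<longleftrightarrow> integrable lborel (\<lambda>x. indicator S x * F x) \<and> (LBINT x. indicator S x * F x) = b"
  using m F b by (intro nn_integral_eq_integrable) (auto simp: indicator_def)
 also have "\<dots> \<longleftrightarrow> integrable lebesgue (\<lambda>x. indicator S x * F x) \<and> (LINT x|lebesgue. indicator S x * F x) = b"
  using m by (simp add: integrable_completion integral_completion)
 also have "\<dots> \<longleftrightarrow> F absolutely_integrable_on S \<and> integral S F = b"
  using set_lebesgue_integral_eq_integral(2)[of S F] by (auto simp: set_integrable_def set_lebesgue_integral_def)
 finally show ?thesis .
qed

lemma nn_integral_change_of_variables_wo:
 fixes T :: "real ^ 'n::{finite,wellorder} \<Rightarrow> real ^ 'n::_" and f :: "real ^ 'n::_ \<Rightarrow> real"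
 assumes S: "S \<in> sets borel" and T: "\<And>x. x \<in> S ==> (T has_derivative T' x) (at x)" "inj_on T S"
  and f: "\<And>y. f y \<ge> 0" "(\<lambda>y. indicator (T ` S) y * f y) \<in> borel_measurable borel"
  and m: "(\<lambda>x. indicator S x * (\<bar>det (matrix (T' x))\<bar> * f (T x))) \<in> borel_measurable borel"
 shows "(\<integral>\<^sup>+y\<in>T ` S. ennreal (f y) \<partial>lborel) = (\<integral>\<^sup>+x\<in>S. ennreal (\<bar>det (matrix (T' x))\<bar> * f (T x)) \<partial>lborel)"
  (is "?l = ?r")
proof -
 have iff: "?l = ennreal b \<longleftrightarrow> ?r = ennreal b" if b: "b \<ge> 0" for b
 proof -
  have "?l = ennreal b \<longleftrightarrow> f absolutely_integrable_on (T ` S) \<and> integral (T ` S) f = b"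
   using f b by (intro nn_integral_eq_abs_integral) auto
  also have "\<dots> \<longleftrightarrow> (\<lambda>x. vec (f x) :: real^1) absolutely_integrable_on (T ` S) \<and> integral (T ` S) (\<lambda>x. vec (f x) :: real^1) = vec b"
   unfolding absolutely_integrable_on_1_iff integral_on_1_eq by (auto simp: vec_eq_iff)
  also have "\<dots> \<longleftrightarrow> (\<lambda>x. \<bar>det (matrix (T' x))\<bar> *\<^sub>R (vec (f (T x)) :: real^1)) absolutely_integrable_on S \<and>
    integral S (\<lambda>x. \<bar>det (matrix (T' x))\<bar> *\<^sub>R (vec (f (T x)) :: real^1)) = vec b"
   using S T by (intro has_absolute_integral_change_of_variables[symmetric]) (auto intro: has_derivative_at_withinI)
  also have "\<dots> \<longleftrightarrow> (\<lambda>x. \<bar>det (matrix (T' x))\<bar> * f (T x)) absolutely_integrable_on S \<and>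
    integral S (\<lambda>x. \<bar>det (matrix (T' x))\<bar> * f (T x)) = b"
   unfolding absolutely_integrable_on_1_iff integral_on_1_eq by (auto simp: vec_eq_iff)
  also have "\<dots> \<longleftrightarrow> ?r = ennreal b"
   using f m b by (intro nn_integral_eq_abs_integral[symmetric]) auto
  finally show ?thesis .
 qed
 show ?thesis
 proof (cases "?l = top")
  case True
  show ?thesis
  proof (rule ccontr)
   assume "?l \<noteq> ?r"
   then obtain b where "b \<ge> 0" "?r = ennreal b" using True by (cases ?r) auto
   then show False using iff[of b] True by simp
  qed
 next
  case False
  then obtain b where "b \<ge> 0" "?l = ennreal b" by (cases ?l) auto
  then show ?thesis using iff[of b] by simp
 qed
qed

lemma distr_reindex_lborel:
 fixes h :: "'n::finite \<Rightarrow> 'm::finite"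
 assumes h: "bij h"
 shows "distr lborel borel (\<lambda>v :: real ^ 'm. (\<chi> i. v $ h i) :: real ^ 'n) = lborel"
proof (rule lborel_eqI[symmetric])
 let ?\<Phi> = "\<lambda>v :: real ^ 'm. (\<chi> i. v $ h i) :: real ^ 'n"
 have c: "continuous_on UNIV ?\<Phi>" by (intro continuous_intros)
 then have [measurable]: "?\<Phi> \<in> borel_measurable borel" by (rule borel_measurable_continuous_onI)
 have inn: "(z :: real ^ 'k::finite) \<bullet> axis i 1 = z $ i" for z i by (simp add: inner_axis)
 fix l u :: "real ^ 'n" assume lu: "\<And>b. b \<in> Basis ==> l \<bullet> b \<le> u \<bullet> b"
 then have lu': "l $ i \<le> u $ i" for i using lu[of "axis i 1"] by (simp add: inn axis_in_Basis_iff)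
 define l' u' where "l' = (\<chi> j. l $ inv h j)" and "u' = (\<chi> j. u $ inv h j)"
 have hs: "h (inv h j) = j" "inv h (h i) = i" for i j using h by (auto simp: bij_is_surj surj_f_inv_f bij_is_inj)
 have "?\<Phi> -` box l u = box l' u'"
  by (auto simp: mem_box_cart l'_def u'_def) (metis hs)+
 then have "emeasure (distr lborel borel ?\<Phi>) (box l u) = emeasure lborel (box l' u')"
  by (subst emeasure_distr) auto
 also have "\<dots> = (\<Prod>b\<in>Basis. (u' - l') \<bullet> b)"
  using lu' by (intro emeasure_lborel_box) (auto simp: Basis_vec_def inn l'_def u'_def)
 also have "(\<Prod>b\<in>Basis. (u' - l') \<bullet> b) = (\<Prod>j\<in>UNIV. u' $ j - l' $ j)"
  unfolding Basis_vec_def by (simp add: UNION_singleton_eq_range prod.reindex inj_on_def axis_eq_axis inn)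
 also have "\<dots> = (\<Prod>i\<in>UNIV. u $ i - l $ i)"
  using prod.reindex_bij_betw[OF h, of "\<lambda>j. u' $ j - l' $ j"] by (simp add: l'_def u'_def hs)
 also have "\<dots> = (\<Prod>b\<in>Basis. (u - l) \<bullet> b)"
  unfolding Basis_vec_def by (simp add: UNION_singleton_eq_range prod.reindex inj_on_def axis_eq_axis inn)
 finally show "emeasure (distr lborel borel ?\<Phi>) (box l u) = (\<Prod>b\<in>Basis. (u - l) \<bullet> b)" .
qed simp

text \<open>T is conjugated with a relabelling of the coordinates. Relabelling preserves Lebesgue
  measure and permutes rows and columns of the Jacobian matrix alike, which leaves its determinant
  alone.\<close>

theorem nn_integral_change_of_variables:
 fixes T :: "real ^ 'm::finite \<Rightarrow> real ^ 'm" and f :: "real ^ 'm \<Rightarrow> real"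
 assumes S: "S \<in> sets borel" and T: "\<And>x. x \<in> S ==> (T has_derivative T' x) (at x)" "inj_on T S"
  and f: "\<And>y. f y \<ge> 0" "(\<lambda>y. indicator (T ` S) y * f y) \<in> borel_measurable borel"
  and m: "(\<lambda>x. indicator S x * (\<bar>det (matrix (T' x))\<bar> * f (T x))) \<in> borel_measurable borel"
 shows "(\<integral>\<^sup>+y\<in>T ` S. ennreal (f y) \<partial>lborel) = (\<integral>\<^sup>+x\<in>S. ennreal (\<bar>det (matrix (T' x))\<bar> * f (T x)) \<partial>lborel)"
proof -
 obtain h :: "'m wo_index \<Rightarrow> 'm" where h: "bij h" by (rule wo_index_bij)
 have hs: "h (inv h j) = j" "inv h (h i) = i" for i j using h by (auto simp: bij_is_surj surj_f_inv_f bij_is_inj)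
 define \<Phi> where "\<Phi> v = (\<chi> i. v $ h i)" for v :: "real ^ 'm"
 define \<Psi> where "\<Psi> v = (\<chi> j. v $ inv h j)" for v :: "real ^ 'm wo_index"
 have inv: "\<Phi> (\<Psi> w) = w" "\<Psi> (\<Phi> v) = v" for v w by (simp_all add: \<Phi>_def \<Psi>_def vec_eq_iff hs)
 have lin: "linear \<Phi>" "linear \<Psi>" by (auto intro!: linearI simp: \<Phi>_def \<Psi>_def vec_eq_iff)
 have bl: "bounded_linear \<Phi>" "bounded_linear \<Psi>" using lin by (auto simp: linear_conv_bounded_linear)
 have [measurable]: "\<Phi> \<in> borel_measurable borel" "\<Psi> \<in> borel_measurable borel"
  using bl by (auto intro!: borel_measurable_continuous_onI linear_continuous_on)
 have d\<Phi>: "distr lborel borel \<Phi> = lborel" using distr_reindex_lborel[OF h] by (simp add: \<Phi>_def[abs_def])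
 have tr: "(\<integral>\<^sup>+y. F y \<partial>lborel) = (\<integral>\<^sup>+x. F (\<Phi> x) \<partial>lborel)" if "F \<in> borel_measurable borel" for F
  by (subst d\<Phi>[symmetric], subst nn_integral_distr) (use that in auto)
 define T2 where "T2 w = \<Phi> (T (\<Psi> w))" for w
 define T2' where "T2' w v = \<Phi> (T' (\<Psi> w) (\<Psi> v))" for w v
 define S2 where "S2 = \<Psi> -` S"
 define f2 where "f2 w = f (\<Psi> w)" for w
 have S2: "S2 \<in> sets borel" unfolding S2_def using measurable_sets[of \<Psi> borel borel S] S by simp
 have det: "det (matrix (T2' w)) = det (matrix (T' (\<Psi> w)))" for w
 proof -
  have ax: "\<Psi> (axis j 1) = axis (h j) 1" for j
   by (auto simp: \<Psi>_def vec_eq_iff axis_def hs)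
  have "matrix (T2' w) = (\<chi> i j. matrix (T' (\<Psi> w)) $ h i $ h j)"
   by (simp add: matrix_def T2'_def ax) (simp add: \<Phi>_def)
  then show ?thesis by (simp add: det_reindex[OF h])
 qed
 have img: "\<Phi> y \<in> T2 ` S2 \<longleftrightarrow> y \<in> T ` S" for y
 proof
  assume "\<Phi> y \<in> T2 ` S2"
  then obtain w where w: "\<Psi> w \<in> S" "\<Phi> y = \<Phi> (T (\<Psi> w))" by (auto simp: T2_def S2_def)
  then have "y = T (\<Psi> w)" by (metis inv(2))
  then show "y \<in> T ` S" using w by auto
 next
  assume "y \<in> T ` S"
  then obtain x where "x \<in> S" "y = T x" by auto
  then show "\<Phi> y \<in> T2 ` S2" by (intro image_eqI[of _ _ "\<Phi> x"]) (auto simp: T2_def S2_def inv)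
 qed
 have ims: "\<Phi> x \<in> S2 \<longleftrightarrow> x \<in> S" for x by (simp add: S2_def inv)
 have mf: "(\<lambda>y. indicator (T2 ` S2) y * f2 y) \<in> borel_measurable borel"
 proof -
  have "(\<lambda>y. indicator (T ` S) (\<Psi> y) * f (\<Psi> y)) \<in> borel_measurable borel"
   using measurable_compose[OF _ f(2), of \<Psi> borel] by simp
  moreover have "indicator (T ` S) (\<Psi> y) = (indicator (T2 ` S2) y :: real)" for y
   using img[of "\<Psi> y"] by (auto simp: inv indicator_def)
  ultimately show ?thesis by (simp add: f2_def)
 qed
 have mm: "(\<lambda>x. indicator S2 x * (\<bar>det (matrix (T2' x))\<bar> * f2 (T2 x))) \<in> borel_measurable borel"
 proof -
  have "(\<lambda>x. indicator S (\<Psi> x) * (\<bar>det (matrix (T' (\<Psi> x)))\<bar> * f (T (\<Psi> x)))) \<in> borel_measurable borel"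
   using measurable_compose[OF _ m, of \<Psi> borel] by simp
  moreover have "indicator S (\<Psi> x) = (indicator S2 x :: real)" for x by (auto simp: S2_def indicator_def)
  ultimately show ?thesis by (simp add: f2_def T2_def inv det)
 qed
 have e: "(\<integral>\<^sup>+y\<in>T2 ` S2. ennreal (f2 y) \<partial>lborel) = (\<integral>\<^sup>+x\<in>S2. ennreal (\<bar>det (matrix (T2' x))\<bar> * f2 (T2 x)) \<partial>lborel)"
 proof (rule nn_integral_change_of_variables_wo[OF S2 _ _ _ mf mm])
  fix x assume "x \<in> S2"
  then have "(T has_derivative T' (\<Psi> x)) (at (\<Psi> x))" using T(1) by (simp add: S2_def)
  from has_derivative_compose[OF bounded_linear_imp_has_derivative[OF bl(2)] this]
  have "((\<lambda>w. T (\<Psi> w)) has_derivative (\<lambda>v. T' (\<Psi> x) (\<Psi> v))) (at x)" .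
  from bounded_linear.has_derivative[OF bl(1) this]
  show "(T2 has_derivative T2' x) (at x)" by (simp add: T2_def[abs_def] T2'_def[abs_def])
 next
  show "inj_on T2 S2"
   using T(2) unfolding inj_on_def T2_def S2_def by (metis inv vimageD)
 qed (simp add: f2_def f)
 have "(\<integral>\<^sup>+y\<in>T ` S. ennreal (f y) \<partial>lborel) = (\<integral>\<^sup>+y. ennreal (indicator (T2 ` S2) (\<Phi> y) * f2 (\<Phi> y)) \<partial>lborel)"
  by (rule nn_integral_cong) (auto simp: indicator_def img f2_def inv)
 also have "\<dots> = (\<integral>\<^sup>+y. ennreal (indicator (T2 ` S2) y * f2 y) \<partial>lborel)"
  by (rule tr[symmetric]) (use mf in measurable)
 also have "\<dots> = (\<integral>\<^sup>+y\<in>T2 ` S2. ennreal (f2 y) \<partial>lborel)"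
  by (rule nn_integral_cong) (auto simp: indicator_def)
 also note e
 also have "(\<integral>\<^sup>+x\<in>S2. ennreal (\<bar>det (matrix (T2' x))\<bar> * f2 (T2 x)) \<partial>lborel) = (\<integral>\<^sup>+x. ennreal (indicator S2 x * (\<bar>det (matrix (T2' x))\<bar> * f2 (T2 x))) \<partial>lborel)"
  by (rule nn_integral_cong) (auto simp: indicator_def)
 also have "\<dots> = (\<integral>\<^sup>+x. ennreal (indicator S2 (\<Phi> x) * (\<bar>det (matrix (T2' (\<Phi> x)))\<bar> * f2 (T2 (\<Phi> x)))) \<partial>lborel)"
  by (rule tr) (use mm in measurable)
 also have "\<dots> = (\<integral>\<^sup>+x\<in>S. ennreal (\<bar>det (matrix (T' x))\<bar> * f (T x)) \<partial>lborel)"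
  by (rule nn_integral_cong) (auto simp: indicator_def ims det f2_def T2_def inv)
 finally show ?thesis .
qed

section \<open>Riemannian volume\<close>

lemma vec_inner_matrix_eq: "v \<bullet> (M *v w) = (\<Sum>i\<in>UNIV. \<Sum>j\<in>UNIV. v $ i * w $ j * M $ i $ j)"
 for M :: "real ^ 'm ^ 'm"
 by (simp add: inner_vec_def matrix_vector_mult_def sum_distrib_left mult_ac)

text \<open>The segment from the identity to M consists of positive definite, hence injective,
  matrices; a nonpositive determinant at M would produce a kernel vector somewhere on it.\<close>

lemma det_pos_definite:
 fixes M :: "real ^ 'm::finite ^ 'm"
 assumes pd: "\<And>v. v \<noteq> 0 ==> v \<bullet> (M *v v) > 0"
 shows "det M > 0"
proof (rule ccontr)
 assume "\<not> det M > 0"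
 define N where "N t = (\<chi> i j. (1 - t) * (mat 1 :: real ^ 'm ^ 'm) $ i $ j + t * M $ i $ j)" for t :: real
 have c: "continuous_on {0..1} (\<lambda>t. det (N t))"
  unfolding det_def N_def by (auto intro!: continuous_intros)
 have "N 0 = mat 1" "N 1 = M" by (simp_all add: N_def vec_eq_iff)
 then have "det (N 1) \<le> 0" "0 \<le> det (N 0)" using \<open>\<not> det M > 0\<close> by auto
 then obtain t where t: "0 \<le> t" "t \<le> 1" "det (N t) = 0" using IVT2'[of "\<lambda>t. det (N t)" 1 0 0] c by auto
 then obtain v where v: "v \<noteq> 0" "N t *v v = 0"
  using invertible_det_nz[of "N t"] invertible_left_inverse[of "N t"] matrix_left_invertible_ker[of "N t"] by auto
 have "N t *v v = (1 - t) *\<^sub>R v + t *\<^sub>R (M *v v)"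
  by (simp add: vec_eq_iff N_def matrix_vector_mult_def mat_def sum.distrib sum_distrib_left algebra_simps if_distrib[of "\<lambda>x. _ * x"] cong: if_cong)
 then have "0 = (1 - t) * (v \<bullet> v) + t * (v \<bullet> (M *v v))"
  using v(2) by (metis inner_add_right inner_scaleR_right inner_zero_right)
 moreover have "v \<bullet> v > 0" using v by simp
 ultimately show False using t pd[OF v(1)]
  by (smt (verit) mult_nonneg_nonneg mult_pos_pos)
qed

lemma borel_measurable_completion_AE:
 assumes f: "f \<in> borel_measurable (completion M)" and ae: "AE x in completion M. f x = h x"
 shows "h \<in> borel_measurable (completion M)"
proof (rule measurableI)
 fix A :: "'b set" assume A: "A \<in> sets borel"
 show "h -` A \<inter> space (completion M) \<in> sets (completion M)"
 proof (rule completion.in_sets_AE)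
  show "AE x in completion M. x \<in> f -` A \<inter> space (completion M) \<longleftrightarrow> x \<in> h -` A \<inter> space (completion M)"
   using ae by eventually_elim auto
  show "f -` A \<inter> space (completion M) \<in> sets (completion M)" using f A by (rule measurable_sets)
 qed auto
qed simp

lemma suminf_ennreal_swap: "(\<Sum>i. \<Sum>n. f i n) = (\<Sum>n. \<Sum>i. f i (n :: nat) :: ennreal)" for f :: "nat \<Rightarrow> nat \<Rightarrow> ennreal"
proof -
 have "(\<Sum>n. \<Sum>i. f i n) = (\<integral>\<^sup>+n. (\<Sum>i. f i n) \<partial>count_space UNIV)" by (simp add: nn_integral_count_space_nat)
 also have "\<dots> = (\<Sum>i. \<integral>\<^sup>+n. f i n \<partial>count_space UNIV)" by (rule nn_integral_suminf) simp
 finally show ?thesis by (simp add: nn_integral_count_space_nat)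
qed

context rmfd
begin

abbreviation gram where "gram \<equiv> gram_matrix \<A> g"

definition vdens :: "('a, 'm) chart \<Rightarrow> real ^ 'm \<Rightarrow> real" where
 "vdens c y = sqrt (det (gram c y))"

lemma inner_gram: "c \<in> \<A> ==> y \<in> img c ==> v \<bullet> (gram c y *v w) = lm c y v w"
 by (subst lm_expand) (simp_all add: vec_inner_matrix_eq gram_matrix_def)

lemma det_gram_pos: "c \<in> \<A> ==> y \<in> img c ==> det (gram c y) > 0"
 by (rule det_pos_definite) (simp add: inner_gram lm_pos)

lemma vdens_pos: "c \<in> \<A> ==> y \<in> img c ==> vdens c y > 0"
 by (simp add: vdens_def det_gram_pos)

lemma continuous_vdens: "c \<in> \<A> ==> continuous_on (img c) (vdens c)"
 unfolding vdens_def det_def gram_matrix_def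
 by (auto intro!: continuous_intros continuous_lm_fixed)

text \<open>The two Gram matrices are congruent through the Jacobian J, so their determinants differ
  by the square of det J.\<close>

lemma vdens_transform:
 assumes c: "c \<in> \<A>" "x \<in> fst c" and d: "d \<in> \<A>" "x \<in> fst d"
 shows "vdens c (snd c x) = \<bar>det (matrix (dtrans c d x))\<bar> * vdens d (snd d x)"
proof -
 let ?J = "matrix (dtrans c d x)"
 have J: "?J *v v = dtrans c d x v" for v using linear_dtrans[OF c(1) d(1) c(2) d(2)] by (simp add: matrix_works)
 have lmt: "lm c (snd c x) v w = lm d (snd d x) (dtrans c d x v) (dtrans c d x w)" for v w
  using g_eq_lm[OF d tvec_of_in[OF c] tvec_of_in[OF c], of v w] g_eq_lm[OF c tvec_of_in[OF c] tvec_of_in[OF c], of v w] c d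
  by (simp add: tvec_of_eq[of c x v] tvec_of_eq[of c x w] dtrans_self)
 have "gram c (snd c x) = transpose ?J ** gram d (snd d x) ** ?J"
 proof -
  have "v \<bullet> (gram c (snd c x) *v w) = v \<bullet> ((transpose ?J ** gram d (snd d x) ** ?J) *v w)" for v w
  proof -
   have "v \<bullet> ((transpose ?J ** gram d (snd d x) ** ?J) *v w) = (?J *v v) \<bullet> (gram d (snd d x) *v (?J *v w))"
    by (simp add: matrix_vector_mul_assoc[symmetric] dot_lmul_matrix vector_transpose_matrix)
     (metis dot_lmul_matrix transpose_matrix_vector inner_commute transpose_transpose)
   then show ?thesis using c d lmt by (simp add: inner_gram J)
  qed
  then have "gram c (snd c x) *v w = (transpose ?J ** gram d (snd d x) ** ?J) *v w" for w
   by (metis vector_eq_ldot)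
  then show ?thesis by (simp add: matrix_eq)
 qed
 then have "det (gram c (snd c x)) = (det ?J)\<^sup>2 * det (gram d (snd d x))"
  by (simp add: det_mul det_transpose power2_eq_square)
 then show ?thesis by (simp add: vdens_def real_sqrt_mult)
qed

definition chart_measure :: "('a, 'm) chart \<Rightarrow> 'a measure" where
 "chart_measure c = distr (density (restrict_space lborel (img c)) (\<lambda>y. ennreal (vdens c y))) borel (chart_inv c)"

lemma measurable_chart_inv [measurable]:
 "c \<in> \<A> ==> chart_inv c \<in> measurable (restrict_space borel (img c)) borel"
 by (rule borel_measurable_continuous_on_restrict[OF cont_chart_inv])

lemma img_borel [measurable]: "c \<in> \<A> ==> img c \<in> sets borel"
 using open_img by auto

lemma dom_borel [measurable]: "c \<in> \<A> ==> fst c \<in> sets borel"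
 using open_dom by auto

lemma measurable_vdens: "c \<in> \<A> ==> vdens c \<in> borel_measurable (restrict_space borel (img c))"
 by (rule borel_measurable_continuous_on_restrict[OF continuous_vdens])

lemma image_chart_borel:
 assumes c: "c \<in> \<A>" and B: "B \<in> sets borel" "B \<subseteq> fst c"
 shows "snd c ` B \<in> sets borel"
proof -
 have "snd c ` B = chart_inv c -` B \<inter> space (restrict_space borel (img c))"
  using B c by (auto simp: space_restrict_space intro!: image_eqI[of _ "snd c"])
 then have "snd c ` B \<in> sets (restrict_space borel (img c))"
  using measurable_sets[OF measurable_chart_inv[OF c] B(1)] by simp
 then show ?thesis using img_borel[OF c] by (auto simp: sets_restrict_space)
qed

lemma nn_integral_chart_measure:
 assumes c: "c \<in> \<A>" and f: "f \<in> borel_measurable borel"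
 shows "(\<integral>\<^sup>+x. f x \<partial>chart_measure c) = (\<integral>\<^sup>+y\<in>img c. ennreal (vdens c y) * f (chart_inv c y) \<partial>lborel)"
proof -
 have r: "restrict_space lborel (img c) = restrict_space lborel (img c)" ..
 have m: "chart_inv c \<in> measurable (restrict_space lborel (img c)) borel"
  "vdens c \<in> borel_measurable (restrict_space lborel (img c))"
  using measurable_chart_inv[OF c] measurable_vdens[OF c]
  by (simp_all cong: measurable_cong_sets add: measurable_cong_sets[OF sets_restrict_space_cong[OF sets_lborel] refl])
 have mf: "(\<lambda>y. f (chart_inv c y)) \<in> borel_measurable (restrict_space lborel (img c))"
  using measurable_compose[OF m(1) f] .
 have "(\<integral>\<^sup>+x. f x \<partial>chart_measure c) = (\<integral>\<^sup>+y. f (chart_inv c y) \<partial>density (restrict_space lborel (img c)) (\<lambda>y. ennreal (vdens c y)))"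
  unfolding chart_measure_def by (rule nn_integral_distr) (use m f in auto)
 also have "\<dots> = (\<integral>\<^sup>+y. ennreal (vdens c y) * f (chart_inv c y) \<partial>restrict_space lborel (img c))"
  by (rule nn_integral_density) (use m mf in auto)
 also have "\<dots> = (\<integral>\<^sup>+y\<in>img c. ennreal (vdens c y) * f (chart_inv c y) \<partial>lborel)"
  by (rule nn_integral_restrict_space) (use img_borel[OF c] in auto)
 finally show ?thesis .
qed

lemma sets_chart_measure [simp]: "sets (chart_measure c) = sets borel"
 by (simp add: chart_measure_def)

lemma emeasure_chart_measure:
 assumes c: "c \<in> \<A>" and B: "B \<in> sets borel" "B \<subseteq> fst c"
 shows "emeasure (chart_measure c) B = (\<integral>\<^sup>+y\<in>snd c ` B. ennreal (vdens c y) \<partial>lborel)"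
proof -
 have "emeasure (chart_measure c) B = (\<integral>\<^sup>+x. indicator B x \<partial>chart_measure c)" using B by simp
 also have "\<dots> = (\<integral>\<^sup>+y\<in>img c. ennreal (vdens c y) * indicator B (chart_inv c y) \<partial>lborel)"
  by (rule nn_integral_chart_measure[OF c]) (use B in auto)
 also have "\<dots> = (\<integral>\<^sup>+y\<in>snd c ` B. ennreal (vdens c y) \<partial>lborel)"
 proof (rule nn_integral_cong)
  fix y
  have "y \<in> snd c ` B \<longleftrightarrow> y \<in> img c \<and> chart_inv c y \<in> B"
   using B c by (auto intro!: image_eqI[of _ "snd c"])
  then show "ennreal (vdens c y) * indicator B (chart_inv c y) * indicator (img c) y = ennreal (vdens c y) * indicator (snd c ` B) y"
   by (auto simp: indicator_def)
 qed
 finally show ?thesis .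
qed

lemma chart_measure_compat:
 assumes c: "c \<in> \<A>" and d: "d \<in> \<A>" and B: "B \<in> sets borel" "B \<subseteq> fst c" "B \<subseteq> fst d"
 shows "emeasure (chart_measure c) B = emeasure (chart_measure d) B"
proof -
 let ?S = "snd c ` B"
 have S: "?S \<in> sets borel" "snd d ` B \<in> sets borel" by (rule image_chart_borel[OF c B(1,2)], rule image_chart_borel[OF d B(1,3)])
 have im: "transition c d ` ?S = snd d ` B" using B c by (force simp: image_image)
 define T' where "T' y = dtrans c d (chart_inv c y)" for y
 have mon: "(\<lambda>y. indicator A y * vdens e y) \<in> borel_measurable borel" if "A \<in> sets borel" "A \<subseteq> img e" "e \<in> \<A>" for A e
  using borel_measurable_continuous_on_indicator[OF that(1) continuous_on_subset[OF continuous_vdens[OF that(3)] that(2)]] by simp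
 \<comment> \<open>\<open>vdens\<close> is known to be positive only on chart images, while the
   change of variables asks for a function nonnegative everywhere; hence the maximum with 0.\<close>
 have dens: "indicator ?S y * (\<bar>det (matrix (T' y))\<bar> * max 0 (vdens d (transition c d y))) = indicator ?S y * vdens c y" for y
 proof (cases "y \<in> ?S")
  case True
  then obtain x where x: "x \<in> B" "y = snd c x" by auto
  have xc: "x \<in> fst c" "x \<in> fst d" using x B by auto
  have "chart_inv c y = x" "transition c d y = snd d x" using x(2) xc c by simp_all
  then show ?thesis using vdens_transform[OF c xc(1) d xc(2)] vdens_pos[OF d imageI[OF xc(2)]] x(2) True by (simp add: T'_def max_def)
 qed simp
 have "(\<integral>\<^sup>+y\<in>transition c d ` ?S. ennreal (max 0 (vdens d y)) \<partial>lborel) = (\<integral>\<^sup>+y\<in>?S. ennreal (\<bar>det (matrix (T' y))\<bar> * max 0 (vdens d (transition c d y))) \<partial>lborel)"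
 proof (rule nn_integral_change_of_variables[OF S(1)])
  fix y assume "y \<in> ?S"
  then obtain x where x: "x \<in> B" "y = snd c x" by auto
  then have xc: "x \<in> fst c" "x \<in> fst d" using B by auto
  then show "(transition c d has_derivative T' y) (at y)" using transition_has_derivative[OF c d xc] x c by (simp add: T'_def)
 next
  have "inj_on (snd d) B" using inj_chart[OF d] B(3) by (rule inj_on_subset)
  then show "inj_on (transition c d) ?S"
   using subsetD[OF B(2)] c by (auto simp: inj_on_def)
 next
  have "(\<lambda>y. max 0 (indicator (snd d ` B) y * vdens d y)) \<in> borel_measurable borel"
   using mon[OF S(2) _ d] B(3) by (intro borel_measurable_max) auto
  moreover have "max 0 (indicator (snd d ` B) y * vdens d y) = indicator (transition c d ` ?S) y * max 0 (vdens d y)" for y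
   unfolding im by (auto simp: indicator_def)
  ultimately show "(\<lambda>y. indicator (transition c d ` ?S) y * max 0 (vdens d y)) \<in> borel_measurable borel" by simp
  show "(\<lambda>x. indicator ?S x * (\<bar>det (matrix (T' x))\<bar> * max 0 (vdens d (transition c d x)))) \<in> borel_measurable borel"
   unfolding dens using mon[OF S(1) _ c] B(2) by auto
 qed auto
 moreover have "(\<integral>\<^sup>+y\<in>transition c d ` ?S. ennreal (max 0 (vdens d y)) \<partial>lborel) = emeasure (chart_measure d) B"
  unfolding im emeasure_chart_measure[OF d B(1,3)] by (rule nn_integral_cong) (auto simp: indicator_def max_def ennreal_neg)
 moreover have "(\<integral>\<^sup>+y\<in>?S. ennreal (\<bar>det (matrix (T' y))\<bar> * max 0 (vdens d (transition c d y))) \<partial>lborel) = emeasure (chart_measure c) B"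
  unfolding emeasure_chart_measure[OF c B(1,2)]
 proof (rule nn_integral_cong)
  fix y show "ennreal (\<bar>det (matrix (T' y))\<bar> * max 0 (vdens d (transition c d y))) * indicator ?S y = ennreal (vdens c y) * indicator ?S y"
   using dens[of y] by (auto simp: indicator_def split: if_splits)
 qed
 ultimately show ?thesis by simp
qed

section \<open>Gluing the chart measures to the Riemannian volume\<close>

lemma countable_charts: obtains cs :: "nat \<Rightarrow> ('a, 'm) chart" where "range cs \<subseteq> \<A>" "(\<Union>n. fst (cs n)) = UNIV"
proof -
 have "\<exists>F\<subseteq>fst ` \<A>. countable F \<and> \<Union>F = \<Union>(fst ` \<A>)"
 proof (rule Lindelof[of "fst ` \<A>"])
  fix S assume "S \<in> fst ` \<A>"
  then obtain c where "c \<in> \<A>" "S = fst c" by (rule imageE)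
  then show "open S" using open_dom by simp
 qed (intro exI conjI, assumption+)
 then obtain F where F: "F \<subseteq> fst ` \<A>" "countable F" "\<Union>F = \<Union>(fst ` \<A>)" by (elim exE conjE)
 have U: "\<Union>(fst ` \<A>) = UNIV" using chart_cover by blast
 obtain C where C: "C \<subseteq> \<A>" "countable C" "F = fst ` C"
  using countable_subset_image[of F fst \<A>] F by auto
 have "C \<noteq> {}" using C F U by auto
 then have "range (from_nat_into C) = C" using C(2) by (simp add: range_from_nat_into)
 then have r: "range (from_nat_into C) \<subseteq> \<A>" "fst ` range (from_nat_into C) = F" using C by simp_all
 then have "(\<Union>n. fst (from_nat_into C n)) = UNIV" using F(3) U by (simp add: image_image)
 then show ?thesis using r(1) by (intro that)
qed

definition chart_seq :: "nat \<Rightarrow> ('a, 'm) chart" where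
 "chart_seq = (SOME cs. range cs \<subseteq> \<A> \<and> (\<Union>n. fst (cs n)) = UNIV)"

lemma chart_seq: "chart_seq n \<in> \<A>" "(\<Union>n. fst (chart_seq n)) = UNIV"
proof -
 have "range chart_seq \<subseteq> \<A> \<and> (\<Union>n. fst (chart_seq n)) = UNIV"
  unfolding chart_seq_def
 proof (rule someI_ex[of "\<lambda>cs :: nat \<Rightarrow> ('a, 'm) chart. range cs \<subseteq> \<A> \<and> (\<Union>n. fst (cs n)) = UNIV"])
  obtain cs :: "nat \<Rightarrow> ('a, 'm) chart" where "range cs \<subseteq> \<A>" "(\<Union>n. fst (cs n)) = UNIV" by (rule countable_charts)
  then show "\<exists>cs :: nat \<Rightarrow> ('a, 'm) chart. range cs \<subseteq> \<A> \<and> (\<Union>n. fst (cs n)) = UNIV" by (intro exI[of _ cs] conjI)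
 qed
 then show "chart_seq n \<in> \<A>" "(\<Union>n. fst (chart_seq n)) = UNIV" by auto
qed

definition piece :: "nat \<Rightarrow> 'a set" where "piece = disjointed (\<lambda>n. fst (chart_seq n))"

lemma piece: "disjoint_family piece" "(\<Union>n. piece n) = UNIV" "piece n \<subseteq> fst (chart_seq n)" "piece n \<in> sets borel"
proof -
 show "disjoint_family piece" unfolding piece_def by (rule disjoint_family_disjointed)
 show "(\<Union>n. piece n) = UNIV" unfolding piece_def UN_disjointed_eq by (rule chart_seq(2))
 show "piece n \<subseteq> fst (chart_seq n)" unfolding piece_def by (rule disjointed_subset)
 show "piece n \<in> sets borel" unfolding piece_def disjointed_def using dom_borel[OF chart_seq(1)] by auto
qed

lemma emeasure_pieces:
 assumes "sets M = sets borel" "B \<in> sets borel"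
 shows "emeasure M B = (\<Sum>n. emeasure M (B \<inter> piece n))"
proof -
 have "B = (\<Union>n. B \<inter> piece n)" using piece(2) by auto
 then have "emeasure M B = emeasure M (\<Union>n. B \<inter> piece n)" by simp
 also have "\<dots> = (\<Sum>n. emeasure M (B \<inter> piece n))"
  using assms piece by (intro suminf_emeasure[symmetric]) (auto simp: disjoint_family_on_def)
 finally show ?thesis .
qed

text \<open>Every piece of a countable Borel partition is measured in its own chart; by
  \<open>chart_measure_compat\<close> the result agrees with the measure of any other chart on the
  sets inside that chart.\<close>

definition vol0 :: "'a measure" where
 "vol0 = measure_of UNIV (sets borel) (\<lambda>B. \<Sum>n. emeasure (chart_measure (chart_seq n)) (B \<inter> piece n))"

lemma sets_vol0 [simp]: "sets vol0 = sets borel"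
 using sets.sigma_sets_eq[of "borel :: 'a measure"] sets.space_closed[of "borel :: 'a measure"]
 by (simp add: vol0_def sets_measure_of)

lemma emeasure_vol0:
 assumes "B \<in> sets borel"
 shows "emeasure vol0 B = (\<Sum>n. emeasure (chart_measure (chart_seq n)) (B \<inter> piece n))"
proof (rule emeasure_measure_of[OF vol0_def])
 show "countably_additive (sets vol0) (\<lambda>B. \<Sum>n. emeasure (chart_measure (chart_seq n)) (B \<inter> piece n))"
  unfolding countably_additive_def
 proof (intro allI impI)
  fix A :: "nat \<Rightarrow> 'a set" assume A: "range A \<subseteq> sets vol0" "disjoint_family A" "\<Union> (range A) \<in> sets vol0"
  have "(\<Sum>i. \<Sum>n. emeasure (chart_measure (chart_seq n)) (A i \<inter> piece n))
   = (\<Sum>n. \<Sum>i. emeasure (chart_measure (chart_seq n)) (A i \<inter> piece n))" by (rule suminf_ennreal_swap)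
  also have "\<dots> = (\<Sum>n. emeasure (chart_measure (chart_seq n)) (\<Union>(range A) \<inter> piece n))"
  proof (rule suminf_cong)
   fix n
   have "(\<Sum>i. emeasure (chart_measure (chart_seq n)) (A i \<inter> piece n)) = emeasure (chart_measure (chart_seq n)) (\<Union>i. A i \<inter> piece n)"
    using A piece(4)[of n] by (intro suminf_emeasure) (auto simp: disjoint_family_on_def)
   also have "(\<Union>i. A i \<inter> piece n) = \<Union>(range A) \<inter> piece n" by auto
   finally show "(\<Sum>i. emeasure (chart_measure (chart_seq n)) (A i \<inter> piece n)) = emeasure (chart_measure (chart_seq n)) (\<Union>(range A) \<inter> piece n)" .
  qed
  finally show "(\<Sum>i. \<Sum>n. emeasure (chart_measure (chart_seq n)) (A i \<inter> piece n)) = (\<Sum>n. emeasure (chart_measure (chart_seq n)) (\<Union>(range A) \<inter> piece n))" .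
 qed
qed (use assms in \<open>auto simp: positive_def\<close>)

lemma emeasure_vol0_chart:
 assumes c: "c \<in> \<A>" and B: "B \<in> sets borel" "B \<subseteq> fst c"
 shows "emeasure vol0 B = emeasure (chart_measure c) B"
proof -
 have "emeasure vol0 B = (\<Sum>n. emeasure (chart_measure c) (B \<inter> piece n))"
  unfolding emeasure_vol0[OF B(1)]
  using piece(3,4) B by (intro suminf_cong chart_measure_compat chart_seq(1) c) auto
 also have "\<dots> = emeasure (chart_measure c) B" by (rule emeasure_pieces[symmetric]) (use B in auto)
 finally show ?thesis .
qed

lemma is_borel_volume_vol0: "is_borel_volume \<A> g vol0"
 unfolding is_borel_volume_def
 by (auto simp: emeasure_vol0_chart emeasure_chart_measure vdens_def)

text \<open>Two volumes agree on the Borel subsets of each chart, hence on the pieces, hence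
  everywhere. This uniqueness is what makes the definite description meaningful.\<close>

lemma volume_measure_eq: "volume_measure \<A> g = completion vol0"
proof -
 have "(THE \<mu>. is_borel_volume \<A> g \<mu>) = vol0"
 proof (rule the_equality)
  show "is_borel_volume \<A> g vol0" by (rule is_borel_volume_vol0)
 next
  fix \<mu> assume \<mu>: "is_borel_volume \<A> g \<mu>"
  then have s: "sets \<mu> = sets borel" by (simp add: is_borel_volume_def)
  show "\<mu> = vol0"
  proof (rule measure_eqI)
   fix B assume "B \<in> sets \<mu>"
   then have B: "B \<in> sets borel" using s by simp
   have "emeasure \<mu> B = (\<Sum>n. emeasure \<mu> (B \<inter> piece n))" by (rule emeasure_pieces[OF s B])
   also have "\<dots> = (\<Sum>n. emeasure vol0 (B \<inter> piece n))"
   proof (rule suminf_cong)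
    fix n
    have "B \<inter> piece n \<in> sets borel" "B \<inter> piece n \<subseteq> fst (chart_seq n)" using B piece(3,4)[of n] by auto
    then show "emeasure \<mu> (B \<inter> piece n) = emeasure vol0 (B \<inter> piece n)"
     using \<mu> is_borel_volume_vol0 chart_seq(1)[of n] unfolding is_borel_volume_def by simp
   qed
   also have "\<dots> = emeasure vol0 B" by (rule emeasure_pieces[symmetric]) (use B in auto)
   finally show "emeasure \<mu> B = emeasure vol0 B" .
  qed (use s in simp)
 qed
 then show ?thesis by (simp add: volume_measure_def)
qed

section \<open>Null sets, measurability and integrability seen in charts\<close>

abbreviation vol :: "'a measure" where "vol \<equiv> volume_measure \<A> g"

lemma space_vol0 [simp]: "space vol0 = UNIV"
 using sets_eq_imp_space_eq[OF sets_vol0] by simp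

lemma AE_vol_iff: "(AE x in vol. P x) \<longleftrightarrow> (AE x in vol0. P x)"
 unfolding volume_measure_eq by (rule AE_completion_iff)

lemma space_vol [simp]: "space vol = UNIV"
 by (simp add: volume_measure_eq)

lemma borel_in_vol [intro, simp]: "B \<in> sets borel ==> B \<in> sets vol"
 by (simp add: volume_measure_eq)

lemma borel_measurable_vol: "f \<in> borel_measurable borel ==> f \<in> borel_measurable vol"
 unfolding volume_measure_eq by (intro measurable_completion) (simp cong: measurable_cong_sets)

lemma nn_integral_vol0_chart:
 assumes c: "c \<in> \<A>" and f: "f \<in> borel_measurable borel"
 shows "(\<integral>\<^sup>+x\<in>fst c. f x \<partial>vol0) = (\<integral>\<^sup>+y\<in>img c. ennreal (vdens c y) * f (chart_inv c y) \<partial>lborel)"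
proof -
 have "restrict_space vol0 (fst c) = restrict_space (chart_measure c) (fst c)"
 proof (rule measure_eqI)
  show "sets (restrict_space vol0 (fst c)) = sets (restrict_space (chart_measure c) (fst c))"
   by (rule sets_restrict_space_cong) simp
  fix B assume "B \<in> sets (restrict_space vol0 (fst c))"
  then have B: "B \<in> sets borel" "B \<subseteq> fst c" using dom_borel[OF c] by (auto simp: sets_restrict_space)
  have sp: "fst c \<inter> space M \<in> sets M" if "sets M = sets borel" for M :: "'a measure"
   using that dom_borel[OF c] sets_eq_imp_space_eq[OF that] by auto
  show "emeasure (restrict_space vol0 (fst c)) B = emeasure (restrict_space (chart_measure c) (fst c)) B"
   using emeasure_vol0_chart[OF c B] emeasure_restrict_space[OF sp[OF sets_vol0] B(2)]
    emeasure_restrict_space[OF sp[OF sets_chart_measure] B(2)] by simp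
 qed
 then have "(\<integral>\<^sup>+x. f x \<partial>restrict_space vol0 (fst c)) = (\<integral>\<^sup>+x. f x \<partial>restrict_space (chart_measure c) (fst c))" by simp
 then have "(\<integral>\<^sup>+x\<in>fst c. f x \<partial>vol0) = (\<integral>\<^sup>+x\<in>fst c. f x \<partial>chart_measure c)"
  using dom_borel[OF c] sets_eq_imp_space_eq[of "chart_measure c" borel] by (simp add: nn_integral_restrict_space)
 also have "\<dots> = (\<integral>\<^sup>+y\<in>img c. ennreal (vdens c y) * (f (chart_inv c y) * indicator (fst c) (chart_inv c y)) \<partial>lborel)"
  using f dom_borel[OF c] by (intro nn_integral_chart_measure[OF c]) auto
 also have "\<dots> = (\<integral>\<^sup>+y\<in>img c. ennreal (vdens c y) * f (chart_inv c y) \<partial>lborel)"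
  by (rule nn_integral_cong) (auto simp: indicator_def)
 finally show ?thesis .
qed

text \<open>The density is strictly positive on the image, so it neither creates nor hides null
  sets.\<close>

lemma null_chart:
 assumes c: "c \<in> \<A>" and B: "B \<in> sets borel" "B \<subseteq> fst c"
 shows "B \<in> null_sets vol0 \<longleftrightarrow> snd c ` B \<in> null_sets lborel"
proof -
 have S: "snd c ` B \<in> sets borel" by (rule image_chart_borel[OF c B])
 have sub: "snd c ` B \<subseteq> img c" using B by auto
 have m: "(\<lambda>y. ennreal (vdens c y) * indicator (snd c ` B) y) \<in> borel_measurable lborel"
 proof -
  have "(\<lambda>y. indicator (snd c ` B) y *\<^sub>R vdens c y) \<in> borel_measurable borel"
   by (rule borel_measurable_continuous_on_indicator[OF S continuous_on_subset[OF continuous_vdens[OF c] sub]])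
  then have "(\<lambda>y. ennreal (indicator (snd c ` B) y *\<^sub>R vdens c y)) \<in> borel_measurable borel" by simp
  moreover have "ennreal (indicator (snd c ` B) y *\<^sub>R vdens c y) = ennreal (vdens c y) * indicator (snd c ` B) y" for y
   by (auto simp: indicator_def)
  ultimately show ?thesis by simp
 qed
 have "B \<in> null_sets vol0 \<longleftrightarrow> (\<integral>\<^sup>+y\<in>snd c ` B. ennreal (vdens c y) \<partial>lborel) = 0"
  using B emeasure_vol0_chart[OF c B] emeasure_chart_measure[OF c B] by (auto simp: null_sets_def)
 also have "\<dots> \<longleftrightarrow> (AE y in lborel. ennreal (vdens c y) * indicator (snd c ` B) y = 0)"
  by (rule nn_integral_0_iff_AE[OF m])
 also have "\<dots> \<longleftrightarrow> (AE y in lborel. y \<notin> snd c ` B)"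
  by (rule AE_cong) (use vdens_pos[OF c] sub in \<open>force simp: indicator_def\<close>)
 also have "\<dots> \<longleftrightarrow> snd c ` B \<in> null_sets lborel" using S by (simp add: AE_iff_null_sets)
 finally show ?thesis .
qed

lemma AE_vol_imp_chart:
 assumes c: "c \<in> \<A>" and P: "AE x in vol. x \<in> fst c \<longrightarrow> P x"
 shows "AE y in lebesgue. y \<in> img c \<longrightarrow> P (chart_inv c y)"
proof -
 have "AE x in vol0. x \<in> fst c \<longrightarrow> P x" using P unfolding AE_vol_iff .
 then obtain N where N: "N \<in> null_sets vol0" "{x. \<not> (x \<in> fst c \<longrightarrow> P x)} \<subseteq> N"
  by (auto simp: eventually_ae_filter)
 have Nb: "N \<inter> fst c \<in> sets borel" using N(1) dom_borel[OF c] by (auto simp: null_sets_def)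
 have "N \<inter> fst c \<in> null_sets vol0" using Nb by (intro null_sets_subset[OF N(1) _ Int_lower1]) simp
 then have "snd c ` (N \<inter> fst c) \<in> null_sets lborel" using null_chart[OF c Nb] by auto
 then have "AE y in lborel. y \<notin> snd c ` (N \<inter> fst c)" by (rule AE_not_in)
 then have "AE y in lborel. y \<in> img c \<longrightarrow> P (chart_inv c y)"
  by eventually_elim (use N(2) c in auto)
 then show ?thesis by (rule AE_completion)
qed

lemma AE_chart_imp_vol:
 assumes P: "\<And>c. c \<in> \<A> ==> AE y in lebesgue. y \<in> img c \<longrightarrow> P (chart_inv c y)"
 shows "AE x in vol. P x"
proof -
 have "AE x in vol0. x \<in> fst (chart_seq n) \<longrightarrow> P x" for n
 proof -
  let ?c = "chart_seq n"
  have c: "?c \<in> \<A>" by (rule chart_seq)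
  have "AE y in lborel. y \<in> img ?c \<longrightarrow> P (chart_inv ?c y)" using P[OF c] by (simp add: AE_completion_iff)
  then obtain N where N: "N \<in> null_sets lborel" "{y. \<not> (y \<in> img ?c \<longrightarrow> P (chart_inv ?c y))} \<subseteq> N"
   by (auto simp: eventually_ae_filter)
  define B where "B = fst ?c \<inter> snd ?c -` N"
  have m: "snd ?c \<in> measurable (restrict_space borel (fst ?c)) borel"
   by (rule borel_measurable_continuous_on_restrict[OF cont_chart[OF c]])
  have Nb: "N \<in> sets borel" using N(1) by (auto simp: null_sets_def)
  have "B \<in> sets (restrict_space borel (fst ?c))"
   using measurable_sets[OF m Nb] by (simp add: B_def space_restrict_space Int_commute)
  then have Bb: "B \<in> sets borel" "B \<subseteq> fst ?c" using dom_borel[OF c] by (auto simp: sets_restrict_space B_def)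
  have "snd ?c ` B \<subseteq> N" by (auto simp: B_def)
  then have "snd ?c ` B \<in> null_sets lborel" using N(1) image_chart_borel[OF c Bb] by (auto intro: null_sets_subset)
  then have "B \<in> null_sets vol0" using null_chart[OF c Bb] by simp
  then have "AE x in vol0. x \<notin> B" by (rule AE_not_in)
  then show ?thesis
  proof eventually_elim
   case (elim x)
   show ?case
   proof
    assume x: "x \<in> fst ?c"
    then have "snd ?c x \<notin> N" using elim by (auto simp: B_def)
    then have "P (chart_inv ?c (snd ?c x))" using N(2) x by blast
    then show "P x" using c x by simp
   qed
  qed
 qed
 then have "AE x in vol0. \<forall>n. x \<in> fst (chart_seq n) \<longrightarrow> P x" unfolding AE_all_countable ..
 then have "AE x in vol0. P x" by eventually_elim (use chart_seq(2) in blast)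
 then show ?thesis unfolding AE_vol_iff .
qed

lemma measurable_vol_imp_chart:
 fixes f :: "'a \<Rightarrow> real"
 assumes c: "c \<in> \<A>" and f: "f \<in> borel_measurable vol"
 shows "(\<lambda>y. f (chart_inv c y)) \<in> borel_measurable (lebesgue_on (img c))"
proof -
 obtain f' where f': "f' \<in> borel_measurable vol0" "AE x in vol0. f x = f' x"
  using completion_ex_borel_measurable_real f unfolding volume_measure_eq by blast
 have "AE x in vol. x \<in> fst c \<longrightarrow> f x = f' x" unfolding AE_vol_iff using f'(2) by eventually_elim simp
 from AE_vol_imp_chart[OF c this] have ae: "AE y in lebesgue. y \<in> img c \<longrightarrow> f (chart_inv c y) = f' (chart_inv c y)" .
 have mf': "f' \<in> borel_measurable borel" using f'(1) by (simp cong: measurable_cong_sets)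
 have "(\<lambda>y. f' (chart_inv c y)) \<in> borel_measurable (restrict_space borel (img c))"
  using measurable_compose[OF measurable_chart_inv[OF c] mf'] .
 then have "(\<lambda>y. indicator (img c) y *\<^sub>R f' (chart_inv c y)) \<in> borel_measurable borel"
  using img_borel[OF c] by (subst (asm) borel_measurable_restrict_space_iff) auto
 then have "(\<lambda>y. indicator (img c) y *\<^sub>R f' (chart_inv c y)) \<in> borel_measurable lebesgue"
  by (intro measurable_completion) (simp cong: measurable_cong_sets)
 then have "(\<lambda>y. indicator (img c) y *\<^sub>R f (chart_inv c y)) \<in> borel_measurable lebesgue"
  by (rule borel_measurable_AE) (use ae in \<open>eventually_elim, auto simp: indicator_def\<close>)
 then show ?thesis using img_borel[OF c] by (subst borel_measurable_restrict_space_iff) auto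
qed

text \<open>Each chart yields a Borel representative on its piece; selection by the index of the
  piece glues the countably many representatives into one.\<close>

lemma measurable_chart_imp_vol:
 fixes f :: "'a \<Rightarrow> real"
 assumes f: "\<And>c. c \<in> \<A> ==> (\<lambda>y. f (chart_inv c y)) \<in> borel_measurable (lebesgue_on (img c))"
 shows "f \<in> borel_measurable vol"
proof -
 have "\<exists>h. h \<in> borel_measurable vol0 \<and> (AE x in vol0. x \<in> piece n \<longrightarrow> f x = h x)" for n
 proof -
  let ?c = "chart_seq n"
  have c: "?c \<in> \<A>" by (rule chart_seq)
  have "(\<lambda>y. indicator (img ?c) y *\<^sub>R f (chart_inv ?c y)) \<in> borel_measurable lebesgue"
   using f[OF c] img_borel[OF c] by (subst (asm) borel_measurable_restrict_space_iff) auto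
  then obtain k where k: "k \<in> borel_measurable lborel" "AE y in lborel. indicator (img ?c) y *\<^sub>R f (chart_inv ?c y) = k y"
   using completion_ex_borel_measurable_real by blast
  have m: "snd ?c \<in> measurable (restrict_space borel (fst ?c)) borel"
   by (rule borel_measurable_continuous_on_restrict[OF cont_chart[OF c]])
  have "(\<lambda>x. k (snd ?c x)) \<in> borel_measurable (restrict_space borel (fst ?c))"
   using measurable_compose[OF m] k(1) by simp
  then have h: "(\<lambda>x. indicator (fst ?c) x *\<^sub>R k (snd ?c x)) \<in> borel_measurable borel"
   using dom_borel[OF c] by (subst (asm) borel_measurable_restrict_space_iff) auto
  \<comment> \<open>The exceptional set is null in the chart of the piece; \<open>vol0\<close>
    carries this into an arbitrary chart d, as \<open>AE_chart_imp_vol\<close> requires.\<close>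
  have ae: "AE y in lebesgue. y \<in> img d \<longrightarrow> (chart_inv d y \<in> fst ?c \<longrightarrow> f (chart_inv d y) = k (snd ?c (chart_inv d y)))"
   if d: "d \<in> \<A>" for d
  proof -
   obtain N where N: "N \<in> null_sets lborel" "{y. indicator (img ?c) y *\<^sub>R f (chart_inv ?c y) \<noteq> k y} \<subseteq> N"
    using k(2) by (auto simp: eventually_ae_filter)
   define B where "B = fst ?c \<inter> snd ?c -` N"
   have Nb: "N \<in> sets borel" using N(1) by (auto simp: null_sets_def)
   have "B \<in> sets (restrict_space borel (fst ?c))"
    using measurable_sets[OF m Nb] by (simp add: B_def space_restrict_space Int_commute)
   then have Bb: "B \<in> sets borel" "B \<subseteq> fst ?c" using dom_borel[OF c] by (auto simp: sets_restrict_space B_def)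
   have "snd ?c ` B \<subseteq> N" by (auto simp: B_def)
   then have "snd ?c ` B \<in> null_sets lborel" using N(1) image_chart_borel[OF c Bb] by (auto intro: null_sets_subset)
   then have "B \<in> null_sets vol0" using null_chart[OF c Bb] by simp
   then have "AE x in vol0. x \<notin> B" by (rule AE_not_in)
   then have "AE x in vol. x \<in> fst d \<longrightarrow> x \<notin> B" unfolding AE_vol_iff by eventually_elim simp
   from AE_vol_imp_chart[OF d this] show ?thesis
   proof eventually_elim
    case (elim y)
    show ?case
    proof (intro impI)
     let ?x = "chart_inv d y"
     assume y: "y \<in> img d" and x: "?x \<in> fst ?c"
     then have "snd ?c ?x \<notin> N" using elim by (auto simp: B_def)
     then have "indicator (img ?c) (snd ?c ?x) *\<^sub>R f (chart_inv ?c (snd ?c ?x)) = k (snd ?c ?x)" using N(2) by blast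
     then show "f ?x = k (snd ?c ?x)" using x c by simp
    qed
   qed
  qed
  have "AE x in vol. x \<in> fst ?c \<longrightarrow> f x = k (snd ?c x)" by (rule AE_chart_imp_vol[OF ae])
  then have "AE x in vol0. x \<in> fst ?c \<longrightarrow> f x = k (snd ?c x)" unfolding AE_vol_iff .
  then have "AE x in vol0. x \<in> piece n \<longrightarrow> f x = indicator (fst ?c) x *\<^sub>R k (snd ?c x)"
   by eventually_elim (use piece(3)[of n] in auto)
  then show ?thesis using h by (intro exI[of _ "\<lambda>x. indicator (fst ?c) x *\<^sub>R k (snd ?c x)"]) (simp cong: measurable_cong_sets)
 qed
 then obtain h where h: "\<And>n. h n \<in> borel_measurable vol0" "\<And>n. AE x in vol0. x \<in> piece n \<longrightarrow> f x = h n x" by metis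
 have ex1: "\<exists>n. x \<in> piece n" for x using piece(2) by blast
 define nn where "nn x = (LEAST n. x \<in> piece n)" for x
 have nn: "x \<in> piece (nn x)" for x unfolding nn_def using ex1[of x] by (rule LeastI_ex)
 have uniq: "x \<in> piece n \<longleftrightarrow> nn x = n" for x n
  using nn[of x] piece(1) by (auto simp: disjoint_family_on_def)
 have mn: "nn \<in> measurable vol0 (count_space UNIV)"
 proof (subst measurable_count_space_eq_countable, simp, intro conjI ballI)
  fix n
  have "nn -` {n} = piece n" using uniq by auto
  then show "nn -` {n} \<inter> space vol0 \<in> sets vol0" using piece(4)[of n] by simp
 qed simp
 have "(\<lambda>x. h (nn x) x) \<in> borel_measurable vol0"
  by (rule measurable_compose_countable[OF h(1) mn])
 moreover have "AE x in vol0. f x = h (nn x) x"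
 proof -
  have "AE x in vol0. \<forall>n. x \<in> piece n \<longrightarrow> f x = h n x" using h(2) by (simp add: AE_all_countable)
  then show ?thesis by eventually_elim (use nn in auto)
 qed
 ultimately have m: "(\<lambda>x. h (nn x) x) \<in> borel_measurable (completion vol0)" and ae: "AE x in completion vol0. f x = h (nn x) x"
  by (auto intro: measurable_completion AE_completion)
 have "AE x in completion vol0. h (nn x) x = f x" using ae by eventually_elim simp
 then show ?thesis unfolding volume_measure_eq by (rule borel_measurable_completion_AE[OF m])
qed

text \<open>On a compact set \<open>vdens\<close> is bounded below by a positive constant, so
  integrability with the density implies integrability without it.\<close>

lemma set_integrable_chart:
 fixes f :: "'a \<Rightarrow> real"
 assumes c: "c \<in> \<A>" and f: "(\<lambda>y. f (chart_inv c y)) \<in> borel_measurable (lebesgue_on (img c))"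
  "f \<in> borel_measurable vol" and K: "compact K" "K \<subseteq> fst c"
  and i: "set_integrable vol K f"
 shows "set_integrable lebesgue (snd c ` K) (\<lambda>y. f (chart_inv c y))"
proof -
 obtain f' where f': "f' \<in> borel_measurable vol0" "AE x in vol0. f x = f' x"
  using completion_ex_borel_measurable_real f(2) unfolding volume_measure_eq by blast
 have mf' [measurable]: "f' \<in> borel_measurable borel" using f'(1) by (simp cong: measurable_cong_sets)
 have Kb: "K \<in> sets borel" using K(1) by (simp add: compact_imp_closed)
 have S: "snd c ` K \<in> sets borel" by (rule image_chart_borel[OF c Kb K(2)])
 have sub: "snd c ` K \<subseteq> img c" using K by auto
 have cK: "compact (snd c ` K)" by (rule compact_chart_image[OF c K])
 have ae: "AE y in lebesgue. y \<in> img c \<longrightarrow> f (chart_inv c y) = f' (chart_inv c y)"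
 proof (rule AE_vol_imp_chart[OF c])
  show "AE x in vol. x \<in> fst c \<longrightarrow> f x = f' x" unfolding AE_vol_iff using f'(2) by eventually_elim simp
 qed
 have "set_integrable vol K f \<longleftrightarrow> (\<integral>\<^sup>+x. ennreal \<bar>indicator K x * f x\<bar> \<partial>vol) < \<infinity>"
 proof -
  have "(\<lambda>x. indicator K x * f x) \<in> borel_measurable vol"
   using f(2) Kb by (intro borel_measurable_times borel_measurable_indicator) auto
  then show ?thesis unfolding set_integrable_def integrable_iff_bounded by simp
 qed
 also have "(\<integral>\<^sup>+x. ennreal \<bar>indicator K x * f x\<bar> \<partial>vol) = (\<integral>\<^sup>+x. ennreal \<bar>indicator K x * f x\<bar> \<partial>vol0)"
  unfolding volume_measure_eq by (rule nn_integral_completion)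
 also have "\<dots> = (\<integral>\<^sup>+x\<in>fst c. ennreal \<bar>indicator K x * f' x\<bar> \<partial>vol0)"
  by (rule nn_integral_cong_AE, use f'(2) in eventually_elim) (use K in \<open>auto simp: indicator_def\<close>)
 also have "\<dots> = (\<integral>\<^sup>+y\<in>img c. ennreal (vdens c y) * ennreal \<bar>indicator K (chart_inv c y) * f' (chart_inv c y)\<bar> \<partial>lborel)"
  by (intro nn_integral_vol0_chart[OF c]) (use Kb in measurable)
 also have "\<dots> = (\<integral>\<^sup>+y\<in>img c. ennreal (vdens c y) * ennreal \<bar>indicator K (chart_inv c y) * f' (chart_inv c y)\<bar> \<partial>lebesgue)"
  by (rule nn_integral_completion[symmetric])
 also have "\<dots> = (\<integral>\<^sup>+y. ennreal \<bar>indicator (snd c ` K) y * f (chart_inv c y) * vdens c y\<bar> \<partial>lebesgue)"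
 proof (rule nn_integral_cong_AE, use ae in eventually_elim)
  case (elim y)
  have "y \<in> snd c ` K \<longleftrightarrow> y \<in> img c \<and> chart_inv c y \<in> K"
   using K c by (auto intro!: image_eqI[of _ "snd c"])
  then show ?case using elim vdens_pos[OF c, of y]
   by (cases "y \<in> snd c ` K") (auto simp: ennreal_mult'[symmetric] abs_mult mult.commute)
 qed
 finally have fin: "(\<integral>\<^sup>+y. ennreal \<bar>indicator (snd c ` K) y * f (chart_inv c y) * vdens c y\<bar> \<partial>lebesgue) < \<infinity>" using i by simp
 obtain b where b: "b > 0" "\<And>y. y \<in> snd c ` K ==> b \<le> vdens c y"
 proof (cases "snd c ` K = {}")
  case False
  from continuous_attains_inf[OF cK False continuous_on_subset[OF continuous_vdens[OF c] sub]]
  obtain y1 where "y1 \<in> snd c ` K" "\<And>y. y \<in> snd c ` K ==> vdens c y1 \<le> vdens c y" by auto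
  then show ?thesis using that vdens_pos[OF c subsetD[OF sub]] by blast
 qed (use that[of 1] in simp)
 have mm: "(\<lambda>y. indicator (snd c ` K) y * f (chart_inv c y)) \<in> borel_measurable lebesgue"
 proof -
  have "(\<lambda>y. indicator (img c) y *\<^sub>R f (chart_inv c y)) \<in> borel_measurable lebesgue"
   using f(1) img_borel[OF c] by (subst (asm) borel_measurable_restrict_space_iff) auto
  then have "(\<lambda>y. indicator (snd c ` K) y * (indicator (img c) y *\<^sub>R f (chart_inv c y))) \<in> borel_measurable lebesgue"
   using S by (intro borel_measurable_times borel_measurable_indicator) auto
  moreover have "(\<lambda>y. indicator (snd c ` K) y * (indicator (img c) y *\<^sub>R f (chart_inv c y))) = (\<lambda>y. indicator (snd c ` K) y * f (chart_inv c y))"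
   using sub by (auto simp: fun_eq_iff indicator_def)
  ultimately show ?thesis by (simp only:)
 qed
 let ?I = "\<lambda>k. (\<integral>\<^sup>+y. ennreal \<bar>indicator (snd c ` K) y * f (chart_inv c y) * k y\<bar> \<partial>lebesgue)"
 have l: "ennreal b * ?I (\<lambda>_. 1) \<le> ?I (vdens c)"
 proof -
  have "ennreal b * ?I (\<lambda>_. 1) = (\<integral>\<^sup>+y. ennreal b * ennreal \<bar>indicator (snd c ` K) y * f (chart_inv c y) * 1\<bar> \<partial>lebesgue)"
   using mm by (intro nn_integral_cmult[symmetric]) auto
  also have "\<dots> \<le> ?I (vdens c)"
  proof (rule nn_integral_mono)
   fix y show "ennreal b * ennreal \<bar>indicator (snd c ` K) y * f (chart_inv c y) * 1\<bar> \<le> ennreal \<bar>indicator (snd c ` K) y * f (chart_inv c y) * vdens c y\<bar>"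
    using b(1) b(2)[of y] mult_left_mono[of b "vdens c y" "\<bar>f (chart_inv c y)\<bar>"]
    by (auto simp: indicator_def ennreal_mult'[symmetric] abs_mult mult.commute intro!: ennreal_leI)
  qed
  finally show ?thesis .
 qed
 have "ennreal b * ?I (\<lambda>_. 1) < \<infinity>" using l fin by (rule le_less_trans)
 then have "(\<integral>\<^sup>+y. ennreal \<bar>indicator (snd c ` K) y * f (chart_inv c y)\<bar> \<partial>lebesgue) < \<infinity>"
  using b(1) by (auto simp: ennreal_mult_less_top)
 then show ?thesis using mm unfolding set_integrable_def integrable_iff_bounded by simp
qed

section \<open>C1 functions and gradients\<close>

definition dif :: "('a \<Rightarrow> real) \<Rightarrow> ('a, 'm) chart \<Rightarrow> real ^ 'm \<Rightarrow> real ^ 'm \<Rightarrow> real" where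
 "dif f c y = frechet_derivative (\<lambda>y. f (chart_inv c y)) (at y)"

definition C1M :: "'a set \<Rightarrow> ('a \<Rightarrow> real) \<Rightarrow> bool" where
 "C1M W f \<longleftrightarrow> (\<forall>c\<in>\<A>.
  (\<forall>y\<in>imgs c W. ((\<lambda>y. f (chart_inv c y)) has_derivative dif f c y) (at y)) \<and>
  (\<forall>v. continuous_on (imgs c W) (\<lambda>y. dif f c y v)))"

lemma C1M_has_derivative:
 "C1M W f ==> c \<in> \<A> ==> y \<in> imgs c W ==> ((\<lambda>y. f (chart_inv c y)) has_derivative dif f c y) (at y)"
 unfolding C1M_def by blast

lemma C1M_continuous_dif:
 "C1M W f ==> c \<in> \<A> ==> continuous_on (imgs c W) (\<lambda>y. dif f c y v)"
 unfolding C1M_def by blast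

lemma linear_dif: "C1M W f ==> c \<in> \<A> ==> y \<in> imgs c W ==> linear (dif f c y)"
 by (rule has_derivative_linear[OF C1M_has_derivative])

lemma C1M_continuous:
 "C1M W f ==> c \<in> \<A> ==> continuous_on (imgs c W) (\<lambda>y. f (chart_inv c y))"
 by (intro continuous_at_imp_continuous_on ballI has_derivative_continuous[OF C1M_has_derivative])

text \<open>Naming a candidate D proves regularity and evaluates \<open>dif\<close> at once; the
  rules for products, sums and compositions below are instances.\<close>

lemma C1MI:
 assumes D: "\<And>c y. c \<in> \<A> ==> y \<in> imgs c W ==> ((\<lambda>y. f (chart_inv c y)) has_derivative D c y) (at y)"
  and C: "\<And>c v. c \<in> \<A> ==> continuous_on (imgs c W) (\<lambda>y. D c y v)"
 shows "C1M W f"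
  and "\<And>c y. c \<in> \<A> ==> y \<in> imgs c W ==> dif f c y = D c y"
proof -
 show d: "dif f c y = D c y" if "c \<in> \<A>" "y \<in> imgs c W" for c y
  unfolding dif_def by (rule frechet_derivativeI[OF D[OF that]])
 show "C1M W f"
  unfolding C1M_def
 proof (intro ballI conjI allI)
  fix c assume c: "c \<in> \<A>"
  show "((\<lambda>y. f (chart_inv c y)) has_derivative dif f c y) (at y)" if "y \<in> imgs c W" for y
   unfolding d[OF c that] by (rule D[OF c that])
  show "continuous_on (imgs c W) (\<lambda>y. dif f c y v)" for v
   using C[OF c, of v] by (rule continuous_on_eq) (simp only: d[OF c])
 qed
qed

lemma open_chart_Int: "c \<in> \<A> ==> open W ==> open (imgs c W)"
 by (intro open_image_chart) (auto intro: open_dom)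

lemma C1M_cong:
 assumes W: "open W" and eq: "\<And>x. x \<in> W ==> h x = f x" and f: "C1M W f"
 shows "C1M W h" "\<And>c y. c \<in> \<A> ==> y \<in> imgs c W ==> dif h c y = dif f c y"
proof -
 have D: "((\<lambda>y. h (chart_inv c y)) has_derivative dif f c y) (at y)" if "c \<in> \<A>" "y \<in> imgs c W" for c y
  by (rule has_derivative_transform_within_open[OF C1M_has_derivative[OF f that] open_chart_Int[OF that(1) W] that(2)])
   (use eq that in auto)
 show "C1M W h" "\<And>c y. c \<in> \<A> ==> y \<in> imgs c W ==> dif h c y = dif f c y"
  by (rule C1MI[OF D C1M_continuous_dif[OF f]], assumption+)+
qed

lemma C1M_subset: "C1M W f ==> W' \<subseteq> W ==> C1M W' f"
 unfolding C1M_def by (blast intro: continuous_on_subset)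

lemma C1M_Un:
 assumes "open W" "open W'" "C1M W f" "C1M W' f"
 shows "C1M (W \<union> W') f"
 unfolding C1M_def
proof (intro ballI conjI allI)
 fix c assume c: "c \<in> \<A>"
 have U: "snd c ` (fst c \<inter> (W \<union> W')) = imgs c W \<union> imgs c W'" by auto
 show "((\<lambda>y. f (chart_inv c y)) has_derivative dif f c y) (at y)" if "y \<in> snd c ` (fst c \<inter> (W \<union> W'))" for y
  using that C1M_has_derivative[OF assms(3) c] C1M_has_derivative[OF assms(4) c] unfolding U by blast
 show "continuous_on (snd c ` (fst c \<inter> (W \<union> W'))) (\<lambda>y. dif f c y v)" for v
  unfolding U using assms by (intro continuous_on_open_Un open_chart_Int C1M_continuous_dif c)
qed

lemma C1M_const: "C1M W (\<lambda>_. k)" "c \<in> \<A> ==> x \<in> fst c ==> dif (\<lambda>_. k) c (snd c x) = (\<lambda>_. 0)"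
 by (rule C1MI(1)[where D = "\<lambda>_ _ _. 0"], auto)
  (simp add: dif_def frechet_derivativeI[OF has_derivative_const])

lemma C1M_mult:
 assumes "C1M W f" "C1M W h"
 shows "C1M W (\<lambda>x. f x * h x)"
  and "\<And>c y. c \<in> \<A> ==> y \<in> imgs c W ==>
   dif (\<lambda>x. f x * h x) c y = (\<lambda>v. f (chart_inv c y) * dif h c y v + dif f c y v * h (chart_inv c y))"
 by (rule C1MI[where D = "\<lambda>c y v. f (chart_inv c y) * dif h c y v + dif f c y v * h (chart_inv c y)"],
   (intro has_derivative_mult continuous_on_add continuous_on_mult C1M_has_derivative[OF assms(1)] C1M_has_derivative[OF assms(2)]
    C1M_continuous[OF assms(1)] C1M_continuous[OF assms(2)]
    C1M_continuous_dif[OF assms(1)] C1M_continuous_dif[OF assms(2)], assumption+)+)+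

lemma C1M_sum:
 assumes "finite I" "\<And>i. i \<in> I ==> C1M W (f i)"
 shows "C1M W (\<lambda>x. \<Sum>i\<in>I. f i x)"
  and "\<And>c y. c \<in> \<A> ==> y \<in> imgs c W ==> dif (\<lambda>x. \<Sum>i\<in>I. f i x) c y = (\<lambda>v. \<Sum>i\<in>I. dif (f i) c y v)"
 by (rule C1MI[where D = "\<lambda>c y v. \<Sum>i\<in>I. dif (f i) c y v"],
   (intro has_derivative_sum continuous_on_sum C1M_has_derivative[OF assms(2)] C1M_continuous_dif[OF assms(2)], assumption+)+)+

lemma C1M_compose:
 assumes f: "C1M W f" and \<psi>: "\<And>x. x \<in> W ==> (\<psi> has_real_derivative \<psi>' (f x)) (at (f x))"
  and c\<psi>: "continuous_on (f ` W) \<psi>'"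
 shows "C1M W (\<lambda>x. \<psi> (f x))"
  and "\<And>c y. c \<in> \<A> ==> y \<in> imgs c W ==> dif (\<lambda>x. \<psi> (f x)) c y = (\<lambda>v. \<psi>' (f (chart_inv c y)) * dif f c y v)"
proof -
 have D: "((\<lambda>y. \<psi> (f (chart_inv c y))) has_derivative (\<lambda>v. \<psi>' (f (chart_inv c y)) * dif f c y v)) (at y)"
  if c: "c \<in> \<A>" and y: "y \<in> imgs c W" for c y
 proof -
  have "chart_inv c y \<in> W" using c y by auto
  from has_derivative_compose[OF C1M_has_derivative[OF f c y] \<psi>[OF this, unfolded has_field_derivative_def]]
  show ?thesis by (simp add: mult.commute)
 qed
 have C: "continuous_on (imgs c W) (\<lambda>y. \<psi>' (f (chart_inv c y)) * dif f c y v)" if c: "c \<in> \<A>" for c v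
  using c by (intro continuous_on_mult C1M_continuous_dif[OF f c] continuous_on_compose2[OF c\<psi> C1M_continuous[OF f c]]) auto
 show "C1M W (\<lambda>x. \<psi> (f x))" by (rule C1MI(1)[OF D C])
 show "\<And>c y. c \<in> \<A> ==> y \<in> imgs c W ==> dif (\<lambda>x. \<psi> (f x)) c y = (\<lambda>v. \<psi>' (f (chart_inv c y)) * dif f c y v)"
  by (rule C1MI(2)[OF D C])
qed

lemma C1M_chart:
 assumes d: "d \<in> \<A>" and V: "open V" "V \<subseteq> img d"
  and h: "\<And>z. z \<in> V ==> h differentiable (at z)"
  and ch: "\<And>v. continuous_on V (\<lambda>z. ddir h z v)"
 shows "C1M (chart_inv d ` V) (\<lambda>x. h (snd d x))"
  and "\<And>x. x \<in> chart_inv d ` V ==> dif (\<lambda>x. h (snd d x)) d (snd d x) = frechet_derivative h (at (snd d x))"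
proof -
 let ?W = "chart_inv d ` V"
 let ?D = "\<lambda>c y v. frechet_derivative h (at (transition c d y)) (frechet_derivative (transition c d) (at y) v)"
 have Wd: "?W \<subseteq> fst d" using V by auto
 have D: "((\<lambda>y. h (snd d (chart_inv c y))) has_derivative ?D c y) (at y)"
  if c: "c \<in> \<A>" and y: "y \<in> snd c ` (fst c \<inter> ?W)" for c y
 proof -
  obtain x where x: "y = snd c x" "x \<in> fst c" "x \<in> ?W" using y by auto
  have xV: "snd d x \<in> V" "x \<in> fst d" using x(3) V by auto
  have "(transition c d has_derivative frechet_derivative (transition c d) (at y)) (at y)"
   using transition_has_derivative[OF c d x(2) xV(2)] by (simp add: dtrans_def x(1))
  moreover have "(h has_derivative frechet_derivative h (at (transition c d y))) (at (transition c d y))"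
   using h[OF xV(1)] c x by (simp add: frechet_derivative_works)
  ultimately show ?thesis using has_derivative_compose by (fastforce simp: transition_def)
 qed
 have C: "continuous_on (snd c ` (fst c \<inter> ?W)) (\<lambda>y. ?D c y v)" if c: "c \<in> \<A>" for c v
 proof -
  let ?U = "snd c ` (fst c \<inter> ?W)"
  have U: "?U \<subseteq> snd c ` (fst c \<inter> fst d)" using Wd by auto
  have T: "continuous_on ?U (\<lambda>y. frechet_derivative (transition c d) (at y) v)"
   using transition_Ck[OF c d, of "Suc 0"] by (intro continuous_on_subset[OF _ U]) simp
  have T0: "continuous_on ?U (transition c d)"
   using transition_Ck[OF c d, of 0] by (intro continuous_on_subset[OF _ U]) simp
  have TV: "transition c d y \<in> V" if "y \<in> ?U" for y using that c V by auto
  \<comment> \<open>The continuity hypothesis on h concerns fixed directions, while the direction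
    here moves with y; expansion in the standard basis reduces to fixed ones.\<close>
  have e: "?D c y v = (\<Sum>i\<in>UNIV. frechet_derivative (transition c d) (at y) v $ i * frechet_derivative h (at (transition c d y)) (axis i 1))"
   if "y \<in> ?U" for y
  proof -
   have l: "linear (frechet_derivative h (at (transition c d y)))" using h[OF TV[OF that]] by (rule linear_frechet_derivative)
   have "?D c y v = frechet_derivative h (at (transition c d y)) (\<Sum>i\<in>UNIV. frechet_derivative (transition c d) (at y) v $ i *\<^sub>R axis i 1)"
    using basis_expansion[of "frechet_derivative (transition c d) (at y) v"] by (simp add: scalar_mult_eq_scaleR)
   then show ?thesis using l by (simp add: linear_sum linear_cmul)
  qed
  have "continuous_on ?U (\<lambda>y. \<Sum>i\<in>UNIV. frechet_derivative (transition c d) (at y) v $ i * frechet_derivative h (at (transition c d y)) (axis i 1))"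
   using T TV by (intro continuous_intros continuous_on_compose2[OF ch T0]) auto
  then show ?thesis by (rule continuous_on_eq) (simp only: e)
 qed
 show "C1M ?W (\<lambda>x. h (snd d x))" by (rule C1MI(1)[OF D C])
 fix x assume x: "x \<in> ?W"
 have xd: "x \<in> fst d" using x Wd by auto
 have "dif (\<lambda>x. h (snd d x)) d (snd d x) = ?D d (snd d x)"
  by (rule C1MI(2)[OF D C d]) (use x xd in auto)
 also have "\<dots> = frechet_derivative h (at (snd d x))"
  using dtrans_self[OF d xd] d xd by (simp add: dtrans_def)
 finally show "dif (\<lambda>x. h (snd d x)) d (snd d x) = frechet_derivative h (at (snd d x))" .
qed

lemma dif_chart_change:
 assumes f: "C1M W f" and x: "x \<in> W" and c: "c \<in> \<A>" "x \<in> fst c" and d: "d \<in> \<A>" "x \<in> fst d"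
 shows "dif f c (snd c x) v = dif f d (snd d x) (dtrans c d x v)"
proof -
 have "((\<lambda>y. f (chart_inv d y)) has_derivative dif f d (snd d x)) (at (transition c d (snd c x)))"
  using C1M_has_derivative[OF f d(1)] x d c by auto
 from has_derivative_compose[OF transition_has_derivative[OF c(1) d(1) c(2) d(2)] this]
 have "((\<lambda>y. f (chart_inv d (transition c d y))) has_derivative (\<lambda>v. dif f d (snd d x) (dtrans c d x v))) (at (snd c x))" .
 then have "((\<lambda>y. f (chart_inv c y)) has_derivative (\<lambda>v. dif f d (snd d x) (dtrans c d x v))) (at (snd c x))"
 proof (rule has_derivative_transform_within_open)
  show "open (snd c ` (fst c \<inter> fst d))" by (rule open_overlap[OF c(1) d(1)])
 qed (use c d in \<open>auto simp: transition_def\<close>)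
 then show ?thesis unfolding dif_def[of f c] by (simp add: frechet_derivativeI)
qed

lemma lnorm_chart_change:
 assumes c: "c \<in> \<A>" "x \<in> fst c" and d: "d \<in> \<A>" "x \<in> fst d"
 shows "lnorm d (snd d x) (dtrans c d x v) = lnorm c (snd c x) v"
 using tangent_eq_tvec_of[OF tvec_of_in[OF c, of v] d] d
 by (simp add: lnorm_eq_tnorm[OF c] lnorm_eq_tnorm[OF d] tvec_of_eq[of c])

text \<open>A bound of the differential by the metric norm does not depend on the chart, so it can
  be proved in a well-adapted chart and used in any other.\<close>

lemma dif_bound_chart_change:
 assumes f: "C1M W f" and x: "x \<in> W" and c: "c \<in> \<A>" "x \<in> fst c" and d: "d \<in> \<A>" "x \<in> fst d"
  and b: "\<And>v. \<bar>dif f d (snd d x) v\<bar> \<le> N * lnorm d (snd d x) v"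
 shows "\<bar>dif f c (snd c x) v\<bar> \<le> N * lnorm c (snd c x) v"
 unfolding dif_chart_change[OF f x c d] lnorm_chart_change[OF c d, symmetric] by (rule b)

text \<open>Cramer's rule for the vector that represents the linear form l through the metric. The
  explicit formula shows that gradients are continuous in coordinates, which mere existence would
  not.\<close>

definition riesz :: "('a, 'm) chart \<Rightarrow> real ^ 'm \<Rightarrow> (real ^ 'm \<Rightarrow> real) \<Rightarrow> real ^ 'm" where
 "riesz c y l = (\<chi> k. det (\<chi> i j. if j = k then l (axis i 1) else gram c y $ i $ j) / det (gram c y))"

lemma lm_riesz:
 assumes c: "c \<in> \<A>" and y: "y \<in> img c" and l: "linear l"
 shows "lm c y (riesz c y l) v = l v"
proof -
 have "riesz c y l = (\<chi> k. det (\<chi> i j. if j = k then (\<chi> i. l (axis i 1)) $ i else gram c y $ i $ j) / det (gram c y))"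
  unfolding riesz_def by (simp only: vec_lambda_beta cong: if_cong)
 then have "gram c y *v riesz c y l = (\<chi> i. l (axis i 1))"
  using cramer[of "gram c y" "riesz c y l" "\<chi> i. l (axis i 1)"] det_gram_pos[OF c y] by simp
 then have "lm c y v (riesz c y l) = v \<bullet> (\<chi> i. l (axis i 1))" by (simp add: inner_gram[OF c y, symmetric])
 also have "\<dots> = l (\<Sum>i\<in>UNIV. v $ i *\<^sub>R axis i 1)" using l by (simp add: inner_vec_def linear_sum linear_cmul)
 also have "\<dots> = l v" using basis_expansion[of v] by (simp add: scalar_mult_eq_scaleR)
 finally show ?thesis using lm_bilinear(3)[OF c y] by simp
qed

definition grad :: "('a \<Rightarrow> real) \<Rightarrow> 'a \<Rightarrow> ('a, 'm) tvec" where
 "grad f x = (SOME \<xi>. \<xi> \<in> TM x \<and>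
  (\<forall>c\<in>\<A>. x \<in> fst c \<longrightarrow> (\<forall>v. g x \<xi> (tv c x v) = dif f c (snd c x) v)))"

lemma grad:
 assumes f: "C1M W f" and x: "x \<in> W"
 shows grad_in: "grad f x \<in> TM x"
  and g_grad: "c \<in> \<A> ==> x \<in> fst c ==> g x (grad f x) (tv c x v) = dif f c (snd c x) v"
proof -
 obtain d where d: "d \<in> \<A>" "x \<in> fst d" by (rule chart_cover)
 have l: "linear (dif f d (snd d x))" using f d(1) by (rule linear_dif) (use d x in auto)
 let ?\<xi> = "tv d x (riesz d (snd d x) (dif f d (snd d x)))"
 have "g x ?\<xi> (tv c x v) = dif f c (snd c x) v" if c: "c \<in> \<A>" "x \<in> fst c" for c v
  unfolding dif_chart_change[OF f x c d]
  using g_eq_lm[OF d tvec_of_in[OF d] tvec_of_in[OF c]] lm_riesz[OF d(1) _ l] d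
  by (simp add: tvec_of_eq[of c])
 then have "\<exists>\<xi>. \<xi> \<in> TM x \<and> (\<forall>c\<in>\<A>. x \<in> fst c \<longrightarrow> (\<forall>v. g x \<xi> (tv c x v) = dif f c (snd c x) v))"
  using tvec_of_in[OF d] by blast
 from someI_ex[OF this] show "grad f x \<in> TM x"
  "c \<in> \<A> ==> x \<in> fst c ==> g x (grad f x) (tv c x v) = dif f c (snd c x) v"
  unfolding grad_def by blast+
qed

lemma tangent_nondegenerate:
 assumes c: "c \<in> \<A>" "x \<in> fst c" and \<xi>: "\<xi> \<in> TM x" "\<eta> \<in> TM x"
  and eq: "\<And>v. g x \<xi> (tv c x v) = g x \<eta> (tv c x v)"
 shows "\<xi> = \<eta>"
proof -
 let ?z = "\<lambda>c. 1 *\<^sub>R \<xi> c + (- 1) *\<^sub>R \<eta> c"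
 have z: "?z \<in> TM x" using \<xi> by (rule tangent_comb)
 have "g x ?z ?z = g x \<xi> ?z - g x \<eta> ?z" unfolding g_left[OF \<xi> z] by simp
 also have "\<dots> = 0" using eq[of "?z c"] tangent_eq_tvec_of[OF z c] by simp
 finally have "?z = (\<lambda>_. 0)" using g_pos[OF z] by fastforce
 then show ?thesis by (auto simp: fun_eq_iff)
qed

text \<open>Evaluation at the gradient itself: |grad f|^2 = df(grad f) \<le> N |grad f|.\<close>

lemma tnorm_grad_le:
 assumes f: "C1M W f" and x: "x \<in> W" and c: "c \<in> \<A>" "x \<in> fst c"
  and b: "\<And>v. \<bar>dif f c (snd c x) v\<bar> \<le> N * lnorm c (snd c x) v"
 shows "tnorm g x (grad f x) \<le> N"
proof -
 let ?\<xi> = "grad f x"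
 note \<xi> = grad_in[OF f x]
 have e: "?\<xi> = tv c x (?\<xi> c)" by (rule tangent_eq_tvec_of[OF \<xi> c])
 \<comment> \<open>Any nonzero vector shows this; it settles the case of a vanishing gradient, in
   which the inequality cannot be divided.\<close>
 have N: "N \<ge> 0"
 proof -
  have "lnorm c (snd c x) (axis undefined 1) > 0" using lm_pos[of c "snd c x" "axis undefined 1"] c by (simp add: lnorm_def axis_eq_0_iff)
  then show ?thesis using b[of "axis undefined 1"] by (smt (verit) mult_neg_pos)
 qed
 have "(tnorm g x ?\<xi>)\<^sup>2 = dif f c (snd c x) (?\<xi> c)"
  unfolding tnorm_sq[OF \<xi>] using g_grad[OF f x c, of "?\<xi> c"] e by simp
 also have "\<dots> \<le> N * tnorm g x ?\<xi>"
  using b[of "?\<xi> c"] lnorm_eq_tnorm[OF c, of "?\<xi> c"] e by simp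
 finally show ?thesis using N tnorm_nonneg[OF \<xi>] by (cases "tnorm g x ?\<xi> = 0") (auto simp: power2_eq_square)
qed

lemma grad_chart:
 assumes f: "C1M W f" and c: "c \<in> \<A>" and y: "y \<in> imgs c W"
 shows "grad f (chart_inv c y) c = riesz c y (dif f c y)"
proof -
 obtain x where x: "x \<in> fst c" "x \<in> W" "y = snd c x" "chart_inv c y = x" using y c by auto
 have l: "linear (dif f c y)" by (rule linear_dif[OF f c y])
 have "grad f x = tv c x (riesz c y (dif f c y))"
 proof (rule tangent_nondegenerate[OF c x(1) grad_in[OF f x(2)] tvec_of_in[OF c x(1)]])
  fix v show "g x (grad f x) (tv c x v) = g x (tv c x (riesz c y (dif f c y))) (tv c x v)"
   using g_grad[OF f x(2) c x(1)] g_eq_lm[OF c x(1) tvec_of_in[OF c x(1)] tvec_of_in[OF c x(1)]] lm_riesz[OF c _ l] x c by simp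
 qed
 then show ?thesis using x c by simp
qed

lemma continuous_grad_chart:
 assumes f: "C1M W f" and c: "c \<in> \<A>"
 shows "continuous_on (imgs c W) (\<lambda>y. grad f (chart_inv c y) c)"
proof -
 let ?S = "imgs c W"
 have sub: "?S \<subseteq> img c" by auto
 have gi: "continuous_on ?S (\<lambda>y. gram c y $ i $ j)" for i j
  unfolding gram_matrix_def using continuous_on_subset[OF continuous_lm_fixed[OF c] sub] by simp
 have cd: "continuous_on ?S (\<lambda>y. dif f c y v)" for v by (rule C1M_continuous_dif[OF f c])
 have ent: "continuous_on ?S (\<lambda>y. (\<chi> i j. if j = k then dif f c y (axis i 1) else gram c y $ i $ j) $ i $ j)" for i j k
  by (cases "j = k") (simp_all add: gi cd)
 have "continuous_on ?S (\<lambda>y. riesz c y (dif f c y))"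
  unfolding riesz_def
 proof (intro continuous_on_vec_lambda continuous_on_divide)
  fix k
  show "continuous_on ?S (\<lambda>y. det (\<chi> i j. if j = k then dif f c y (axis i 1) else gram c y $ i $ j))"
   unfolding det_def by (intro continuous_on_sum continuous_on_mult continuous_on_const continuous_on_prod ent)
  show "continuous_on ?S (\<lambda>y. det (gram c y))"
   unfolding det_def by (intro continuous_on_sum continuous_on_mult continuous_on_const continuous_on_prod gi)
  show "\<forall>y\<in>?S. det (gram c y) \<noteq> 0" using det_gram_pos[OF c] sub by force
 qed
 then show ?thesis by (rule continuous_on_eq) (simp only: grad_chart[OF f c])
qed

lemma C1M_continuous_on:
 assumes f: "C1M W f" and W: "open W"
 shows "continuous_on W f"
 unfolding continuous_on_eq_continuous_at[OF W]
proof
 fix x assume x: "x \<in> W"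
 obtain c where c: "c \<in> \<A>" "x \<in> fst c" by (rule chart_cover)
 have o: "open (fst c \<inter> W)" using open_dom[OF c(1)] W by (rule open_Int)
 have "continuous_on (fst c \<inter> W) (\<lambda>x. f (chart_inv c (snd c x)))"
  by (rule continuous_on_compose2[OF C1M_continuous[OF f c(1)] continuous_on_subset[OF cont_chart[OF c(1)]]]) auto
 then have "continuous_on (fst c \<inter> W) f" by (rule continuous_on_eq) (use c in auto)
 then show "isCont f x" using continuous_on_eq_continuous_at[OF o] x c by blast
qed

lemma C1M_extend_zero:
 assumes "open W" "open W'" "W \<union> W' = UNIV" "C1M W f" "\<And>x. x \<in> W' ==> f x = 0"
 shows "C1M UNIV f" "c \<in> \<A> ==> x \<in> fst c ==> x \<in> W' ==> dif f c (snd c x) v = 0"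
proof -
 have "C1M W' f" by (rule C1M_cong(1)[OF assms(2,5) C1M_const(1)])
 from C1M_Un[OF assms(1,2,4) this] show "C1M UNIV f" by (simp add: assms(3))
 show "c \<in> \<A> ==> x \<in> fst c ==> x \<in> W' ==> dif f c (snd c x) v = 0"
  using C1M_cong(2)[OF assms(2,5) C1M_const(1), where c = c and y = "snd c x"] C1M_const(2)[of c x] by auto
qed

end

section \<open>C1 approximation of the distance function\<close>

context rmfd_complete
begin

text \<open>A chart ball on which the metric norms at any two points agree up to the factor 1 + e.
  The radius 3s leaves room for averaging, 2s is where the mollified function lives, and s bounds
  the support of the partition function.\<close>

definition good_chart :: "real \<Rightarrow> 'a \<Rightarrow> ('a, 'm) chart \<Rightarrow> real \<Rightarrow> real \<Rightarrow> bool" where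
 "good_chart e z d s b \<longleftrightarrow> d \<in> \<A> \<and> z \<in> fst d \<and> s > 0 \<and> b > 0 \<and> cball (snd d z) (3 * s) \<subseteq> img d \<and>
  (\<forall>y\<in>cball (snd d z) (3 * s). \<forall>y'\<in>cball (snd d z) (3 * s). \<forall>v. lnorm d y v \<le> (1 + e) * lnorm d y' v) \<and>
  (\<forall>y\<in>cball (snd d z) (3 * s). \<forall>v. b * norm v \<le> lnorm d y v)"

lemma good_chart_ex:
 assumes "e > 0"
 shows "\<exists>d s b. good_chart e z d s b"
proof -
 obtain d where d: "d \<in> \<A>" "z \<in> fst d" by (rule chart_cover)
 obtain s where s: "s > 0" "cball (snd d z) s \<subseteq> img d"
  "\<And>y y' v. y \<in> cball (snd d z) s ==> y' \<in> cball (snd d z) s ==> lnorm d y v \<le> (1 + e) * lnorm d y' v"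
  by (rule lnorm_near[OF d(1) imageI[OF d(2)] assms]) (rule that)
 obtain b B where b: "b > 0" "\<And>y v. y \<in> cball (snd d z) s ==> b * norm v \<le> lnorm d y v"
  by (rule lnorm_bounds[OF d(1) compact_cball s(2)]) (rule that)
 have "good_chart e z d (s / 3) b" unfolding good_chart_def using d s b by auto
 then show ?thesis by blast
qed

text \<open>By coordinate segments the distance is Lipschitz with constant 1 + e for the constant
  norm at the centre, and mollification preserves a bound by a constant norm.\<close>

lemma good_chart_mollify:
 assumes G: "good_chart e z d s b" and e: "e > 0" "e' > 0"
 shows "\<exists>h. (\<forall>y\<in>ball (snd d z) (2 * s). h differentiable (at y) \<and> \<bar>h y - dist_g x0 (chart_inv d y)\<bar> \<le> e' \<and>
   (\<forall>v. \<bar>ddir h y v\<bar> \<le> (1 + e) * lnorm d (snd d z) v)) \<and>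
  (\<forall>v. continuous_on (ball (snd d z) (2 * s)) (\<lambda>y. ddir h y v))"
proof -
 have d: "d \<in> \<A>" "z \<in> fst d" "s > 0" and sub: "cball (snd d z) (3 * s) \<subseteq> img d"
  and near: "\<And>y v. y \<in> cball (snd d z) (3 * s) ==> lnorm d y v \<le> (1 + e) * lnorm d (snd d z) v"
  using G unfolding good_chart_def by auto
 obtain B where B: "B > 0" "\<And>y v. y \<in> cball (snd d z) (3 * s) ==> lnorm d y v \<le> B * norm v"
  by (rule lnorm_bounds[OF d(1) compact_cball sub]) (rule that)
 have lip: "\<bar>dist_g x0 (chart_inv d y') - dist_g x0 (chart_inv d y)\<bar> \<le> (1 + e) * lnorm d (snd d z) (y' - y)"
  if "y \<in> cball (snd d z) (3 * s)" "y' \<in> cball (snd d z) (3 * s)" for y y'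
 proof -
  have "ed (chart_inv d y) (chart_inv d y') \<le> ennreal ((1 + e) * lnorm d (snd d z) (y' - y))"
   by (rule segment_length[OF d(1) convex_cball sub that near])
  moreover have "0 \<le> (1 + e) * lnorm d (snd d z) (y' - y)" using e d by (simp add: lnorm_def lm_nonneg)
  ultimately have "dist_g (chart_inv d y) (chart_inv d y') \<le> (1 + e) * lnorm d (snd d z) (y' - y)" by (simp add: dist_g_le_iff)
  then show ?thesis
   using M.triangle[of x0 "chart_inv d y" "chart_inv d y'"] M.triangle[of x0 "chart_inv d y'" "chart_inv d y"]
    M.commute[of "chart_inv d y" "chart_inv d y'"] by simp
 qed
 show ?thesis
 proof (rule mollify_Lipschitz[where f = "\<lambda>y. dist_g x0 (chart_inv d y)" and c = "(1 + e) * B"])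
  show "(1 + e) * lnorm d (snd d z) (t *\<^sub>R v) = \<bar>t\<bar> * ((1 + e) * lnorm d (snd d z) v)" for t v
   using d by (simp add: lnorm_scale)
  show "(1 + e) * lnorm d (snd d z) v \<le> (1 + e) * B * norm v" for v
   using mult_left_mono[OF B(2)[of "snd d z" v], of "1 + e"] e d by (simp add: mult.assoc)
 qed (use d e B lip in simp_all)
qed

text \<open>The constant 8 s^3 / b is 4 s^2 from the radial factor of the derivative, times 2s for
  the distance to the centre, divided by b to pass from the Euclidean to the metric norm.\<close>

lemma C1M_bump:
 assumes G: "good_chart e z d s b"
 defines "\<beta> \<equiv> \<lambda>x. if x \<in> fst d then quartic_bump s (snd d z - snd d x) else 0"
  and "W \<equiv> chart_inv d ` ball (snd d z) (2 * s)" and "W' \<equiv> - chart_inv d ` cball (snd d z) s"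
 shows "open W" "open W'" "W \<union> W' = UNIV" "W \<subseteq> fst d" "\<And>x. x \<in> W' ==> \<beta> x = 0" "C1M UNIV \<beta>"
  and "\<And>x v. x \<in> W ==> \<bar>dif \<beta> d (snd d x) v\<bar> \<le> 8 * s ^ 3 / b * lnorm d (snd d x) v"
proof -
 let ?y = "snd d z"
 have d: "d \<in> \<A>" "z \<in> fst d" "s > 0" "b > 0" and sub: "cball ?y (3 * s) \<subseteq> img d"
  and bd: "\<And>y v. y \<in> cball ?y (3 * s) ==> b * norm v \<le> lnorm d y v"
  using G unfolding good_chart_def by auto
 have sub1: "ball ?y (2 * s) \<subseteq> img d" and sub2: "cball ?y s \<subseteq> img d"
  and sub3: "cball ?y s \<subseteq> ball ?y (2 * s)" and sub4: "ball ?y (2 * s) \<subseteq> cball ?y (3 * s)"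
  using sub d(3) by (force, force, force, force)
 show W: "open W" unfolding W_def by (rule open_chart_inv_image[OF d(1) open_ball sub1])
 show W': "open W'" unfolding W'_def
  by (intro open_Compl compact_imp_closed compact_chart_inv_image[OF d(1) compact_cball sub2])
 show WW: "W \<union> W' = UNIV" unfolding W_def W'_def using sub3 by blast
 show Wd: "W \<subseteq> fst d" unfolding W_def using sub1 by auto
 show z': "\<beta> x = 0" if x: "x \<in> W'" for x
 proof (cases "x \<in> fst d")
  case True
  have "snd d x \<notin> cball ?y s"
  proof
   assume "snd d x \<in> cball ?y s"
   then have "chart_inv d (snd d x) \<in> chart_inv d ` cball ?y s" by (rule imageI)
   then show False using x True d by (simp add: W'_def)
  qed
  then show ?thesis using d(3) by (simp add: \<beta>_def quartic_bump_zero dist_norm)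
 qed (simp add: \<beta>_def)
 let ?q = "\<lambda>y. quartic_bump s (?y - y)"
 have fq: "frechet_derivative ?q (at y) = (\<lambda>v. 4 * max 0 (s\<^sup>2 - (?y - y) \<bullet> (?y - y)) * ((?y - y) \<bullet> v))" for y
  by (rule frechet_derivativeI[OF has_derivative_quartic_bump])
 have cq: "C1M W (\<lambda>x. ?q (snd d x))" unfolding W_def
  by (rule C1M_chart(1)[OF d(1) open_ball sub1])
   (auto intro!: differentiableI[OF has_derivative_quartic_bump] continuous_intros simp: fq)
 have eq: "\<beta> x = ?q (snd d x)" if "x \<in> W" for x using that Wd by (auto simp: \<beta>_def)
 have c\<beta>: "C1M W \<beta>" by (rule C1M_cong(1)[OF W eq cq])
 show "C1M UNIV \<beta>" by (rule C1M_extend_zero(1)[OF W W' WW c\<beta> z'])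
 fix x v assume x: "x \<in> W"
 have xd: "x \<in> fst d" and xb: "snd d x \<in> ball ?y (2 * s)" using x sub1 d(1) unfolding W_def by auto
 have "dif \<beta> d (snd d x) = dif (\<lambda>x. ?q (snd d x)) d (snd d x)"
  by (rule C1M_cong(2)[OF W eq cq d(1)]) (use x xd in auto)
 also have "\<dots> = frechet_derivative ?q (at (snd d x))"
  by (rule C1M_chart(2)[OF d(1) open_ball sub1])
   (use x in \<open>auto intro!: differentiableI[OF has_derivative_quartic_bump] continuous_intros simp: fq W_def\<close>)
 finally have D: "dif \<beta> d (snd d x) v = 4 * max 0 (s\<^sup>2 - (?y - snd d x) \<bullet> (?y - snd d x)) * ((?y - snd d x) \<bullet> v)" by (simp add: fq)
 have "\<bar>(?y - snd d x) \<bullet> v\<bar> \<le> 2 * s * norm v"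
  using Cauchy_Schwarz_ineq2[of "?y - snd d x" v] mult_right_mono[of "norm (?y - snd d x)" "2 * s" "norm v"] xb
  by (simp add: dist_norm)
 then have "\<bar>dif \<beta> d (snd d x) v\<bar> \<le> 4 * s\<^sup>2 * (2 * s * norm v)"
  unfolding D abs_mult by (intro mult_mono) auto
 also have "\<dots> = 8 * s ^ 3 / b * (b * norm v)" using d(4) by (simp add: power2_eq_square power3_eq_cube)
 also have "\<dots> \<le> 8 * s ^ 3 / b * lnorm d (snd d x) v"
  using bd[of "snd d x" v] xb sub4 d(3,4) by (intro mult_left_mono) auto
 finally show "\<bar>dif \<beta> d (snd d x) v\<bar> \<le> 8 * s ^ 3 / b * lnorm d (snd d x) v" .
qed

text \<open>Local mollifications of the distance function, which is almost \<open>1\<close>-Lipschitz for the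
 constant metric at the centre of a small chart, are glued by a partition of unity. Mollifying finely compared with the size of the gradients
 of the partition makes the gluing error negligible.\<close>

theorem smooth_distance:
 assumes \<delta>: "\<delta> > 0"
 obtains \<rho> where "C1M (M.mball x0 R) \<rho>" "\<And>x. x \<in> M.mball x0 R ==> \<bar>\<rho> x - dist_g x0 x\<bar> \<le> \<delta>"
  "\<And>x. x \<in> M.mball x0 R ==> tnorm g x (grad \<rho> x) \<le> 1 + \<delta>"
proof -
 \<comment> \<open>The factor 1 + e is paid twice: for the Lipschitz constant, and for evaluating
   the norm at x instead of the centre. As e \<le> 1, the excess 2e + e^2 is at most 3e \<le>
   \<delta>/2.\<close>
 define e where "e = min 1 (\<delta> / 6)"
 have e: "e > 0" "(1 + e) * (1 + e) \<le> 1 + \<delta> / 2"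
 proof -
  show "e > 0" using \<delta> by (simp add: e_def)
  have "e * e \<le> 1 * e" using \<delta> by (intro mult_right_mono) (auto simp: e_def)
  moreover have "e \<le> \<delta> / 6" by (simp add: e_def)
  ultimately show "(1 + e) * (1 + e) \<le> 1 + \<delta> / 2" by (simp add: algebra_simps)
 qed
 let ?K = "M.mcball x0 R" and ?B = "M.mball x0 R"
 have "\<forall>z. \<exists>t. good_chart e z (fst t) (fst (snd t)) (snd (snd t))" using good_chart_ex[OF e(1)] by simp
 then obtain t where "\<And>z. good_chart e z (fst (t z)) (fst (snd (t z))) (snd (snd (t z)))" using choice[of "\<lambda>z t. good_chart e z (fst t) (fst (snd t)) (snd (snd t))"] by blast
 then obtain d s b where G: "\<And>z. good_chart e z (d z) (s z) (b z)"
  using that[of "\<lambda>z. fst (t z)" "\<lambda>z. fst (snd (t z))" "\<lambda>z. snd (snd (t z))"] by simp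
 let ?c = "\<lambda>z. 8 * s z ^ 3 / b z" and ?y = "\<lambda>z. snd (d z) z"
 let ?b = "\<lambda>z. ball (?y z) (2 * s z)"
 define U where "U z = chart_inv (d z) ` ball (?y z) (s z)" for z
 define \<beta> where "\<beta> z x = (if x \<in> fst (d z) then quartic_bump (s z) (?y z - snd (d z) x) else 0)" for z x
 define W where "W z = chart_inv (d z) ` ?b z" for z
 define W' where "W' z = - chart_inv (d z) ` cball (?y z) (s z)" for z
 have d: "d z \<in> \<A>" "z \<in> fst (d z)" "s z > 0" "b z > 0" "cball (?y z) (3 * s z) \<subseteq> img (d z)" for z
  using G[of z] unfolding good_chart_def by auto
 note bump = C1M_bump[OF G, folded \<beta>_def W_def W'_def]
 have \<beta>_nonneg: "\<beta> z x \<ge> 0" for z x by (simp add: \<beta>_def quartic_bump_nonneg)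
 have subW: "?b z \<subseteq> img (d z)" for z
  using d(3)[of z] by (intro subset_trans[OF _ d(5)]) auto
 obtain I where I: "I \<subseteq> ?K" "finite I" "?K \<subseteq> (\<Union>z\<in>I. U z)"
 proof (rule compactE_image[OF compact_mcball, of ?K U x0 R])
  show "open (U z)" for z unfolding U_def
   using d(3)[of z] by (intro open_chart_inv_image[OF d(1) open_ball] subset_trans[OF _ d(5)]) auto
  show "?K \<subseteq> (\<Union>z\<in>?K. U z)"
  proof
   fix z assume z: "z \<in> ?K"
   have "chart_inv (d z) (?y z) \<in> U z" unfolding U_def using d(3)[of z] by (intro imageI) simp
   then show "z \<in> (\<Union>z\<in>?K. U z)" using z d(1,2)[of z] by auto
  qed
 qed
 define S where "S x = (\<Sum>z\<in>I. \<beta> z x)" for x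
 have S1: "C1M UNIV S" unfolding S_def by (rule C1M_sum(1)[OF I(2) bump(6)])
 have S_pos: "S x > 0" if xK: "x \<in> ?K" for x
 proof -
  obtain z where z: "z \<in> I" "x \<in> U z" using subsetD[OF I(3) xK] by (rule UN_E)
  then obtain y where y: "y \<in> ball (?y z) (s z)" "x = chart_inv (d z) y" unfolding U_def by blast
  have "y \<in> ?b z" using y(1) d(3)[of z] by simp
  then have "y \<in> img (d z)" using subW[of z] by blast
  then have "snd (d z) x \<in> ball (?y z) (s z)" "x \<in> fst (d z)" using y by simp_all
  then have "\<beta> z x > 0" unfolding \<beta>_def by (simp add: quartic_bump_pos dist_norm)
  then show ?thesis unfolding S_def using z(1) I(2) \<beta>_nonneg by (intro sum_pos2[of I z]) auto
 qed
 obtain \<sigma> where \<sigma>: "\<sigma> > 0" "\<And>x. x \<in> ?K ==> \<sigma> \<le> S x"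
 proof (cases "?K = {}")
  case True
  then show ?thesis using that[of 1] by simp
 next
  case False
  have "continuous_on ?K S" by (rule continuous_on_subset[OF C1M_continuous_on[OF S1 open_UNIV]]) simp
  from continuous_attains_inf[OF compact_mcball False this] show ?thesis using S_pos that by blast
 qed
 define C where "C = (\<Sum>z\<in>I. ?c z)"
 have C0: "C \<ge> 0" unfolding C_def using d(3,4) by (intro sum_nonneg divide_nonneg_pos mult_nonneg_nonneg zero_le_power) (auto intro: less_imp_le)
 \<comment> \<open>The partition, and with it \<sigma> and C, is fixed before any mollification, so
   the precision may depend on it. The gluing error 2 e' C is then at most \<delta>/2 times the
   lower bound \<sigma> of S.\<close>
 define e' where "e' = min \<delta> (\<sigma> * \<delta> / (4 * (C + 1)))"
 have e': "e' > 0" "e' \<le> \<delta>" "2 * e' * C \<le> \<sigma> * (\<delta> / 2)"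
 proof -
  show "e' > 0" "e' \<le> \<delta>" using \<delta> \<sigma> C0 by (auto simp: e'_def)
  have "e' * (4 * (C + 1)) \<le> \<sigma> * \<delta>" using C0 by (simp add: e'_def pos_le_divide_eq[symmetric])
  then show "2 * e' * C \<le> \<sigma> * (\<delta> / 2)" using \<open>e' > 0\<close> by (simp add: algebra_simps)
 qed
 obtain h where h: "\<And>z y. y \<in> ?b z ==> h z differentiable (at y)"
  "\<And>z y. y \<in> ?b z ==> \<bar>h z y - dist_g x0 (chart_inv (d z) y)\<bar> \<le> e'"
  "\<And>z y v. y \<in> ?b z ==> \<bar>frechet_derivative (h z) (at y) v\<bar> \<le> (1 + e) * lnorm (d z) (?y z) v"
  "\<And>z v. continuous_on (?b z) (\<lambda>y. frechet_derivative (h z) (at y) v)"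
 proof -
  have "\<forall>z. \<exists>h. (\<forall>y\<in>?b z. h differentiable (at y) \<and> \<bar>h y - dist_g x0 (chart_inv (d z) y)\<bar> \<le> e' \<and>
   (\<forall>v. \<bar>ddir h y v\<bar> \<le> (1 + e) * lnorm (d z) (?y z) v)) \<and>
   (\<forall>v. continuous_on (?b z) (\<lambda>y. ddir h y v))"
   by (intro allI good_chart_mollify[OF G e(1) e'(1)])
  from choice[OF this] show ?thesis using that by blast
 qed
 define F where "F z x = h z (snd (d z) x)" for z x
 have F1: "C1M (W z) (F z)" for z
  unfolding F_def W_def by (rule C1M_chart(1)[OF d(1) open_ball subW h(1,4)])
 have Wb: "snd (d z) x \<in> ?b z" "x \<in> fst (d z)" if "x \<in> W z" for x z
  using that subW[of z] d(1) unfolding W_def by auto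
 have dF: "\<bar>dif (F z) (d z) (snd (d z) x) v\<bar> \<le> (1 + \<delta> / 2) * lnorm (d z) (snd (d z) x) v" if x: "x \<in> W z" for z x v
 proof -
  have "dif (F z) (d z) (snd (d z) x) = frechet_derivative (h z) (at (snd (d z) x))"
   unfolding F_def by (rule C1M_chart(2)[OF d(1) open_ball subW h(1,4)]) (use x in \<open>simp_all add: W_def\<close>)
  then have "\<bar>dif (F z) (d z) (snd (d z) x) v\<bar> \<le> (1 + e) * lnorm (d z) (?y z) v" using h(3)[OF Wb(1)[OF x]] by simp
  also have "\<dots> \<le> (1 + e) * ((1 + e) * lnorm (d z) (snd (d z) x) v)"
  proof (rule mult_left_mono)
   have "snd (d z) x \<in> cball (?y z) (3 * s z)" using Wb(1)[OF x] d(3)[of z] by auto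
   then show "lnorm (d z) (?y z) v \<le> (1 + e) * lnorm (d z) (snd (d z) x) v"
    using G[of z] d(3)[of z] unfolding good_chart_def by auto
  qed (use e in simp)
  also have "\<dots> \<le> (1 + \<delta> / 2) * lnorm (d z) (snd (d z) x) v"
   using mult_right_mono[OF e(2), of "lnorm (d z) (snd (d z) x) v"] lm_nonneg[OF d(1) imageI[OF Wb(2)[OF x]]]
   by (simp add: lnorm_def mult.assoc)
  finally show ?thesis .
 qed
 have F_close: "\<bar>F z x - dist_g x0 x\<bar> \<le> e'" if "x \<in> W z" for z x
  using h(2)[OF Wb(1)[OF that]] Wb(2)[OF that] d(1)[of z] by (simp add: F_def)
 have \<beta>F: "C1M (W z) (\<lambda>x. \<beta> z x * F z x)" for z
  by (rule C1M_mult(1)[OF C1M_subset[OF bump(6)] F1]) simp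
 have \<beta>F0: "\<beta> z x * F z x = 0" if "x \<in> W' z" for z x using bump(5)[OF that] by simp
 have \<beta>F1: "C1M UNIV (\<lambda>x. \<beta> z x * F z x)" for z by (rule C1M_extend_zero(1)[OF bump(1,2,3) \<beta>F \<beta>F0])
 define P where "P x = (\<Sum>z\<in>I. \<beta> z x * F z x)" for x
 have P1: "C1M UNIV P" unfolding P_def by (rule C1M_sum(1)[OF I(2) \<beta>F1])
 define \<rho> where "\<rho> x = P x * inverse (S x)" for x
 have BK: "x \<in> ?K" if "x \<in> ?B" for x using that by (auto simp: M.mball_def M.mcball_def)
 have PB: "C1M ?B P" and SB: "C1M ?B S" by (rule C1M_subset[OF P1 subset_UNIV], rule C1M_subset[OF S1 subset_UNIV])
 have Si: "C1M ?B (\<lambda>x. inverse (S x))"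
  by (rule C1M_compose(1)[where \<psi> = inverse and \<psi>' = "\<lambda>t. - (inverse t ^ Suc (Suc 0))", OF SB DERIV_inverse])
   (use S_pos[OF BK] in \<open>force intro!: continuous_intros\<close>)+
 have \<rho>1: "C1M ?B \<rho>" unfolding \<rho>_def by (rule C1M_mult(1)[OF PB Si])
 have \<rho>S: "P x = \<rho> x * S x" if "x \<in> ?B" for x using S_pos[OF BK[OF that]] by (simp add: \<rho>_def)
 have close: "\<bar>\<rho> x - dist_g x0 x\<bar> \<le> e'" if x: "x \<in> ?B" for x
 proof -
  have "\<bar>\<rho> x - dist_g x0 x\<bar> * S x = \<bar>P x - dist_g x0 x * S x\<bar>"
   using S_pos[OF BK[OF x]] \<rho>S[OF x] by (simp add: left_diff_distrib[symmetric] abs_mult)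
  also have "\<dots> = \<bar>\<Sum>z\<in>I. \<beta> z x * (F z x - dist_g x0 x)\<bar>"
   by (simp add: P_def S_def sum_distrib_left right_diff_distrib sum_subtractf mult.commute)
  also have "\<dots> \<le> (\<Sum>z\<in>I. \<bar>\<beta> z x * (F z x - dist_g x0 x)\<bar>)" by (rule sum_abs)
  also have "\<dots> \<le> (\<Sum>z\<in>I. \<beta> z x * e')"
  proof (rule sum_mono)
   fix z show "\<bar>\<beta> z x * (F z x - dist_g x0 x)\<bar> \<le> \<beta> z x * e'"
   proof (cases "x \<in> W z")
    case True
    then show ?thesis using F_close[OF True] \<beta>_nonneg[of z x] by (simp add: abs_mult mult_left_mono)
   next
    case False
    then have "x \<in> W' z" using bump(3)[of z] by blast
    then show ?thesis using bump(5) by simp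
   qed
  qed
  also have "\<dots> = e' * S x" by (simp add: S_def sum_distrib_left mult.commute)
  finally show ?thesis using S_pos[OF BK[OF x]] by simp
 qed
 have gr: "tnorm g x (grad \<rho> x) \<le> 1 + \<delta>" if x: "x \<in> ?B" for x
 proof -
  obtain c where c: "c \<in> \<A>" "x \<in> fst c" by (rule chart_cover)
  have xc: "snd c x \<in> snd c ` (fst c \<inter> ?B)" "snd c x \<in> imgs c UNIV" using x c by auto
  show ?thesis
  proof (rule tnorm_grad_le[OF \<rho>1 x c])
   fix v
   let ?n = "lnorm c (snd c x) v" and ?D = "\<lambda>f. dif f c (snd c x) v"
   have n0: "?n \<ge> 0" using lm_nonneg[OF c(1) imageI[OF c(2)]] by (simp add: lnorm_def)
   \<comment> \<open>Differentiating P = \<rho> S avoids the quotient rule and leaves a sum of terms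
     \<beta> dF + (F - \<rho>) d\<beta>, in which the possibly large gradients of the partition meet
     only the small differences F - \<rho>.\<close>
   have "?D P = ?D (\<lambda>x. \<rho> x * S x)" using C1M_cong(2)[OF open_mball \<rho>S C1M_mult(1)[OF \<rho>1 SB] c(1) xc(1)] by simp
   also have "\<dots> = \<rho> x * ?D S + ?D \<rho> * S x" using C1M_mult(2)[OF \<rho>1 SB c(1) xc(1)] c by simp
   finally have "?D \<rho> * S x = ?D P - \<rho> x * ?D S" by simp
   also have "\<dots> = (\<Sum>z\<in>I. ?D (\<lambda>x. \<beta> z x * F z x) - \<rho> x * ?D (\<beta> z))"
   proof -
    have "?D P = (\<Sum>z\<in>I. ?D (\<lambda>x. \<beta> z x * F z x))" "?D S = (\<Sum>z\<in>I. ?D (\<beta> z))"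
     unfolding P_def[abs_def] S_def[abs_def]
     using C1M_sum(2)[where f = "\<lambda>z x. \<beta> z x * F z x", OF I(2) \<beta>F1 c(1) xc(2)] C1M_sum(2)[where f = \<beta>, OF I(2) bump(6) c(1) xc(2)]
     by (simp_all add: fun_eq_iff)
    then show ?thesis by (simp add: sum_subtractf sum_distrib_left)
   qed
   finally have "\<bar>?D \<rho>\<bar> * S x = \<bar>\<Sum>z\<in>I. ?D (\<lambda>x. \<beta> z x * F z x) - \<rho> x * ?D (\<beta> z)\<bar>"
    using S_pos[OF BK[OF x]] by (metis abs_mult abs_of_pos)
   also have "\<dots> \<le> (\<Sum>z\<in>I. \<bar>?D (\<lambda>x. \<beta> z x * F z x) - \<rho> x * ?D (\<beta> z)\<bar>)" by (rule sum_abs)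
   also have "\<dots> \<le> (\<Sum>z\<in>I. (\<beta> z x * (1 + \<delta> / 2) + 2 * e' * ?c z) * ?n)"
   proof (rule sum_mono)
    fix z
    have pos: "0 \<le> ?c z" using d(3,4)[of z] by simp
    show "\<bar>?D (\<lambda>x. \<beta> z x * F z x) - \<rho> x * ?D (\<beta> z)\<bar> \<le> (\<beta> z x * (1 + \<delta> / 2) + 2 * e' * ?c z) * ?n"
    proof (cases "x \<in> W z")
     case True
     have xw: "snd c x \<in> snd c ` (fst c \<inter> W z)" using True c by auto
     have "?D (\<lambda>x. \<beta> z x * F z x) = \<beta> z x * ?D (F z) + ?D (\<beta> z) * F z x"
      using C1M_mult(2)[OF C1M_subset[OF bump(6)] F1 c(1) xw] c by simp
     then have "\<bar>?D (\<lambda>x. \<beta> z x * F z x) - \<rho> x * ?D (\<beta> z)\<bar> = \<bar>\<beta> z x * ?D (F z) + (F z x - \<rho> x) * ?D (\<beta> z)\<bar>"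
      by (simp add: algebra_simps)
     also have "\<dots> \<le> \<beta> z x * \<bar>?D (F z)\<bar> + \<bar>F z x - \<rho> x\<bar> * \<bar>?D (\<beta> z)\<bar>"
      using abs_triangle_ineq[of "\<beta> z x * ?D (F z)" "(F z x - \<rho> x) * ?D (\<beta> z)"] \<beta>_nonneg[of z x] by (simp add: abs_mult)
     also have "\<dots> \<le> \<beta> z x * ((1 + \<delta> / 2) * ?n) + 2 * e' * (?c z * ?n)"
     proof (intro add_mono mult_mono mult_nonneg_nonneg)
      show "\<bar>?D (F z)\<bar> \<le> (1 + \<delta> / 2) * ?n"
       by (rule dif_bound_chart_change[OF F1 True c d(1) Wb(2)[OF True] dF[OF True]])
      show "\<bar>?D (\<beta> z)\<bar> \<le> ?c z * ?n"
       by (rule dif_bound_chart_change[OF bump(6) UNIV_I c d(1) Wb(2)[OF True] bump(7)[OF True]])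
      show "\<bar>F z x - \<rho> x\<bar> \<le> 2 * e'" using F_close[OF True] close[OF x] by linarith
     qed (use \<beta>_nonneg e'(1) pos n0 in auto)
     finally show ?thesis by (simp add: algebra_simps)
    next
     case False
     then have xw: "x \<in> W' z" using bump(3)[of z] by blast
     have "?D (\<lambda>x. \<beta> z x * F z x) = 0" by (rule C1M_extend_zero(2)[OF bump(1,2,3) \<beta>F \<beta>F0 c xw])
     moreover have "?D (\<beta> z) = 0"
      by (rule C1M_extend_zero(2)[OF bump(1,2,3) C1M_subset[OF bump(6) subset_UNIV] bump(5) c xw])
     moreover have "0 \<le> (\<beta> z x * (1 + \<delta> / 2) + 2 * e' * ?c z) * ?n"
      by (intro mult_nonneg_nonneg add_nonneg_nonneg) (use \<beta>_nonneg[of z x] e'(1) \<delta> pos n0 in auto)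
     ultimately show ?thesis by simp
    qed
   qed
   also have "\<dots> = (S x * (1 + \<delta> / 2) + 2 * e' * C) * ?n"
    unfolding S_def C_def sum_distrib_left sum_distrib_right sum.distrib[symmetric] ..
   also have "\<dots> \<le> (S x * (1 + \<delta> / 2) + S x * (\<delta> / 2)) * ?n"
    using order_trans[OF e'(3) mult_right_mono[OF \<sigma>(2)[OF BK[OF x]], of "\<delta> / 2"]] \<delta> n0 by (intro mult_right_mono add_left_mono) auto
   also have "\<dots> = (1 + \<delta>) * ?n * S x" by (simp add: algebra_simps)
   finally show "\<bar>?D \<rho>\<bar> \<le> (1 + \<delta>) * ?n" using S_pos[OF BK[OF x]] by simp
  qed
 qed
 show ?thesis using e'(2) close by (intro that[OF \<rho>1 _ gr]) force
qed

end

section \<open>Weak gradients\<close>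

lemma test_function_continuous:
 fixes \<phi> :: "'e::real_normed_vector \<Rightarrow> real"
 assumes "test_function V \<phi>"
 shows "continuous_on UNIV \<phi>" "continuous_on UNIV (\<lambda>y. ddir \<phi> y v)"
proof -
 have "Ck_on 0 UNIV \<phi>" "Ck_on (Suc 0) UNIV \<phi>" using assms unfolding test_function_def smooth_on_def by blast+
 then show "continuous_on UNIV \<phi>" "continuous_on UNIV (\<lambda>y. ddir \<phi> y v)" by simp_all
qed

lemma test_function_mono: "test_function V \<phi> ==> V \<subseteq> V' ==> test_function V' \<phi>"
 unfolding test_function_def by (meson order_trans)

lemma test_function_zero:
 fixes \<phi> :: "'e::real_normed_vector \<Rightarrow> real"
 assumes K: "compact K" "\<And>y. y \<notin> K ==> \<phi> y = 0" and y: "y \<notin> K"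
 shows "ddir \<phi> y v = 0"
proof -
 have o: "open (- K)" using K(1) by (simp add: compact_imp_closed open_Compl)
 have "frechet_derivative \<phi> (at y) = frechet_derivative (\<lambda>_. 0) (at y)"
  by (rule frechet_derivative_cong_open(1)[OF o]) (use K y in auto)
 then show ?thesis by (simp add: frechet_derivativeI[OF has_derivative_const])
qed

lemma powr_add_le:
 fixes a b :: real
 assumes "a \<ge> 0" "b \<ge> 0" "p > 0"
 shows "(a + b) powr p \<le> 2 powr p * (a powr p + b powr p)"
proof -
 have "(a + b) powr p \<le> (2 * max a b) powr p" using assms by (intro powr_mono2) auto
 also have "\<dots> = 2 powr p * max a b powr p" using assms by (simp add: powr_mult)
 also have "\<dots> \<le> 2 powr p * (a powr p + b powr p)" by (intro mult_left_mono) (auto simp: max_def)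
 finally show ?thesis .
qed

context rmfd
begin

lemma chart_pairing:
 assumes "c \<in> \<A>" "y \<in> img c" "\<xi> \<in> TM (chart_inv c y)"
 shows "g (chart_inv c y) \<xi> (tv c (chart_inv c y) v) = lm c y (\<xi> c) v"
 using g_eq_lm[OF assms(1) chart_inv_in[OF assms(2)] assms(3) tvec_of_in[OF assms(1) chart_inv_in[OF assms(2)]]] assms by simp

lemma measurable_lm:
 assumes c: "c \<in> \<A>" and T: "T \<subseteq> img c" "T \<in> sets lebesgue"
  and f: "f \<in> borel_measurable (lebesgue_on T)" and h: "h \<in> borel_measurable (lebesgue_on T)"
 shows "(\<lambda>y. lm c y (f y) (h y)) \<in> borel_measurable (lebesgue_on T)"
proof -
 have nth: "(\<lambda>y. k y $ i) \<in> borel_measurable (lebesgue_on T)" if "k \<in> borel_measurable (lebesgue_on T)" for k :: "real ^ 'm \<Rightarrow> real ^ 'm" and i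
  by (rule measurable_compose[OF that]) (auto intro!: borel_measurable_continuous_onI continuous_intros)
 have l: "(\<lambda>y. lm c y v w) \<in> borel_measurable (lebesgue_on T)" for v w
  by (rule continuous_imp_measurable_on_sets_lebesgue[OF continuous_on_subset[OF continuous_lm_fixed[OF c] T(1)] T(2)])
 have "(\<lambda>y. \<Sum>i\<in>UNIV. \<Sum>j\<in>UNIV. f y $ i * h y $ j * lm c y (axis i 1) (axis j 1)) \<in> borel_measurable (lebesgue_on T)"
  by (intro borel_measurable_sum borel_measurable_times nth l f h)
 then show ?thesis
  by (rule measurable_cong[THEN iffD1, rotated]) (use T in \<open>simp add: space_restrict_space subset_eq lm_expand[OF c, symmetric]\<close>)
qed

lemma chart_sets: "c \<in> \<A> ==> open W ==> imgs c W \<in> sets lebesgue"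
 using open_chart_Int lborelD by (metis sets_completionI_sets sets_lborel borel_open)

lemma measurable_field_extend:
 assumes X: "mfield \<Omega> X" and \<Omega>: "open \<Omega>"
 shows "mfield UNIV (\<lambda>x. if x \<in> \<Omega> then X x else (\<lambda>_. 0))"
 unfolding measurable_field_def
proof (intro conjI ballI)
 show "(if x \<in> \<Omega> then X x else (\<lambda>_. 0)) \<in> TM x" for x
  using X by (auto simp: measurable_field_def)
 fix c assume c: "c \<in> \<A>"
 let ?V = "imgs c \<Omega>"
 have "(\<lambda>y. indicator ?V y *\<^sub>R X (chart_inv c y) c) \<in> borel_measurable lebesgue"
  by (rule borel_measurable_restrict_space_iff[THEN iffD1]) (use X c chart_sets[OF c \<Omega>] in \<open>simp_all add: measurable_field_def\<close>)
 then have "(\<lambda>y. indicator ?V y *\<^sub>R X (chart_inv c y) c) \<in> borel_measurable (lebesgue_on (imgs c UNIV))"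
  by (rule measurable_restrict_space1)
 then show "(\<lambda>y. (if chart_inv c y \<in> \<Omega> then X (chart_inv c y) else (\<lambda>_. 0)) c) \<in> borel_measurable (lebesgue_on (imgs c UNIV))"
  by (rule measurable_cong[THEN iffD1, rotated]) (use c in \<open>auto simp: space_restrict_space indicator_def\<close>)
qed

lemma measurable_field_in: "mfield \<Omega> X ==> x \<in> \<Omega> ==> X x \<in> TM x"
 by (simp add: measurable_field_def)

lemma measurable_field_chart:
 "mfield UNIV X ==> c \<in> \<A> ==> (\<lambda>y. X (chart_inv c y) c) \<in> borel_measurable (lebesgue_on (img c))"
 by (simp add: measurable_field_def)

lemma measurable_g:
 assumes X: "mfield UNIV X" and Y: "mfield UNIV Y"
 shows "(\<lambda>x. g x (X x) (Y x)) \<in> borel_measurable vol"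
proof (rule measurable_chart_imp_vol)
 fix c assume c: "c \<in> \<A>"
 have "(\<lambda>y. lm c y (X (chart_inv c y) c) (Y (chart_inv c y) c)) \<in> borel_measurable (lebesgue_on (img c))"
  using chart_sets[OF c open_UNIV] by (intro measurable_lm[OF c] measurable_field_chart X Y c) auto
 then show "(\<lambda>y. g (chart_inv c y) (X (chart_inv c y)) (Y (chart_inv c y))) \<in> borel_measurable (lebesgue_on (img c))"
 proof (rule measurable_cong[THEN iffD1, rotated])
  fix y assume "y \<in> space (lebesgue_on (img c))"
  then have y: "y \<in> img c" by (simp add: space_restrict_space)
  show "lm c y (X (chart_inv c y) c) (Y (chart_inv c y) c) = g (chart_inv c y) (X (chart_inv c y)) (Y (chart_inv c y))"
   using g_eq_lm[OF c chart_inv_in[OF y] measurable_field_in[OF X UNIV_I] measurable_field_in[OF Y UNIV_I]] y by simp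
 qed
qed

lemma measurable_tnorm:
 assumes "mfield UNIV X"
 shows "(\<lambda>x. tnorm g x (X x)) \<in> borel_measurable vol"
 unfolding tnorm_def
 by (rule measurable_compose[OF measurable_g[OF assms assms]]) (intro borel_measurable_continuous_onI continuous_intros)

lemma measurable_field_comb:
 assumes X: "mfield UNIV X" and Y: "mfield UNIV Y"
  and a: "a \<in> borel_measurable vol" and b: "b \<in> borel_measurable vol"
 shows "mfield UNIV (\<lambda>x c. a x *\<^sub>R X x c + b x *\<^sub>R Y x c)"
 unfolding measurable_field_def
 using measurable_vol_imp_chart[OF _ a] measurable_vol_imp_chart[OF _ b] measurable_field_chart[OF X] measurable_field_chart[OF Y]
 by (auto intro!: tangent_comb measurable_field_in[OF X] measurable_field_in[OF Y])

lemma measurable_field_grad: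
 assumes "C1M UNIV f"
 shows "mfield UNIV (grad f)"
 unfolding measurable_field_def
proof (intro conjI ballI)
 show "grad f x \<in> TM x" for x by (rule grad_in[OF assms UNIV_I])
 fix c assume c: "c \<in> \<A>"
 show "(\<lambda>y. grad f (chart_inv c y) c) \<in> borel_measurable (lebesgue_on (imgs c UNIV))"
  by (rule continuous_imp_measurable_on_sets_lebesgue[OF continuous_grad_chart[OF assms c] chart_sets[OF c open_UNIV]])
qed

lemma test_function_integral_subset:
 fixes \<phi> :: "real ^ 'm \<Rightarrow> real"
 assumes K: "compact K" "K \<subseteq> V'" "\<And>y. y \<notin> K ==> \<phi> y = 0" and V: "V' \<subseteq> V"
 shows "(LINT y:V|lebesgue. f y * \<phi> y) = (LINT y:V'|lebesgue. f y * \<phi> y)"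
  and "(LINT y:V|lebesgue. f y * ddir \<phi> y v) = (LINT y:V'|lebesgue. f y * ddir \<phi> y v)"
proof -
 have z: "\<phi> y = 0 \<and> ddir \<phi> y v = 0" if "y \<notin> V'" for y
 proof -
  have "y \<notin> K" using that K(2) by blast
  then show ?thesis using K(3) test_function_zero[where \<phi> = \<phi>, OF K(1,3)] by simp
 qed
 show "(LINT y:V|lebesgue. f y * \<phi> y) = (LINT y:V'|lebesgue. f y * \<phi> y)"
  "(LINT y:V|lebesgue. f y * ddir \<phi> y v) = (LINT y:V'|lebesgue. f y * ddir \<phi> y v)"
  unfolding set_lebesgue_integral_def
  by (rule integral_cong_B; use V z in \<open>force simp: indicator_def\<close>)+
qed

lemma is_weak_gradientD:
 assumes "wgrad \<Omega> u X"
 shows "loc_integrable vol \<Omega> u" "mfield \<Omega> X" "loc_integrable vol \<Omega> (\<lambda>x. tnorm g x (X x))"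
  and "\<And>c v \<phi>. c \<in> \<A> ==> test_function (imgs c \<Omega>) \<phi> ==>
    (LINT y:imgs c \<Omega>|lebesgue. u (chart_inv c y) * ddir \<phi> y v) =
    - (LINT y:imgs c \<Omega>|lebesgue. pairing X c v y * \<phi> y)"
 using assms by (simp_all add: is_weak_gradient_def)

lemma loc_integrable_subset: "loc_integrable M \<Omega> f ==> \<Omega>' \<subseteq> \<Omega> ==> loc_integrable M \<Omega>' f"
 unfolding loc_integrable_def by (meson order_trans)

lemma is_weak_gradient_subset:
 assumes X: "wgrad \<Omega> u X" and \<Omega>: "\<Omega>' \<subseteq> \<Omega>"
 shows "wgrad \<Omega>' u X"
 unfolding is_weak_gradient_def
proof (intro conjI ballI allI impI)
 show "loc_integrable vol \<Omega>' u" "loc_integrable vol \<Omega>' (\<lambda>x. tnorm g x (X x))"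
  by (rule loc_integrable_subset[OF _ \<Omega>], rule is_weak_gradientD[OF X])+
 show "mfield \<Omega>' X"
  unfolding measurable_field_def
 proof (intro conjI ballI)
  show "X x \<in> TM x" if "x \<in> \<Omega>'" for x
   using is_weak_gradientD(2)[OF X] \<Omega> that by (auto simp: measurable_field_def)
  fix c assume "c \<in> \<A>"
  then have "(\<lambda>y. X (chart_inv c y) c) \<in> borel_measurable (lebesgue_on (imgs c \<Omega>))"
   using is_weak_gradientD(2)[OF X] by (simp add: measurable_field_def)
  then show "(\<lambda>y. X (chart_inv c y) c) \<in> borel_measurable (lebesgue_on (imgs c \<Omega>'))"
   by (rule measurable_restrict_mono) (use \<Omega> in auto)
 qed
 fix c v \<phi> assume c: "c \<in> \<A>" and \<phi>: "test_function (imgs c \<Omega>') \<phi>"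
 then obtain K where K: "compact K" "K \<subseteq> imgs c \<Omega>'" "\<And>y. y \<notin> K ==> \<phi> y = 0"
  unfolding test_function_def by blast
 have sub: "imgs c \<Omega>' \<subseteq> imgs c \<Omega>" using \<Omega> by auto
 have t: "test_function (imgs c \<Omega>) \<phi>" using \<phi> sub by (rule test_function_mono)
 show "(LINT y:imgs c \<Omega>'|lebesgue. u (chart_inv c y) * ddir \<phi> y v) =
   - (LINT y:imgs c \<Omega>'|lebesgue. pairing X c v y * \<phi> y)"
 proof -
  define f1 f2 where "f1 y = u (chart_inv c y)" and "f2 y = pairing X c v y" for y
  have e: "(LINT y:imgs c \<Omega>|lebesgue. f1 y * ddir \<phi> y v) =
    (LINT y:imgs c \<Omega>'|lebesgue. f1 y * ddir \<phi> y v)"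
   "(LINT y:imgs c \<Omega>|lebesgue. f2 y * \<phi> y) = (LINT y:imgs c \<Omega>'|lebesgue. f2 y * \<phi> y)"
   by (rule test_function_integral_subset(2)[OF K(1,2) _ sub], erule K(3), rule test_function_integral_subset(1)[OF K(1,2) _ sub], erule K(3))
  show ?thesis unfolding f1_def[symmetric] f2_def[symmetric] e[symmetric]
   unfolding f1_def f2_def by (rule is_weak_gradientD(4)[OF X c t])
 qed
qed

lemma set_integrable_vol_imp_chart:
 fixes f :: "'a \<Rightarrow> real"
 assumes c: "c \<in> \<A>" and K: "compact K" "K \<subseteq> img c" and f: "set_integrable vol (chart_inv c ` K) f"
 shows "set_integrable lebesgue K (\<lambda>y. f (chart_inv c y))"
proof -
 let ?L = "chart_inv c ` K"
 have L: "compact ?L" "?L \<subseteq> fst c" "snd c ` ?L = K"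
  using compact_chart_inv_image[OF c K] K(2) by (auto simp: image_image subset_eq)
 define f' where "f' x = indicator ?L x *\<^sub>R f x" for x
 have m: "f' \<in> borel_measurable vol" using f unfolding f'_def[abs_def] set_integrable_def by (rule borel_measurable_integrable)
 have "set_integrable vol ?L f'" 
 proof -
  have "(\<lambda>x. indicator ?L x *\<^sub>R f' x) = (\<lambda>x. indicator ?L x *\<^sub>R f x)" by (auto simp: f'_def indicator_def)
  then show ?thesis using f unfolding set_integrable_def by simp
 qed
 then have "set_integrable lebesgue K (\<lambda>y. f' (chart_inv c y))"
  using set_integrable_chart[OF c measurable_vol_imp_chart[OF c m] m L(1,2)] L(3) by simp
 then show ?thesis
  unfolding set_integrable_def by (rule integrable_cong_B[THEN iffD1, rotated 2]) (auto simp: f'_def indicator_def)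
qed

lemma measurable_pairing:
 assumes X: "mfield \<Omega> X" and \<Omega>: "open \<Omega>" and c: "c \<in> \<A>"
 shows "(\<lambda>y. pairing X c v y) \<in> borel_measurable (lebesgue_on (imgs c \<Omega>))"
proof -
 let ?V = "imgs c \<Omega>"
 have "(\<lambda>y. lm c y (X (chart_inv c y) c) v) \<in> borel_measurable (lebesgue_on ?V)"
  using X c chart_sets[OF c \<Omega>] by (intro measurable_lm) (auto simp: measurable_field_def)
 then show ?thesis
 proof (rule measurable_cong[THEN iffD1, rotated])
  fix y assume "y \<in> space (lebesgue_on ?V)"
  then obtain x where "x \<in> fst c" "x \<in> \<Omega>" "y = snd c x" by (auto simp: space_restrict_space)
  then show "lm c y (X (chart_inv c y) c) v = pairing X c v y"
   using chart_pairing[OF c, of y "X x" v] measurable_field_in[OF X] c by simp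
 qed
qed

text \<open>Cauchy-Schwarz against the coordinate vector field, whose metric norm is bounded on
  compact sets.\<close>

lemma weak_gradient_chart_integrable:
 assumes X: "wgrad \<Omega> u X" and \<Omega>: "open \<Omega>" and c: "c \<in> \<A>" and K: "compact K" "K \<subseteq> imgs c \<Omega>"
 shows "set_integrable lebesgue K (\<lambda>y. u (chart_inv c y))"
  and "set_integrable lebesgue K (\<lambda>y. pairing X c v y)"
proof -
 let ?V = "imgs c \<Omega>"
 have K': "K \<subseteq> img c" using K by auto
 have L: "compact (chart_inv c ` K)" "chart_inv c ` K \<subseteq> \<Omega>"
  using compact_chart_inv_image[OF c K(1) K'] K(2) c by auto
 have i: "set_integrable vol (chart_inv c ` K) u" "set_integrable vol (chart_inv c ` K) (\<lambda>x. tnorm g x (X x))"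
  and mf: "mfield \<Omega> X"
  using is_weak_gradientD(1-3)[OF X] L by (auto simp: loc_integrable_def)
 show "set_integrable lebesgue K (\<lambda>y. u (chart_inv c y))" by (rule set_integrable_vol_imp_chart[OF c K(1) K' i(1)])
 have t: "set_integrable lebesgue K (\<lambda>y. tnorm g (chart_inv c y) (X (chart_inv c y)))"
  by (rule set_integrable_vol_imp_chart[OF c K(1) K' i(2)])
 obtain B where B: "B > 0" "\<And>y v. y \<in> K ==> lnorm c y v \<le> B * norm v"
  by (rule lnorm_bounds[OF c K(1) K']) (rule that)
 have Xt: "X (chart_inv c y) \<in> TM (chart_inv c y)" if "y \<in> ?V" for y
  by (rule measurable_field_in[OF mf]) (use that c in auto)
 have "(\<lambda>y. pairing X c v y) \<in> borel_measurable (lebesgue_on K)"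
  by (rule measurable_restrict_mono[OF measurable_pairing[OF mf \<Omega> c] K(2)])
 moreover have "K \<in> sets lebesgue" using K(1) by (simp add: lmeasurable_compact fmeasurableD)
 ultimately have m: "set_borel_measurable lebesgue K (\<lambda>y. pairing X c v y)"
  unfolding set_borel_measurable_def by (simp add: borel_measurable_restrict_space_iff)
 have t': "set_integrable lebesgue K (\<lambda>y. B * norm v * tnorm g (chart_inv c y) (X (chart_inv c y)))"
  by (intro set_integrable_mult_right t)
 show "set_integrable lebesgue K (\<lambda>y. pairing X c v y)"
 proof (rule set_integrable_bound[OF t' m])
  show "AE y in lebesgue. y \<in> K \<longrightarrow> norm (pairing X c v y)
    \<le> norm (B * norm v * tnorm g (chart_inv c y) (X (chart_inv c y)))"
  proof (intro AE_I2 impI)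
   fix y assume y: "y \<in> K"
   let ?x = "chart_inv c y"
   have x: "?x \<in> fst c" using y K' by auto
   have "X ?x \<in> TM ?x" using Xt y K by blast
   moreover have "tnorm g ?x (tv c ?x v) \<le> B * norm v"
    using lnorm_eq_tnorm[OF c x, of v] B(2)[OF y, of v] y K' by (simp add: subset_eq)
   ultimately have "\<bar>g ?x (X ?x) (tv c ?x v)\<bar> \<le> tnorm g ?x (X ?x) * (B * norm v)" "0 \<le> tnorm g ?x (X ?x)"
    using order_trans[OF g_Cauchy_Schwarz[OF _ tvec_of_in[OF c x]] mult_left_mono] tnorm_nonneg by blast+
   then show "norm (g ?x (X ?x) (tv c ?x v)) \<le> norm (B * norm v * tnorm g ?x (X ?x))"
    using B(1) by (simp add: abs_mult mult_ac)
  qed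
 qed
qed

text \<open>In each chart and basis direction the two candidates integrate equally against all test
  functions; nondegeneracy of the metric recovers the vector from these finitely many
  components.\<close>

lemma weak_gradient_unique:
 assumes X: "wgrad \<Omega> u X" and Y: "wgrad \<Omega> u Y" and \<Omega>: "open \<Omega>"
 shows "AE x in vol. x \<in> \<Omega> \<longrightarrow> X x = Y x"
proof (rule AE_chart_imp_vol)
 fix c assume c: "c \<in> \<A>"
 let ?V = "imgs c \<Omega>"
 let ?w = "\<lambda>X v y. pairing X c v y"
 have V: "open ?V" by (rule open_chart_Int[OF c \<Omega>])
 have ae: "AE y in lebesgue. y \<in> ?V \<longrightarrow> ?w X v y - ?w Y v y = 0" for v
 proof (rule fundamental_lemma[OF V])
  show "set_integrable lebesgue K (\<lambda>y. ?w X v y - ?w Y v y)" if "compact K" "K \<subseteq> ?V" for K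
   by (rule set_integral_diff(1)[OF weak_gradient_chart_integrable(2)[OF X \<Omega> c that] weak_gradient_chart_integrable(2)[OF Y \<Omega> c that]])
  fix \<phi> assume \<phi>: "test_function ?V \<phi>"
  then obtain K where K: "compact K" "K \<subseteq> ?V" "\<And>y. y \<notin> K ==> \<phi> y = 0" unfolding test_function_def by blast
  have int: "set_integrable lebesgue ?V (\<lambda>y. ?w Z v y * \<phi> y)" if Z: "wgrad \<Omega> u Z" for Z
  proof -
   have iK: "set_integrable lebesgue K (?w Z v)" by (rule weak_gradient_chart_integrable(2)[OF Z \<Omega> c K(1,2)])
   have c\<phi>: "continuous_on UNIV \<phi>" by (rule test_function_continuous(1)[OF \<phi>])
   obtain M where M: "\<And>y. y \<in> K ==> \<bar>\<phi> y\<bar> \<le> M"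
    using compact_imp_bounded[OF compact_continuous_image[OF continuous_on_subset[OF c\<phi> subset_UNIV] K(1)]] by (auto simp: bounded_iff)
   have "\<phi> \<in> borel_measurable borel" using c\<phi> by (rule borel_measurable_continuous_onI)
   then have "\<phi> \<in> borel_measurable lebesgue" by (intro measurable_completion) (simp only: measurable_lborel2)
   then have "integrable lebesgue (\<lambda>y. (indicator K y *\<^sub>R ?w Z v y) * \<phi> y)"
   proof -
    have "integrable lebesgue (\<lambda>y. \<bar>M\<bar> * (indicator K y *\<^sub>R ?w Z v y))" using iK unfolding set_integrable_def by (rule integrable_mult_right)
    then show ?thesis
    proof (rule integrable_bound_B)
     show "AE y in lebesgue. norm ((indicator K y *\<^sub>R ?w Z v y) * \<phi> y) \<le> norm (\<bar>M\<bar> * (indicator K y *\<^sub>R ?w Z v y))"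
     proof (rule AE_I2)
      fix y show "norm ((indicator K y *\<^sub>R ?w Z v y) * \<phi> y) \<le> norm (\<bar>M\<bar> * (indicator K y *\<^sub>R ?w Z v y))"
       using mult_right_mono[OF order_trans[OF M abs_ge_self], of y "\<bar>?w Z v y\<bar>"]
       by (auto simp: indicator_def abs_mult mult.commute)
     qed
    qed (use iK \<open>\<phi> \<in> borel_measurable lebesgue\<close> in \<open>auto simp: set_integrable_def intro!: borel_measurable_times borel_measurable_integrable\<close>)
   qed
   then show ?thesis
    unfolding set_integrable_def by (rule integrable_cong_B[THEN iffD1, rotated 2]) (use K in \<open>auto simp: indicator_def\<close>)
  qed
  have "(LINT y:?V|lebesgue. ?w X v y * \<phi> y) = (LINT y:?V|lebesgue. ?w Y v y * \<phi> y)"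
   using is_weak_gradientD(4)[OF X c \<phi>, of v] is_weak_gradientD(4)[OF Y c \<phi>, of v] by simp
  then show "(LINT y:?V|lebesgue. (?w X v y - ?w Y v y) * \<phi> y) = 0"
   using set_integral_diff(2)[OF int[OF X] int[OF Y]] by (simp add: left_diff_distrib)
 qed
 have "AE y in lebesgue. \<forall>v\<in>Basis. y \<in> ?V \<longrightarrow> ?w X v y - ?w Y v y = 0"
  by (rule AE_finite_allI[OF finite_Basis ae])
 then show "AE y in lebesgue. y \<in> img c \<longrightarrow> (chart_inv c y \<in> \<Omega> \<longrightarrow> X (chart_inv c y) = Y (chart_inv c y))"
 proof eventually_elim
  case (elim y)
  show ?case
  proof (intro impI)
   assume y: "y \<in> img c" and x: "chart_inv c y \<in> \<Omega>"
   have yV: "y \<in> ?V" using y x c by auto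
   have t: "X (chart_inv c y) \<in> TM (chart_inv c y)" "Y (chart_inv c y) \<in> TM (chart_inv c y)"
    using measurable_field_in[OF is_weak_gradientD(2)[OF X] x] measurable_field_in[OF is_weak_gradientD(2)[OF Y] x] by simp_all
   have "lm c y (X (chart_inv c y) c) = lm c y (Y (chart_inv c y) c)"
   proof (rule linear_eq_stdbasis)
    show "linear (lm c y (X (chart_inv c y) c))" "linear (lm c y (Y (chart_inv c y) c))"
     using linear_lm(2)[OF c y] by simp_all
    fix b :: "real ^ 'm" assume "b \<in> Basis"
    then show "lm c y (X (chart_inv c y) c) b = lm c y (Y (chart_inv c y) c) b"
     using elim yV chart_pairing[OF c y t(1), of b] chart_pairing[OF c y t(2), of b] by auto
   qed
   then show "X (chart_inv c y) = Y (chart_inv c y)"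
    by (intro tangent_nondegenerate[OF c chart_inv_in[OF y] t]) (simp add: chart_pairing[OF c y t(1)] chart_pairing[OF c y t(2)])
  qed
 qed
qed

lemma set_integrable_vol_AE:
 fixes f f' :: "'a \<Rightarrow> real"
 assumes "set_integrable vol K f" "f' \<in> borel_measurable vol" "K \<in> sets vol" "AE x in vol. x \<in> K \<longrightarrow> f x = f' x"
 shows "set_integrable vol K f'"
 unfolding set_integrable_def
proof (rule integrable_cong_AE_imp)
 show "integrable vol (\<lambda>x. indicator K x *\<^sub>R f x)" using assms(1) by (simp add: set_integrable_def)
 show "(\<lambda>x. indicator K x *\<^sub>R f' x) \<in> borel_measurable vol"
  using assms(2,3) by (intro borel_measurable_scaleR borel_measurable_indicator)
 show "AE x in vol. indicator K x *\<^sub>R f x = indicator K x *\<^sub>R f' x"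
  using assms(4) by eventually_elim (auto simp: indicator_def)
qed

lemma compact_in_vol: "compact K ==> K \<in> sets vol"
 by (intro borel_in_vol borel_compact)

lemma loc_integrable_bound:
 fixes f h :: "'a \<Rightarrow> real"
 assumes h: "loc_integrable vol UNIV h" and f: "f \<in> borel_measurable vol" and b: "\<And>x. \<bar>f x\<bar> \<le> h x"
 shows "loc_integrable vol UNIV f"
 unfolding loc_integrable_def
proof (intro allI impI)
 fix K :: "'a set" assume K: "compact K \<and> K \<subseteq> UNIV"
 show "set_integrable vol K f"
 proof (rule set_integrable_bound)
  show "set_integrable vol K h" using h K unfolding loc_integrable_def by blast
  show "set_borel_measurable vol K f" unfolding set_borel_measurable_def
   using f K by (intro borel_measurable_scaleR borel_measurable_indicator) (auto intro: compact_in_vol)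
  show "AE x in vol. x \<in> K \<longrightarrow> norm (f x) \<le> norm (h x)"
   using order_trans[OF b abs_ge_self] by simp
 qed
qed

lemma loc_integrable_add:
 "loc_integrable M \<Omega> f ==> loc_integrable M \<Omega> h ==> loc_integrable M \<Omega> (\<lambda>x. a * f x + b * h x)"
 unfolding loc_integrable_def by (intro allI impI set_integral_add(1) set_integrable_mult_right) blast+

lemma is_weak_gradient_AE:
 assumes X: "wgrad \<Omega> u X" and \<Omega>: "open \<Omega>" and Y: "mfield UNIV Y"
  and eq: "AE x in vol. x \<in> \<Omega> \<longrightarrow> X x = Y x"
 shows "wgrad \<Omega> u Y"
 unfolding is_weak_gradient_def
proof (intro conjI ballI allI impI)
 show "loc_integrable vol \<Omega> u" by (rule is_weak_gradientD(1)[OF X])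
 show "mfield \<Omega> Y"
  using Y by (auto simp: measurable_field_def intro: measurable_restrict_mono)
 show "loc_integrable vol \<Omega> (\<lambda>x. tnorm g x (Y x))"
  unfolding loc_integrable_def
 proof (intro allI impI)
  fix K assume K: "compact K \<and> K \<subseteq> \<Omega>"
  show "set_integrable vol K (\<lambda>x. tnorm g x (Y x))"
  proof (rule set_integrable_vol_AE[OF _ measurable_tnorm[OF Y] compact_in_vol])
   show "set_integrable vol K (\<lambda>x. tnorm g x (X x))" using is_weak_gradientD(3)[OF X] K by (simp add: loc_integrable_def)
   show "AE x in vol. x \<in> K \<longrightarrow> tnorm g x (X x) = tnorm g x (Y x)" using eq by eventually_elim (use K in auto)
  qed (use K in simp)
 qed
 fix c v \<phi> assume c: "c \<in> \<A>" and \<phi>: "test_function (imgs c \<Omega>) \<phi>"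
 let ?V = "imgs c \<Omega>"
 let ?w = "\<lambda>X y. pairing X c v y"
 have "AE x in vol. x \<in> fst c \<longrightarrow> (x \<in> \<Omega> \<longrightarrow> X x = Y x)" using eq by eventually_elim simp
 from AE_vol_imp_chart[OF c this]
 have ae: "AE y in lebesgue. y \<in> ?V \<longrightarrow> ?w X y = ?w Y y" by eventually_elim (use c in auto)
 have "\<phi> \<in> borel_measurable borel" by (rule borel_measurable_continuous_onI[OF test_function_continuous(1)[OF \<phi>]])
 then have m\<phi>: "\<phi> \<in> borel_measurable lebesgue" by (intro measurable_completion) (simp only: measurable_lborel2)
 have mw: "(\<lambda>y. indicator ?V y *\<^sub>R (?w Z y * \<phi> y)) \<in> borel_measurable lebesgue" if "mfield \<Omega> Z" for Z
 proof -
  have "(\<lambda>y. indicator ?V y *\<^sub>R ?w Z y) \<in> borel_measurable lebesgue"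
   by (rule borel_measurable_restrict_space_iff[THEN iffD1, OF _ measurable_pairing[OF that \<Omega> c]]) (use chart_sets[OF c \<Omega>] in simp)
  from borel_measurable_times[OF this m\<phi>] show ?thesis by (simp add: mult.assoc)
 qed
 have "(LINT y:?V|lebesgue. ?w X y * \<phi> y) = (LINT y:?V|lebesgue. ?w Y y * \<phi> y)"
  unfolding set_lebesgue_integral_def
 proof (rule integral_cong_AE[OF mw mw])
  show "mfield \<Omega> X" by (rule is_weak_gradientD(2)[OF X])
  show "mfield \<Omega> Y" by fact
  show "AE y in lebesgue. indicator ?V y *\<^sub>R (?w X y * \<phi> y) = indicator ?V y *\<^sub>R (?w Y y * \<phi> y)"
   using ae by eventually_elim (auto simp: indicator_def)
 qed
 then show "(LINT y:?V|lebesgue. u (chart_inv c y) * ddir \<phi> y v) = - (LINT y:?V|lebesgue. ?w Y y * \<phi> y)"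
  using is_weak_gradientD(4)[OF X c \<phi>, of v] by argo
qed

text \<open>A test function has compact support, so its support already lies in the image of a
  single \<open>B n\<close>.\<close>

lemma is_weak_gradient_UNIV:
 assumes X: "\<And>n :: nat. wgrad (B n) u X" and B: "\<And>K. compact K ==> \<exists>n. K \<subseteq> B n"
  and m: "mfield UNIV X"
 shows "wgrad UNIV u X"
 unfolding is_weak_gradient_def
proof (intro conjI ballI allI impI)
 have "loc_integrable vol UNIV f" if "\<And>n. loc_integrable vol (B n) f" for f
  using that B unfolding loc_integrable_def by meson
 then show "loc_integrable vol UNIV u" "loc_integrable vol UNIV (\<lambda>x. tnorm g x (X x))"
  using is_weak_gradientD(1,3)[OF X] by blast+
 show "mfield UNIV X" by (rule m)
 fix c v \<phi> assume c: "c \<in> \<A>" and \<phi>: "test_function (imgs c UNIV) \<phi>"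
 then obtain K where K: "compact K" "K \<subseteq> img c" "\<And>y. y \<notin> K ==> \<phi> y = 0"
  unfolding test_function_def by auto
 obtain n where n: "chart_inv c ` K \<subseteq> B n" using B[OF compact_chart_inv_image[OF c K(1,2)]] by blast
 have K': "K \<subseteq> snd c ` (fst c \<inter> B n)"
 proof
  fix y assume y: "y \<in> K"
  then have "y = snd c (chart_inv c y)" "chart_inv c y \<in> fst c \<inter> B n" using K(2) n by auto
  then show "y \<in> snd c ` (fst c \<inter> B n)" by blast
 qed
 have sub: "snd c ` (fst c \<inter> B n) \<subseteq> imgs c UNIV" by auto
 have t: "test_function (snd c ` (fst c \<inter> B n)) \<phi>"
  using \<phi> K K' unfolding test_function_def by meson
 define f1 f2 where "f1 y = u (chart_inv c y)" and "f2 y = pairing X c v y" for y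
 have e: "(LINT y:imgs c UNIV|lebesgue. f1 y * ddir \<phi> y v) =
   (LINT y:snd c ` (fst c \<inter> B n)|lebesgue. f1 y * ddir \<phi> y v)"
  "(LINT y:imgs c UNIV|lebesgue. f2 y * \<phi> y) = (LINT y:snd c ` (fst c \<inter> B n)|lebesgue. f2 y * \<phi> y)"
  by (rule test_function_integral_subset(2)[OF K(1) K' _ sub], erule K(3), rule test_function_integral_subset(1)[OF K(1) K' _ sub], erule K(3))
 show "(LINT y:imgs c UNIV|lebesgue. u (chart_inv c y) * ddir \<phi> y v) =
   - (LINT y:imgs c UNIV|lebesgue. pairing X c v y * \<phi> y)"
  unfolding f1_def[symmetric] f2_def[symmetric] e
  unfolding f1_def f2_def by (rule is_weak_gradientD(4)[OF X c t])
qed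

end

section \<open>Global weak gradients and admissible test functions\<close>

context rmfd_complete
begin

text \<open>Local integrability gives measurability only after restriction to compact sets; the
  closed balls are compact and exhaust the manifold.\<close>

lemma loc_integrable_measurable:
 assumes "loc_integrable vol UNIV f"
 shows "f \<in> borel_measurable vol"
proof (rule borel_measurable_LIMSEQ_real)
 fix x0 x :: 'a
 show "(\<lambda>n. indicator (M.mcball undefined (real n)) x *\<^sub>R f x) \<longlonglongrightarrow> f x"
 proof (rule tendsto_eventually)
  obtain N :: nat where N: "dist_g undefined x \<le> real N" using real_arch_simple by blast
  show "\<forall>\<^sub>F n in sequentially. indicator (M.mcball undefined (real n)) x *\<^sub>R f x = f x"
   using eventually_ge_at_top[of N] by eventually_elim (use N in \<open>auto simp: M.mcball_def indicator_def\<close>)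
 qed
next
 fix n
 have "set_integrable vol (M.mcball undefined (real n)) f"
  using assms compact_mcball by (simp add: loc_integrable_def)
 then show "(\<lambda>x. indicator (M.mcball undefined (real n)) x *\<^sub>R f x) \<in> borel_measurable vol"
  unfolding set_integrable_def by (rule borel_measurable_integrable)
qed

text \<open>\<open>W1p_loc\<close> supplies an unrelated gradient on each relatively compact open
  set. By uniqueness they agree almost everywhere, so they glue along an exhaustion by balls; this
  provides the witness for the choice in \<open>weak_gradient\<close>.\<close>

lemma W1p_loc_weak_gradient:
 assumes u: "u \<in> Wloc p"
 shows "wgrad UNIV u (nabla u)"
  and "loc_integrable vol UNIV (\<lambda>x. \<bar>u x\<bar> powr p)"
  and "loc_integrable vol UNIV (\<lambda>x. tnorm g x (nabla u x) powr p)"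
proof -
 define B where "B n = M.mball undefined (real n)" for n
 have oB: "open (B n)" for n unfolding B_def by (rule open_mball)
 have mono: "B m \<subseteq> B n" if "m \<le> n" for m n using that unfolding B_def by auto
 have KB: "\<exists>n. K \<subseteq> B n" if K: "compact K" for K
 proof -
  obtain R where R: "K \<subseteq> M.mball undefined R" "R > 0" by (rule compact_subset_mball[OF K]) (rule that)
  obtain n where "R \<le> real n" using real_arch_simple by blast
  then have "M.mball undefined R \<subseteq> B n" unfolding B_def by auto
  then show ?thesis using R(1) by blast
 qed
 have cover: "\<exists>n. x \<in> B n" for x using KB[of "{x}"] by auto
 have "u \<in> W1p \<A> g p (B n)" for n
  using u mball_relatively_compact unfolding W1p_loc_def B_def by blast
 then have "\<exists>X. wgrad (B n) u X \<and> set_integrable vol (B n) (\<lambda>x. \<bar>u x\<bar> powr p) \<and>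
   set_integrable vol (B n) (\<lambda>x. tnorm g x (X x) powr p)" for n
  unfolding W1p_def by simp
 then obtain X where X: "\<And>n. wgrad (B n) u (X n)" "\<And>n. set_integrable vol (B n) (\<lambda>x. \<bar>u x\<bar> powr p)"
  "\<And>n. set_integrable vol (B n) (\<lambda>x. tnorm g x (X n x) powr p)" by metis
 define X' where "X' n x = (if x \<in> B n then X n x else (\<lambda>_. 0))" for n x
 have mX': "mfield UNIV (X' n)" for n
  unfolding X'_def by (rule measurable_field_extend[OF is_weak_gradientD(2)[OF X(1)] oB])
 define N where "N x = (LEAST n. x \<in> B n)" for x
 have N: "x \<in> B (N x)" for x unfolding N_def using cover by (rule LeastI_ex)
 \<comment> \<open>The field of the first ball containing x: a countable measurable selection, so Y
   is a measurable field although the gradients agree only up to null sets.\<close>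
 define Y where "Y x = X' (N x) x" for x
 have "AE x in vol. x \<in> B m \<longrightarrow> X m x = X n x" if "m \<le> n" for m n
  by (rule weak_gradient_unique[OF X(1) is_weak_gradient_subset[OF X(1) mono[OF that]] oB])
 then have "AE x in vol. \<forall>m n. m \<le> n \<longrightarrow> x \<in> B m \<longrightarrow> X m x = X n x"
  unfolding AE_all_countable by (intro allI) (auto intro: AE_impI)
 then have eq: "AE x in vol. \<forall>n. x \<in> B n \<longrightarrow> X n x = Y x"
 proof eventually_elim
  case (elim x)
  show ?case
  proof (intro allI impI)
   fix n assume "x \<in> B n"
   then have "N x \<le> n" unfolding N_def by (rule Least_le)
   then show "X n x = Y x" using elim N[of x] by (simp add: Y_def X'_def)
  qed
 qed
 have mY: "mfield UNIV Y"
  unfolding measurable_field_def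
 proof (intro conjI ballI)
  show "Y x \<in> TM x" for x unfolding Y_def by (rule measurable_field_in[OF mX' UNIV_I])
  fix c assume c: "c \<in> \<A>"
  let ?M = "lebesgue_on (imgs c UNIV)"
  have "(\<lambda>y. N (chart_inv c y)) \<in> measurable ?M (count_space UNIV)"
   unfolding N_def
  proof (rule measurable_Least)
   fix n
   have "{y \<in> space ?M. chart_inv c y \<in> B n} = snd c ` (fst c \<inter> B n)"
    using c by (auto simp: space_restrict_space)
   moreover have "snd c ` (fst c \<inter> B n) \<in> sets ?M"
    using chart_sets[OF c oB[of n]] chart_sets[OF c open_UNIV] by (subst sets_restrict_space_iff) auto
   ultimately show "(\<lambda>y. chart_inv c y \<in> B n) \<in> measurable ?M (count_space UNIV)"
    by (simp add: pred_def)
  qed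
  moreover have "(\<lambda>y. X' n (chart_inv c y) c) \<in> borel_measurable ?M" for n
   using measurable_field_chart[OF mX' c] by simp
  ultimately show "(\<lambda>y. Y (chart_inv c y) c) \<in> borel_measurable ?M"
   unfolding Y_def by (rule measurable_compose_countable[rotated])
 qed
 have "AE x in vol. x \<in> B n \<longrightarrow> X n x = Y x" for n using eq by eventually_elim simp
 then have "wgrad (B n) u Y" for n by (rule is_weak_gradient_AE[OF X(1) oB mY])
 then have "wgrad UNIV u Y" by (rule is_weak_gradient_UNIV[OF _ KB mY])
 then show G: "wgrad UNIV u (nabla u)"
  unfolding weak_gradient_def by (rule someI[of "wgrad UNIV u"])
 have mG: "(\<lambda>x. tnorm g x (nabla u x) powr p) \<in> borel_measurable vol"
  using measurable_tnorm[OF is_weak_gradientD(2)[OF G]] by measurable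
 show "loc_integrable vol UNIV (\<lambda>x. \<bar>u x\<bar> powr p)" "loc_integrable vol UNIV (\<lambda>x. tnorm g x (nabla u x) powr p)"
  unfolding loc_integrable_def
 proof (safe)
  fix K :: "'a set" assume K: "compact K"
  then obtain n where n: "K \<subseteq> B n" using KB by blast
  show "set_integrable vol K (\<lambda>x. \<bar>u x\<bar> powr p)" by (rule set_integrable_subset[OF X(2) compact_in_vol[OF K] n])
  have "AE x in vol. x \<in> B n \<longrightarrow> X n x = nabla u x"
   by (rule weak_gradient_unique[OF X(1) is_weak_gradient_subset[OF G subset_UNIV] oB])
  then have "AE x in vol. x \<in> K \<longrightarrow> tnorm g x (X n x) powr p = tnorm g x (nabla u x) powr p"
   by eventually_elim (use n in auto)
  then show "set_integrable vol K (\<lambda>x. tnorm g x (nabla u x) powr p)"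
   by (rule set_integrable_vol_AE[OF set_integrable_subset[OF X(3) compact_in_vol[OF K] n] mG compact_in_vol[OF K]])
 qed
qed

lemma W1p_loc_measurable: "u \<in> Wloc p ==> u \<in> borel_measurable vol"
 by (rule loc_integrable_measurable[OF is_weak_gradientD(1)[OF W1p_loc_weak_gradient(1)]])

text \<open>The product and chain rule is applied chart by chart. Bounds on \<eta>, its gradient and
  F' give p-integrability, and \<open>F 0 = 0\<close> turns the Lipschitz estimate into |F(u)| \<le>
  L |u|.\<close>

theorem cutoff_chain_rule:
 fixes F F' :: "real \<Rightarrow> real" and \<eta> :: "'a \<Rightarrow> real"
 assumes u: "u \<in> Wloc p" and p: "p > 0"
  and \<eta>: "C1M UNIV \<eta>" "\<And>x. \<bar>\<eta> x\<bar> \<le> B" "\<And>x. tnorm g x (grad \<eta> x) \<le> B"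
  and K: "compact K" "\<And>x. x \<notin> K ==> \<eta> x = 0"
  and F: "\<And>s. (F has_real_derivative F' s) (at s)" "continuous_on UNIV F'" "\<And>s. \<bar>F' s\<bar> \<le> L" "F 0 = 0"
 shows "(\<lambda>x. \<eta> x * F (u x)) \<in> W1p_c \<A> g p" (is "?\<phi> \<in> _")
  and "AE x in vol. nabla (\<lambda>x. \<eta> x * F (u x)) x =
   (\<lambda>c. (\<eta> x * F' (u x)) *\<^sub>R nabla u x c + F (u x) *\<^sub>R grad \<eta> x c)"
proof -
 define X where "X = nabla u"
 define Z where "Z x = (\<lambda>c. (\<eta> x * F' (u x)) *\<^sub>R X x c + F (u x) *\<^sub>R grad \<eta> x c)" for x
 note W = W1p_loc_weak_gradient[OF u, folded X_def]
 note mX = is_weak_gradientD(2)[OF W(1)] and mu = W1p_loc_measurable[OF u]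
 have Xt: "X x \<in> TM x" and Gt: "grad \<eta> x \<in> TM x" for x
  by (rule measurable_field_in[OF mX UNIV_I], rule grad_in[OF \<eta>(1) UNIV_I])
 have B0: "B \<ge> 0" and L0: "L \<ge> 0" using \<eta>(2)[of undefined] F(3)[of 0] by linarith+
 have cF: "continuous_on UNIV F" by (rule DERIV_continuous_on[where D = F']) (rule has_field_derivative_at_within[OF F(1)])
 have FL: "\<bar>F s\<bar> \<le> L * \<bar>s\<bar>" for s
  using field_differentiable_bound[of UNIV F F' L s 0] F by simp
 have mF: "(\<lambda>x. F (u x)) \<in> borel_measurable vol" "(\<lambda>x. F' (u x)) \<in> borel_measurable vol"
  by (rule measurable_compose[OF mu borel_measurable_continuous_onI[OF cF]], rule measurable_compose[OF mu borel_measurable_continuous_onI[OF F(2)]])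
 have m\<eta>: "\<eta> \<in> borel_measurable vol"
  by (rule borel_measurable_vol[OF borel_measurable_continuous_onI[OF C1M_continuous_on[OF \<eta>(1) open_UNIV]]])
 have m\<phi>: "?\<phi> \<in> borel_measurable vol" by (rule borel_measurable_times[OF m\<eta> mF(1)])
 have mZ: "mfield UNIV Z"
  unfolding Z_def by (intro measurable_field_comb mX measurable_field_grad \<eta> borel_measurable_times m\<eta> mF)
 have b\<phi>: "\<bar>?\<phi> x\<bar> \<le> B * L * \<bar>u x\<bar>" for x
  using mult_mono[OF \<eta>(2) FL B0 abs_ge_zero, of x "u x"] by (simp add: abs_mult mult_ac)
 have bZ: "tnorm g x (Z x) \<le> B * L * tnorm g x (X x) + B * L * \<bar>u x\<bar>" for x
 proof -
  have "tnorm g x (Z x) \<le> \<bar>\<eta> x * F' (u x)\<bar> * tnorm g x (X x) + \<bar>F (u x)\<bar> * tnorm g x (grad \<eta> x)"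
   unfolding Z_def by (rule tnorm_triangle[OF Xt Gt])
  also have "\<dots> \<le> B * L * tnorm g x (X x) + (L * \<bar>u x\<bar>) * B"
   unfolding abs_mult using B0 L0 tnorm_nonneg[OF Xt] tnorm_nonneg[OF Gt]
   by (intro add_mono mult_mono \<eta> F FL) auto
  finally show ?thesis by (simp add: mult_ac)
 qed
 have BL: "B * L \<ge> 0" using B0 L0 by simp
 have absu: "loc_integrable vol UNIV (\<lambda>x. \<bar>u x\<bar>)"
  using is_weak_gradientD(1)[OF W(1)] unfolding loc_integrable_def by (blast intro: set_integrable_abs)
 have G: "wgrad UNIV ?\<phi> Z"
  unfolding is_weak_gradient_def
 proof (intro conjI ballI allI impI)
  show "loc_integrable vol UNIV ?\<phi>"
   by (rule loc_integrable_bound[OF loc_integrable_add[OF absu absu, of "B * L" 0] m\<phi>]) (use b\<phi> in simp)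
  show "mfield UNIV Z" by (rule mZ)
  show "loc_integrable vol UNIV (\<lambda>x. tnorm g x (Z x))"
   by (rule loc_integrable_bound[OF loc_integrable_add[OF is_weak_gradientD(3)[OF W(1)] absu, of "B * L" "B * L"] measurable_tnorm[OF mZ]])
    (use bZ tnorm_nonneg[OF measurable_field_in[OF mZ UNIV_I]] in simp)
  fix c v \<phi> assume c: "c \<in> \<A>" and \<phi>: "test_function (imgs c UNIV) \<phi>"
  let ?V = "imgs c UNIV"
  have H: "((\<lambda>y. \<eta> (chart_inv c y)) has_derivative dif \<eta> c y) (at y)" if "y \<in> ?V" for y
   by (rule C1M_has_derivative[OF \<eta>(1) c that])
  have "(LINT y:?V|lebesgue. (\<eta> (chart_inv c y) * F (u (chart_inv c y))) * ddir \<phi> y v) =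
   - (LINT y:?V|lebesgue. (\<eta> (chart_inv c y) * F' (u (chart_inv c y)) * pairing X c v y
    + F (u (chart_inv c y)) * frechet_derivative (\<lambda>y. \<eta> (chart_inv c y)) (at y) v) * \<phi> y)"
  proof (rule weak_derivative_product_chain[where L = L])
   show "open ?V" by (rule open_chart_Int[OF c open_UNIV])
   show "continuous_on ?V (\<lambda>y. frechet_derivative (\<lambda>y. \<eta> (chart_inv c y)) (at y) v)"
    using C1M_continuous_dif[OF \<eta>(1) c, of v] unfolding dif_def .
  qed (use weak_gradient_chart_integrable[OF W(1) open_UNIV c] is_weak_gradientD(4)[OF W(1) c] F \<phi> differentiableI[OF H] in auto)
  also have "(LINT y:?V|lebesgue. (\<eta> (chart_inv c y) * F' (u (chart_inv c y)) * pairing X c v y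
    + F (u (chart_inv c y)) * frechet_derivative (\<lambda>y. \<eta> (chart_inv c y)) (at y) v) * \<phi> y) =
   (LINT y:?V|lebesgue. pairing Z c v y * \<phi> y)"
   unfolding set_lebesgue_integral_def
  proof (rule integral_cong_B[OF refl])
   fix y
   show "indicator ?V y *\<^sub>R ((\<eta> (chart_inv c y) * F' (u (chart_inv c y)) * pairing X c v y
    + F (u (chart_inv c y)) * frechet_derivative (\<lambda>y. \<eta> (chart_inv c y)) (at y) v) * \<phi> y) =
    indicator ?V y *\<^sub>R (pairing Z c v y * \<phi> y)"
   proof (cases "y \<in> ?V")
    case True
    then have x: "chart_inv c y \<in> fst c" "snd c (chart_inv c y) = y" by auto
    show ?thesis
     unfolding Z_def g_left[OF Xt Gt tvec_of_in[OF c x(1)]] g_grad[OF \<eta>(1) UNIV_I c x(1)] x(2) dif_def ..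
   qed simp
  qed
  finally show "(LINT y:?V|lebesgue. ?\<phi> (chart_inv c y) * ddir \<phi> y v) =
   - (LINT y:?V|lebesgue. pairing Z c v y * \<phi> y)" .
 qed
 have p\<phi>: "loc_integrable vol UNIV (\<lambda>x. \<bar>?\<phi> x\<bar> powr p)"
 proof (rule loc_integrable_bound[OF loc_integrable_add[OF W(2) W(2), of "(B * L) powr p" 0]])
  show "(\<lambda>x. \<bar>?\<phi> x\<bar> powr p) \<in> borel_measurable vol" using m\<phi> by measurable
  fix x show "\<bar>\<bar>?\<phi> x\<bar> powr p\<bar> \<le> (B * L) powr p * \<bar>u x\<bar> powr p + 0 * \<bar>u x\<bar> powr p"
   using powr_mono2[OF less_imp_le[OF p] abs_ge_zero b\<phi>] BL by (simp add: powr_mult)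
 qed
 have pZ: "loc_integrable vol UNIV (\<lambda>x. tnorm g x (Z x) powr p)"
 proof (rule loc_integrable_bound[OF loc_integrable_add[OF W(3) W(2), of "2 powr p * (B * L) powr p" "2 powr p * (B * L) powr p"]])
  show "(\<lambda>x. tnorm g x (Z x) powr p) \<in> borel_measurable vol" using measurable_tnorm[OF mZ] by measurable
  fix x
  have "tnorm g x (Z x) powr p \<le> (B * L * tnorm g x (X x) + B * L * \<bar>u x\<bar>) powr p"
   using p by (intro powr_mono2 bZ tnorm_nonneg measurable_field_in[OF mZ]) auto
  also have "\<dots> \<le> 2 powr p * ((B * L * tnorm g x (X x)) powr p + (B * L * \<bar>u x\<bar>) powr p)"
   using BL tnorm_nonneg[OF Xt] p by (intro powr_add_le) auto
  finally show "\<bar>tnorm g x (Z x) powr p\<bar> \<le> 2 powr p * (B * L) powr p * tnorm g x (X x) powr p + 2 powr p * (B * L) powr p * \<bar>u x\<bar> powr p"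
   using BL tnorm_nonneg[OF Xt, of x] by (simp add: powr_mult distrib_left)
 qed
 have "?\<phi> \<in> Wloc p"
  unfolding W1p_loc_def W1p_def mem_Collect_eq
 proof (intro allI impI exI conjI)
  fix \<Omega> :: "'a set" assume \<Omega>: "open \<Omega> \<and> compact (closure \<Omega>)"
  show "wgrad \<Omega> ?\<phi> Z" by (rule is_weak_gradient_subset[OF G subset_UNIV])
  have s: "\<Omega> \<in> sets vol" using \<Omega> by simp
  show "set_integrable vol \<Omega> (\<lambda>x. \<bar>?\<phi> x\<bar> powr p)" "set_integrable vol \<Omega> (\<lambda>x. tnorm g x (Z x) powr p)"
   using p\<phi> pZ \<Omega> unfolding loc_integrable_def by (blast intro: set_integrable_subset[OF _ s closure_subset])+
 qed
 then show *: "?\<phi> \<in> W1p_c \<A> g p"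
  unfolding W1p_c_def using K by (auto intro!: exI[of _ K])
 have "?\<phi> \<in> Wloc p" using * by (simp add: W1p_c_def)
 from weak_gradient_unique[OF W1p_loc_weak_gradient(1)[OF this] G open_UNIV]
 show "AE x in vol. nabla ?\<phi> x = (\<lambda>c. (\<eta> x * F' (u x)) *\<^sub>R nabla u x c + F (u x) *\<^sub>R grad \<eta> x c)"
  by eventually_elim (simp add: Z_def X_def)
qed

end

section \<open>The energy estimate\<close>

lemma has_real_derivative_max_powr:
 fixes p t :: real
 assumes p: "p > 1"
 shows "((\<lambda>t. max 0 t powr p) has_real_derivative p * max 0 t powr (p - 1)) (at t)"
proof -
 consider "t > 0" | "t < 0" | "t = 0" by linarith
 then show ?thesis
 proof cases
  case 1
  have "((\<lambda>t. t powr p) has_real_derivative p * t powr (p - 1)) (at t)" by (rule has_real_derivative_powr[OF 1])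
  then have "((\<lambda>t. max 0 t powr p) has_real_derivative p * t powr (p - 1)) (at t)"
   by (rule DERIV_cong_ev[OF refl _ refl, THEN iffD1, rotated])
    (use eventually_nhds_in_open[of "{0<..}" t] 1 in \<open>auto elim!: eventually_mono simp: max_def\<close>)
  then show ?thesis using 1 by simp
 next
  case 2
  have "((\<lambda>_. 0) has_real_derivative 0) (at t)" by simp
  then have "((\<lambda>t. max 0 t powr p) has_real_derivative 0) (at t)"
   by (rule DERIV_cong_ev[OF refl _ refl, THEN iffD1, rotated])
    (use eventually_nhds_in_open[of "{..<0}" t] 2 in \<open>auto elim!: eventually_mono simp: max_def\<close>)
  then show ?thesis using 2 by simp
 next
  case 3
  have "((\<lambda>h. (max 0 (0 + h) powr p - max 0 0 powr p) / h) \<longlongrightarrow> 0) (at (0 :: real))"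
  proof (rule Lim_null_comparison)
   show "\<forall>\<^sub>F h in at (0 :: real). norm ((max 0 (0 + h) powr p - max 0 0 powr p) / h) \<le> \<bar>h\<bar> powr (p - 1)"
   proof (rule always_eventually, rule allI)
    fix h :: real
    show "norm ((max 0 (0 + h) powr p - max 0 0 powr p) / h) \<le> \<bar>h\<bar> powr (p - 1)"
    proof (cases "h > 0")
     case True
     then show ?thesis by (simp add: powr_diff)
    next
     case False
     then have "max 0 (0 + h) = 0" by simp
     then show ?thesis by (simp only:) simp
    qed
   qed
   have "((\<lambda>h. \<bar>h\<bar> powr (p - 1)) \<longlongrightarrow> \<bar>0 :: real\<bar> powr (p - 1)) (at 0)"
    using p by (intro tendsto_powr' tendsto_intros) auto
   then show "((\<lambda>h. \<bar>h\<bar> powr (p - 1)) \<longlongrightarrow> 0) (at (0 :: real))" by simp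
  qed
  then show ?thesis using 3 p unfolding DERIV_def by simp
 qed
qed

text \<open>Young's inequality, weighted so that the power of Y gets coefficient exactly 1. The
  right side is the maximum of the left side over Y \<ge> 0, so this step costs nothing in the final
  threshold.\<close>

lemma Young_absorb:
 fixes X Y p :: real
 assumes X: "X \<ge> 0" and Y: "Y \<ge> 0" and p: "p > 1"
 shows "X * Y - Y powr (p / (p - 1)) \<le> (p - 1) powr (p - 1) * p powr (- p) * X powr p"
proof -
 define q where "q = p / (p - 1)"
 have q: "q > 1" "1 / p + 1 / q = 1" using p by (simp_all add: q_def field_simps)
 \<comment> \<open>m^q = q cancels the factor 1/q in Young's inequality.\<close>
 define m where "m = q powr (1 / q)"
 have m: "m > 0" using q by (simp add: m_def)
 have "X * Y = (X / m) * (Y * m)" using m by simp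
 also have "\<dots> \<le> (X / m) powr p / p + (Y * m) powr q / q"
  using X Y m p q by (intro Youngs_inequality) auto
 also have "(Y * m) powr q / q = Y powr q" using q Y m by (simp add: powr_mult m_def powr_powr)
 also have "(X / m) powr p / p = X powr p * (q powr (- (p - 1)) / p)"
 proof -
  have "1 / q * p = p - 1" using p by (simp add: q_def)
  then have "m powr p = q powr (p - 1)" by (simp add: m_def powr_powr)
  then have "(X / m) powr p = X powr p / q powr (p - 1)" using X m by (simp add: powr_divide)
  then show ?thesis unfolding powr_minus by (simp add: divide_inverse mult_ac)
 qed
 also have "q powr (- (p - 1)) / p = (p - 1) powr (p - 1) * p powr (- p)"
 proof -
  have "q powr (- (p - 1)) = (p - 1) powr (p - 1) / p powr (p - 1)"
  proof -
   have "q powr (- (p - 1)) = inverse (p powr (p - 1) / (p - 1) powr (p - 1))"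
    unfolding powr_minus q_def using p by (subst powr_divide) auto
   then show ?thesis by simp
  qed
  moreover have "p powr p = p powr (p - 1) * p" using p by (simp add: powr_diff)
  ultimately show ?thesis using p by (simp add: powr_minus inverse_eq_divide)
 qed
 finally show ?thesis by (simp add: q_def mult.commute)
qed

text \<open>Here a is the energy density, G w the derivative of the nonlinearity and p \<zeta>^(p-1)
  M a bound for the gradient of the cutoff. The conjugate power of Y is exactly the good term
  \<zeta>^p G w a, and neither a nor \<zeta> is left in X.\<close>

lemma energy_pointwise:
 fixes a \<zeta> G w s k M p :: real
 assumes p: "p > 1" and a: "a \<ge> 0" and \<zeta>: "\<zeta> \<ge> 0" and G: "G > 0" and w: "w > 0" and k: "k \<ge> 0" and M: "M \<ge> 0"
 shows "\<bar>s\<bar> * G * (k * a powr ((p - 1) / p)) * (p * \<zeta> powr (p - 1) * M) - \<zeta> powr p * (G * w) * a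
  \<le> (p - 1) powr (p - 1) * p powr (- p) * (k * p * M) powr p * (\<bar>s\<bar> powr p * G * w powr (1 - p))"
proof -
 define D where "D = G * w"
 define r where "r = (p - 1) / p"
 have D: "D > 0" using G w by (simp add: D_def)
 define X where "X = \<bar>s\<bar> * G * (k * p * M) * D powr (- r)"
 define Y where "Y = (\<zeta> powr p * D * a) powr r"
 have "Y = \<zeta> powr (p - 1) * D powr r * a powr r"
  using \<zeta> D a p by (simp add: Y_def powr_mult powr_powr r_def)
 then have XY: "X * Y = \<bar>s\<bar> * G * (k * a powr r) * (p * \<zeta> powr (p - 1) * M)"
  using D by (simp add: X_def powr_minus field_simps)
 have Yq: "Y powr (p / (p - 1)) = \<zeta> powr p * D * a"
  using \<zeta> D a p by (simp add: Y_def powr_powr r_def)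
 have GD: "G powr p * D powr (1 - p) = G * w powr (1 - p)"
  using G w by (simp add: D_def powr_mult powr_diff)
 have "- r * p = 1 - p" using p by (simp add: r_def)
 then have Xp: "X powr p = (k * p * M) powr p * (\<bar>s\<bar> powr p * (G powr p * D powr (1 - p)))"
  using G D k M p by (simp add: X_def powr_mult powr_powr mult_ac)
 have X0: "X \<ge> 0" "Y \<ge> 0" using G k M p D by (auto simp: X_def Y_def)
 show ?thesis
  using Young_absorb[OF X0 p] unfolding XY Yq Xp GD by (simp add: r_def D_def mult_ac)
qed

text \<open>As \<open>\<epsilon> \<rightarrow> 0\<close> the function \<open>s * trunc_power b \<epsilon> s\<close> tends to \<open>s \<bar>s\<bar>\<^sup>b\<^sup>-\<^sup>1\<close>, which itself is not an admissible
 test nonlinearity since its derivative is unbounded (at \<open>0\<close> or at infinity). The derivative of the approximation is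
 \<open>trunc_power b \<epsilon> s * trunc_weight b \<epsilon> s\<close>.\<close>

definition trunc_ratio :: "real \<Rightarrow> real \<Rightarrow> real" where
 "trunc_ratio \<epsilon> s = (s\<^sup>2 + \<epsilon>) / (1 + \<epsilon> * s\<^sup>2)"

definition trunc_power :: "real \<Rightarrow> real \<Rightarrow> real \<Rightarrow> real" where
 "trunc_power b \<epsilon> s = trunc_ratio \<epsilon> s powr ((b - 1) / 2)"

definition trunc_weight :: "real \<Rightarrow> real \<Rightarrow> real \<Rightarrow> real" where
 "trunc_weight b \<epsilon> s = 1 + (b - 1) * (s\<^sup>2 * (1 - \<epsilon>\<^sup>2) / ((s\<^sup>2 + \<epsilon>) * (1 + \<epsilon> * s\<^sup>2)))"

context
 fixes b \<epsilon> :: real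
 assumes b: "b > 0" and \<epsilon>: "0 < \<epsilon>" "\<epsilon> < 1"
begin

lemma trunc_denominators: "s\<^sup>2 + \<epsilon> > 0" "1 + \<epsilon> * s\<^sup>2 > 0"
 using \<epsilon> by (auto simp: add_nonneg_pos add_pos_nonneg)

lemma trunc_ratio_pos: "trunc_ratio \<epsilon> s > 0"
 unfolding trunc_ratio_def using trunc_denominators by (rule divide_pos_pos)

lemma trunc_power_pos: "trunc_power b \<epsilon> s > 0"
 using trunc_ratio_pos[of s] by (simp add: trunc_power_def)

text \<open>The differences to the two end values have numerators (1 - \<epsilon>)(1 - s^2) and
  \<epsilon>(1 - s^4), up to sign. The resulting range does not depend on \<epsilon>.\<close>

lemma trunc_ratio_between: "trunc_ratio \<epsilon> s \<in> {min 1 (s\<^sup>2)..max 1 (s\<^sup>2)}"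
proof (cases "s\<^sup>2 \<le> 1")
 case True
 have "0 \<le> (1 - \<epsilon>) * (1 - s\<^sup>2)" "s\<^sup>2 * s\<^sup>2 \<le> 1 * 1" using \<epsilon> True by (intro mult_nonneg_nonneg mult_mono; simp)+
 then have "s\<^sup>2 * (1 + \<epsilon> * s\<^sup>2) \<le> s\<^sup>2 + \<epsilon>" "s\<^sup>2 + \<epsilon> \<le> 1 * (1 + \<epsilon> * s\<^sup>2)"
  using mult_left_mono[of "s\<^sup>2 * s\<^sup>2" 1 \<epsilon>] \<epsilon> by (auto simp: algebra_simps)
 then show ?thesis using True trunc_denominators[of s] by (simp add: trunc_ratio_def pos_le_divide_eq pos_divide_le_eq min_def max_def)
next
 case False
 have "0 \<le> (1 - \<epsilon>) * (s\<^sup>2 - 1)" "1 * 1 \<le> s\<^sup>2 * s\<^sup>2" using \<epsilon> False by (intro mult_nonneg_nonneg mult_mono; simp)+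
 then have "1 * (1 + \<epsilon> * s\<^sup>2) \<le> s\<^sup>2 + \<epsilon>" "s\<^sup>2 + \<epsilon> \<le> s\<^sup>2 * (1 + \<epsilon> * s\<^sup>2)"
  using mult_left_mono[of 1 "s\<^sup>2 * s\<^sup>2" \<epsilon>] \<epsilon> by (auto simp: algebra_simps)
 then show ?thesis using False trunc_denominators[of s] by (simp add: trunc_ratio_def pos_le_divide_eq pos_divide_le_eq min_def max_def)
qed

lemma powr_between:
 fixes x y z e :: real
 assumes "0 < x" "x \<le> y" "y \<le> z"
 shows "y powr e \<le> max (x powr e) (z powr e)"
 using assms powr_mono2[of e y z] powr_mono2'[of e x y] by (cases "e \<ge> 0") (auto simp: max_def)

text \<open>A majorant free of \<epsilon>, for dominated convergence. The sum of two powers covers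
  both signs of b - 1, for which the power is monotone in opposite directions.\<close>

lemma trunc_power_growth: "\<bar>s\<bar> powr p * trunc_power b \<epsilon> s \<le> \<bar>s\<bar> powr p + \<bar>s\<bar> powr (p + b - 1)"
proof (cases "s = 0")
 case False
 have s2: "(s\<^sup>2) powr ((b - 1) / 2) = \<bar>s\<bar> powr (b - 1)"
 proof -
  have "s\<^sup>2 = \<bar>s\<bar> powr 2" using False by simp
  moreover have "2 * ((b - 1) / 2) = b - 1" by simp
  ultimately show ?thesis by (simp only: powr_powr)
 qed
 have "trunc_power b \<epsilon> s \<le> max (min 1 (s\<^sup>2) powr ((b - 1) / 2)) (max 1 (s\<^sup>2) powr ((b - 1) / 2))"
  unfolding trunc_power_def using trunc_ratio_between[of s] False by (intro powr_between) auto
 also have "\<dots> \<le> 1 + \<bar>s\<bar> powr (b - 1)" by (auto simp: min_def max_def s2)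
 finally have "\<bar>s\<bar> powr p * trunc_power b \<epsilon> s \<le> \<bar>s\<bar> powr p * (1 + \<bar>s\<bar> powr (b - 1))" by (intro mult_left_mono) auto
 also have "\<dots> = \<bar>s\<bar> powr p + \<bar>s\<bar> powr (p + b - 1)" by (simp add: distrib_left powr_add[symmetric] add_diff_eq)
 finally show ?thesis .
qed simp

text \<open>The bound may depend on \<epsilon>: together with the bounded weight it makes the
  nonlinearity Lipschitz, hence admissible.\<close>

lemma trunc_power_bounded: "trunc_power b \<epsilon> s \<le> max (\<epsilon> powr ((b - 1) / 2)) ((1 / \<epsilon>) powr ((b - 1) / 2))"
proof -
 have "\<epsilon> * \<epsilon> \<le> 1 * 1" using \<epsilon> by (intro mult_mono) auto
 then have "\<epsilon> * (1 + \<epsilon> * s\<^sup>2) \<le> s\<^sup>2 + \<epsilon>" "(s\<^sup>2 + \<epsilon>) * \<epsilon> \<le> 1 + \<epsilon> * s\<^sup>2"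
  using mult_right_mono[of "\<epsilon> * \<epsilon>" 1 "s\<^sup>2"] by (auto simp: algebra_simps)
 then have "\<epsilon> \<le> trunc_ratio \<epsilon> s" "trunc_ratio \<epsilon> s \<le> 1 / \<epsilon>"
  using trunc_denominators[of s] \<epsilon> by (simp_all add: trunc_ratio_def pos_le_divide_eq pos_divide_le_eq)
 then show ?thesis unfolding trunc_power_def using \<epsilon> by (intro powr_between) auto
qed

text \<open>The fraction in the weight lies in [0, 1], so the weight interpolates between 1 and b.
  It thus stays away from 0, which keeps its negative power 1 - p bounded.\<close>

lemma trunc_weight_between: "trunc_weight b \<epsilon> s \<in> {min 1 b..max 1 b}"
proof -
 define t where "t = s\<^sup>2 * (1 - \<epsilon>\<^sup>2) / ((s\<^sup>2 + \<epsilon>) * (1 + \<epsilon> * s\<^sup>2))"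
 have e2: "\<epsilon>\<^sup>2 \<le> 1" using \<epsilon> by (simp add: power_le_one)
 have "s\<^sup>2 * (1 - \<epsilon>\<^sup>2) \<le> s\<^sup>2 * 1" using e2 by (intro mult_left_mono) auto
 also have "\<dots> \<le> (s\<^sup>2 + \<epsilon>) * (1 + \<epsilon> * s\<^sup>2)" using \<epsilon> by (intro mult_mono) auto
 finally have "t \<le> 1" using trunc_denominators[of s] by (simp add: t_def pos_divide_le_eq)
 moreover have "t \<ge> 0" unfolding t_def using e2 trunc_denominators[of s] by (intro divide_nonneg_pos) auto
 ultimately have t: "0 \<le> t" "t \<le> 1" by auto
 have w: "trunc_weight b \<epsilon> s = 1 + (b - 1) * t" by (simp add: trunc_weight_def t_def)
 show ?thesis
 proof (cases "b \<ge> 1")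
  case True
  then have "0 \<le> (b - 1) * t" "(b - 1) * t \<le> (b - 1) * 1" using t by (intro mult_nonneg_nonneg mult_left_mono; simp)+
  then show ?thesis using True w by auto
 next
  case False
  then have "0 \<le> (1 - b) * t" "(1 - b) * t \<le> (1 - b) * 1" using t by (auto intro!: mult_left_mono)
  then show ?thesis using False w by (auto simp: algebra_simps)
 qed
qed

lemma trunc_weight_pos: "trunc_weight b \<epsilon> s > 0"
 using trunc_weight_between[of s] b by auto

lemma continuous_trunc:
 "continuous_on UNIV (trunc_power b \<epsilon>)" "continuous_on UNIV (trunc_weight b \<epsilon>)"
proof -
 have ne: "s\<^sup>2 + \<epsilon> \<noteq> 0" "1 + \<epsilon> * s\<^sup>2 \<noteq> 0" for s using trunc_denominators[of s] by linarith+
 show "continuous_on UNIV (trunc_weight b \<epsilon>)" unfolding trunc_weight_def using ne by (intro continuous_intros) auto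
 show "continuous_on UNIV (trunc_power b \<epsilon>)"
  unfolding trunc_power_def
 proof (intro continuous_on_powr continuous_on_const ballI)
  show "continuous_on UNIV (trunc_ratio \<epsilon>)" unfolding trunc_ratio_def using ne by (intro continuous_intros) auto
  show "trunc_ratio \<epsilon> s \<noteq> 0" for s using trunc_ratio_pos[of s] by simp
 qed
qed

lemma has_real_derivative_trunc:
 "((\<lambda>s. s * trunc_power b \<epsilon> s) has_real_derivative trunc_power b \<epsilon> s * trunc_weight b \<epsilon> s) (at s)"
proof -
 note d = trunc_denominators[of s]
 let ?r = "trunc_ratio \<epsilon> s" and ?r' = "2 * s * (1 - \<epsilon>\<^sup>2) / (1 + \<epsilon> * s\<^sup>2)\<^sup>2"
 have r: "(trunc_ratio \<epsilon> has_real_derivative ?r') (at s)"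
  unfolding trunc_ratio_def using d
  by (auto intro!: derivative_eq_intros simp: power2_eq_square) (simp add: field_simps)
 have "((\<lambda>s. trunc_ratio \<epsilon> s powr ((b - 1) / 2)) has_real_derivative (b - 1) / 2 * ?r powr ((b - 1) / 2 - 1) * ?r') (at s)"
  by (rule DERIV_chain2[OF has_real_derivative_powr[OF trunc_ratio_pos] r])
 from DERIV_mult[OF DERIV_ident this]
 have "((\<lambda>s. s * trunc_power b \<epsilon> s) has_real_derivative
   trunc_power b \<epsilon> s + s * ((b - 1) / 2 * ?r powr ((b - 1) / 2 - 1) * ?r')) (at s)"
  unfolding trunc_power_def by (simp add: mult.commute)
 also have "s * ((b - 1) / 2 * ?r powr ((b - 1) / 2 - 1) * ?r') = trunc_power b \<epsilon> s * ((b - 1) * (s * ?r' / (2 * ?r)))"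
 proof -
  have "?r powr ((b - 1) / 2 - 1) = ?r powr ((b - 1) / 2) / ?r" using trunc_ratio_pos[of s] by (subst powr_diff) simp
  moreover have "s * (e * (P / r) * r') = P * (2 * e * (s * r' / (2 * r)))" for e P r r' :: real by simp
  ultimately show ?thesis by (simp only: trunc_power_def)
 qed
 also have "s * ?r' / (2 * ?r) = s\<^sup>2 * (1 - \<epsilon>\<^sup>2) / ((s\<^sup>2 + \<epsilon>) * (1 + \<epsilon> * s\<^sup>2))"
 proof -
  have "s * (2 * s * e / D\<^sup>2) / (2 * (N / D)) = s\<^sup>2 * e / (N * D)" if "N > 0" "D > 0" for e N D :: real
   using that by (simp add: field_simps power2_eq_square)
  from this[OF d] show ?thesis unfolding trunc_ratio_def .
 qed
 finally show ?thesis by (simp add: trunc_weight_def distrib_left)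
qed

end

lemma trunc_limits:
 assumes \<epsilon>: "\<epsilon> \<longlonglongrightarrow> 0" and s: "s \<noteq> 0"
 shows "(\<lambda>n. trunc_power b (\<epsilon> n) s) \<longlonglongrightarrow> \<bar>s\<bar> powr (b - 1)"
  and "(\<lambda>n. trunc_weight b (\<epsilon> n) s) \<longlonglongrightarrow> b"
proof -
 have s2: "s\<^sup>2 = \<bar>s\<bar> powr 2" using s by simp
 have "(\<lambda>n. trunc_power b (\<epsilon> n) s) \<longlonglongrightarrow> ((s\<^sup>2 + 0) / (1 + 0 * s\<^sup>2)) powr ((b - 1) / 2)"
  unfolding trunc_power_def trunc_ratio_def using s by (intro tendsto_intros \<epsilon>) auto
 also have "((s\<^sup>2 + 0) / (1 + 0 * s\<^sup>2)) powr ((b - 1) / 2) = (\<bar>s\<bar> powr 2) powr ((b - 1) / 2)" using s2 by simp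
 also have "\<dots> = \<bar>s\<bar> powr (b - 1)"
 proof -
  have "2 * ((b - 1) / 2) = b - 1" by simp
  then show ?thesis by (simp only: powr_powr)
 qed
 finally show "(\<lambda>n. trunc_power b (\<epsilon> n) s) \<longlonglongrightarrow> \<bar>s\<bar> powr (b - 1)" .
 have "(\<lambda>n. trunc_weight b (\<epsilon> n) s) \<longlonglongrightarrow> 1 + (b - 1) * (s\<^sup>2 * (1 - 0\<^sup>2) / ((s\<^sup>2 + 0) * (1 + 0 * s\<^sup>2)))"
  unfolding trunc_weight_def using s by (intro tendsto_intros \<epsilon>) auto
 then show "(\<lambda>n. trunc_weight b (\<epsilon> n) s) \<longlonglongrightarrow> b" using s by simp
qed

section \<open>Testing the equation with exponential cutoffs of the distance\<close>

context rmfd_complete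
begin

text \<open>Where \<zeta> is positive, its gradient is that of exp(-\<kappa>\<rho>), since
  subtracting a constant costs nothing. The power p > 1 smooths the corner where the positive part
  sets in.\<close>

lemma distance_cutoff:
 assumes \<kappa>: "\<kappa> > 0" and p: "p > 1" and \<delta>: "0 < \<delta>" "\<delta> < 1"
 obtains \<zeta> :: "'a \<Rightarrow> real" where "\<And>x. \<zeta> x \<ge> 0" "\<And>x. \<zeta> x \<le> exp (- \<kappa> * (dist_g x0 x - \<delta>))"
  "\<And>x. exp (- \<kappa> * (dist_g x0 x + \<delta>)) - exp (- \<kappa> * R) \<le> \<zeta> x"
  "\<And>x. x \<notin> M.mball x0 (R + 1) ==> \<zeta> x = 0" "C1M UNIV (\<lambda>x. \<zeta> x powr p)"
  "\<And>x. tnorm g x (grad (\<lambda>x. \<zeta> x powr p) x) \<le> p * \<zeta> x powr (p - 1) * (\<kappa> * (1 + \<delta>) * exp (- \<kappa> * (dist_g x0 x - \<delta>)))"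
proof -
 \<comment> \<open>\<rho> is controlled on the ball of radius R + 1, but \<zeta> already vanishes
   beyond R + \<delta>, as \<rho> exceeds R there. The overlap of these two open sets permits
   extension by zero.\<close>
 let ?W = "M.mball x0 (R + 1)" and ?W' = "- M.mcball x0 (R + \<delta>)" and ?r = "dist_g x0"
 obtain \<rho> where \<rho>: "C1M ?W \<rho>" "\<And>x. x \<in> ?W ==> \<bar>\<rho> x - ?r x\<bar> \<le> \<delta>" "\<And>x. x \<in> ?W ==> tnorm g x (grad \<rho> x) \<le> 1 + \<delta>"
  by (rule smooth_distance[OF \<delta>(1), of x0 "R + 1"]) (rule that)
 define m where "m t = max 0 (exp (- \<kappa> * t) - exp (- \<kappa> * R))" for t
 define m' where "m' t = p * m t powr (p - 1) * (- \<kappa> * exp (- \<kappa> * t))" for t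
 define \<zeta> where "\<zeta> x = (if x \<in> ?W then m (\<rho> x) else 0)" for x
 have in_W: "x \<in> ?W \<longleftrightarrow> ?r x < R + 1" for x by (simp add: M.mball_def)
 have in_W': "x \<in> ?W' \<longleftrightarrow> R + \<delta> < ?r x" for x by (auto simp: M.mcball_def)
 have oW': "open ?W'" using compact_mcball by (intro open_Compl compact_imp_closed)
 have WW: "?W \<union> ?W' = UNIV" using \<delta> in_W in_W' by fastforce
 have der: "((\<lambda>t. m t powr p) has_real_derivative m' t) (at t)" for t
 proof -
  have "((\<lambda>t. exp (- \<kappa> * t) - exp (- \<kappa> * R)) has_real_derivative - \<kappa> * exp (- \<kappa> * t)) (at t)"
   by (auto intro!: derivative_eq_intros)
  from DERIV_chain2[OF has_real_derivative_max_powr[OF p] this] show ?thesis by (simp only: m_def m'_def)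
 qed
 have cont: "continuous_on S m'" for S
  unfolding m'_def m_def using p by (intro continuous_intros continuous_on_powr') auto
 note comp = C1M_compose[where \<psi> = "\<lambda>t. m t powr p" and \<psi>' = m', OF \<rho>(1) der cont]
 have eqW: "\<zeta> x powr p = m (\<rho> x) powr p" if "x \<in> ?W" for x using that by (simp add: \<zeta>_def)
 have W: "C1M ?W (\<lambda>x. \<zeta> x powr p)" by (rule C1M_cong(1)[OF open_mball eqW comp(1)])
 have W2: "dif (\<lambda>x. \<zeta> x powr p) c y = dif (\<lambda>x. m (\<rho> x) powr p) c y" if "c \<in> \<A>" "y \<in> snd c ` (fst c \<inter> ?W)" for c y
  by (rule C1M_cong(2)[OF open_mball eqW comp(1) that])
 have \<zeta>0: "\<zeta> x = 0" if "x \<in> ?W'" for x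
 proof (cases "x \<in> ?W")
  case True
  then have "R \<le> \<rho> x" using \<rho>(2)[OF True] that unfolding in_W' by linarith
  then show ?thesis using \<kappa> by (simp add: \<zeta>_def m_def)
 qed (simp add: \<zeta>_def)
 then have z0: "\<zeta> x powr p = 0" if "x \<in> ?W'" for x using that by simp
 have C: "C1M UNIV (\<lambda>x. \<zeta> x powr p)" by (rule C1M_extend_zero(1)[OF open_mball oW' WW W z0])
 have C2: "dif (\<lambda>x. \<zeta> x powr p) c (snd c x) v = 0" if "c \<in> \<A>" "x \<in> fst c" "x \<in> ?W'" for c x v
  by (rule C1M_extend_zero(2)[OF open_mball oW' WW W z0 that])
 have \<zeta>_nonneg: "\<zeta> x \<ge> 0" for x by (simp add: \<zeta>_def m_def)
 show ?thesis
 proof (rule that)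
  show "\<zeta> x \<ge> 0" for x by (rule \<zeta>_nonneg)
  show "x \<notin> ?W ==> \<zeta> x = 0" for x by (simp add: \<zeta>_def)
  show "C1M UNIV (\<lambda>x. \<zeta> x powr p)" by (rule C)
  have e: "exp (- \<kappa> * \<rho> x) \<le> exp (- \<kappa> * (?r x - \<delta>))" "exp (- \<kappa> * (?r x + \<delta>)) \<le> exp (- \<kappa> * \<rho> x)" if "x \<in> ?W" for x
   using \<rho>(2)[OF that] \<kappa> by auto
  fix x
  show "\<zeta> x \<le> exp (- \<kappa> * (?r x - \<delta>))"
  proof (cases "x \<in> ?W")
   case True
   have "\<zeta> x \<le> exp (- \<kappa> * \<rho> x)" using True by (simp add: \<zeta>_def m_def)
   then show ?thesis using e(1)[OF True] by linarith
  qed (simp add: \<zeta>_def)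
  show "exp (- \<kappa> * (?r x + \<delta>)) - exp (- \<kappa> * R) \<le> \<zeta> x"
  proof (cases "x \<in> ?W")
   case True
   have "exp (- \<kappa> * \<rho> x) - exp (- \<kappa> * R) \<le> \<zeta> x" using True by (simp add: \<zeta>_def m_def)
   then show ?thesis using e(2)[OF True] by linarith
  next
   case False
   then have "exp (- \<kappa> * (?r x + \<delta>)) \<le> exp (- \<kappa> * R)" using \<kappa> \<delta> unfolding in_W by simp
   then show ?thesis using False by (simp add: \<zeta>_def)
  qed
  obtain c where c: "c \<in> \<A>" "x \<in> fst c" by (rule chart_cover)
  let ?N = "p * \<zeta> x powr (p - 1) * (\<kappa> * (1 + \<delta>) * exp (- \<kappa> * (?r x - \<delta>)))"
  show "tnorm g x (grad (\<lambda>x. \<zeta> x powr p) x) \<le> ?N"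
  proof (rule tnorm_grad_le[OF C UNIV_I c])
   fix v
   have n0: "lnorm c (snd c x) v \<ge> 0" using lm_nonneg[OF c(1) imageI[OF c(2)]] by (simp add: lnorm_def)
   show "\<bar>dif (\<lambda>x. \<zeta> x powr p) c (snd c x) v\<bar> \<le> ?N * lnorm c (snd c x) v"
   proof (cases "x \<in> ?W")
    case True
    have y: "snd c x \<in> snd c ` (fst c \<inter> ?W)" using True c by auto
    have "dif (\<lambda>x. \<zeta> x powr p) c (snd c x) v = m' (\<rho> x) * dif \<rho> c (snd c x) v"
     using W2[OF c(1) y] comp(2)[OF c(1) y] c by simp
    also have "\<bar>\<dots>\<bar> \<le> (p * \<zeta> x powr (p - 1) * (\<kappa> * exp (- \<kappa> * (?r x - \<delta>)))) * ((1 + \<delta>) * lnorm c (snd c x) v)"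
     unfolding abs_mult
    proof (intro mult_mono)
     show "\<bar>m' (\<rho> x)\<bar> \<le> p * \<zeta> x powr (p - 1) * (\<kappa> * exp (- \<kappa> * (?r x - \<delta>)))"
      unfolding m'_def abs_mult using True e(1)[OF True] p \<kappa> by (intro mult_mono) (auto simp: \<zeta>_def m_def)
     have "dif \<rho> c (snd c x) v = g x (grad \<rho> x) (tv c x v)" by (rule g_grad[OF \<rho>(1) True c, symmetric])
     then have "\<bar>dif \<rho> c (snd c x) v\<bar> \<le> tnorm g x (grad \<rho> x) * lnorm c (snd c x) v"
      using g_Cauchy_Schwarz[OF grad_in[OF \<rho>(1) True] tvec_of_in[OF c]] by (simp add: lnorm_eq_tnorm[OF c])
     also have "\<dots> \<le> (1 + \<delta>) * lnorm c (snd c x) v" by (rule mult_right_mono[OF \<rho>(3)[OF True] n0])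
     finally show "\<bar>dif \<rho> c (snd c x) v\<bar> \<le> (1 + \<delta>) * lnorm c (snd c x) v" .
    qed (use p \<kappa> n0 in auto)
    finally show ?thesis by (simp add: mult_ac)
   next
    case False
    then have x: "x \<in> ?W'" using WW by blast
    have "0 \<le> ?N" using p \<kappa> \<delta> by (intro mult_nonneg_nonneg) auto
    then have "0 \<le> ?N * lnorm c (snd c x) v" using n0 by (rule mult_nonneg_nonneg)
    then show ?thesis using C2[OF c x] by simp
   qed
  qed
 qed
qed

lemma integrable_compact_bound:
 assumes h: "loc_integrable vol UNIV h" and K: "compact K" and f: "f \<in> borel_measurable vol"
  and b: "\<And>x. \<bar>f x\<bar> \<le> indicator K x * h x"
 shows "integrable vol f"
proof (rule integrable_bound_B[OF _ f])
 show "integrable vol (\<lambda>x. indicator K x *\<^sub>R h x)"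
  using h K unfolding loc_integrable_def set_integrable_def by blast
 show "AE x in vol. norm (f x) \<le> norm (indicator K x *\<^sub>R h x)"
  using order_trans[OF b abs_ge_self] by simp
qed

lemma measurable_dist: "dist_g x0 \<in> borel_measurable vol"
 by (rule borel_measurable_vol[OF borel_measurable_continuous_onI[OF continuous_dist_g]])

text \<open>The outcome of testing with \<zeta>^p F(u), before any limit: the gradient of u has been
  absorbed, and on the left \<zeta> is replaced by an explicit lower bound in terms of the
  distance.\<close>

lemma energy_inequality:
 assumes p: "p > 1" and lam: "lam > 0" and k: "k > 0" and coer: "weakly_p_coercive \<A> g p k A"
  and u: "u \<in> Wloc p" and sol: "weakly_solves \<A> g p A u (\<lambda>x. lam * \<bar>u x\<bar> powr (p - 2) * u x)"
  and b: "b > 0" and \<epsilon>: "0 < \<epsilon>" "\<epsilon> < 1" and \<alpha>: "\<alpha> > 0" and \<delta>: "0 < \<delta>" "\<delta> < 1"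
 defines "c \<equiv> (p - 1) powr (p - 1) * p powr (- p) * (k * \<alpha> * (1 + \<delta>)) powr p"
 shows "lam * (LINT x|vol. \<bar>u x\<bar> powr p * trunc_power b \<epsilon> (u x) *
   max 0 (exp (- (\<alpha> / p) * (dist_g x0 x + \<delta>)) - exp (- (\<alpha> / p) * R)) powr p)
  \<le> (LINT x|vol. indicator (M.mball x0 (R + 1)) x * (c * (\<bar>u x\<bar> powr p * trunc_power b \<epsilon> (u x) *
   trunc_weight b \<epsilon> (u x) powr (1 - p)) * exp (- \<alpha> * (dist_g x0 x - \<delta>))))"
  (is "lam * (LINT x|vol. ?P x) \<le> (LINT x|vol. ?H x)")
proof -
 \<comment> \<open>Chosen so that the p-th power of exp(-\<kappa>r) is exp(-\<alpha>r).\<close>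
 define \<kappa> where "\<kappa> = \<alpha> / p"
 have \<kappa>: "\<kappa> > 0" "\<kappa> * p = \<alpha>" using \<alpha> p by (simp_all add: \<kappa>_def)
 let ?r = "dist_g x0" and ?G = "trunc_power b \<epsilon>" and ?w = "trunc_weight b \<epsilon>"
 let ?e = "\<lambda>x. exp (- \<kappa> * (?r x - \<delta>))" and ?p = "\<lambda>x. \<bar>u x\<bar> powr p" and ?U = "M.mball x0 (R + 1)"
  and ?g = "\<lambda>x. ?G (u x)" and ?v = "\<lambda>x. ?w (u x)"
 obtain \<zeta> where z: "\<And>x. \<zeta> x \<ge> 0" "\<And>x. \<zeta> x \<le> ?e x"
  "\<And>x. exp (- \<kappa> * (?r x + \<delta>)) - exp (- \<kappa> * R) \<le> \<zeta> x"
  "\<And>x. x \<notin> ?U ==> \<zeta> x = 0" "C1M UNIV (\<lambda>x. \<zeta> x powr p)"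
  "\<And>x. tnorm g x (grad (\<lambda>x. \<zeta> x powr p) x) \<le> p * \<zeta> x powr (p - 1) * (\<kappa> * (1 + \<delta>) * ?e x)"
  by (rule distance_cutoff[OF \<kappa>(1) p \<delta>, of x0 R]) (rule that)
 let ?z = "\<lambda>x. \<zeta> x powr p"
 let ?K = "M.mcball x0 (R + 1)"
 have BK: "x \<in> ?K" if "x \<in> ?U" for x using that by auto
 have r0: "?e x \<le> exp (\<kappa> * \<delta>)" for x
  using \<kappa> dist_g_nonneg[of x0 x] by (simp add: algebra_simps)
 have zb: "\<zeta> x \<le> exp (\<kappa> * \<delta>)" for x using z(2)[of x] r0[of x] by linarith
 define E where "E = exp (\<kappa> * \<delta>) powr p"
 have zpE: "\<zeta> x powr p \<le> E" for x unfolding E_def using p by (intro powr_mono2 z(1) zb) auto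
 obtain L where L: "\<And>s. ?G s \<le> L" "L > 0"
  using trunc_power_bounded[OF b \<epsilon>] trunc_power_pos[OF b \<epsilon>] less_le_trans by meson
 note Gp = trunc_power_pos[OF b \<epsilon>] and wp = trunc_weight_pos[OF b \<epsilon>]
 have wb: "min 1 b \<le> ?w s" "?w s \<le> max 1 b" for s using trunc_weight_between[OF b \<epsilon>, of s] by auto
 define X where "X = nabla u"
 note W = W1p_loc_weak_gradient[OF u, folded X_def]
 have mu [measurable]: "u \<in> borel_measurable vol" by (rule W1p_loc_measurable[OF u])
 have mG [measurable]: "(\<lambda>x. ?g x) \<in> borel_measurable vol"
  by (rule measurable_compose[OF mu borel_measurable_continuous_onI[OF continuous_trunc(1)[OF b \<epsilon>]]])
 have mw [measurable]: "(\<lambda>x. ?v x) \<in> borel_measurable vol"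
  by (rule measurable_compose[OF mu borel_measurable_continuous_onI[OF continuous_trunc(2)[OF b \<epsilon>]]])
 have mr [measurable]: "?r \<in> borel_measurable vol" by (rule measurable_dist)
 have m\<eta> [measurable]: "?z \<in> borel_measurable vol"
  by (rule borel_measurable_vol[OF borel_measurable_continuous_onI[OF C1M_continuous_on[OF z(5) open_UNIV]]])
 have mB: "indicat_real (?U) \<in> borel_measurable vol"
  using open_mball by (intro borel_measurable_indicator borel_in_vol) auto
 define F F' where "F s = s * ?G s" and "F' s = ?G s * ?w s" for s
 have F: "(F has_real_derivative F' s) (at s)" "continuous_on UNIV F'" "\<bar>F' s\<bar> \<le> L * max 1 b" "F 0 = 0" for s
 proof -
  show "(F has_real_derivative F' s) (at s)" unfolding F_def F'_def by (rule has_real_derivative_trunc[OF b \<epsilon>])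
  show "continuous_on UNIV F'" unfolding F'_def by (intro continuous_on_mult continuous_trunc b \<epsilon>)
  show "\<bar>F' s\<bar> \<le> L * max 1 b" unfolding F'_def using L wb(2) Gp[of s] wp[of s] by (auto simp: abs_mult intro!: mult_mono)
 qed (simp add: F_def)
 let ?N = "\<lambda>x. p * \<zeta> x powr (p - 1) * (\<kappa> * (1 + \<delta>) * ?e x)"
 have Nb: "?N x \<le> p * exp (\<kappa> * \<delta>) powr (p - 1) * (\<kappa> * (1 + \<delta>) * exp (\<kappa> * \<delta>))" (is "_ \<le> ?NB") for x
  using p \<kappa> \<delta> zb z(1) r0 by (intro mult_mono mult_nonneg_nonneg powr_mono2) auto
 let ?\<phi> = "\<lambda>x. \<zeta> x powr p * F (u x)"
 have \<phi>: "?\<phi> \<in> W1p_c \<A> g p"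
  "AE x in vol. nabla ?\<phi> x = (\<lambda>c. (\<zeta> x powr p * F' (u x)) *\<^sub>R X x c + F (u x) *\<^sub>R grad ?z x c)"
  unfolding X_def
  by (rule cutoff_chain_rule[OF u _ z(5), where B = "max E ?NB" and K = ?K and L = "L * max 1 b"];
    use p zpE order_trans[OF z(6) Nb] compact_mcball z(4) BK F in \<open>force simp: le_max_iff_disj\<close>)+
 let ?gA = "\<lambda>x. g x (A x (u x) (X x)) (nabla ?\<phi> x)"
 let ?Q = "\<lambda>x. ?p x * ?g x * \<zeta> x powr p"
 have eqn: "- (LINT x|vol. ?gA x) = (LINT x|vol. lam * ?Q x)"
 proof -
  have "lam * \<bar>u x\<bar> powr (p - 2) * u x * ?\<phi> x = lam * ?Q x" for x
  proof -
   have "\<bar>u x\<bar> powr (p - 2) * (u x * u x) = ?p x"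
    by (cases "u x = 0") (auto simp: powr_diff power2_eq_square)
   then show ?thesis by (simp add: F_def mult_ac)
  qed
  then have "(LINT x|vol. lam * \<bar>u x\<bar> powr (p - 2) * u x * ?\<phi> x) = (LINT x|vol. lam * ?Q x)" by (simp only:)
  then show ?thesis using bspec[OF sol[unfolded weakly_solves_def] \<phi>(1)] unfolding X_def by (rule trans[rotated])
 qed
 \<comment> \<open>Minus the flux term is -\<zeta>^p F'(u) a plus a cross term with the gradient of
   the cutoff; Cauchy-Schwarz and coercivity bring the cross term into the form of
   \<open>energy_pointwise\<close>.\<close>
 have ae: "AE x in vol. - ?gA x \<le> ?H x"
  using \<phi>(2)
 proof eventually_elim
  case (elim x)
  let ?a = "g x (A x (u x) (X x)) (X x)"
  have Xt: "X x \<in> TM x" by (rule measurable_field_in[OF is_weak_gradientD(2)[OF W(1)] UNIV_I])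
  have Gt: "grad ?z x \<in> TM x" by (rule grad_in[OF z(5) UNIV_I])
  have At: "A x (u x) (X x) \<in> TM x" "?a \<ge> 0" "tnorm g x (A x (u x) (X x)) \<le> k * ?a powr ((p - 1) / p)"
   using coer Xt unfolding weakly_p_coercive_def caratheodory_map_def by auto
  have "- ?gA x = - (\<zeta> x powr p * F' (u x)) * ?a - F (u x) * g x (A x (u x) (X x)) (grad ?z x)"
   unfolding elim g_right[OF Xt Gt At(1)] by simp
  moreover have "\<bar>g x (A x (u x) (X x)) (grad ?z x)\<bar> \<le> (k * ?a powr ((p - 1) / p)) * ?N x"
   by (rule order_trans[OF g_Cauchy_Schwarz[OF At(1) Gt]])
    (intro mult_mono At(3) z(6) mult_nonneg_nonneg tnorm_nonneg Gt; use k in simp)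
  then have "\<bar>F (u x)\<bar> * \<bar>g x (A x (u x) (X x)) (grad ?z x)\<bar> \<le> (\<bar>u x\<bar> * ?g x) * ((k * ?a powr ((p - 1) / p)) * ?N x)"
   using Gp[of "u x"] by (intro mult_mono) (auto simp: F_def abs_mult)
  moreover have "- (F (u x) * y) \<le> \<bar>F (u x)\<bar> * \<bar>y\<bar>" for y using abs_ge_minus_self[of "F (u x) * y"] by (simp add: abs_mult)
  ultimately have le: "- ?gA x \<le> \<bar>u x\<bar> * ?g x * (k * ?a powr ((p - 1) / p)) * ?N x - \<zeta> x powr p * (?g x * ?v x) * ?a"
   by (smt (verit, best) F'_def mult.assoc mult_minus_left)
  show ?case
  proof (cases "x \<in> ?U")
   case True
   have M0: "0 \<le> \<kappa> * (1 + \<delta>) * ?e x" using \<kappa> \<delta> by simp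
   have "(k * p * (\<kappa> * (1 + \<delta>) * ?e x)) powr p = ((k * \<alpha> * (1 + \<delta>)) * ?e x) powr p"
   proof -
    have "k * p * (\<kappa> * (1 + \<delta>) * e) = k * (\<kappa> * p) * (1 + \<delta>) * e" for e by simp
    then show ?thesis unfolding \<kappa>(2) by (simp only:)
   qed
   also have "\<dots> = (k * \<alpha> * (1 + \<delta>)) powr p * exp (- \<kappa> * (?r x - \<delta>) * p)"
    using k \<alpha> \<delta> by (subst powr_mult) (auto simp: exp_powr_real)
   also have "- \<kappa> * (?r x - \<delta>) * p = - \<alpha> * (?r x - \<delta>)" using \<kappa>(2) by (simp add: mult_ac)
   finally have e: "(k * p * (\<kappa> * (1 + \<delta>) * ?e x)) powr p = (k * \<alpha> * (1 + \<delta>)) powr p * exp (- \<alpha> * (?r x - \<delta>))" .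
   from le energy_pointwise[where s = "u x", OF p At(2) z(1)[of x] Gp[of "u x"] wp[of "u x"] less_imp_le[OF k] M0]
   have "- ?gA x \<le> c * (?p x * ?g x * ?v x powr (1 - p)) * exp (- \<alpha> * (?r x - \<delta>))"
    unfolding e c_def by (simp add: mult_ac)
   then show ?thesis using True by simp
  next
   case False
   then show ?thesis using le z(4) p by simp
  qed
 qed
 have c0: "c \<ge> 0" by (simp add: c_def)
 have loc: "loc_integrable vol UNIV (\<lambda>x. B * ?p x)" for B
  using loc_integrable_add[OF W(2) W(2), of B 0] by simp
 have intQ: "integrable vol ?Q"
 proof (rule integrable_compact_bound[OF loc[of "L * E"] compact_mcball[of x0 "R + 1"]])
  show "?Q \<in> borel_measurable vol" by measurable
  fix x
  have "?g x * \<zeta> x powr p \<le> L * E" using L zpE Gp by (intro mult_mono) (auto intro: less_imp_le)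
  then have "?p x * (?g x * \<zeta> x powr p) \<le> ?p x * (L * E)" by (intro mult_left_mono) auto
  moreover have "0 \<le> indicat_real ?K x * (L * E * ?p x)" using L by (intro mult_nonneg_nonneg) (auto simp: E_def)
  ultimately show "\<bar>?Q x\<bar> \<le> indicator ?K x * (L * E * ?p x)"
   using z(4)[of x] BK[of x] Gp[of "u x"] p by (cases "x \<in> ?U") (simp_all add: abs_mult mult_ac)
 qed
 have H0: "?H x \<ge> 0" for x using c0 Gp[of "u x"] by (auto simp: indicator_def)
 have intH: "integrable vol ?H"
 proof (rule integrable_compact_bound[OF loc[of "c * (L * min 1 b powr (1 - p)) * exp (\<alpha> * \<delta>)"] compact_mcball[of x0 "R + 1"]])
  show "?H \<in> borel_measurable vol" using mB by measurable
  fix x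
  have "?v x powr (1 - p) \<le> min 1 b powr (1 - p)" using wb(1) b p by (intro powr_mono2') auto
  then have "c * (?p x * ?g x * ?v x powr (1 - p)) * exp (- \<alpha> * (?r x - \<delta>))
   \<le> c * (?p x * L * min 1 b powr (1 - p)) * exp (\<alpha> * \<delta>)"
   using c0 L Gp[of "u x"] \<alpha> dist_g_nonneg[of x0 x] by (intro mult_mono mult_nonneg_nonneg) (auto simp: algebra_simps)
  then show "\<bar>?H x\<bar> \<le> indicator ?K x * (c * (L * min 1 b powr (1 - p)) * exp (\<alpha> * \<delta>) * ?p x)"
   using H0[of x] BK[of x] c0 L by (cases "x \<in> ?U") (auto simp: indicator_def mult_ac)
 qed
 have Pz: "max 0 (exp (- \<kappa> * (?r x + \<delta>)) - exp (- \<kappa> * R)) powr p \<le> \<zeta> x powr p" for x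
  using z(1,3)[of x] p by (intro powr_mono2) auto
 have "(LINT x|vol. ?P x) \<le> (LINT x|vol. ?Q x)"
 proof (rule integral_mono')
  show "?P x \<le> ?Q x" for x using Pz[of x] Gp[of "u x"] unfolding \<kappa>_def by (intro mult_left_mono mult_nonneg_nonneg) auto
  show "0 \<le> ?Q x" for x using Gp[of "u x"] by simp
 qed (rule intQ)
 then have "lam * (LINT x|vol. ?P x) \<le> lam * (LINT x|vol. ?Q x)" using lam by simp
 also have "\<dots> = - (LINT x|vol. ?gA x)" using eqn by simp
 also have "\<dots> \<le> (LINT x|vol. ?H x)"
 \<comment> \<open>If the flux term is not integrable, its integral is 0 by convention, and the
   right side is nonnegative.\<close>
 proof (cases "integrable vol ?gA")
  case True
  then show ?thesis using integral_mono_AE[OF _ intH ae] by simp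
 next
  case False
  then show ?thesis using H0 by (simp add: not_integrable_integral_eq)
 qed
 finally show ?thesis .
qed

text \<open>Dominated convergence as \<epsilon> tends to 0 with R fixed. Both integrands are
  supported in one compact ball, on which |u|^p is integrable by the Sobolev assumption and |u|^q by
  \<open>uq\<close>.\<close>

lemma energy_limit:
 assumes p: "p > 1" and lam: "lam > 0" and k: "k > 0" and coer: "weakly_p_coercive \<A> g p k A"
  and u: "u \<in> Wloc p" and sol: "weakly_solves \<A> g p A u (\<lambda>x. lam * \<bar>u x\<bar> powr (p - 2) * u x)"
  and b: "b > 0" and \<alpha>: "\<alpha> > 0" and \<delta>: "0 < \<delta>" "\<delta> < 1" and q: "q = p + b - 1"
  and uq: "loc_integrable vol UNIV (\<lambda>x. \<bar>u x\<bar> powr q)"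
 defines "c \<equiv> (p - 1) powr (p - 1) * p powr (- p) * (k * \<alpha> * (1 + \<delta>)) powr p"
 shows "lam * (LINT x|vol. \<bar>u x\<bar> powr q *
   max 0 (exp (- (\<alpha> / p) * (dist_g x0 x + \<delta>)) - exp (- (\<alpha> / p) * R)) powr p)
  \<le> (LINT x|vol. indicator (M.mball x0 (R + 1)) x * (c * (\<bar>u x\<bar> powr q * b powr (1 - p)) * exp (- \<alpha> * (dist_g x0 x - \<delta>))))"
  (is "lam * (LINT x|vol. ?P x) \<le> (LINT x|vol. ?H x)")
proof -
 \<comment> \<open>The summand 2 keeps every term strictly below 1, including the one for n =
   0.\<close>
 define e where "e n = 1 / (real n + 2)" for n
 have e: "0 < e n" "e n < 1" for n by (simp_all add: e_def)
 have e0: "e \<longlonglongrightarrow> 0" unfolding e_def by real_asymp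
 let ?r = "dist_g x0" and ?K = "M.mcball x0 (R + 1)"
 let ?h = "\<lambda>x. max 0 (exp (- (\<alpha> / p) * (?r x + \<delta>)) - exp (- (\<alpha> / p) * R))"
 let ?\<Psi> = "\<lambda>x. ?h x powr p" and ?p = "\<lambda>x. \<bar>u x\<bar> powr p" and ?q = "\<lambda>x. \<bar>u x\<bar> powr q"
 let ?G = "\<lambda>n x. trunc_power b (e n) (u x)" and ?w = "\<lambda>n x. trunc_weight b (e n) (u x)"
 let ?E = "\<lambda>x. exp (- \<alpha> * (?r x - \<delta>))" and ?B = "M.mball x0 (R + 1)"
 define P where "P n x = ?p x * ?G n x * ?\<Psi> x" for n x
 define H where "H n x = indicat_real ?B x * (c * (?p x * ?G n x * ?w n x powr (1 - p)) * ?E x)" for n x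
 have mu [measurable]: "u \<in> borel_measurable vol" by (rule W1p_loc_measurable[OF u])
 have mG [measurable]: "(\<lambda>x. ?G n x) \<in> borel_measurable vol" for n
  by (rule measurable_compose[OF mu borel_measurable_continuous_onI[OF continuous_trunc(1)[OF b e]]])
 have mw [measurable]: "(\<lambda>x. ?w n x) \<in> borel_measurable vol" for n
  by (rule measurable_compose[OF mu borel_measurable_continuous_onI[OF continuous_trunc(2)[OF b e]]])
 have mr [measurable]: "?r \<in> borel_measurable vol" by (rule measurable_dist)
 have mB: "indicat_real ?B \<in> borel_measurable vol"
  using open_mball by (intro borel_measurable_indicator borel_in_vol) auto
 have G: "0 < trunc_power b (e n) s" "\<bar>s\<bar> powr p * trunc_power b (e n) s \<le> \<bar>s\<bar> powr p + \<bar>s\<bar> powr q" for n s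
  using trunc_power_pos[OF b e] trunc_power_growth[OF b e] q by simp_all
 have w: "0 < trunc_weight b (e n) s" "trunc_weight b (e n) s powr (1 - p) \<le> min 1 b powr (1 - p)" for n s
  using trunc_weight_pos[OF b e] trunc_weight_between[OF b e, of n s] b p by (auto intro!: powr_mono2')
 have c0: "c \<ge> 0" by (simp add: c_def)
 have loc: "loc_integrable vol UNIV (\<lambda>x. B * ?p x + B * ?q x)" for B
  by (rule loc_integrable_add[OF W1p_loc_weak_gradient(2)[OF u] uq])
 have \<Psi>: "?\<Psi> x \<le> indicator ?K x" for x
 proof (cases "x \<in> ?K")
  case True
  have "?h x \<le> 1"
  proof -
   have "exp (- (\<alpha> / p) * (?r x + \<delta>)) \<le> 1" using \<alpha> p \<delta> dist_g_nonneg[of x0 x] by (simp add: mult_nonneg_nonneg)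
   then show ?thesis using exp_gt_zero[of "- (\<alpha> / p) * R"] by linarith
  qed
  then have "?\<Psi> x \<le> 1 powr p" using p by (intro powr_mono2) auto
  then show ?thesis using True by simp
 next
  case False
  then have "R \<le> ?r x + \<delta>" using \<delta> by (simp add: M.mcball_def)
  then have "exp (- (\<alpha> / p) * (?r x + \<delta>)) \<le> exp (- (\<alpha> / p) * R)"
   using mult_left_mono[of R "?r x + \<delta>" "\<alpha> / p"] \<alpha> p by simp
  then have "?h x = 0" by simp
  then show ?thesis by (simp only:) simp
 qed
 have ind: "integrable vol (\<lambda>x. indicator ?K x * (B * ?p x + B * ?q x))" for B
  using loc[of B] compact_mcball[of x0 "R + 1"] unfolding loc_integrable_def set_integrable_def by simp
 have limP: "(\<lambda>n. LINT x|vol. P n x) \<longlonglongrightarrow> (LINT x|vol. ?P x)"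
 proof (rule integral_dominated_convergence[OF _ _ ind[of 1]])
  show "?P \<in> borel_measurable vol" "P n \<in> borel_measurable vol" for n unfolding P_def by measurable
  show "AE x in vol. (\<lambda>n. P n x) \<longlonglongrightarrow> ?P x"
  proof (rule AE_I2)
   fix x show "(\<lambda>n. P n x) \<longlonglongrightarrow> ?P x"
   proof (cases "u x = 0")
    case False
    have "(\<lambda>n. P n x) \<longlonglongrightarrow> ?p x * \<bar>u x\<bar> powr (b - 1) * ?\<Psi> x"
     unfolding P_def by (intro tendsto_mult tendsto_const trunc_limits(1)[OF e0 False])
    then show ?thesis by (simp add: powr_add[symmetric] q add_diff_eq)
   qed (simp add: P_def)
  qed
  show "AE x in vol. norm (P n x) \<le> indicator ?K x * (1 * ?p x + 1 * ?q x)" for n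
  proof (rule AE_I2)
   fix x
   have "P n x \<le> (?p x + ?q x) * indicator ?K x"
    unfolding P_def by (intro mult_mono G \<Psi>) auto
   moreover have "0 \<le> P n x" using G(1)[of n "u x"] by (simp add: P_def)
   ultimately show "norm (P n x) \<le> indicator ?K x * (1 * ?p x + 1 * ?q x)" by (simp add: mult.commute)
  qed
 qed
 let ?C = "c * min 1 b powr (1 - p) * exp (\<alpha> * \<delta>)"
 have limH: "(\<lambda>n. LINT x|vol. H n x) \<longlonglongrightarrow> (LINT x|vol. ?H x)"
 proof (rule integral_dominated_convergence[OF _ _ ind[of ?C]])
  show "?H \<in> borel_measurable vol" "H n \<in> borel_measurable vol" for n unfolding H_def using mB by measurable
  show "AE x in vol. (\<lambda>n. H n x) \<longlonglongrightarrow> ?H x"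
  proof (rule AE_I2)
   fix x show "(\<lambda>n. H n x) \<longlonglongrightarrow> ?H x"
   proof (cases "u x = 0")
    case False
    have "(\<lambda>n. H n x) \<longlonglongrightarrow> indicator ?B x * (c * (?p x * \<bar>u x\<bar> powr (b - 1) * b powr (1 - p)) * ?E x)"
     unfolding H_def using b by (intro tendsto_mult tendsto_const tendsto_powr trunc_limits[OF e0 False]) auto
    then show ?thesis by (simp add: powr_add[symmetric] q add_diff_eq)
   qed (simp add: H_def)
  qed
  show "AE x in vol. norm (H n x) \<le> indicator ?K x * (?C * ?p x + ?C * ?q x)" for n
  proof (rule AE_I2)
   fix x
   have "H n x \<le> indicator ?K x * (c * ((?p x + ?q x) * min 1 b powr (1 - p)) * exp (\<alpha> * \<delta>))"
    unfolding H_def using c0 G(1)[of n "u x"] \<alpha> dist_g_nonneg[of x0 x]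
    by (intro mult_mono G w mult_nonneg_nonneg) (auto simp: indicator_def algebra_simps)
   moreover have "0 \<le> H n x" using c0 G(1)[of n "u x"] by (simp add: H_def)
   ultimately show "norm (H n x) \<le> indicator ?K x * (?C * ?p x + ?C * ?q x)" by (simp add: algebra_simps)
  qed
 qed
 show ?thesis
 proof (rule LIMSEQ_le[OF tendsto_mult[OF tendsto_const limP] limH])
  show "\<exists>N. \<forall>n\<ge>N. lam * (LINT x|vol. P n x) \<le> (LINT x|vol. H n x)"
   unfolding P_def H_def c_def using energy_inequality[OF p lam k coer u sol b e \<alpha> \<delta>] by blast
 qed
qed

text \<open>On the shell n \<le> r < n + 1 the weight is at most exp(-\<alpha>n) and, for large n,
  the mass at most exp(C(n + 1)); since C < \<alpha>, a geometric series dominates.\<close>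

lemma exponential_growth_integrable:
 assumes f: "f \<in> borel_measurable vol" "\<And>x. f x \<ge> 0" and C: "C < \<alpha>" and \<alpha>: "\<alpha> > 0"
  and growth: "\<forall>\<^sub>F R in at_top. (\<integral>\<^sup>+x\<in>M.mball x0 R. ennreal (f x) \<partial>vol) \<le> ennreal (exp (C * R))"
 shows "loc_integrable vol UNIV f" "integrable vol (\<lambda>x. f x * exp (- \<alpha> * dist_g x0 x))"
proof -
 let ?V = "\<lambda>R. (\<integral>\<^sup>+x\<in>M.mball x0 R. ennreal (f x) \<partial>vol)" and ?r = "dist_g x0"
 have mf [measurable]: "f \<in> borel_measurable vol" by (rule f)
 have mr [measurable]: "?r \<in> borel_measurable vol" by (rule measurable_dist)
 have mB: "M.mball x0 R \<in> sets vol" for R using open_mball by (intro borel_in_vol) auto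
 obtain R0 where R0: "\<And>R. R \<ge> R0 ==> ?V R \<le> ennreal (exp (C * R))"
  using growth unfolding eventually_at_top_linorder by blast
 have mono: "?V R \<le> ?V R'" if "R \<le> R'" for R R'
  using that by (intro nn_integral_mono) (auto simp: indicator_def)
 have fin: "?V R < top" for R
  by (rule le_less_trans[OF order_trans[OF mono[of R "max R R0"] R0[of "max R R0"]]]) simp_all
 show "loc_integrable vol UNIV f"
  unfolding loc_integrable_def
 proof (intro allI impI)
  fix K :: "'a set" assume K: "compact K \<and> K \<subseteq> UNIV"
  obtain R where R: "K \<subseteq> M.mball x0 R" by (rule compact_subset_mball[of K x0]) (use K that in auto)
  have "set_integrable vol (M.mball x0 R) f"
   unfolding set_integrable_def
  proof (rule integrableI_bounded)
   show "(\<lambda>x. indicator (M.mball x0 R) x *\<^sub>R f x) \<in> borel_measurable vol"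
    using mB by (intro borel_measurable_scaleR borel_measurable_indicator f)
   have "(\<integral>\<^sup>+x. ennreal (norm (indicator (M.mball x0 R) x *\<^sub>R f x)) \<partial>vol) = ?V R"
    using f(2) by (intro nn_integral_cong) (auto simp: indicator_def)
   then show "(\<integral>\<^sup>+x. ennreal (norm (indicator (M.mball x0 R) x *\<^sub>R f x)) \<partial>vol) < \<infinity>" using fin[of R] by simp
  qed
  then show "set_integrable vol K f" by (rule set_integrable_subset[OF _ compact_in_vol R]) (use K in simp)
 qed
 define v where "v n = enn2real (?V (real n + 1))" for n :: nat
 have v: "?V (real n + 1) = ennreal (v n)" for n unfolding v_def using fin[of "real n + 1"] by simp
 have v0: "v n \<ge> 0" for n by (simp add: v_def)
 have "summable (\<lambda>n. exp (- \<alpha> * real n) * v n)"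
 proof (rule summable_comparison_test_ev)
  show "summable (\<lambda>n. exp C * exp (C - \<alpha>) ^ n)"
   using C by (intro summable_mult summable_geometric) simp
  have "exp (- \<alpha> * real n) * v n \<le> exp C * exp (C - \<alpha>) ^ n" if "real n \<ge> R0" for n
  proof -
   have "ennreal (v n) \<le> ennreal (exp (C * (real n + 1)))" using R0[of "real n + 1"] that by (simp add: v)
   then have "v n \<le> exp (C * (real n + 1))" by simp
   then have "exp (- \<alpha> * real n) * v n \<le> exp (- \<alpha> * real n) * exp (C * (real n + 1))" by simp
   also have "\<dots> = exp C * exp (C - \<alpha>) ^ n"
    by (simp add: exp_add[symmetric] exp_of_nat_mult[symmetric] algebra_simps)
   finally show ?thesis .
  qed
  then show "\<forall>\<^sub>F n in sequentially. norm (exp (- \<alpha> * real n) * v n) \<le> exp C * exp (C - \<alpha>) ^ n"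
   using eventually_ge_at_top[of "nat \<lceil>R0\<rceil>"] v0 by (auto elim!: eventually_mono simp: abs_mult)
 qed
 then have sum: "(\<Sum>n. ennreal (exp (- \<alpha> * real n) * v n)) < top"
  using v0 by (subst suminf_ennreal2) auto
 show "integrable vol (\<lambda>x. f x * exp (- \<alpha> * ?r x))"
 proof (rule integrableI_bounded)
  have "(\<integral>\<^sup>+x. ennreal (norm (f x * exp (- \<alpha> * ?r x))) \<partial>vol)
   \<le> (\<integral>\<^sup>+x. (\<Sum>n. ennreal (exp (- \<alpha> * real n)) * (ennreal (f x) * indicator (M.mball x0 (real n + 1)) x)) \<partial>vol)"
  proof (rule nn_integral_mono)
   fix x
   \<comment> \<open>The index of the shell containing x: its single term already dominates the
     integrand at x.\<close>
   define n where "n = nat \<lfloor>?r x\<rfloor>"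
   have n: "real n \<le> ?r x" "?r x < real n + 1" using dist_g_nonneg[of x0 x] by (simp_all add: n_def)
   have "ennreal (norm (f x * exp (- \<alpha> * ?r x))) \<le> ennreal (exp (- \<alpha> * real n) * f x)"
   proof (rule ennreal_leI)
    have "exp (- \<alpha> * ?r x) \<le> exp (- \<alpha> * real n)" using n(1) \<alpha> by simp
    from mult_right_mono[OF this f(2)[of x]] show "norm (f x * exp (- \<alpha> * ?r x)) \<le> exp (- \<alpha> * real n) * f x"
     using f(2)[of x] by (simp add: abs_mult mult.commute)
   qed
   also have "\<dots> = ennreal (exp (- \<alpha> * real n)) * (ennreal (f x) * indicator (M.mball x0 (real n + 1)) x)"
    using n(2) f(2)[of x] by (simp add: ennreal_mult)
   also have "\<dots> = (\<Sum>i\<in>{n}. ennreal (exp (- \<alpha> * real i)) * (ennreal (f x) * indicator (M.mball x0 (real i + 1)) x))" by simp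
   also have "\<dots> \<le> (\<Sum>i. ennreal (exp (- \<alpha> * real i)) * (ennreal (f x) * indicator (M.mball x0 (real i + 1)) x))"
    by (intro sum_le_suminf) auto
   finally show "ennreal (norm (f x * exp (- \<alpha> * ?r x))) \<le> (\<Sum>i. ennreal (exp (- \<alpha> * real i)) * (ennreal (f x) * indicator (M.mball x0 (real i + 1)) x))" .
  qed
  also have "\<dots> = (\<Sum>n. \<integral>\<^sup>+x. ennreal (exp (- \<alpha> * real n)) * (ennreal (f x) * indicator (M.mball x0 (real n + 1)) x) \<partial>vol)"
   using mB by (intro nn_integral_suminf) (auto intro!: borel_measurable_times_ennreal borel_measurable_indicator)
  also have "\<dots> = (\<Sum>n. ennreal (exp (- \<alpha> * real n)) * ?V (real n + 1))"
   using mB by (intro suminf_cong nn_integral_cmult) (auto intro!: borel_measurable_times_ennreal borel_measurable_indicator)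
  also have "\<dots> = (\<Sum>n. ennreal (exp (- \<alpha> * real n) * v n))"
   using v0 by (simp add: v ennreal_mult)
  also have "\<dots> < \<infinity>" using sum by simp
  finally show "(\<integral>\<^sup>+x. ennreal (norm (f x * exp (- \<alpha> * ?r x))) \<partial>vol) < \<infinity>" .
 qed measurable
qed

text \<open>The threshold for \<alpha> is the p-th root of the claim: multiplying by k and raising
  to the power p turns one into the other. This is where the constant of the theorem
  originates.\<close>

lemma threshold_constant:
 fixes p b lam k \<alpha> :: real
 assumes p: "p > 1" and b: "b > 0" and lam: "lam > 0" and k: "k > 0" and \<alpha>: "\<alpha> > 0"
  and lt: "\<alpha> < p * b powr ((p - 1) / p) / (p - 1) powr ((p - 1) / p) * (lam powr (1 / p) / k)" (is "_ < ?T")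
 shows "(p - 1) powr (p - 1) * p powr (- p) * (k * \<alpha>) powr p * b powr (1 - p) < lam"
proof -
 have "k * \<alpha> < k * ?T" by (rule mult_strict_left_mono[OF lt k])
 then have "(k * \<alpha>) powr p < (k * ?T) powr p" using k \<alpha> p by (intro powr_less_mono2) auto
 also have "k * ?T = p * b powr ((p - 1) / p) / (p - 1) powr ((p - 1) / p) * lam powr (1 / p)" using k by simp
 also have "\<dots> powr p = p powr p * b powr (p - 1) / (p - 1) powr (p - 1) * lam"
  using p b lam by (simp add: powr_mult powr_divide powr_powr)
 finally have "(p - 1) powr (p - 1) * p powr (- p) * b powr (1 - p) * (k * \<alpha>) powr p
  < (p - 1) powr (p - 1) * p powr (- p) * b powr (1 - p) * (p powr p * b powr (p - 1) / (p - 1) powr (p - 1) * lam)"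
  using p b by (intro mult_strict_left_mono) auto
 also have "\<dots> = (p powr (- p) * p powr p) * (b powr (1 - p) * b powr (p - 1)) * lam"
  using p by simp
 also have "\<dots> = lam" using p b by (simp add: powr_add[symmetric])
 finally show ?thesis by (simp add: mult_ac)
qed

text \<open>Letting R grow gives lam exp(-\<alpha>\<delta>) J \<le> c(\<delta>) b^(1-p)
  exp(\<alpha>\<delta>) J for the finite weighted integral J. \<delta> is fixed beforehand, small
  enough that the coefficient on the right stays strictly below the one on the left, which forces J
  = 0.\<close>

theorem slow_growth_vanishes:
 assumes p: "p > 1" and lam: "lam > 0" and k: "k > 0" and coer: "weakly_p_coercive \<A> g p k A"
  and u: "u \<in> Wloc p" and sol: "weakly_solves \<A> g p A u (\<lambda>x. lam * \<bar>u x\<bar> powr (p - 2) * u x)"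
  and q: "q > p - 1"
  and growth: "\<forall>\<^sub>F R in at_top. (\<integral>\<^sup>+x\<in>M.mball x0 R. ennreal (\<bar>u x\<bar> powr q) \<partial>vol) \<le> ennreal (exp (C * R))"
  and C: "C < p * (q - p + 1) powr ((p - 1) / p) / (p - 1) powr ((p - 1) / p) * (lam powr (1 / p) / k)" (is "_ < ?T")
 shows "AE x in vol. u x = 0"
proof -
 define b where "b = q - p + 1"
 have b: "b > 0" "q = p + b - 1" using q by (simp_all add: b_def)
 have "?T > 0" using p q k lam by (intro mult_pos_pos divide_pos_pos) auto
 \<comment> \<open>C may be negative while the weight has to decay; hence the maximum with
   0.\<close>
 then obtain \<alpha> where \<alpha>: "max C 0 < \<alpha>" "\<alpha> < ?T" using dense[of "max C 0" ?T] C by auto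
 then have \<alpha>0: "\<alpha> > 0" "C < \<alpha>" by auto
 define c where "c \<delta> = (p - 1) powr (p - 1) * p powr (- p) * (k * \<alpha> * (1 + \<delta>)) powr p" for \<delta>
 \<comment> \<open>exp(2\<alpha>\<delta>) collects one factor exp(\<alpha>\<delta>) from either side
   of the energy inequality, as the approximate distance may err by \<delta> in both
   directions.\<close>
 have "((\<lambda>\<delta>. c \<delta> * b powr (1 - p) * exp (2 * \<alpha> * \<delta>)) \<longlongrightarrow> c 0 * b powr (1 - p) * exp (2 * \<alpha> * 0)) (at_right 0)"
  unfolding c_def using k \<alpha>0 by (intro tendsto_intros) auto
 moreover have "c 0 * b powr (1 - p) * exp (2 * \<alpha> * 0) < lam"
  using threshold_constant[OF p b(1) lam k \<alpha>0(1)] \<alpha>(2) by (simp add: c_def b_def)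
 ultimately have "\<forall>\<^sub>F \<delta> in at_right 0. c \<delta> * b powr (1 - p) * exp (2 * \<alpha> * \<delta>) < lam" by (rule order_tendstoD(2))
 moreover have "\<forall>\<^sub>F \<delta> in at_right 0. \<delta> \<in> {0<..<1 :: real}" by (rule eventually_at_rightI[of 0 1]) auto
 ultimately have "\<forall>\<^sub>F \<delta> in at_right 0. c \<delta> * b powr (1 - p) * exp (2 * \<alpha> * \<delta>) < lam \<and> \<delta> \<in> {0<..<1}" by (rule eventually_conj)
 from eventually_happens'[OF trivial_limit_at_right_real this]
 obtain \<delta> where "c \<delta> * b powr (1 - p) * exp (2 * \<alpha> * \<delta>) < lam \<and> \<delta> \<in> {0<..<1}" by (elim exE)
 then have \<delta>: "0 < \<delta>" "\<delta> < 1" "c \<delta> * b powr (1 - p) * exp (2 * \<alpha> * \<delta>) < lam" by simp_all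
 let ?r = "dist_g x0"
 let ?q = "\<lambda>x. \<bar>u x\<bar> powr q" and ?e = "\<lambda>x. exp (- \<alpha> * ?r x)" and ?c = "c \<delta> * b powr (1 - p) * exp (\<alpha> * \<delta>)"
 let ?s = "\<lambda>x. exp (- \<alpha> * (?r x + \<delta>))" and ?k = "\<lambda>x. exp (- (\<alpha> / p) * (?r x + \<delta>))" and ?j = "\<lambda>x. ?q x * ?e x"
 have mu [measurable]: "u \<in> borel_measurable vol" by (rule W1p_loc_measurable[OF u])
 have mr [measurable]: "?r \<in> borel_measurable vol" by (rule measurable_dist)
 have uq: "loc_integrable vol UNIV (\<lambda>x. ?q x)" and int: "integrable vol (\<lambda>x. ?j x)"
  using exponential_growth_integrable[OF _ _ \<alpha>0(2,1) growth] by auto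
 define J where "J = (LINT x|vol. ?j x)"
 have J0: "J \<ge> 0" unfolding J_def by (rule integral_nonneg_B) simp
 let ?\<Psi> = "\<lambda>R x. max 0 (?k x - exp (- (\<alpha> / p) * R)) powr p"
 have \<alpha>p: "exp (- (\<alpha> / p) * t) powr p = exp (- \<alpha> * t)" for t using p by (simp add: exp_powr_real)
 have up: "lam * (LINT x|vol. ?q x * ?\<Psi> (real n) x) \<le> ?c * J" for n
 proof (rule order_trans[OF energy_limit[OF p lam k coer u sol b(1) \<alpha>0(1) \<delta>(1,2) b(2) uq, of x0 "real n"]])
  have "(LINT x|vol. indicator (M.mball x0 (real n + 1)) x * (c \<delta> * (?q x * b powr (1 - p)) * exp (- \<alpha> * (?r x - \<delta>))))
   \<le> (LINT x|vol. ?c * ?j x)"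
  proof (rule integral_mono')
   show "integrable vol (\<lambda>x. ?c * ?j x)"
    by (intro integrable_mult_right int)
   fix x
   have "exp (- \<alpha> * (?r x - \<delta>)) = exp (\<alpha> * \<delta>) * ?e x" by (simp add: exp_add[symmetric] algebra_simps)
   then show "indicator (M.mball x0 (real n + 1)) x * (c \<delta> * (?q x * b powr (1 - p)) * exp (- \<alpha> * (?r x - \<delta>)))
    \<le> ?c * ?j x"
    by (auto simp: indicator_def c_def)
   show "0 \<le> ?c * ?j x" by (simp add: c_def)
  qed
  then show "(LINT x|vol. indicator (M.mball x0 (real n + 1)) x * ((p - 1) powr (p - 1) * p powr (- p) * (k * \<alpha> * (1 + \<delta>)) powr p *
    (?q x * b powr (1 - p)) * exp (- \<alpha> * (?r x - \<delta>)))) \<le> ?c * J"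
   by (simp add: c_def J_def)
 qed
 have "(\<lambda>n. LINT x|vol. ?q x * ?\<Psi> (real n) x) \<longlonglongrightarrow> (LINT x|vol. ?q x * ?s x)"
 proof (rule integral_dominated_convergence[OF _ _ int])
  show "(\<lambda>x. ?q x * ?s x) \<in> borel_measurable vol"
   "(\<lambda>x. ?q x * ?\<Psi> (real n) x) \<in> borel_measurable vol" for n by measurable
  show "AE x in vol. (\<lambda>n. ?q x * ?\<Psi> (real n) x) \<longlonglongrightarrow> ?q x * ?s x"
  proof (rule AE_I2)
   fix x
   have z: "(\<lambda>n. exp (- (\<alpha> / p) * real n)) \<longlonglongrightarrow> 0" using \<alpha>0 p by real_asymp
   have "(\<lambda>n. ?q x * ?\<Psi> (real n) x) \<longlonglongrightarrow> ?q x * max 0 (?k x - 0) powr p"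
    using p by (intro tendsto_mult tendsto_const tendsto_powr' tendsto_max tendsto_diff z) auto
   moreover have "max 0 (?k x - 0) powr p = ?s x"
    using \<alpha>p by (simp add: max_def)
   ultimately show "(\<lambda>n. ?q x * ?\<Psi> (real n) x) \<longlonglongrightarrow> ?q x * ?s x" by (simp only:)
  qed
  show "AE x in vol. norm (?q x * ?\<Psi> (real n) x) \<le> ?j x" for n
  proof (rule AE_I2)
   fix x
   have "(\<alpha> / p) * ?r x \<le> (\<alpha> / p) * (?r x + \<delta>)" using \<alpha>0 p \<delta> by (intro mult_left_mono) auto
   then have "?k x \<le> exp (- (\<alpha> / p) * ?r x)" by simp
   then have "max 0 (?k x - exp (- (\<alpha> / p) * real n)) \<le> exp (- (\<alpha> / p) * ?r x)"
    using exp_gt_zero[of "- (\<alpha> / p) * real n"] exp_gt_zero[of "- (\<alpha> / p) * ?r x"] by linarith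
   then have "?\<Psi> (real n) x \<le> exp (- (\<alpha> / p) * ?r x) powr p" using p by (intro powr_mono2) auto
   then have "?\<Psi> (real n) x \<le> ?e x" unfolding \<alpha>p .
   then have "?q x * ?\<Psi> (real n) x \<le> ?j x" by (rule mult_left_mono) simp
   then show "norm (?q x * ?\<Psi> (real n) x) \<le> ?j x" by simp
  qed
 qed
 from LIMSEQ_le_const2[OF tendsto_mult[OF tendsto_const[of lam] this]] up
 have "lam * (LINT x|vol. ?q x * ?s x) \<le> ?c * J" by blast
 also have "(LINT x|vol. ?q x * ?s x) = exp (- \<alpha> * \<delta>) * J"
 proof -
  have "?q x * ?s x = exp (- \<alpha> * \<delta>) * ?j x" for x
   by (simp add: exp_add[symmetric] algebra_simps)
  then show ?thesis unfolding J_def by (simp only: integral_mult_right_zero)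
 qed
 finally have "exp (\<alpha> * \<delta>) * (lam * (exp (- \<alpha> * \<delta>) * J)) \<le> exp (\<alpha> * \<delta>) * (?c * J)"
  by (rule mult_left_mono) simp
 moreover have "exp (\<alpha> * \<delta>) * exp (- \<alpha> * \<delta>) = 1" "exp (\<alpha> * \<delta>) * exp (\<alpha> * \<delta>) = exp (2 * \<alpha> * \<delta>)"
  by (simp_all add: exp_add[symmetric])
 ultimately have "lam * J \<le> c \<delta> * b powr (1 - p) * exp (2 * \<alpha> * \<delta>) * J"
  by (metis (no_types, lifting) mult.assoc mult.left_commute mult.right_neutral)
 then have "J = 0" using \<delta>(3) J0 mult_strict_right_mono[of _ lam J] by (smt (verit, best))
 then have "AE x in vol. ?j x = 0"
  using integral_nonneg_eq_0_iff_AE[OF int] unfolding J_def by simp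
 then show ?thesis by eventually_elim simp
qed

end

theorem theorem7:
  fixes \<A> :: "('a::{t2_space, second_countable_topology}, 'm::finite) chart set"
    and g :: "('a, 'm) metric_tensor"
    and A :: "('a, 'm) bundle_map"
    and u :: "'a \<Rightarrow> real"
    and x0 :: 'a
    and p p' q lam k C :: real
  assumes "riemannian_manifold \<A> g"
    and "connected (UNIV :: 'a set)"
    and "complete_manifold \<A> g"
    and "p > 1" and "p' = p / (p - 1)" and "lam > 0" and "k > 0"
    and "weakly_p_coercive \<A> g p k A"
    and "u \<in> W1p_loc \<A> g p"
    and "weakly_solves \<A> g p A u (\<lambda>x. lam * \<bar>u x\<bar> powr (p - 2) * u x)"
    and "q > p - 1"
    and "\<forall>\<^sub>F R in at_top.
           (\<integral>\<^sup>+x\<in>geodesic_ball \<A> g x0 R. ennreal (\<bar>u x\<bar> powr q) \<partial>volume_measure \<A> g)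
             \<le> ennreal (exp (C * R))"
    and "C < p * (q - p + 1) powr (1 / p') / (p - 1) powr (1 / p') * (lam powr (1 / p) / k)"
  shows "AE x in volume_measure \<A> g. u x = 0"
proof -
  interpret rmfd_complete \<A> g
    by (unfold_locales; fact assms)
  have "1 / p' = (p - 1) / p" using \<open>p > 1\<close> \<open>p' = p / (p - 1)\<close> by simp
  then show ?thesis
    using slow_growth_vanishes[OF \<open>p > 1\<close> \<open>lam > 0\<close> \<open>k > 0\<close> assms(8-11), of x0 C] assms(12,13)
    by (simp only: geodesic_ball_def)
qed

end
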